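(* Let $(R,\mathfrak{m},k)\subseteq(S,\mathfrak{n},l)$ be a local inclusion of $d$-dimensional $F$-finite Noetherian local domains of characteristic $p>0$, with corresponding extension of fraction fields $K=\operatorname{Frac}(R)\subseteq\operatorname{Frac}(S)=L$. Assume $S$ is a finitely generated $R$-module and write $S=R^{\oplus f}\oplus M$ as $R$-modules, where $M$ has no nonzero free direct summands. Then $$f\cdot s(S)\le[L:K]\cdot s(R).$$ If additionally $S$ is regular, then equality holds and $$s(R)=\frac{f}{[L:K]}.$$
   Context: For a ring $A$ of prime characteristic $p$ and $e\in\mathbb{N}$ (positive integers), $F^e_*A$ denotes $A$ viewed as an $A$-module by restriction of scalars along the $e$-th iterated Frobenius $r\mapsto r^{p^e}$. $A$ is $F$-finite if $F_*A$ is a finitely generated $A$-module. For an $F$-finite local ring $(A,\mathfrak{m}_A,\kappa)$ of dimension $d$, put $\alpha(A)=\log_p[\kappa:\kappa^p]$ and let $a_e(A)$ be the largest rank of a free $A$-module appearing in a direct sum decomposition of $F^e_*A$. The $F$-signature of $A$ is $s(A)=\lim_{e\to\infty}\frac{a_e(A)}{p^{e(d+\alpha(A))}}$; this limit exists for every $F$-finite local ring. *)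

theory Defs
  imports
    Complex_Main
    "HOL-Library.Extended_Nat"
    "HOL-Computational_Algebra.Primes"
    "HOL-Algebra.Embedded_Algebras"
    "HOL-Algebra.Module"
    "HOL-Algebra.QuotRing"
    "HOL-Algebra.Ring_Divisibility"
begin

section \<open>Local rings, dimension, regularity\<close>

definition local_ring :: "('a, 'b) ring_scheme \<Rightarrow> bool" where
  "local_ring A \<longleftrightarrow> cring A \<and> (\<exists>!I. maximalideal I A)"

definition max_ideal :: "('a, 'b) ring_scheme \<Rightarrow> 'a set" where
  "max_ideal A = (THE I. maximalideal I A)"

definition residue_field :: "('a, 'b) ring_scheme \<Rightarrow> 'a set ring" where
  "residue_field A = A Quot (max_ideal A)"

definition krull_dim :: "('a, 'b) ring_scheme \<Rightarrow> enat" where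
  "krull_dim A =
     Sup {enat n | n. \<exists>P :: nat \<Rightarrow> 'a set.
            (\<forall>i\<le>n. primeideal (P i) A) \<and> (\<forall>i<n. P i \<subset> P (Suc i))}"

text \<open>A Noetherian local ring is regular if the minimal number of generators of its
  maximal ideal equals its Krull dimension.\<close>

definition embedding_dim :: "('a, 'b) ring_scheme \<Rightarrow> nat" where
  "embedding_dim A =
     (LEAST n. \<exists>B \<subseteq> carrier A. finite B \<and> card B = n \<and> genideal A B = max_ideal A)"

definition regular_local_ring :: "('a, 'b) ring_scheme \<Rightarrow> bool" where
  "regular_local_ring A \<longleftrightarrow>
     noetherian_ring A \<and> local_ring A \<and> krull_dim A = enat (embedding_dim A)"


section \<open>Finitely generated and free modules, direct summands\<close>

definition module_span ::
  "('r, 'c) ring_scheme \<Rightarrow> ('r, 'm, 'd) module_scheme \<Rightarrow> 'm set \<Rightarrow> 'm set" where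
  "module_span R M B =
     {\<Oplus>\<^bsub>M\<^esub>b\<in>F. c b \<odot>\<^bsub>M\<^esub> b | F c. finite F \<and> F \<subseteq> B \<and> c \<in> F \<rightarrow> carrier R}"

definition module_independent ::
  "('r, 'c) ring_scheme \<Rightarrow> ('r, 'm, 'd) module_scheme \<Rightarrow> 'm set \<Rightarrow> bool" where
  "module_independent R M B \<longleftrightarrow>
     (\<forall>F c. finite F \<and> F \<subseteq> B \<and> c \<in> F \<rightarrow> carrier R \<and> (\<Oplus>\<^bsub>M\<^esub>b\<in>F. c b \<odot>\<^bsub>M\<^esub> b) = \<zero>\<^bsub>M\<^esub>
        \<longrightarrow> (\<forall>b\<in>F. c b = \<zero>\<^bsub>R\<^esub>))"

definition module_basis ::
  "('r, 'c) ring_scheme \<Rightarrow> ('r, 'm, 'd) module_scheme \<Rightarrow> 'm set \<Rightarrow> bool" where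
  "module_basis R M B \<longleftrightarrow>
     B \<subseteq> carrier M \<and> module_independent R M B \<and> module_span R M B = carrier M"

definition finitely_generated_module ::
  "('r, 'c) ring_scheme \<Rightarrow> ('r, 'm, 'd) module_scheme \<Rightarrow> bool" where
  "finitely_generated_module R M \<longleftrightarrow>
     (\<exists>B \<subseteq> carrier M. finite B \<and> module_span R M B = carrier M)"

definition free_module ::
  "('r, 'c) ring_scheme \<Rightarrow> ('r, 'm, 'd) module_scheme \<Rightarrow> bool" where
  "free_module R M \<longleftrightarrow> (\<exists>B. module_basis R M B)"

definition free_module_of_rank ::
  "('r, 'c) ring_scheme \<Rightarrow> ('r, 'm, 'd) module_scheme \<Rightarrow> nat \<Rightarrow> bool" where
  "free_module_of_rank R M n \<longleftrightarrow> (\<exists>B. finite B \<and> card B = n \<and> module_basis R M B)"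

text \<open>\<open>M\<close> is the internal direct sum of its submodules \<open>N\<^sub>1\<close> and \<open>N\<^sub>2\<close>.\<close>

definition direct_decomp ::
  "('r, 'c) ring_scheme \<Rightarrow> ('r, 'm, 'd) module_scheme \<Rightarrow> 'm set \<Rightarrow> 'm set \<Rightarrow> bool" where
  "direct_decomp R M N\<^sub>1 N\<^sub>2 \<longleftrightarrow>
     submodule N\<^sub>1 R M \<and> submodule N\<^sub>2 R M \<and>
     N\<^sub>1 <+>\<^bsub>M\<^esub> N\<^sub>2 = carrier M \<and> N\<^sub>1 \<inter> N\<^sub>2 = {\<zero>\<^bsub>M\<^esub>}"

definition no_free_summand ::
  "('r, 'c) ring_scheme \<Rightarrow> ('r, 'm, 'd) module_scheme \<Rightarrow> bool" where
  "no_free_summand R M \<longleftrightarrow>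
     (\<forall>G N. direct_decomp R M G N \<and> free_module R (M\<lparr>carrier := G\<rparr>) \<longrightarrow> G = {\<zero>\<^bsub>M\<^esub>})"

definition max_free_rank ::
  "('r, 'c) ring_scheme \<Rightarrow> ('r, 'm, 'd) module_scheme \<Rightarrow> nat" where
  "max_free_rank R M =
     Max {n. \<exists>G N. direct_decomp R M G N \<and> free_module_of_rank R (M\<lparr>carrier := G\<rparr>) n}"

text \<open>A ring \<open>A\<close> with multiplication as scalar action, to be used as a module over any
  subring of \<open>A\<close>.\<close>

definition ring_as_module :: "('a, 'b) ring_scheme \<Rightarrow> ('a, 'a) module" where
  "ring_as_module A =
     \<lparr>carrier = carrier A, monoid.mult = monoid.mult A, one = one A, zero = zero A, add = add A,
      smult = monoid.mult A\<rparr>"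


section \<open>Frobenius and F-signature\<close>

text \<open>For prime \<open>p\<close> and \<open>\<one> \<noteq> \<zero>\<close>, \<open>p \<cdot> \<one> = \<zero>\<close> says that the characteristic is exactly \<open>p\<close>.
  (The unqualified \<open>prime\<close> is the notion of HOL-Algebra.)\<close>

definition prime_char :: "nat \<Rightarrow> ('a, 'b) ring_scheme \<Rightarrow> bool" where
  "prime_char p A \<longleftrightarrow>
     Factorial_Ring.prime p \<and> \<one>\<^bsub>A\<^esub> \<noteq> \<zero>\<^bsub>A\<^esub> \<and> [p] \<cdot>\<^bsub>A\<^esub> \<one>\<^bsub>A\<^esub> = \<zero>\<^bsub>A\<^esub>"

text \<open>\<open>F\<^sup>e\<^sub>*A\<close>: the additive group of \<open>A\<close> on which \<open>r\<close> acts as multiplication by \<open>r^(p^e)\<close>.\<close>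

definition frobenius_module :: "nat \<Rightarrow> nat \<Rightarrow> ('a, 'b) ring_scheme \<Rightarrow> ('a, 'a) module" where
  "frobenius_module p e A =
     \<lparr>carrier = carrier A, monoid.mult = monoid.mult A, one = one A, zero = zero A, add = add A,
      smult = (\<lambda>r x. (r [^]\<^bsub>A\<^esub> (p ^ e)) \<otimes>\<^bsub>A\<^esub> x)\<rparr>"

definition F_finite :: "nat \<Rightarrow> ('a, 'b) ring_scheme \<Rightarrow> bool" where
  "F_finite p A \<longleftrightarrow> finitely_generated_module A (frobenius_module p 1 A)"

definition alpha :: "nat \<Rightarrow> ('a, 'b) ring_scheme \<Rightarrow> real" where
  "alpha p A =
     (let \<kappa> = residue_field A;
          \<kappa>p = (\<lambda>x. x [^]\<^bsub>\<kappa>\<^esub> p) ` carrier \<kappa>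
      in log (real p) (real (ring.dim \<kappa> \<kappa>p (carrier \<kappa>))))"

definition frobenius_free_rank :: "nat \<Rightarrow> ('a, 'b) ring_scheme \<Rightarrow> nat \<Rightarrow> nat" where
  "frobenius_free_rank p A e = max_free_rank A (frobenius_module p e A)"

text \<open>Meaningful for F-finite Noetherian local rings only: there the limit exists, and
  \<open>krull_dim\<close>, the degree in \<open>alpha\<close> and the ranks entering \<open>max_free_rank\<close> are finite.\<close>

definition F_signature :: "nat \<Rightarrow> ('a, 'b) ring_scheme \<Rightarrow> real" where
  "F_signature p A =
     lim (\<lambda>e. real (frobenius_free_rank p A e) /
            real p powr (real e * (real (the_enat (krull_dim A)) + alpha p A)))"


section \<open>Fraction fields\<close>

text \<open>The fraction field of a subring \<open>A\<close> of a field \<open>L\<close>, formed inside \<open>L\<close>.\<close>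

definition fractions_in :: "('a, 'b) ring_scheme \<Rightarrow> 'a set \<Rightarrow> 'a set" where
  "fractions_in L A = {a \<otimes>\<^bsub>L\<^esub> inv\<^bsub>L\<^esub> b | a b. a \<in> A \<and> b \<in> A - {\<zero>\<^bsub>L\<^esub>}}"

end

theory Submission
  imports Defs
begin

text \<open>Write \<open>t = [L:K]\<close> and let \<open>n\<close> grow. The idea is to estimate the rank over \<open>R\<close> of a maximal free
  summand of \<open>F\<^sup>n\<^sub>*S\<close> in two ways. A basis of \<open>L\<close> over \<open>K\<close> inside \<open>S\<close> spans a free \<open>R\<close>-module \<open>U\<close> of rank \<open>t\<close>
  with \<open>cS \<subseteq> U\<close> for some \<open>c \<noteq> 0\<close>, and since \<open>c\<close> cuts down the dimension, the free ranks of \<open>F\<^sup>n\<^sub>*S\<close> and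
  \<open>F\<^sup>n\<^sub>*U\<close> differ by terms of lower order; so the rank is \<open>t a\<^sub>n(R)\<close> up to lower order. On the other hand every
  free \<open>S\<close>-summand contributes \<open>f\<close> free \<open>R\<close>-summands, so the rank is at least \<open>f a\<^sub>n(S)\<close>, with equality when
  \<open>F\<^sup>n\<^sub>*S\<close> is free over \<open>S\<close>, as is the case for regular \<open>S\<close> by Kunz's theorem. The normalizations for \<open>R\<close> and
  \<open>S\<close> agree because their residue fields have the same degree over their \<open>p\<close>-th powers.

  Free ranks are additive enough for this because the largest rank of a free summand of \<open>V\<close> is the dimension
  over the residue field of \<open>V\<close> modulo the elements which every functional sends into the maximal ideal. The
  part of Kunz's theorem that is needed, a lower bound for the generic rank of \<open>F\<^sub>*S\<close>, is proved one step of a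
  maximal chain of primes at a time, by computing one length in two ways.\<close>

section \<open>Submodules over a ring acting through powers\<close>

text \<open>Neither quotients nor localizations are formed: V/N is replaced by predicates modulo a
  subset (\<open>indep_mod\<close>, \<open>generated_mod\<close>), and localization at Q by closure
  under division by elements outside Q. All modules F^n_* V are then subsets of one type, compared
  by inclusion while only the exponent of the scalars changes. The errors are of lower order because
  A/cA has dimension at most d - 1 for c nonzero: modulo m, F^n_* of it needs at most a constant
  times b^n / p^n generators, where b = p^d [k : k^p]. The same estimate yields the existence of the
  limits. Freeness of F^n_* S for regular S does not come from flatness. A system of d generators of
  the maximal ideal provides b^n generators of F^n_* S, and once the generic rank of F_* S is known
  to be b, these form a basis. That the generic rank is at most b follows from counting generators;
  the opposite inequality must use a chain of d proper inclusions of primes, each of which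
  contributes a factor p.\<close>

locale unital_subring =
  fixes A :: "'u::comm_ring_1 set" and e :: 'u
  assumes one_mem: "e \<in> A"
    and add_mem: "x \<in> A \<Longrightarrow> y \<in> A \<Longrightarrow> x + y \<in> A"
    and uminus_mem: "x \<in> A \<Longrightarrow> - x \<in> A"
    and mult_mem: "x \<in> A \<Longrightarrow> y \<in> A \<Longrightarrow> x * y \<in> A"
    and one_mult: "x \<in> A \<Longrightarrow> e * x = x"
begin

lemma mult_one: "x \<in> A \<Longrightarrow> x * e = x"
  by (metis mult.commute one_mult)

lemma zero_mem: "0 \<in> A"
  using add_mem[OF one_mem uminus_mem[OF one_mem]] by simp

lemma diff_mem: "x \<in> A \<Longrightarrow> y \<in> A \<Longrightarrow> x - y \<in> A"
  using add_mem uminus_mem by (metis diff_conv_add_uminus)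

lemma sum_mem: "(\<And>i. i \<in> I \<Longrightarrow> f i \<in> A) \<Longrightarrow> sum f I \<in> A"
  by (induction I rule: infinite_finite_induct) (auto intro: zero_mem add_mem)

lemma pow_mem: "x \<in> A \<Longrightarrow> n > 0 \<Longrightarrow> x ^ n \<in> A"
proof (induction n)
  case (Suc n)
  then show ?case by (cases "n = 0") (auto intro: mult_mem)
qed simp

lemma pow_mult_mem: "x \<in> A \<Longrightarrow> y \<in> A \<Longrightarrow> x ^ n * y \<in> A"
  by (induction n) (auto intro: mult_mem simp: mult.assoc)

lemma one_pow: "n > 0 \<Longrightarrow> e ^ n = e"
proof (induction n)
  case (Suc n)
  then show ?case using one_mult[OF one_mem] by (cases "n = 0") auto
qed simp

lemmas mem_intros = one_mem zero_mem add_mem uminus_mem mult_mem diff_mem sum_mem pow_mult_mem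

end

text \<open>Rings are subsets \<open>A\<close> of a type of class \<open>comm_ring_1\<close> with a unit \<open>e\<close> of their own, which need not be \<open>1\<close>.
  For \<open>q = p\<^sup>n\<close>, the predicate below describes the \<open>A\<close>-submodules of \<open>F\<^sup>n\<^sub>*B\<close> for every ring \<open>B \<supseteq> A\<close>.\<close>

definition pmodule :: "'u::comm_ring_1 set \<Rightarrow> nat \<Rightarrow> 'u set \<Rightarrow> bool" where
  "pmodule A q N \<longleftrightarrow> 0 \<in> N \<and> (\<forall>x\<in>N. \<forall>y\<in>N. x + y \<in> N) \<and> (\<forall>a\<in>A. \<forall>x\<in>N. a ^ q * x \<in> N)"

lemma pmoduleI:
  assumes "0 \<in> N" "\<And>x y. x \<in> N \<Longrightarrow> y \<in> N \<Longrightarrow> x + y \<in> N"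
    and "\<And>a x. a \<in> A \<Longrightarrow> x \<in> N \<Longrightarrow> a ^ q * x \<in> N"
  shows "pmodule A q N"
  using assms unfolding pmodule_def by blast

lemma pmodule_zero: "pmodule A q N \<Longrightarrow> 0 \<in> N"
  and pmodule_add: "pmodule A q N \<Longrightarrow> x \<in> N \<Longrightarrow> y \<in> N \<Longrightarrow> x + y \<in> N"
  and pmodule_smult: "pmodule A q N \<Longrightarrow> a \<in> A \<Longrightarrow> x \<in> N \<Longrightarrow> a ^ q * x \<in> N"
  unfolding pmodule_def by blast+

lemma pmodule_sum: "pmodule A q N \<Longrightarrow> (\<And>i. i \<in> I \<Longrightarrow> f i \<in> N) \<Longrightarrow> sum f I \<in> N"
  by (induction I rule: infinite_finite_induct) (auto intro: pmodule_zero pmodule_add)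

lemma pmodule_pow: "pmodule A q N \<Longrightarrow> (\<And>a. a \<in> B \<Longrightarrow> a ^ k \<in> A) \<Longrightarrow> pmodule B (k * q) N"
  unfolding pmodule_def by (auto simp: power_mult)

definition ideal_in :: "'u::comm_ring_1 set \<Rightarrow> 'u set \<Rightarrow> bool" where
  "ideal_in A I \<longleftrightarrow> I \<subseteq> A \<and> pmodule A 1 I"

lemma ideal_inI:
  assumes "I \<subseteq> A" "0 \<in> I" "\<And>x y. x \<in> I \<Longrightarrow> y \<in> I \<Longrightarrow> x + y \<in> I"
    and "\<And>a x. a \<in> A \<Longrightarrow> x \<in> I \<Longrightarrow> a * x \<in> I"
  shows "ideal_in A I"
  using assms unfolding ideal_in_def pmodule_def by simp

lemma ideal_in_subset: "ideal_in A I \<Longrightarrow> x \<in> I \<Longrightarrow> x \<in> A"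
  and ideal_in_zero: "ideal_in A I \<Longrightarrow> 0 \<in> I"
  and ideal_in_add: "ideal_in A I \<Longrightarrow> x \<in> I \<Longrightarrow> y \<in> I \<Longrightarrow> x + y \<in> I"
  and ideal_in_mult: "ideal_in A I \<Longrightarrow> a \<in> A \<Longrightarrow> x \<in> I \<Longrightarrow> a * x \<in> I"
  and ideal_in_mult2: "ideal_in A I \<Longrightarrow> a \<in> A \<Longrightarrow> x \<in> I \<Longrightarrow> x * a \<in> I"
  unfolding ideal_in_def pmodule_def by (auto simp: mult.commute)

lemma ideal_in_sum: "ideal_in A I \<Longrightarrow> (\<And>i. i \<in> J \<Longrightarrow> f i \<in> I) \<Longrightarrow> sum f J \<in> I"
  by (induction J rule: infinite_finite_induct) (auto intro: ideal_in_zero ideal_in_add)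

definition prime_in :: "'u::comm_ring_1 set \<Rightarrow> 'u set \<Rightarrow> bool" where
  "prime_in A P \<longleftrightarrow> ideal_in A P \<and> P \<noteq> A \<and> (\<forall>a\<in>A. \<forall>b\<in>A. a * b \<in> P \<longrightarrow> a \<in> P \<or> b \<in> P)"

lemma prime_in_ideal: "prime_in A P \<Longrightarrow> ideal_in A P"
  and prime_in_mult: "prime_in A P \<Longrightarrow> a \<in> A \<Longrightarrow> b \<in> A \<Longrightarrow> a * b \<in> P \<Longrightarrow> a \<in> P \<or> b \<in> P"
  unfolding prime_in_def by auto

context unital_subring begin

lemma ideal_in_uminus: "ideal_in A I \<Longrightarrow> x \<in> I \<Longrightarrow> - x \<in> I"
proof -
  assume I: "ideal_in A I" and x: "x \<in> I"
  have "- x = (- e) * x" using one_mult[OF ideal_in_subset[OF I x]] by simp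
  then show ?thesis using ideal_in_mult[OF I uminus_mem[OF one_mem] x] by simp
qed

lemma ideal_in_diff: "ideal_in A I \<Longrightarrow> x \<in> I \<Longrightarrow> y \<in> I \<Longrightarrow> x - y \<in> I"
  using ideal_in_uminus ideal_in_add by (metis diff_conv_add_uminus)

lemma ideal_in_whole: "ideal_in A I \<Longrightarrow> e \<in> I \<Longrightarrow> I = A"
  using ideal_in_mult2[of A I _ e] ideal_in_subset[of A I] one_mult by fastforce

lemma prime_in_one: "prime_in A P \<Longrightarrow> e \<notin> P"
  using ideal_in_whole unfolding prime_in_def by blast

lemma prime_in_pow: "prime_in A P \<Longrightarrow> a \<in> A \<Longrightarrow> a ^ n * b \<in> P \<Longrightarrow> b \<in> A \<Longrightarrow> a \<in> P \<or> b \<in> P"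
proof (induction n)
  case (Suc n)
  then show ?case using prime_in_mult[of A P a "a ^ n * b"] pow_mult_mem[of a b n]
    by (auto simp: mult.assoc)
qed auto

lemma prime_in_pow1: "prime_in A P \<Longrightarrow> a \<in> A \<Longrightarrow> a ^ n \<in> P \<Longrightarrow> n > 0 \<Longrightarrow> a \<in> P"
  using prime_in_pow[of P a n e] prime_in_one mult_one[OF pow_mem] one_mem by metis

text \<open>Fraction-free Gaussian elimination over the domain \<open>A / P\<close>.\<close>

lemma homogeneous_system:
  assumes P: "prime_in A P"
  shows "finite J \<Longrightarrow> finite I \<Longrightarrow> card J < card I \<Longrightarrow> (\<And>i j. i \<in> I \<Longrightarrow> j \<in> J \<Longrightarrow> c i j \<in> A) \<Longrightarrow>
    \<exists>a\<in>I \<rightarrow> A. (\<exists>i\<in>I. a i \<notin> P) \<and> (\<forall>j\<in>J. (\<Sum>i\<in>I. a i * c i j) \<in> P)"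
proof (induction J arbitrary: I c rule: finite_induct)
  case empty
  then obtain i where "i \<in> I" by fastforce
  then show ?case using prime_in_one[OF P] by (intro bexI[of _ "\<lambda>_. e"]) (auto intro: one_mem)
next
  case (insert j0 J)
  note id = prime_in_ideal[OF P]
  show ?case
  proof (cases "\<forall>i\<in>I. c i j0 \<in> P")
    case True
    have "\<exists>a\<in>I \<rightarrow> A. (\<exists>i\<in>I. a i \<notin> P) \<and> (\<forall>j\<in>J. (\<Sum>i\<in>I. a i * c i j) \<in> P)"
      using insert.prems insert.hyps by (intro insert.IH) auto
    then obtain a where a: "a \<in> I \<rightarrow> A" "\<exists>i\<in>I. a i \<notin> P" "\<forall>j\<in>J. (\<Sum>i\<in>I. a i * c i j) \<in> P" by blast
    have "(\<Sum>i\<in>I. a i * c i j0) \<in> P"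
      using a True by (intro ideal_in_sum[OF id] ideal_in_mult[OF id]) auto
    then show ?thesis using a by auto
  next
    case False
    then obtain i0 where i0: "i0 \<in> I" "c i0 j0 \<notin> P" by auto
    define I' where "I' = I - {i0}"
    \<comment> \<open>Cross-multiplying with the pivot \<open>c i0 j0\<close> clears the column
      \<open>j0\<close> without division.\<close>
    define c' where "c' i j = c i0 j0 * c i j - c i j0 * c i0 j" for i j
    have fI': "finite I'" and cI': "card J < card I'" and I': "I = insert i0 I'" "i0 \<notin> I'"
      using insert.prems insert.hyps i0 by (auto simp: I'_def)
    have "\<exists>a\<in>I' \<rightarrow> A. (\<exists>i\<in>I'. a i \<notin> P) \<and> (\<forall>j\<in>J. (\<Sum>i\<in>I'. a i * c' i j) \<in> P)"
      using insert.prems i0 fI' cI' unfolding c'_def by (intro insert.IH) (auto simp: I'_def intro!: mem_intros)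
    then obtain a where a: "a \<in> I' \<rightarrow> A" "\<exists>i\<in>I'. a i \<notin> P" "\<forall>j\<in>J. (\<Sum>i\<in>I'. a i * c' i j) \<in> P" by blast
    \<comment> \<open>The coefficient at the pivot row is chosen so that the equation for
      \<open>j0\<close> holds exactly. The others are multiplied by the pivot, which lies outside
      the prime \<open>P\<close> and so keeps the solution nontrivial.\<close>
    define b where "b i = (if i = i0 then - (\<Sum>i\<in>I'. a i * c i j0) else c i0 j0 * a i)" for i
    have cA: "c i j \<in> A" if "i \<in> I" "j \<in> insert j0 J" for i j using insert.prems that by blast
    have bA: "b \<in> I \<rightarrow> A"
      using a(1) cA i0 I' unfolding b_def by (auto intro!: mem_intros)
    have nt: "\<exists>i\<in>I. b i \<notin> P"
    proof -
      obtain i where i: "i \<in> I'" "a i \<notin> P" using a(2) by blast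
      then have "b i \<notin> P" using prime_in_mult[OF P, of "c i0 j0" "a i"] i0 cA[of i0 j0] a(1) I' by (auto simp: b_def)
      then show ?thesis using i I' by blast
    qed
    have eq: "(\<Sum>i\<in>I. b i * c i j) = (\<Sum>i\<in>I'. a i * c' i j)" for j
    proof -
      have "(\<Sum>i\<in>I. b i * c i j) = b i0 * c i0 j + (\<Sum>i\<in>I'. b i * c i j)"
        using I' fI' by simp
      also have "(\<Sum>i\<in>I'. b i * c i j) = (\<Sum>i\<in>I'. c i0 j0 * a i * c i j)"
        using I' by (intro sum.cong) (auto simp: b_def)
      also have "b i0 * c i0 j = - (\<Sum>i\<in>I'. a i * c i j0 * c i0 j)"
        by (simp add: b_def sum_distrib_right)
      finally show ?thesis
        by (simp add: c'_def algebra_simps sum_subtractf flip: sum_negf sum.distrib)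
    qed
    have "(\<Sum>i\<in>I. b i * c i j0) = 0" unfolding eq by (simp add: c'_def mult.commute)
    then have "\<forall>j\<in>insert j0 J. (\<Sum>i\<in>I. b i * c i j) \<in> P"
      using a(3) eq ideal_in_zero[OF id] by auto
    then show ?thesis using bA nt by blast
  qed
qed

end

text \<open>The coefficient set is separate from the acting ring: with \<open>C = A\<close> this is
  the submodule of F^n_* generated by \<open>X\<close>, and with \<open>C = m\<close>,
  \<open>X = V\<close> it is the product of the maximal ideal with F^n_* V.\<close>

inductive_set qspan :: "'u::comm_ring_1 set \<Rightarrow> nat \<Rightarrow> 'u set \<Rightarrow> 'u set" for C q X where
  qspan_zero: "0 \<in> qspan C q X"
| qspan_step: "a \<in> C \<Longrightarrow> x \<in> X \<Longrightarrow> y \<in> qspan C q X \<Longrightarrow> a ^ q * x + y \<in> qspan C q X"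

lemma qspan_mono: "C \<subseteq> D \<Longrightarrow> X \<subseteq> Y \<Longrightarrow> qspan C q X \<subseteq> qspan D q Y"
proof
  fix z assume *: "C \<subseteq> D" "X \<subseteq> Y" "z \<in> qspan C q X"
  show "z \<in> qspan D q Y" using *(3) by induction (use *(1,2) in \<open>auto intro: qspan.intros\<close>)
qed

lemma qspan_add: "y \<in> qspan C q X \<Longrightarrow> z \<in> qspan C q X \<Longrightarrow> y + z \<in> qspan C q X"
  by (induction rule: qspan.induct) (auto intro: qspan.intros simp: add.assoc)

lemma qspan_smult_base: "a \<in> C \<Longrightarrow> x \<in> X \<Longrightarrow> a ^ q * x \<in> qspan C q X"
  using qspan_step[OF _ _ qspan_zero, of a C x X q] by simp

lemma qspan_subset: "(\<And>a x. a \<in> C \<Longrightarrow> x \<in> X \<Longrightarrow> a ^ q * x \<in> N) \<Longrightarrow> 0 \<in> N \<Longrightarrow>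
    (\<And>x y. x \<in> N \<Longrightarrow> y \<in> N \<Longrightarrow> x + y \<in> N) \<Longrightarrow> qspan C q X \<subseteq> N"
proof
  fix z assume *: "\<And>a x. a \<in> C \<Longrightarrow> x \<in> X \<Longrightarrow> a ^ q * x \<in> N" "0 \<in> N"
    "\<And>x y. x \<in> N \<Longrightarrow> y \<in> N \<Longrightarrow> x + y \<in> N" "z \<in> qspan C q X"
  show "z \<in> N" using *(4) by induction (use *(1-3) in auto)
qed

lemma qspan_subset_pmodule: "pmodule A q N \<Longrightarrow> X \<subseteq> N \<Longrightarrow> qspan A q X \<subseteq> N"
  by (rule qspan_subset) (auto intro: pmodule_zero pmodule_add pmodule_smult)

section \<open>Additivity of q-th powers in characteristic p\<close>

locale char_p_subring = unital_subring A e for A :: "'u::comm_ring_1 set" and e +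
  fixes p :: nat
  assumes prime_p: "Factorial_Ring.prime p" and char_p: "of_nat p * e = 0"
begin

lemma q_pos: "0 < p ^ n"
  using prime_p prime_gt_0_nat by simp

lemma char_mult: "x \<in> A \<Longrightarrow> of_nat p * x = 0"
  using one_mult[of x] char_p by (metis mult.assoc mult_zero_left)

lemma add_pow_p:
  assumes x: "x \<in> A" and y: "y \<in> A"
  shows "(x + y) ^ p = x ^ p + y ^ p"
proof -
  have p0: "0 < p" using q_pos[of 1] by simp
  have z: "of_nat (p choose k) * x ^ k * y ^ (p - k) = 0" if k: "k \<in> {0<..<p}" for k
  proof -
    have "p dvd (p choose k)" using k prime_p p0 by (intro dvd_choose_prime) auto
    then obtain m where m: "p choose k = m * p" by (auto simp: dvd_def mult.commute)
    have "of_nat (p choose k) * x ^ k = of_nat m * (of_nat p * x ^ k)" by (simp add: m mult.assoc)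
    also have "\<dots> = 0" using char_mult[OF pow_mem[OF x, of k]] k by simp
    finally show ?thesis by simp
  qed
  have "(x + y) ^ p = (\<Sum>k\<le>p. of_nat (p choose k) * x ^ k * y ^ (p - k))" by (rule binomial_ring)
  also have "{..p} = insert 0 (insert p {0<..<p})" using p0 by auto
  also have "(\<Sum>k\<in>\<dots>. of_nat (p choose k) * x ^ k * y ^ (p - k)) =
      y ^ p + (x ^ p + (\<Sum>k\<in>{0<..<p}. of_nat (p choose k) * x ^ k * y ^ (p - k)))"
    using p0 by simp
  also have "(\<Sum>k\<in>{0<..<p}. of_nat (p choose k) * x ^ k * y ^ (p - k)) = 0"
    by (rule sum.neutral) (use z in blast)
  finally show ?thesis by simp
qed

lemma add_pow: "x \<in> A \<Longrightarrow> y \<in> A \<Longrightarrow> (x + y) ^ (p ^ n) = x ^ (p ^ n) + y ^ (p ^ n)"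
proof (induction n)
  case (Suc n)
  have "(x + y) ^ (p ^ Suc n) = ((x + y) ^ (p ^ n)) ^ p" by (simp add: mult.commute flip: power_mult)
  also have "\<dots> = (x ^ (p ^ n)) ^ p + (y ^ (p ^ n)) ^ p"
    using Suc add_pow_p pow_mem q_pos by simp
  finally show ?case by (simp add: mult.commute flip: power_mult)
qed simp

lemma zero_pow: "(0::'u) ^ (p ^ n) = 0"
  using q_pos by (simp add: zero_power)

lemma sum_pow: "(\<And>i. i \<in> I \<Longrightarrow> f i \<in> A) \<Longrightarrow> (sum f I) ^ (p ^ n) = (\<Sum>i\<in>I. f i ^ (p ^ n))"
  by (induction I rule: infinite_finite_induct) (simp_all add: zero_pow add_pow sum_mem)

lemma uminus_pow: "x \<in> A \<Longrightarrow> (- x) ^ (p ^ n) = - (x ^ (p ^ n))"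
  using add_pow[OF uminus_mem, of x x n] zero_pow[of n] by (simp add: eq_neg_iff_add_eq_0)

lemma diff_pow: "x \<in> A \<Longrightarrow> y \<in> A \<Longrightarrow> (x - y) ^ (p ^ n) = x ^ (p ^ n) - y ^ (p ^ n)"
  using add_pow[OF _ uminus_mem, of x y n] uminus_pow by simp

lemma pow_mem_q: "x \<in> A \<Longrightarrow> x ^ (p ^ n) \<in> A"
  using pow_mem q_pos by blast

lemma one_pow_q: "e ^ (p ^ n) = e"
  using one_pow q_pos by blast

lemma pmodule_uminus: 
  assumes "pmodule A (p ^ n) N" "x \<in> N" "e * x = x"
  shows "- x \<in> N"
  using pmodule_smult[OF assms(1) uminus_mem[OF one_mem] assms(2)] uminus_pow[OF one_mem] one_pow_q assms(3)
  by simp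

lemma pmodule_diff:
  assumes "pmodule A (p ^ n) N" "x \<in> N" "y \<in> N" "e * y = y"
  shows "x - y \<in> N"
  using pmodule_add[OF assms(1,2) pmodule_uminus[OF assms(1,3,4)]] by simp

lemma qspan_base: "x \<in> X \<Longrightarrow> e * x = x \<Longrightarrow> x \<in> qspan A (p ^ n) X"
  using qspan_smult_base[OF one_mem] one_pow_q by metis

lemma qspan_pmodule:
  assumes "\<And>a c. a \<in> A \<Longrightarrow> c \<in> C \<Longrightarrow> a * c \<in> C"
  shows "pmodule A q (qspan C q X)"
proof (rule pmoduleI)
  show "a ^ q * x \<in> qspan C q X" if "a \<in> A" "x \<in> qspan C q X" for a x
    using that(2)
  proof induction
    case (qspan_step b x y)
    have "a ^ q * (b ^ q * x + y) = (a * b) ^ q * x + a ^ q * y" by (simp add: algebra_simps power_mult_distrib)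
    then show ?case using qspan_step assms[OF that(1)] by (auto intro: qspan.intros)
  qed (auto intro: qspan_zero)
qed (auto intro: qspan_zero qspan_add)

lemma qspan_pmodule': "pmodule A q (qspan A q X)"
  by (rule qspan_pmodule) (rule mult_mem)

lemma qspan_trans: "X \<subseteq> qspan A q Y \<Longrightarrow> qspan A q X \<subseteq> qspan A q Y"
  by (rule qspan_subset_pmodule[OF qspan_pmodule'])

text \<open>Several occurrences of a generator merge into one coefficient because q-th powers are
  additive; generators that lie in \<open>N\<close> are absorbed into \<open>w\<close>.\<close>

lemma qspan_finite_rep:
  assumes N: "pmodule A (p ^ n) N" and X: "finite X" and y: "y \<in> qspan A (p ^ n) (N \<union> X)"
  shows "\<exists>w\<in>N. \<exists>c\<in>X \<rightarrow> A. y = w + (\<Sum>x\<in>X. c x ^ (p ^ n) * x)"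
  using y
proof induction
  case qspan_zero
  show ?case using pmodule_zero[OF N] zero_mem zero_pow
    by (intro bexI[of _ 0] bexI[of _ "\<lambda>_. 0"]) auto
next
  case (qspan_step a x y)
  then obtain w c where w: "w \<in> N" "c \<in> X \<rightarrow> A" "y = w + (\<Sum>x\<in>X. c x ^ (p ^ n) * x)" by blast
  show ?case
  proof (cases "x \<in> N")
    case True
    then show ?thesis using w pmodule_add[OF N pmodule_smult[OF N qspan_step.hyps(1) True] w(1)]
      by (intro bexI[of _ "a ^ (p ^ n) * x + w"] bexI[of _ c]) (auto simp: add.assoc)
  next
    case False
    then have xX: "x \<in> X" using qspan_step.hyps by blast
    define c' where "c' = c(x := c x + a)"
    have "(\<Sum>z\<in>X. c' z ^ (p ^ n) * z) = (c x + a) ^ (p ^ n) * x + (\<Sum>z\<in>X-{x}. c z ^ (p ^ n) * z)"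
      using X xX by (subst sum.remove[of _ x]) (auto simp: c'_def intro!: sum.cong)
    also have "\<dots> = a ^ (p ^ n) * x + (\<Sum>z\<in>X. c z ^ (p ^ n) * z)"
      using X xX w qspan_step.hyps by (subst sum.remove[of X x]) (auto simp: add_pow algebra_simps Pi_iff)
    finally show ?thesis using w xX qspan_step.hyps(1)
      by (intro bexI[of _ w] bexI[of _ c']) (auto simp: c'_def Pi_iff intro: add_mem)
  qed
qed

end

text \<open>When \<open>P\<close> carries the module into \<open>N\<close>, this is linear
  independence of the classes modulo \<open>N\<close> over the field \<kappa>(P). With
  \<open>P = N = {0}\<close> it is independence over the fraction field; with the maximal ideal and
  \<open>nonsplit\<close> it is independence over the residue field.\<close>

definition indep_mod :: "'u::comm_ring_1 set \<Rightarrow> 'u set \<Rightarrow> nat \<Rightarrow> 'u set \<Rightarrow> 'i set \<Rightarrow> ('i \<Rightarrow> 'u) \<Rightarrow> bool" where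
  "indep_mod A P q N I v \<longleftrightarrow> (\<forall>c\<in>I \<rightarrow> A. (\<Sum>i\<in>I. c i ^ q * v i) \<in> N \<longrightarrow> (\<forall>i\<in>I. c i \<in> P))"

lemma indep_modD: "indep_mod A P q N I v \<Longrightarrow> c \<in> I \<rightarrow> A \<Longrightarrow> (\<Sum>i\<in>I. c i ^ q * v i) \<in> N \<Longrightarrow> i \<in> I \<Longrightarrow> c i \<in> P"
  unfolding indep_mod_def by blast

lemma indep_mod_reindex:
  assumes f: "bij_betw f J I" and v: "indep_mod A P q N I v"
  shows "indep_mod A P q N J (v \<circ> f)"
  unfolding indep_mod_def
proof (intro ballI impI)
  fix c j assume c: "c \<in> J \<rightarrow> A" "(\<Sum>i\<in>J. c i ^ q * (v \<circ> f) i) \<in> N" and j: "j \<in> J"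
  define g where "g = inv_into J f"
  have g: "g (f j) = j" if "j \<in> J" for j using f that by (simp add: g_def bij_betw_def)
  have "(\<Sum>i\<in>I. c (g i) ^ q * v i) = (\<Sum>j\<in>J. c (g (f j)) ^ q * v (f j))"
    by (rule sum.reindex_bij_betw[symmetric, OF f])
  also have "\<dots> = (\<Sum>i\<in>J. c i ^ q * (v \<circ> f) i)" by (intro sum.cong) (auto simp: g)
  finally have "(\<Sum>i\<in>I. c (g i) ^ q * v i) \<in> N" using c by simp
  moreover have "(\<lambda>i. c (g i)) \<in> I \<rightarrow> A" using c f by (auto simp: bij_betw_def g)
  ultimately have "c (g (f j)) \<in> P" using indep_modD[OF v, of "\<lambda>i. c (g i)"] f j by (auto simp: bij_betw_def)
  then show "c j \<in> P" using g j by simp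
qed

lemma (in char_p_subring) indep_mod_mono:
  assumes "indep_mod A P (p ^ n) N I v" "J \<subseteq> I" "finite I"
  shows "indep_mod A P (p ^ n) N J v"
  unfolding indep_mod_def
proof (intro ballI impI)
  fix c j assume c: "c \<in> J \<rightarrow> A" "(\<Sum>i\<in>J. c i ^ (p ^ n) * v i) \<in> N" and j: "j \<in> J"
  define c' where "c' i = (if i \<in> J then c i else 0)" for i
  have "(\<Sum>i\<in>I. c' i ^ (p ^ n) * v i) = (\<Sum>i\<in>J. c' i ^ (p ^ n) * v i)"
    using assms by (intro sum.mono_neutral_right) (auto simp: c'_def zero_pow)
  also have "\<dots> = (\<Sum>i\<in>J. c i ^ (p ^ n) * v i)" by (intro sum.cong) (auto simp: c'_def)
  finally have "c' j \<in> P" using indep_modD[OF assms(1), of c' j] c j assms(2)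
    by (auto simp: c'_def zero_mem Pi_iff)
  then show "c j \<in> P" using j by (simp add: c'_def)
qed

context char_p_subring begin

text \<open>The exchange lemma for the \<open>\<kappa>(P)\<close>-vector space obtained from a module modulo \<open>N\<close>.\<close>

lemma indep_mod_card_le:
  assumes P: "prime_in A P" and N: "pmodule A (p ^ n) N"
    and I: "finite I" and v: "indep_mod A P (p ^ n) N I v"
    and X: "finite X" and vX: "\<And>i. i \<in> I \<Longrightarrow> v i \<in> qspan A (p ^ n) (N \<union> X)"
    and PX: "\<And>a x. a \<in> P \<Longrightarrow> x \<in> X \<Longrightarrow> a ^ (p ^ n) * x \<in> N"
  shows "card I \<le> card X"
proof (rule ccontr)
  assume "\<not> card I \<le> card X"
  then have lt: "card X < card I" by simp
  have "\<forall>i\<in>I. \<exists>z. fst z \<in> N \<and> snd z \<in> X \<rightarrow> A \<and> v i = fst z + (\<Sum>x\<in>X. snd z x ^ (p ^ n) * x)"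
  proof
    fix i assume "i \<in> I"
    from qspan_finite_rep[OF N X vX[OF this]]
    obtain w c where "w \<in> N" "c \<in> X \<rightarrow> A" "v i = w + (\<Sum>x\<in>X. c x ^ (p ^ n) * x)" by blast
    then show "\<exists>z. fst z \<in> N \<and> snd z \<in> X \<rightarrow> A \<and> v i = fst z + (\<Sum>x\<in>X. snd z x ^ (p ^ n) * x)"
      by (intro exI[of _ "(w, c)"]) simp
  qed
  from bchoice[OF this] obtain z where z: "\<forall>i\<in>I. fst (z i) \<in> N \<and> snd (z i) \<in> X \<rightarrow> A \<and>
    v i = fst (z i) + (\<Sum>x\<in>X. snd (z i) x ^ (p ^ n) * x)" by blast
  define w c where "w i = fst (z i)" and "c i = snd (z i)" for i
  have wc: "\<And>i. i \<in> I \<Longrightarrow> w i \<in> N" "\<And>i. i \<in> I \<Longrightarrow> c i \<in> X \<rightarrow> A"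
    "\<And>i. i \<in> I \<Longrightarrow> v i = w i + (\<Sum>x\<in>X. c i x ^ (p ^ n) * x)"
    using z unfolding w_def c_def by blast+
  have "\<exists>a\<in>I \<rightarrow> A. (\<exists>i\<in>I. a i \<notin> P) \<and> (\<forall>j\<in>X. (\<Sum>i\<in>I. a i * c i j) \<in> P)"
    using wc(2) by (intro homogeneous_system[OF P X I lt]) auto
  then obtain a where a: "a \<in> I \<rightarrow> A" "\<exists>i\<in>I. a i \<notin> P" "\<forall>j\<in>X. (\<Sum>i\<in>I. a i * c i j) \<in> P" by blast
  have "(\<Sum>i\<in>I. a i ^ (p ^ n) * v i) = (\<Sum>i\<in>I. a i ^ (p ^ n) * w i) + (\<Sum>i\<in>I. \<Sum>x\<in>X. a i ^ (p ^ n) * (c i x ^ (p ^ n) * x))"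
    by (simp add: wc(3) distrib_left sum_distrib_left flip: sum.distrib cong: sum.cong)
  also have "(\<Sum>i\<in>I. \<Sum>x\<in>X. a i ^ (p ^ n) * (c i x ^ (p ^ n) * x)) = (\<Sum>x\<in>X. (\<Sum>i\<in>I. a i * c i x) ^ (p ^ n) * x)"
  proof (subst sum.swap, intro sum.cong refl)
    fix x assume x: "x \<in> X"
    have "(\<Sum>i\<in>I. a i * c i x) ^ (p ^ n) = (\<Sum>i\<in>I. (a i * c i x) ^ (p ^ n))"
      using a wc(2) x by (intro sum_pow) (auto intro!: mult_mem)
    then show "(\<Sum>i\<in>I. a i ^ (p ^ n) * (c i x ^ (p ^ n) * x)) = (\<Sum>i\<in>I. a i * c i x) ^ (p ^ n) * x"
      by (simp add: sum_distrib_right power_mult_distrib mult.assoc)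
  qed
  also have "(\<Sum>i\<in>I. a i ^ (p ^ n) * w i) + \<dots> \<in> N"
    using a wc(1) PX by (intro pmodule_add[OF N] pmodule_sum[OF N]) (auto intro: pmodule_smult[OF N])
  finally have "\<forall>i\<in>I. a i \<in> P" using v a(1) unfolding indep_mod_def by blast
  then show False using a(2) by blast
qed

end

section \<open>Functionals and free ranks\<close>

text \<open>For \<open>q = p ^ n\<close> these are the elements of Hom_A(F^n_* V, A).\<close>

definition qlin :: "'u::comm_ring_1 set \<Rightarrow> nat \<Rightarrow> 'u set \<Rightarrow> ('u \<Rightarrow> 'u) \<Rightarrow> bool" where
  "qlin A q V \<phi> \<longleftrightarrow> \<phi> \<in> V \<rightarrow> A \<and> (\<forall>x\<in>V. \<forall>y\<in>V. \<phi> (x + y) = \<phi> x + \<phi> y) \<and>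
     (\<forall>a\<in>A. \<forall>x\<in>V. \<phi> (a ^ q * x) = a * \<phi> x)"

lemma qlinD:
  assumes "qlin A q V \<phi>"
  shows "x \<in> V \<Longrightarrow> \<phi> x \<in> A" "x \<in> V \<Longrightarrow> y \<in> V \<Longrightarrow> \<phi> (x + y) = \<phi> x + \<phi> y"
    "a \<in> A \<Longrightarrow> x \<in> V \<Longrightarrow> \<phi> (a ^ q * x) = a * \<phi> x"
  using assms unfolding qlin_def by auto

lemma qlin_zero: "qlin A q V \<phi> \<Longrightarrow> 0 \<in> V \<Longrightarrow> \<phi> 0 = 0"
  using qlinD(2)[of A q V \<phi> 0 0] by simp

lemma qlin_sum:
  assumes "qlin A q V \<phi>" "pmodule A q V" "\<And>i. i \<in> I \<Longrightarrow> f i \<in> V"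
  shows "\<phi> (sum f I) = (\<Sum>i\<in>I. \<phi> (f i))"
  using assms(3)
proof (induction I rule: infinite_finite_induct)
  case (insert i I)
  then show ?case using qlinD(2)[OF assms(1), of "f i" "sum f I"] pmodule_sum[OF assms(2), of I f] by auto
qed (use qlin_zero[OF assms(1) pmodule_zero[OF assms(2)]] in auto)

text \<open>For a local ring \<open>(A, m)\<close>, the quotient of \<open>V\<close> by \<open>nonsplit A m q V\<close> is a vector space over
  the residue field whose dimension is the maximal rank of a free direct summand of \<open>V\<close>.\<close>

definition nonsplit :: "'u::comm_ring_1 set \<Rightarrow> 'u set \<Rightarrow> nat \<Rightarrow> 'u set \<Rightarrow> 'u set" where
  "nonsplit A m q V = {v \<in> V. \<forall>\<phi>. qlin A q V \<phi> \<longrightarrow> \<phi> v \<in> m}"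

text \<open>A free direct summand in terms of elements and functionals: the \<open>v i\<close> form
  its basis, and the common kernel of the \<open>\<phi> i\<close> is a complement. Ranks can thus be
  compared without tracking complements.\<close>

definition dual_family ::
    "'u::comm_ring_1 set \<Rightarrow> 'u \<Rightarrow> nat \<Rightarrow> 'u set \<Rightarrow> 'i set \<Rightarrow> ('i \<Rightarrow> 'u) \<Rightarrow> ('i \<Rightarrow> 'u \<Rightarrow> 'u) \<Rightarrow> bool" where
  "dual_family A e q V I v \<phi> \<longleftrightarrow> (\<forall>i\<in>I. v i \<in> V \<and> qlin A q V (\<phi> i)) \<and>
     (\<forall>i\<in>I. \<forall>j\<in>I. \<phi> i (v j) = (if i = j then e else 0))"

definition splits :: "'u::comm_ring_1 set \<Rightarrow> 'u \<Rightarrow> nat \<Rightarrow> 'u set \<Rightarrow> nat \<Rightarrow> bool" where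
  "splits A e q V n \<longleftrightarrow> (\<exists>v \<phi>. dual_family A e q V {..<n} v \<phi>)"

text \<open>The upper counterpart of \<open>splits\<close>: for \<open>N = nonsplit A m q V\<close>
  it bounds the dimension of V/N over the residue field.\<close>

definition generated_mod :: "'u::comm_ring_1 set \<Rightarrow> nat \<Rightarrow> 'u set \<Rightarrow> 'u set \<Rightarrow> nat \<Rightarrow> bool" where
  "generated_mod A q V N n \<longleftrightarrow> (\<exists>X\<subseteq>V. finite X \<and> card X \<le> n \<and> V \<subseteq> qspan A q (N \<union> X))"

lemma splits_family:
  assumes "dual_family A e q V I v \<phi>" "finite I"
  shows "splits A e q V (card I)"
proof -
  obtain f where f: "bij_betw f {..<card I} I" using ex_bij_betw_nat_finite[OF assms(2)] by (auto simp: atLeast0LessThan)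
  then have "dual_family A e q V {..<card I} (v \<circ> f) (\<phi> \<circ> f)"
    using assms(1) unfolding dual_family_def bij_betw_def inj_on_def by (simp add: set_eq_iff image_iff) metis
  then show ?thesis unfolding splits_def by blast
qed

lemma splits_0: "splits A e q V 0"
  unfolding splits_def dual_family_def by auto

lemma nonsplit_subset: "nonsplit A m q V \<subseteq> V"
  unfolding nonsplit_def by auto

text \<open>Functionals on \<open>V\<close> restrict to \<open>W\<close>. Through this inclusion a
  bound for a submodule becomes a bound for the whole module.\<close>

lemma nonsplit_mono:
  assumes "W \<subseteq> V" shows "nonsplit A m q W \<subseteq> nonsplit A m q V"
proof
  fix x assume x: "x \<in> nonsplit A m q W"
  have "qlin A q W \<phi>" if "qlin A q V \<phi>" for \<phi> using that assms unfolding qlin_def by blast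
  then show "x \<in> nonsplit A m q V" using x assms unfolding nonsplit_def by blast
qed

lemma generated_mod_mono: "generated_mod A q V N n \<Longrightarrow> N \<subseteq> N' \<Longrightarrow> n \<le> n' \<Longrightarrow> generated_mod A q V N' n'"
  unfolding generated_mod_def by (meson le_trans order_trans qspan_mono subset_refl sup.mono)

definition loc :: "'u::comm_ring_1 set \<Rightarrow> 'u \<Rightarrow> 'u set \<Rightarrow> bool" where
  "loc A e m \<longleftrightarrow> prime_in A m \<and> (\<forall>x\<in>A. x \<notin> m \<longrightarrow> (\<exists>y\<in>A. x * y = e))"

context char_p_subring begin

lemma nonsplit_pmodule:
  assumes m: "ideal_in A m" and V: "pmodule A q V"
  shows "pmodule A q (nonsplit A m q V)"
  using V by (intro pmoduleI)
    (auto simp: nonsplit_def pmodule_zero pmodule_add pmodule_smult qlin_zero qlinD ideal_in_zero[OF m]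
      intro: ideal_in_add[OF m] ideal_in_mult[OF m])

lemma nonsplit_max:
  assumes m: "ideal_in A m" and V: "pmodule A q V" and "a \<in> m" "v \<in> V"
  shows "a ^ q * v \<in> nonsplit A m q V"
  using assms ideal_in_subset[OF m] by (auto simp: nonsplit_def pmodule_smult qlinD intro: ideal_in_mult2[OF m])

text \<open>Applying \<open>\<phi> i\<close> to a combination reads off the coefficient
  \<open>c i\<close>, and on a nonsplit element the value lies in \<open>m\<close>.\<close>

lemma dual_family_indep:
  assumes m: "ideal_in A m" and V: "pmodule A q V" and I: "finite I" and d: "dual_family A e q V I v \<phi>"
  shows "indep_mod A m q (nonsplit A m q V) I v"
  unfolding indep_mod_def
proof (intro ballI impI)
  fix c i assume c: "c \<in> I \<rightarrow> A" and s: "(\<Sum>i\<in>I. c i ^ q * v i) \<in> nonsplit A m q V" and i: "i \<in> I"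
  have L: "qlin A q V (\<phi> i)" using d i unfolding dual_family_def by blast
  have "\<phi> i (\<Sum>j\<in>I. c j ^ q * v j) = (\<Sum>j\<in>I. \<phi> i (c j ^ q * v j))"
    using d c by (intro qlin_sum[OF L V]) (auto simp: dual_family_def intro!: pmodule_smult[OF V])
  also have "\<dots> = (\<Sum>j\<in>I. if j = i then c i else 0)"
    using d c i qlinD(3)[OF L, of "c _" "v _"]
    by (intro sum.cong) (auto simp: dual_family_def Pi_iff mult_one)
  also have "\<dots> = c i" using I i by simp
  finally show "c i \<in> m" using s L unfolding nonsplit_def by auto
qed

text \<open>\<open>m\<close> acts as zero on \<open>V\<close> modulo \<open>nonsplit\<close>, so the
  exchange lemma over the residue field compares a dual family with a generating set.\<close>

lemma splits_le_generated:
  assumes m: "prime_in A m" and V: "pmodule A (p ^ n) V" and s: "splits A e (p ^ n) V k"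
    and g: "generated_mod A (p ^ n) V (nonsplit A m (p ^ n) V) l"
  shows "k \<le> l"
proof -
  note id = prime_in_ideal[OF m]
  obtain v \<phi> where d: "dual_family A e (p ^ n) V {..<k} v \<phi>" using s unfolding splits_def by blast
  obtain X where X: "X \<subseteq> V" "finite X" "card X \<le> l" "V \<subseteq> qspan A (p ^ n) (nonsplit A m (p ^ n) V \<union> X)"
    using g unfolding generated_mod_def by blast
  have "card {..<k} \<le> card X"
  proof (rule indep_mod_card_le[OF m nonsplit_pmodule[OF id V] _ dual_family_indep[OF id V _ d] X(2)])
    show "v i \<in> qspan A (p ^ n) (nonsplit A m (p ^ n) V \<union> X)" if "i \<in> {..<k}" for i
      using d X(4) that unfolding dual_family_def by blast
    show "a ^ (p ^ n) * x \<in> nonsplit A m (p ^ n) V" if "a \<in> m" "x \<in> X" for a x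
      using nonsplit_max[OF id V that(1)] that(2) X(1) by blast
  qed auto
  then show ?thesis using X(3) by simp
qed

text \<open>A maximal dual family leaves a complement inside \<open>nonsplit\<close>: a functional with a unit value
  there could be corrected to extend the family.\<close>

lemma generated_mod_splits:
  assumes m: "loc A e m" and V: "pmodule A (p ^ n) V" and VE: "\<And>v. v \<in> V \<Longrightarrow> e * v = v"
    and s: "splits A e (p ^ n) V k" and ns: "\<not> splits A e (p ^ n) V (Suc k)"
  shows "generated_mod A (p ^ n) V (nonsplit A m (p ^ n) V) k"
proof -
  define q where "q = p ^ n"
  note V = V[folded q_def]
  have mp: "prime_in A m" using m unfolding loc_def by blast
  obtain v \<phi> where d: "dual_family A e q V {..<k} v \<phi>" using s unfolding splits_def q_def by blast
  have v: "v i \<in> V" and L: "qlin A q V (\<phi> i)" if "i < k" for i using d that unfolding dual_family_def by auto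
  have dd: "\<phi> i (v j) = (if i = j then e else 0)" if "i < k" "j < k" for i j
    using d that unfolding dual_family_def by auto
  \<comment> \<open>\<open>r\<close> is the projection onto the span of the family along the common
    kernel of the functionals.\<close>
  define r where "r y = (\<Sum>i<k. \<phi> i y ^ q * v i)" for y
  have rV: "r y \<in> V" if "y \<in> V" for y unfolding r_def
    using v qlinD(1)[OF L that] by (intro pmodule_sum[OF V] pmodule_smult[OF V]) auto
  have phr: "\<phi> j (r y) = \<phi> j y" if y: "y \<in> V" and j: "j < k" for y j
  proof -
    have "\<phi> j (r y) = (\<Sum>i<k. \<phi> j (\<phi> i y ^ q * v i))" unfolding r_def
      using v qlinD(1)[OF L y] by (intro qlin_sum[OF L[OF j] V] pmodule_smult[OF V]) auto
    also have "\<dots> = (\<Sum>i<k. if i = j then \<phi> j y else 0)"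
      using dd j qlinD(3)[OF L[OF j] qlinD(1)[OF L y] v] qlinD(1)[OF L[OF j] y]
      by (intro sum.cong) (auto simp: mult_one)
    finally show ?thesis using j by simp
  qed
  have neg: "- y \<in> V" if "y \<in> V" for y
    using pmodule_uminus[OF V[unfolded q_def] that VE[OF that]] .
  have key: "y - r y \<in> nonsplit A m q V" if y: "y \<in> V" for y
  proof (rule ccontr)
    define z where "z = y - r y"
    have zV: "z \<in> V" using pmodule_add[OF V y neg[OF rV[OF y]]] by (simp add: z_def)
    have z0: "\<phi> i z = 0" if i: "i < k" for i
    proof -
      have "\<phi> i y = \<phi> i (z + r y)" by (simp add: z_def)
      also have "\<dots> = \<phi> i z + \<phi> i y" using qlinD(2)[OF L[OF i] zV rV[OF y]] phr[OF y i] by simp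
      finally show ?thesis by simp
    qed
    assume "y - r y \<notin> nonsplit A m q V"
    then obtain \<psi> where psi: "qlin A q V \<psi>" "\<psi> z \<notin> m" using zV unfolding nonsplit_def z_def by blast
    obtain b where b: "b \<in> A" "\<psi> z * b = e" using m psi qlinD(1)[OF psi(1) zV] unfolding loc_def by blast
    \<comment> \<open>The new vector is rescaled so that \<open>\<psi>\<close> takes the value
      \<open>e\<close> on it, and \<open>\<psi>\<close> is corrected by its values on the old
      vectors. Since \<open>z\<close> lies in the common kernel, the old dual relations
      survive.\<close>
    define v' where "v' i = (if i = k then b ^ q * z else v i)" for i
    define \<phi>' where "\<phi>' i = (if i = k then (\<lambda>y. \<psi> y - (\<Sum>i<k. \<psi> (v i) * \<phi> i y)) else
        (\<lambda>y. \<phi> i y))" for i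
    have "qlin A q V (\<lambda>y. \<psi> y - (\<Sum>i<k. \<psi> (v i) * \<phi> i y))"
      unfolding qlin_def
    proof (intro conjI ballI)
      show "(\<lambda>y. \<psi> y - (\<Sum>i<k. \<psi> (v i) * \<phi> i y)) \<in> V \<rightarrow> A"
        using qlinD(1)[OF psi(1)] v qlinD(1)[OF L] by (auto intro!: diff_mem sum_mem mult_mem)
      show "\<psi> (x + y) - (\<Sum>i<k. \<psi> (v i) * \<phi> i (x + y)) =
          \<psi> x - (\<Sum>i<k. \<psi> (v i) * \<phi> i x) + (\<psi> y - (\<Sum>i<k. \<psi> (v i) * \<phi> i y))" if "x \<in> V" "y \<in> V" for x y
        using that qlinD(2)[OF psi(1)] qlinD(2)[OF L] by (simp add: distrib_left sum.distrib)
      show "\<psi> (a ^ q * x) - (\<Sum>i<k. \<psi> (v i) * \<phi> i (a ^ q * x)) = a * (\<psi> x - (\<Sum>i<k. \<psi> (v i) * \<phi> i x))"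
        if "a \<in> A" "x \<in> V" for a x
        using that qlinD(3)[OF psi(1)] qlinD(3)[OF L] by (simp add: right_diff_distrib sum_distrib_left algebra_simps)
    qed
    then have L': "qlin A q V (\<phi>' i)" if "i \<le> k" for i using L that by (auto simp: \<phi>'_def)
    have v'V: "v' i \<in> V" if "i \<le> k" for i using v pmodule_smult[OF V b(1) zV] that by (auto simp: v'_def)
    have bz: "\<phi> i (b ^ q * z) = 0" if "i < k" for i using qlinD(3)[OF L[OF that] b(1) zV] z0[OF that] by simp
    have 1: "\<phi>' k (v' k) = e"
      using bz qlinD(3)[OF psi(1) b(1) zV] b by (simp add: \<phi>'_def v'_def mult.commute)
    have 2: "\<phi>' k (v' j) = 0" if j: "j < k" for j
    proof -
      have "(\<Sum>i<k. \<psi> (v i) * \<phi> i (v j)) = (\<Sum>i<k. if i = j then \<psi> (v j) else 0)"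
        using dd j mult_one[OF qlinD(1)[OF psi(1) v]] by (intro sum.cong) auto
      then show ?thesis using j by (simp add: \<phi>'_def v'_def)
    qed
    have 3: "\<phi>' i (v' k) = 0" if "i < k" for i using bz that by (simp add: \<phi>'_def v'_def)
    have 4: "\<phi>' i (v' j) = (if i = j then e else 0)" if "i < k" "j < k" for i j
      using dd that by (simp add: \<phi>'_def v'_def)
    have "\<phi>' i (v' j) = (if i = j then e else 0)" if "i < Suc k" "j < Suc k" for i j
      using 1 2 3 4 that by (cases "i = k"; cases "j = k") auto
    then have "dual_family A e q V {..<Suc k} v' \<phi>'"
      using L' v'V unfolding dual_family_def by auto
    then show False using ns unfolding splits_def q_def by blast
  qed
  let ?N = "nonsplit A m q V"
  have "V \<subseteq> qspan A q (?N \<union> v ` {..<k})"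
  proof
    fix y assume y: "y \<in> V"
    have zE: "e * (y - r y) = y - r y" using VE[OF y] VE[OF rV[OF y]] by (simp add: right_diff_distrib)
    have "y - r y \<in> qspan A q (?N \<union> v ` {..<k})"
      unfolding q_def by (rule qspan_base) (use key[OF y] zE in \<open>simp_all add: q_def\<close>)
    moreover have "r y \<in> qspan A q (?N \<union> v ` {..<k})"
      unfolding r_def using qlinD(1)[OF L y] by (intro pmodule_sum[OF qspan_pmodule'] qspan_smult_base) auto
    ultimately have "(y - r y) + r y \<in> qspan A q (?N \<union> v ` {..<k})" by (rule qspan_add)
    then show "y \<in> qspan A q (?N \<union> v ` {..<k})" by simp
  qed
  moreover have "card (v ` {..<k}) \<le> k" using card_image_le[of "{..<k}" v] by simp
  ultimately show ?thesis unfolding generated_mod_def q_def[symmetric] using v by (intro exI[of _ "v ` {..<k}"]) auto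
qed

text \<open>The nonsplit part of \<open>W\<close> and the product of \<open>m\<close> with F^n_* V
  both lie in the nonsplit part of \<open>V\<close>. So generators of \<open>W\<close> modulo the
  former and of \<open>V\<close> modulo \<open>W\<close> and the latter suffice together; this
  bounds the free rank of \<open>V\<close> by that of a submodule.\<close>

lemma generated_mod_submodule:
  assumes m: "ideal_in A m" and V: "pmodule A (p ^ n) V" and W: "W \<subseteq> V" and VE: "\<And>v. v \<in> V \<Longrightarrow> e * v = v"
    and 1: "generated_mod A (p ^ n) W (nonsplit A m (p ^ n) W) k"
    and 2: "generated_mod A (p ^ n) V (W \<union> qspan m (p ^ n) V) l"
  shows "generated_mod A (p ^ n) V (nonsplit A m (p ^ n) V) (k + l)"
proof -
  let ?q = "p ^ n" and ?N = "nonsplit A m (p ^ n) V"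
  obtain X where X: "X \<subseteq> W" "finite X" "card X \<le> k" "W \<subseteq> qspan A ?q (nonsplit A m ?q W \<union> X)"
    using 1 unfolding generated_mod_def by blast
  obtain Y where Y: "Y \<subseteq> V" "finite Y" "card Y \<le> l" "V \<subseteq> qspan A ?q ((W \<union> qspan m ?q V) \<union> Y)"
    using 2 unfolding generated_mod_def by blast
  let ?S = "qspan A ?q (?N \<union> (X \<union> Y))"
  have "W \<subseteq> ?S"
    using X(4) nonsplit_mono[OF W, of A m ?q] by (meson Un_mono Un_upper1 order_trans qspan_mono subset_refl)
  moreover have "qspan m ?q V \<subseteq> ?N"
    using nonsplit_max[OF m V] nonsplit_pmodule[OF m V]
    by (intro qspan_subset) (auto intro: pmodule_zero pmodule_add)
  moreover have "?N \<subseteq> ?S" "Y \<subseteq> ?S"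
    using VE nonsplit_subset[of A m ?q V] Y(1) by (auto intro!: qspan_base)
  ultimately have "(W \<union> qspan m ?q V) \<union> Y \<subseteq> ?S" by blast
  then have "V \<subseteq> ?S" using Y(4) qspan_trans by blast
  moreover have "card (X \<union> Y) \<le> k + l" using card_Un_le[of X Y] X(3) Y(3) by linarith
  ultimately show ?thesis unfolding generated_mod_def using X Y W by (intro exI[of _ "X \<union> Y"]) auto
qed

text \<open>One generator at a time. With \<open>x\<close> put into \<open>W\<close>, the induction
  hypothesis places the remaining generators in the span of \<open>W\<close> and \<open>x\<close>,
  so \<open>x = w + a ^ q * x\<close> with \<open>a\<close> in \<open>m\<close>. As
  \<open>e - a\<close> is a unit and q-th powers are additive, \<open>x\<close> lies in
  \<open>W\<close>.\<close>

lemma nakayama: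
  assumes m: "loc A e m" and X: "finite X" and W: "pmodule A (p ^ n) W"
    and VE: "\<And>v. v \<in> W \<union> X \<Longrightarrow> e * v = v"
    and XW: "X \<subseteq> qspan A (p ^ n) (W \<union> qspan m (p ^ n) (W \<union> X))"
  shows "X \<subseteq> W"
  using X W VE XW
proof (induction X arbitrary: W rule: finite_induct)
  case (insert x X)
  let ?q = "p ^ n"
  have mp: "prime_in A m" using m unfolding loc_def by blast
  note id = prime_in_ideal[OF mp]
  define W' where "W' = qspan A ?q (W \<union> {x})"
  have W': "pmodule A ?q W'" unfolding W'_def by (rule qspan_pmodule')
  have xW': "x \<in> W'" and WW': "W \<subseteq> W'" using insert.prems(2) by (auto simp: W'_def intro!: qspan_base)
  have E: "pmodule A ?q {v. e * v = v}" by (rule pmoduleI) (auto simp: distrib_left mult.left_commute[of e])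
  have W'E: "e * v = v" if "v \<in> W'" for v
    using qspan_subset_pmodule[OF E, of "W \<union> {x}"] insert.prems(2) that by (auto simp: W'_def)
  have XW': "X \<subseteq> W'"
  proof (rule insert.IH[OF W'])
    show "e * v = v" if "v \<in> W' \<union> X" for v using that W'E insert.prems(2) by auto
    have "qspan m ?q (W \<union> insert x X) \<subseteq> qspan m ?q (W' \<union> X)" using WW' xW' by (intro qspan_mono) auto
    then have "qspan A ?q (W \<union> qspan m ?q (W \<union> insert x X)) \<subseteq> qspan A ?q (W' \<union> qspan m ?q (W' \<union> X))"
      using WW' by (intro qspan_mono) auto
    then show "X \<subseteq> qspan A ?q (W' \<union> qspan m ?q (W' \<union> X))" using insert.prems(3) by blast
  qed
  \<comment> \<open>\<open>M\<close> is \<open>W\<close> plus the multiples of \<open>x\<close> by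
    the maximal ideal; the hypothesis on \<open>insert x X\<close> places \<open>x\<close> itself in
    it.\<close>
  define M where "M = {w + a ^ ?q * x | w a. w \<in> W \<and> a \<in> m}"
  have M: "pmodule A ?q M"
  proof (rule pmoduleI)
    show "0 \<in> M" using pmodule_zero[OF insert.prems(1)] ideal_in_zero[OF id] zero_pow[of n]
      unfolding M_def by force
    fix y z assume "y \<in> M" "z \<in> M"
    then obtain w a w' a' where *: "w \<in> W" "a \<in> m" "y = w + a ^ ?q * x" "w' \<in> W" "a' \<in> m" "z = w' + a' ^ ?q * x"
      unfolding M_def by blast
    then have "y + z = (w + w') + (a + a') ^ ?q * x"
      using ideal_in_subset[OF id] by (simp add: add_pow algebra_simps)
    then show "y + z \<in> M" using * pmodule_add[OF insert.prems(1)] ideal_in_add[OF id] unfolding M_def by blast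
  next
    fix b y assume b: "b \<in> A" and "y \<in> M"
    then obtain w a where *: "w \<in> W" "a \<in> m" "y = w + a ^ ?q * x" unfolding M_def by blast
    then have "b ^ ?q * y = b ^ ?q * w + (b * a) ^ ?q * x" by (simp add: algebra_simps power_mult_distrib)
    then show "b ^ ?q * y \<in> M" using * b pmodule_smult[OF insert.prems(1)] ideal_in_mult[OF id] unfolding M_def by blast
  qed
  have WM: "W \<subseteq> M"
  proof
    fix w assume "w \<in> W"
    then show "w \<in> M" using ideal_in_zero[OF id] zero_pow[of n] unfolding M_def
      by (intro CollectI exI[of _ w] exI[of _ 0]) auto
  qed
  have "a ^ ?q * y \<in> M" if a: "a \<in> m" and y: "y \<in> W'" for a y
  proof -
    from y obtain w c where y': "w \<in> W" "c \<in> {x} \<rightarrow> A" "y = w + (\<Sum>x\<in>{x}. c x ^ ?q * x)"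
      using qspan_finite_rep[OF insert.prems(1), of "{x}" y] unfolding W'_def by blast
    then have "a ^ ?q * y = a ^ ?q * w + (a * c x) ^ ?q * x" by (simp add: algebra_simps power_mult_distrib)
    moreover have "a ^ ?q * w \<in> W" using pmodule_smult[OF insert.prems(1)] ideal_in_subset[OF id a] y' by blast
    moreover have "a * c x \<in> m" using ideal_in_mult2[OF id] a y' by auto
    ultimately show ?thesis unfolding M_def by blast
  qed
  then have "qspan m ?q (W \<union> insert x X) \<subseteq> M"
    using XW' xW' WW' pmodule_zero[OF M] pmodule_add[OF M] by (intro qspan_subset) blast+
  then have "qspan A ?q (W \<union> qspan m ?q (W \<union> insert x X)) \<subseteq> M"
    using qspan_subset_pmodule[OF M] WM by (metis Un_least)
  then have "x \<in> M" using insert.prems(3) by auto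
  then obtain w a where wa: "w \<in> W" "a \<in> m" "x = w + a ^ ?q * x" unfolding M_def by blast
  have aA: "a \<in> A" using ideal_in_subset[OF id wa(2)] .
  have "e - a \<notin> m"
  proof
    assume "e - a \<in> m"
    then have "(e - a) + a \<in> m" using ideal_in_add[OF id] wa(2) by blast
    then show False using prime_in_one[OF mp] by simp
  qed
  then obtain b where b: "b \<in> A" "(e - a) * b = e"
    using m diff_mem[OF one_mem aA] unfolding loc_def by blast
  have xE: "e * x = x" using insert.prems(2) by blast
  have "(e - a) ^ ?q * x = w"
    using arg_cong[OF wa(3), of "\<lambda>z. z - a ^ ?q * x"] xE
    by (simp add: diff_pow[OF one_mem aA] one_pow_q left_diff_distrib)
  then have "b ^ ?q * w = ((e - a) * b) ^ ?q * x" by (auto simp: power_mult_distrib mult_ac)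
  then have "x = b ^ ?q * w" using b xE one_pow_q by simp
  then have xW: "x \<in> W" using pmodule_smult[OF insert.prems(1) b(1) wa(1)] by simp
  then have "W' \<subseteq> W" unfolding W'_def by (intro qspan_subset_pmodule[OF insert.prems(1)]) auto
  then show ?case using XW' xW by blast
qed auto

end

section \<open>Bases and towers\<close>

context char_p_subring begin

lemma pmodule_colon: "pmodule A q M \<Longrightarrow> pmodule A q {v. c * v \<in> M}"
  by (rule pmoduleI) (auto simp: pmodule_zero distrib_left mult.left_commute[of c]
    intro: pmodule_add pmodule_smult)

lemma ideal_in_pmodule: "ideal_in A I \<Longrightarrow> pmodule A (p ^ n) I"
  using pow_mem_q by (intro pmoduleI) (auto intro: ideal_in_zero ideal_in_add ideal_in_mult)

lemma pmodule_self: "pmodule A (p ^ n) A"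
  by (intro pmoduleI) (auto intro: mem_intros)

lemma pmodule_singleton_zero: "pmodule A q {0}"
  by (intro pmoduleI) auto

lemma common_multiplier:
  assumes P: "prime_in A P" and M: "pmodule A q M"
  shows "finite X \<Longrightarrow> (\<And>x. x \<in> X \<Longrightarrow> \<exists>c\<in>A. c \<notin> P \<and> c ^ q * x \<in> M) \<Longrightarrow>
    \<exists>c\<in>A. c \<notin> P \<and> (\<forall>x\<in>X. c ^ q * x \<in> M)"
proof (induction X rule: finite_induct)
  case empty
  then show ?case using one_mem prime_in_one[OF P] by auto
next
  case (insert x X)
  then obtain c where c: "c \<in> A" "c \<notin> P" "\<forall>x\<in>X. c ^ q * x \<in> M" by auto
  obtain d where d: "d \<in> A" "d \<notin> P" "d ^ q * x \<in> M" using insert.prems by blast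
  have "(c * d) ^ q * y \<in> M" if "y \<in> insert x X" for y
  proof (cases "y = x")
    case True
    then show ?thesis using pmodule_smult[OF M c(1) d(3)] by (simp add: power_mult_distrib mult.assoc)
  next
    case False
    then have "d ^ q * (c ^ q * y) \<in> M" using pmodule_smult[OF M d(1)] c(3) that by blast
    then show ?thesis by (simp add: power_mult_distrib mult_ac)
  qed
  then show ?case using prime_in_mult[OF P c(1) d(1)] c d mult_mem[OF c(1) d(1)] by blast
qed

text \<open>Only finitely many denominators occur, so a maximal independent subset of the generators
  spans everything up to one factor \<open>c\<close> outside \<open>P\<close>. For the maximal ideal
  \<open>c\<close> is a unit and \<open>T\<close> lifts a basis over the residue field; for
  \<open>P = {0}\<close> it is a generic basis; for primes between these it computes degrees along a
  chain.\<close>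

lemma maximal_indep:
  assumes P: "prime_in A P" and N: "pmodule A (p ^ n) N" and X: "finite X"
    and E: "\<And>x. x \<in> X \<Longrightarrow> e * x = x" "\<And>x. x \<in> N \<Longrightarrow> e * x = x"
    and PX: "\<And>a x. a \<in> P \<Longrightarrow> x \<in> X \<Longrightarrow> a ^ (p ^ n) * x \<in> N"
  obtains T c where "T \<subseteq> X" "indep_mod A P (p ^ n) N T (\<lambda>x. x)" "c \<in> A" "c \<notin> P"
    "\<And>v. v \<in> qspan A (p ^ n) (N \<union> X) \<Longrightarrow> c ^ (p ^ n) * v \<in> qspan A (p ^ n) (N \<union> T)"
proof -
  let ?q = "p ^ n"
  define TT where "TT = {T. T \<subseteq> X \<and> indep_mod A P ?q N T (\<lambda>x. x)}"
  have fin: "finite TT" using X by (simp add: TT_def)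
  have "{} \<in> TT" by (auto simp: TT_def indep_mod_def)
  then have ne: "TT \<noteq> {}" by blast
  have "Max (card ` TT) \<in> card ` TT" using fin ne by (intro Max_in) auto
  then obtain T where T: "T \<in> TT" and cT: "card T = Max (card ` TT)" by force
  have mx: "card T' \<le> card T" if "T' \<in> TT" for T' unfolding cT using fin that by (intro Max_ge) auto
  have TX: "T \<subseteq> X" and Ti: "indep_mod A P ?q N T (\<lambda>x. x)" using T by (auto simp: TT_def)
  have fT: "finite T" using TX X finite_subset by blast
  define M where "M = qspan A ?q (N \<union> T)"
  have M: "pmodule A ?q M" unfolding M_def by (rule qspan_pmodule')
  have NM: "N \<subseteq> M" and TM: "T \<subseteq> M" using E TX by (auto simp: M_def intro!: qspan_base)
  have "\<exists>c\<in>A. c \<notin> P \<and> c ^ ?q * x \<in> M" if x: "x \<in> X" for x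
  proof (cases "x \<in> T")
    case True
    then show ?thesis using TM one_mem prime_in_one[OF P] one_pow_q E x by (intro bexI[of _ e]) auto
  next
    case False
    have "insert x T \<notin> TT" using mx[of "insert x T"] fT False by auto
    then have "\<not> indep_mod A P ?q N (insert x T) (\<lambda>x. x)" using TX x by (auto simp: TT_def)
    then obtain c i where c: "c \<in> insert x T \<rightarrow> A" "(\<Sum>i\<in>insert x T. c i ^ ?q * i) \<in> N"
      "i \<in> insert x T" "c i \<notin> P" unfolding indep_mod_def by blast
    have s: "c x ^ ?q * x + (\<Sum>i\<in>T. c i ^ ?q * i) \<in> N" using c(2) fT False by simp
    have cT: "(\<Sum>i\<in>T. c i ^ ?q * i) \<in> M"
      using c(1) TM by (intro pmodule_sum[OF M] pmodule_smult[OF M]) auto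
    have EM: "e * y = y" if "y \<in> X" for y using E that by auto
    have Es: "e * (\<Sum>i\<in>T. c i ^ ?q * i) = (\<Sum>i\<in>T. c i ^ ?q * i)"
      using E TX by (auto simp: sum_distrib_left mult.left_commute[of e] intro!: sum.cong)
    have Ex: "e * (c x ^ ?q * x) = c x ^ ?q * x" using E x by (simp add: mult.left_commute[of e])
    \<comment> \<open>Otherwise the term at \<open>x\<close> lies in \<open>N\<close>, and what
      remains is a relation among the elements of \<open>T\<close> alone.\<close>
    have "c x \<notin> P"
    proof
      assume "c x \<in> P"
      then have "c x ^ ?q * x \<in> N" using PX x by blast
      then have "c x ^ ?q * x + (\<Sum>i\<in>T. c i ^ ?q * i) - c x ^ ?q * x \<in> N"
        using pmodule_diff[OF N s] Ex by blast
      then have "\<forall>i\<in>T. c i \<in> P" using Ti c(1) unfolding indep_mod_def by auto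
      then show False using c(3,4) \<open>c x \<in> P\<close> by auto
    qed
    moreover have "c x ^ ?q * x \<in> M"
      using pmodule_diff[OF M _ cT Es, of "c x ^ ?q * x + (\<Sum>i\<in>T. c i ^ ?q * i)"] s NM by auto
    ultimately show ?thesis using c(1) by auto
  qed
  then obtain c where c: "c \<in> A" "c \<notin> P" "\<forall>x\<in>X. c ^ ?q * x \<in> M"
    using common_multiplier[OF P M X] by blast
  have "N \<union> X \<subseteq> {v. c ^ ?q * v \<in> M}" using c(3) pmodule_smult[OF M c(1)] NM by blast
  then have "qspan A ?q (N \<union> X) \<subseteq> {v. c ^ ?q * v \<in> M}"
    by (rule qspan_subset_pmodule[OF pmodule_colon[OF M]])
  then show ?thesis using that[OF TX Ti c(1,2)] unfolding M_def by blast
qed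

end

text \<open>Multiplicativity of degrees, lower half. The coefficient at \<open>g i\<close> is a
  combination of the \<open>h j\<close>, and an element of \<open>B\<close> acts on
  \<open>g i\<close> through its \<open>p ^ a\<close>-th power; hence the shape of the products and
  the sum of the exponents.\<close>

lemma indep_mod_tower:
  assumes B: "char_p_subring B e p" and AB: "A \<subseteq> B" and J: "finite J" and I: "finite I"
    and g: "indep_mod B Q (p ^ a) N I g" and h: "indep_mod A P (p ^ b) Q J h" and hB: "h \<in> J \<rightarrow> B"
  shows "indep_mod A P (p ^ (a + b)) N (I \<times> J) (\<lambda>(i, j). h j ^ (p ^ a) * g i)"
proof -
  interpret B: char_p_subring B e p by (rule B)
  show ?thesis unfolding indep_mod_def
  proof (intro ballI impI)
    fix c x assume c: "c \<in> I \<times> J \<rightarrow> A"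
      and s: "(\<Sum>x\<in>I \<times> J. c x ^ (p ^ (a + b)) * (case x of (i, j) \<Rightarrow> h j ^ (p ^ a) * g i)) \<in> N" and x: "x \<in> I \<times> J"
    have cB: "c (i, j) \<in> B" if "i \<in> I" "j \<in> J" for i j using c AB that by auto
    define d where "d i = (\<Sum>j\<in>J. c (i, j) ^ (p ^ b) * h j)" for i
    have dB: "d \<in> I \<rightarrow> B" using cB hB by (auto simp: d_def intro!: B.sum_mem B.mult_mem B.pow_mem_q)
    have "(\<Sum>x\<in>I \<times> J. c x ^ (p ^ (a + b)) * (case x of (i, j) \<Rightarrow> h j ^ (p ^ a) * g i)) =
        (\<Sum>i\<in>I. \<Sum>j\<in>J. c (i, j) ^ (p ^ (a + b)) * (h j ^ (p ^ a) * g i))"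
      by (simp add: sum.cartesian_product split_def)
    also have "\<dots> = (\<Sum>i\<in>I. d i ^ (p ^ a) * g i)"
    proof (intro sum.cong refl)
      fix i assume i: "i \<in> I"
      have "d i ^ (p ^ a) = (\<Sum>j\<in>J. (c (i, j) ^ (p ^ b) * h j) ^ (p ^ a))"
        unfolding d_def using cB[OF i] hB by (intro B.sum_pow) (auto intro!: B.mult_mem B.pow_mem_q)
      then show "(\<Sum>j\<in>J. c (i, j) ^ (p ^ (a + b)) * (h j ^ (p ^ a) * g i)) = d i ^ (p ^ a) * g i"
        by (simp add: sum_distrib_left sum_distrib_right power_mult_distrib power_add mult_ac flip: power_mult)
    qed
    finally have "(\<Sum>i\<in>I. d i ^ (p ^ a) * g i) \<in> N" using s by simp
    then have "\<forall>i\<in>I. d i \<in> Q" using g dB unfolding indep_mod_def by blast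
    moreover obtain i j where ij: "x = (i, j)" "i \<in> I" "j \<in> J" using x by blast
    ultimately have "(\<Sum>j\<in>J. c (i, j) ^ (p ^ b) * h j) \<in> Q" by (simp add: d_def)
    moreover have "(\<lambda>j. c (i, j)) \<in> J \<rightarrow> A" using c ij by auto
    ultimately show "c x \<in> P" using indep_modD[OF h, of "\<lambda>j. c (i, j)" j] ij by simp
  qed
qed

text \<open>The generating counterpart. \<open>B\<close> is generated only modulo \<open>M\<close>,
  and the hypothesis relating \<open>M\<close>, \<open>X\<close> and \<open>N\<close> makes these
  remainders disappear in \<open>N\<close>.\<close>

lemma qspan_tower:
  assumes A: "char_p_subring A e p" and B: "char_p_subring B e p" and AB: "A \<subseteq> B"
    and V: "V \<subseteq> qspan B (p ^ a) (N \<union> X)" and N: "pmodule B (p ^ a) N" and Y: "B \<subseteq> qspan A (p ^ b) (M \<union> Y)"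
    and MN: "\<And>y x. y \<in> M \<Longrightarrow> x \<in> X \<Longrightarrow> y ^ (p ^ a) * x \<in> N" and YB: "Y \<subseteq> B" and MB: "M \<subseteq> B"
    and E: "\<And>x. x \<in> N \<Longrightarrow> e * x = x" "\<And>x. x \<in> X \<Longrightarrow> e * x = x"
  shows "V \<subseteq> qspan A (p ^ (a + b)) (N \<union> (\<lambda>(x, y). y ^ (p ^ a) * x) ` (X \<times> Y))"
proof -
  interpret A: char_p_subring A e p by (rule A)
  interpret B: char_p_subring B e p by (rule B)
  let ?S = "qspan A (p ^ (a + b)) (N \<union> (\<lambda>(x, y). y ^ (p ^ a) * x) ` (X \<times> Y))"
  have S: "pmodule A (p ^ (a + b)) ?S" by (rule A.qspan_pmodule')
  have NS: "N \<subseteq> ?S" using E by (auto intro!: A.qspan_base)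
  have "c ^ (p ^ a) * x \<in> ?S" if c: "c \<in> B" and x: "x \<in> N \<union> X" for c x
  proof (cases "x \<in> N")
    case True
    then show ?thesis using NS pmodule_smult[OF N c] by blast
  next
    case False
    then have x: "x \<in> X" using x by blast
    \<comment> \<open>The elements of \<open>B\<close> that carry \<open>x\<close> into the target
      form an \<open>A\<close>-submodule of F^b_* B, so testing generators suffices.\<close>
    let ?T = "{c \<in> B. c ^ (p ^ a) * x \<in> ?S}"
    have "pmodule A (p ^ b) ?T"
    proof (rule pmoduleI)
      show "0 \<in> ?T" using B.zero_mem B.zero_pow pmodule_zero[OF S] by auto
      show "y + z \<in> ?T" if "y \<in> ?T" "z \<in> ?T" for y z
        using that pmodule_add[OF S] by (auto simp: B.add_pow distrib_right intro: B.add_mem)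
      show "r ^ (p ^ b) * y \<in> ?T" if "r \<in> A" "y \<in> ?T" for r y
      proof -
        have "(r ^ (p ^ b) * y) ^ (p ^ a) * x = r ^ (p ^ (a + b)) * (y ^ (p ^ a) * x)"
          by (simp add: power_mult_distrib power_add mult_ac flip: power_mult)
        then show ?thesis using that AB pmodule_smult[OF S, of r "y ^ (p ^ a) * x"]
          by (auto intro!: B.mult_mem B.pow_mem_q)
      qed
    qed
    moreover have "M \<union> Y \<subseteq> ?T"
    proof
      fix y assume y: "y \<in> M \<union> Y"
      show "y \<in> ?T"
      proof (cases "y \<in> M")
        case True
        then show ?thesis using MN[OF True x] NS MB by auto
      next
        case False
        then have yY: "y \<in> Y" using y by blast
        have "y ^ (p ^ a) * x \<in> ?S"
          using E(2)[OF x] x yY by (intro A.qspan_base) (auto simp: mult.left_commute[of e])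
        then show ?thesis using yY YB by auto
      qed
    qed
    ultimately have "B \<subseteq> ?T" using Y qspan_subset_pmodule by blast
    then show ?thesis using c by blast
  qed
  then have "qspan B (p ^ a) (N \<union> X) \<subseteq> ?S"
    using pmodule_zero[OF S] pmodule_add[OF S] by (intro qspan_subset) auto
  then show ?thesis using V by blast
qed

context char_p_subring begin

text \<open>Iterating the tower with both rings equal to \<open>A\<close>: degrees over
  \<open>p ^ n\<close>-th powers are at least the n-th powers of those over p-th powers. The next
  lemma is the upper half.\<close>

lemma indep_mod_power:
  assumes T: "finite T" "T \<subseteq> A" "indep_mod A P p P T (\<lambda>x. x)" and P: "prime_in A P"
  shows "\<exists>v. v \<in> {..<card T ^ n} \<rightarrow> A \<and> indep_mod A P (p ^ n) P {..<card T ^ n} v"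
proof (induction n)
  case 0
  have "c 0 \<in> P" if "c (0::nat) \<in> A" "c 0 * e \<in> P" for c using that mult_one by simp
  then show ?case by (intro exI[of _ "\<lambda>_. e"]) (auto simp: indep_mod_def one_mem Pi_iff)
next
  case (Suc n)
  then obtain v where v: "v \<in> {..<card T ^ n} \<rightarrow> A" "indep_mod A P (p ^ n) P {..<card T ^ n} v" by blast
  have c: "char_p_subring A e p" by (rule char_p_subring_axioms)
  let ?I = "T \<times> {..<card T ^ n}" and ?w = "\<lambda>(x, j). v j ^ p ^ 1 * x"
  have w: "indep_mod A P (p ^ (1 + n)) P ?I ?w"
    by (rule indep_mod_tower[OF c subset_refl _ T(1) _ v(2) v(1)]) (use T(3) in auto)
  obtain f where f: "bij_betw f {..<card T ^ Suc n} ?I"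
    using ex_bij_betw_nat_finite[of ?I] T(1) by (auto simp: card_cartesian_product atLeast0LessThan)
  have "?w x \<in> A" if "x \<in> ?I" for x using that v(1) T(2) by (auto intro!: pow_mult_mem)
  then have "?w \<circ> f \<in> {..<card T ^ Suc n} \<rightarrow> A" using bij_betwE[OF f] by auto
  moreover have "indep_mod A P (p ^ Suc n) P {..<card T ^ Suc n} (?w \<circ> f)"
    using indep_mod_reindex[OF f w] by (simp only: plus_1_eq_Suc)
  ultimately show ?case by blast
qed

lemma qspan_power:
  assumes T: "finite T" "T \<subseteq> A" "A \<subseteq> qspan A p (N \<union> T)" and N: "ideal_in A N"
  shows "\<exists>Z\<subseteq>A. finite Z \<and> card Z \<le> card T ^ n \<and> A \<subseteq> qspan A (p ^ n) (N \<union> Z)"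
proof (induction n)
  case 0
  have "x \<in> qspan A 1 (N \<union> {e})" if "x \<in> A" for x
    using qspan_smult_base[OF that, of e "N \<union> {e}" 1] mult_one[OF that] by simp
  then show ?case using one_mem by (intro exI[of _ "{e}"]) auto
next
  case (Suc n)
  then obtain Z where Z: "Z \<subseteq> A" "finite Z" "card Z \<le> card T ^ n" "A \<subseteq> qspan A (p ^ n) (N \<union> Z)" by blast
  have c: "char_p_subring A e p" by (rule char_p_subring_axioms)
  let ?Z = "(\<lambda>(x, y). y ^ (p ^ 1) * x) ` (T \<times> Z)"
  have "A \<subseteq> qspan A (p ^ (1 + n)) (N \<union> ?Z)"
  proof (rule qspan_tower[OF c c subset_refl _ ideal_in_pmodule[OF N] Z(4) _ Z(1)])
    show "A \<subseteq> qspan A (p ^ 1) (N \<union> T)" using T(3) by simp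
    show "y ^ p ^ 1 * x \<in> N" if "y \<in> N" "x \<in> T" for y x
    proof -
      obtain k where "p = Suc k" using q_pos[of 1] by (cases p) auto
      then have "y ^ p ^ 1 * x = (y ^ k * x) * y" by (simp add: mult_ac)
      then show ?thesis using ideal_in_mult[OF N _ that(1)] pow_mult_mem[OF ideal_in_subset[OF N that(1)]] that(2) T(2) by auto
    qed
    show "N \<subseteq> A" using N unfolding ideal_in_def by blast
    show "e * x = x" if "x \<in> N" for x using ideal_in_subset[OF N that] one_mult by blast
    show "e * x = x" if "x \<in> T" for x using T(2) that one_mult by blast
  qed
  moreover have "?Z \<subseteq> A" using T(2) Z(1) by (auto intro!: pow_mult_mem simp del: power_Suc)
  moreover have "card ?Z \<le> card T ^ Suc n"
    using card_image_le[of "T \<times> Z" "\<lambda>(x, y). y ^ (p ^ 1) * x"] T(1) Z(2,3)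
    by (simp add: card_cartesian_product) (meson le_trans mult_le_mono2)
  ultimately show ?case using T(1) Z(2) by (intro exI[of _ ?Z]) auto
qed

end

section \<open>Parameters and colengths\<close>

definition adjoin :: "'u::comm_ring_1 set \<Rightarrow> 'u set \<Rightarrow> 'u \<Rightarrow> 'u set" where
  "adjoin A I y = {i + a * y | i a. i \<in> I \<and> a \<in> A}"

fun adjoin_list :: "'u::comm_ring_1 set \<Rightarrow> 'u set \<Rightarrow> 'u list \<Rightarrow> 'u set" where
  "adjoin_list A I [] = I"
| "adjoin_list A I (y # ys) = adjoin_list A (adjoin A I y) ys"

text \<open>A certificate that \<open>J\<close> modulo \<open>I\<close> has length at most the given
  number when \<open>m\<close> is maximal: every step adjoins one element that \<open>m\<close>
  multiplies into the preceding ideal. Steps may be trivial, so the number is an upper bound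
  only.\<close>

inductive filtered :: "'u::comm_ring_1 set \<Rightarrow> 'u set \<Rightarrow> 'u set \<Rightarrow> nat \<Rightarrow> 'u set \<Rightarrow> bool" for A m where
  filtered_refl: "filtered A m I 0 I"
| filtered_step: "y \<in> A \<Longrightarrow> (\<And>a. a \<in> m \<Longrightarrow> a * y \<in> I) \<Longrightarrow> filtered A m (adjoin A I y) n J \<Longrightarrow> filtered A m I (Suc n) J"

lemma filtered_trans: "filtered A m I k J \<Longrightarrow> filtered A m J l K \<Longrightarrow> filtered A m I (k + l) K"
  by (induction rule: filtered.induct) (auto intro: filtered_step)

lemma adjoinE:
  assumes "z \<in> adjoin A I y" obtains i a where "z = i + a * y" "i \<in> I" "a \<in> A"
  using assms unfolding adjoin_def by blast

context unital_subring begin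

lemma adjoin_ideal:
  assumes I: "ideal_in A I" and y: "y \<in> A"
  shows "ideal_in A (adjoin A I y)"
proof (rule ideal_inI)
  show "adjoin A I y \<subseteq> A" using ideal_in_subset[OF I] y by (auto simp: adjoin_def intro!: mem_intros)
  show "0 \<in> adjoin A I y" using ideal_in_zero[OF I] zero_mem by (force simp: adjoin_def)
  show "u + v \<in> adjoin A I y" if u: "u \<in> adjoin A I y" and v: "v \<in> adjoin A I y" for u v
  proof -
    obtain i a j b where "u = i + a * y" "v = j + b * y" "i \<in> I" "j \<in> I" "a \<in> A" "b \<in> A"
      using adjoinE[OF u] adjoinE[OF v] by metis
    then have "u + v = (i + j) + (a + b) * y" "i + j \<in> I" "a + b \<in> A"
      using ideal_in_add[OF I] add_mem by (auto simp: algebra_simps)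
    then show ?thesis unfolding adjoin_def by blast
  qed
  show "c * u \<in> adjoin A I y" if c: "c \<in> A" and u: "u \<in> adjoin A I y" for c u
  proof -
    obtain i a where "u = i + a * y" "i \<in> I" "a \<in> A" using adjoinE[OF u] .
    then have "c * u = c * i + (c * a) * y" "c * i \<in> I" "c * a \<in> A"
      using ideal_in_mult[OF I] mult_mem c by (auto simp: algebra_simps)
    then show ?thesis unfolding adjoin_def by blast
  qed
qed

lemma adjoin_superset: "I \<subseteq> adjoin A I y"
  unfolding adjoin_def using zero_mem by force

lemma adjoin_self: "ideal_in A I \<Longrightarrow> y \<in> A \<Longrightarrow> y \<in> adjoin A I y"
  using ideal_in_zero[of A I] one_mem one_mult[of y] unfolding adjoin_def by force

lemma adjoin_least: "ideal_in A J \<Longrightarrow> I \<subseteq> J \<Longrightarrow> y \<in> J \<Longrightarrow> adjoin A I y \<subseteq> J"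
  unfolding adjoin_def by (auto intro!: ideal_in_add ideal_in_mult)

lemma adjoin_commute: "adjoin A (adjoin A I x) y = adjoin A (adjoin A I y) x"
  unfolding adjoin_def by (auto; metis (no_types, opaque_lifting) add.assoc add.commute)

lemma adjoin_list_adjoin: "adjoin_list A (adjoin A I x) ys = adjoin A (adjoin_list A I ys) x"
proof (induction ys arbitrary: I)
  case (Cons y ys)
  show ?case by (simp only: adjoin_list.simps adjoin_commute[of I x y] Cons)
qed simp

lemma adjoin_list_ideal: "ideal_in A I \<Longrightarrow> set ys \<subseteq> A \<Longrightarrow> ideal_in A (adjoin_list A I ys)"
  by (induction ys arbitrary: I) (auto intro: adjoin_ideal)

lemma adjoin_list_least: "ideal_in A J \<Longrightarrow> I \<subseteq> J \<Longrightarrow> set ys \<subseteq> J \<Longrightarrow> adjoin_list A I ys \<subseteq> J"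
  by (induction ys arbitrary: I) (auto dest: adjoin_least)

lemma adjoin_list_superset: "I \<subseteq> adjoin_list A I ys"
proof (induction ys arbitrary: I)
  case (Cons y ys)
  then show ?case using adjoin_superset[of I y] by (simp add: subset_trans)
qed simp

lemma adjoin_list_self: "ideal_in A I \<Longrightarrow> set ys \<subseteq> A \<Longrightarrow> set ys \<subseteq> adjoin_list A I ys"
proof (induction ys arbitrary: I)
  case (Cons y ys)
  then have "y \<in> adjoin_list A (adjoin A I y) ys"
    using adjoin_self[of I y] adjoin_list_superset[of "adjoin A I y" ys] by auto
  then show ?case using Cons adjoin_ideal[of I y] by auto
qed simp

text \<open>Multiplication by \<open>x ^ n\<close> sends each step of a filtration to a step, also
  after adding \<open>J0\<close>.\<close>

lemma filtered_mult:
  assumes "filtered A m I k J" and x: "x \<in> A" and J0: "0 \<in> J0"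
  shows "filtered A m {x ^ n * i + j0 | i j0. i \<in> I \<and> j0 \<in> J0} k {x ^ n * i + j0 | i j0. i \<in> J \<and> j0 \<in> J0}"
  using assms(1)
proof induction
  case (filtered_step y I k J)
  let ?f = "\<lambda>I. {x ^ n * i + j0 | i j0. i \<in> I \<and> j0 \<in> J0}"
  have eq: "?f (adjoin A I y) = adjoin A (?f I) (x ^ n * y)"
  proof (intro equalityI subsetI)
    fix z assume "z \<in> ?f (adjoin A I y)"
    then obtain i a j0 where *: "z = x ^ n * (i + a * y) + j0" "i \<in> I" "a \<in> A" "j0 \<in> J0" unfolding adjoin_def by blast
    then have "z = (x ^ n * i + j0) + a * (x ^ n * y)" by (simp add: algebra_simps)
    then show "z \<in> adjoin A (?f I) (x ^ n * y)" using * unfolding adjoin_def by blast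
  next
    fix z assume "z \<in> adjoin A (?f I) (x ^ n * y)"
    then obtain i a j0 where *: "z = (x ^ n * i + j0) + a * (x ^ n * y)" "i \<in> I" "a \<in> A" "j0 \<in> J0" unfolding adjoin_def by blast
    then have "z = x ^ n * (i + a * y) + j0" by (simp add: algebra_simps)
    then show "z \<in> ?f (adjoin A I y)" using * unfolding adjoin_def by blast
  qed
  show ?case
  proof (rule filtered.filtered_step)
    show "x ^ n * y \<in> A" using filtered_step.hyps(1) x by (rule pow_mult_mem[rotated])
    show "a * (x ^ n * y) \<in> ?f I" if "a \<in> m" for a
    proof -
      have "a * (x ^ n * y) = x ^ n * (a * y) + 0" by (simp add: mult_ac)
      then show ?thesis using filtered_step.hyps(2)[OF that] J0 by blast
    qed
    show "filtered A m (adjoin A (?f I) (x ^ n * y)) k (?f J)" using filtered_step.IH unfolding eq .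
  qed
qed (rule filtered_refl)

text \<open>The ideals (J, x^i) for i up to n form a chain whose n quotients are images of A/(J, x)
  under multiplication by x^i.\<close>

lemma filtered_pow:
  assumes J: "ideal_in A J" and x: "x \<in> A" and f: "filtered A m (adjoin A J x) k A"
  shows "filtered A m (adjoin A J (x ^ n)) (n * k) A"
proof (induction n)
  case 0
  \<comment> \<open>\<open>x ^ 0\<close> is the unit \<open>1\<close> of the type, which need not
    lie in \<open>A\<close>; adjoining it yields \<open>A\<close> because its multiples are
    \<open>a * 1\<close>.\<close>
  have "adjoin A J 1 = A"
    using ideal_in_subset[OF J] ideal_in_zero[OF J] by (force simp: adjoin_def intro: add_mem)
  then show ?case using filtered_refl[of A m A] by simp
next
  case (Suc n)
  let ?f = "\<lambda>I. {x ^ n * i + j0 | i j0. i \<in> I \<and> j0 \<in> J}"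
  have "filtered A m (?f (adjoin A J x)) k (?f A)"
    by (rule filtered_mult[OF f x ideal_in_zero[OF J]])
  also have "?f A = adjoin A J (x ^ n)" unfolding adjoin_def by (metis (no_types, opaque_lifting) add.commute mult.commute)
  also have "?f (adjoin A J x) = adjoin A J (x ^ Suc n)"
  proof (intro equalityI subsetI)
    fix z assume "z \<in> ?f (adjoin A J x)"
    then obtain i a j0 where *: "z = x ^ n * (i + a * x) + j0" "i \<in> J" "a \<in> A" "j0 \<in> J" unfolding adjoin_def by blast
    have "x ^ n * i \<in> J"
      using ideal_in_mult[OF J pow_mult_mem[OF x one_mem] *(2)] one_mult[OF ideal_in_subset[OF J *(2)]] by (simp add: mult.assoc)
    then have "z = (x ^ n * i + j0) + a * x ^ Suc n" "x ^ n * i + j0 \<in> J"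
      using * ideal_in_add[OF J] by (auto simp: algebra_simps)
    then show "z \<in> adjoin A J (x ^ Suc n)" using * unfolding adjoin_def by blast
  next
    fix z assume "z \<in> adjoin A J (x ^ Suc n)"
    then obtain a j0 where *: "z = j0 + a * x ^ Suc n" "a \<in> A" "j0 \<in> J" unfolding adjoin_def by blast
    then have "z = x ^ n * (0 + a * x) + j0" by (simp add: algebra_simps)
    then show "z \<in> ?f (adjoin A J x)" using * ideal_in_zero[OF J] unfolding adjoin_def by blast
  qed
  finally show ?case using filtered_trans[OF _ Suc] by simp
qed

text \<open>One parameter at a time is replaced by its power, multiplying the bound by
  \<open>n\<close>; this works because the order of adjoining is immaterial.\<close>

lemma filtered_list_pow:
  assumes "ideal_in A J" "set xs \<subseteq> A" "filtered A m (adjoin_list A J xs) k A"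
  shows "filtered A m (adjoin_list A J (map (\<lambda>x. x ^ n) xs)) (n ^ length xs * k) A"
  using assms
proof (induction xs arbitrary: J)
  case (Cons x xs)
  have x: "x \<in> A" using Cons.prems by simp
  show ?case
  proof (cases "n = 0")
    \<comment> \<open>For \<open>n = 0\<close> the list consists of copies of \<open>1\<close>,
      which may lie outside \<open>A\<close>. The lemmas on ideals do not apply then, and the value
      \<open>A\<close> is computed directly.\<close>
    case True
    have "adjoin A J 1 = A"
      using ideal_in_subset[OF Cons.prems(1)] ideal_in_zero[OF Cons.prems(1)] by (force simp: adjoin_def intro: add_mem)
    moreover have "adjoin_list A A ys = A" if "set ys \<subseteq> {1}" for ys
      using that
    proof (induction ys)
      case (Cons y ys)
      have "adjoin A A 1 = A" using zero_mem by (force simp: adjoin_def intro: add_mem)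
      then show ?case using Cons by simp
    qed simp
    ultimately show ?thesis using True filtered_refl[of A m A] by (simp add: image_subset_iff)
  next
    case False
    let ?xs = "map (\<lambda>x. x ^ n) xs"
    have J': "ideal_in A (adjoin_list A J ?xs)"
      using Cons.prems False by (intro adjoin_list_ideal) (auto intro: pow_mem)
    have "filtered A m (adjoin_list A (adjoin A J x) ?xs) (n ^ length xs * k) A"
      using Cons by (intro Cons.IH) (auto intro: adjoin_ideal)
    then have "filtered A m (adjoin A (adjoin_list A J ?xs) (x ^ n)) (n * (n ^ length xs * k)) A"
      using filtered_pow[OF J' x] by (simp add: adjoin_list_adjoin)
    then show ?thesis by (simp add: adjoin_list_adjoin mult.assoc)
  qed
qed simp

end

context char_p_subring begin

text \<open>Each step contributes a quotient of A/m, hence at most \<open>card W\<close> generators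
  over the \<open>p ^ n\<close>-th powers: the products of \<open>W\<close> with the adjoined
  element.\<close>

lemma filtered_generators:
  assumes "filtered A m I k B" and I: "ideal_in A I"
    and W: "finite W" "W \<subseteq> A" "A \<subseteq> qspan A (p ^ n) (m \<union> W)"
  shows "\<exists>Z\<subseteq>A. finite Z \<and> card Z \<le> k * card W \<and> B \<subseteq> qspan A (p ^ n) (I \<union> Z)"
  using assms(1,2)
proof induction
  case (filtered_refl I)
  then show ?case using one_mult ideal_in_subset[OF filtered_refl] by (intro exI[of _ "{}"]) (auto intro!: qspan_base)
next
  case (filtered_step y I k B)
  obtain Z where Z: "Z \<subseteq> A" "finite Z" "card Z \<le> k * card W" "B \<subseteq> qspan A (p ^ n) (adjoin A I y \<union> Z)"
    using filtered_step.IH[OF adjoin_ideal[OF filtered_step.prems filtered_step.hyps(1)]] by blast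
  let ?Y = "(\<lambda>w. w * y) ` W"
  let ?S = "qspan A (p ^ n) (I \<union> (?Y \<union> Z))"
  have S: "pmodule A (p ^ n) ?S" by (rule qspan_pmodule')
  have YA: "?Y \<subseteq> A" using W filtered_step.hyps(1) mult_mem by auto
  have base: "I \<union> (?Y \<union> Z) \<subseteq> ?S" using one_mult ideal_in_subset[OF filtered_step.prems] YA Z(1) by (blast intro!: qspan_base)
  have T: "pmodule A (p ^ n) {v. y * v \<in> ?S}" by (rule pmodule_colon[OF S])
  have "m \<union> W \<subseteq> {v. y * v \<in> ?S}" using filtered_step.hyps(2) base by (auto simp: mult.commute[of y])
  then have "A \<subseteq> {v. y * v \<in> ?S}" using qspan_subset_pmodule[OF T] W(3) by blast
  then have "adjoin A I y \<subseteq> ?S"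
    using base pmodule_add[OF S] by (auto simp: adjoin_def mult.commute[of _ y])
  then have "B \<subseteq> ?S" using Z(4) base qspan_subset_pmodule[OF S, of "adjoin A I y \<union> Z"] by blast
  moreover have "card (?Y \<union> Z) \<le> Suc k * card W"
    using card_Un_le[of ?Y Z] card_image_le[OF W(1), of "\<lambda>w. w * y"] Z(3) by simp
  ultimately show ?case using YA Z W(1) by (intro exI[of _ "?Y \<union> Z"]) auto
qed

end

section \<open>Noetherian local rings and systems of parameters\<close>

definition noeth_in :: "'u::comm_ring_1 set \<Rightarrow> bool" where
  "noeth_in A \<longleftrightarrow> (\<forall>\<S>. \<S> \<noteq> {} \<and> (\<forall>I\<in>\<S>. ideal_in A I) \<longrightarrow> (\<exists>M\<in>\<S>. \<forall>I\<in>\<S>. M \<subseteq> I \<longrightarrow> I = M))"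

lemma noeth_induct [consumes 2, case_names step]:
  assumes "noeth_in A" and "ideal_in A I"
    and step: "\<And>I. ideal_in A I \<Longrightarrow> (\<And>J. ideal_in A J \<Longrightarrow> I \<subset> J \<Longrightarrow> Q J) \<Longrightarrow> Q I"
  shows "Q I"
proof (rule ccontr)
  assume "\<not> Q I"
  then have "{I. ideal_in A I \<and> \<not> Q I} \<noteq> {}" using assms(2) by blast
  then obtain M where M: "ideal_in A M" "\<not> Q M" "\<And>I. ideal_in A I \<Longrightarrow> \<not> Q I \<Longrightarrow> M \<subseteq> I \<Longrightarrow> I = M"
    using assms(1)[unfolded noeth_in_def, rule_format, of "{I. ideal_in A I \<and> \<not> Q I}"] by auto
  show False using M step[of M] by blast
qed

definition prime_chain :: "'u::comm_ring_1 set \<Rightarrow> 'u set \<Rightarrow> (nat \<Rightarrow> 'u set) \<Rightarrow> nat \<Rightarrow> bool" where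
  "prime_chain A J P k \<longleftrightarrow> (\<forall>i\<le>k. prime_in A (P i) \<and> J \<subseteq> P i) \<and> (\<forall>i<k. P i \<subset> P (Suc i))"

text \<open>A bound for the dimension of A/J. For \<open>J = A\<close> there are no chains and every
  bound holds.\<close>

definition dim_le :: "'u::comm_ring_1 set \<Rightarrow> 'u set \<Rightarrow> nat \<Rightarrow> bool" where
  "dim_le A J n \<longleftrightarrow> (\<forall>P k. prime_chain A J P k \<longrightarrow> k \<le> n)"

lemma prime_chain_Cons:
  assumes "prime_chain A J P k" "prime_in A Q" "J' \<subseteq> Q" "Q \<subset> P 0" "J' \<subseteq> J"
  shows "prime_chain A J' (case_nat Q P) (Suc k)"
proof -
  have "J' \<subseteq> P i" if "i \<le> k" for i using assms that unfolding prime_chain_def by blast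
  then show ?thesis using assms unfolding prime_chain_def by (auto split: nat.splits simp: less_Suc_eq_0_disj)
qed

context unital_subring begin

text \<open>The product of the ideals in \<open>Qs\<close> lies in \<open>J\<close>, tested on
  products of elements. The factor \<open>e\<close> gives the empty product the value
  \<open>e\<close> instead of the unit of the type.\<close>

definition prods_in :: "'u set list \<Rightarrow> 'u set \<Rightarrow> bool" where
  "prods_in Qs J \<longleftrightarrow> (\<forall>as. list_all2 (\<in>) as Qs \<longrightarrow> e * prod_list as \<in> J)"

lemma prods_in_prime:
  assumes P: "prime_in A P" and "prods_in Qs P" and Q: "\<And>Q. Q \<in> set Qs \<Longrightarrow> Q \<subseteq> A"
  shows "\<exists>Q\<in>set Qs. Q \<subseteq> P"
proof (rule ccontr)
  assume n: "\<not> (\<exists>Q\<in>set Qs. Q \<subseteq> P)"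
  have "\<exists>as. list_all2 (\<in>) as Qs \<and> e * prod_list as \<in> A \<and> e * prod_list as \<notin> P" using n Q
  proof (induction Qs)
    case Nil
    then show ?case using prime_in_one[OF P] one_mem by auto
  next
    case (Cons Q Qs)
    then obtain as where as: "list_all2 (\<in>) as Qs" "e * prod_list as \<in> A" "e * prod_list as \<notin> P" by auto
    obtain a where a: "a \<in> Q" "a \<notin> P" "a \<in> A" using Cons.prems by auto
    have "e * prod_list (a # as) = a * (e * prod_list as)" by (simp add: mult_ac)
    moreover have "list_all2 (\<in>) (a # as) (Q # Qs)" using as(1) a(1) by simp
    ultimately show ?case using as a mult_mem[OF a(3) as(2)] prime_in_mult[OF P a(3) as(2)] by metis
  qed
  then show False using assms(2) unfolding prods_in_def by blast
qed

text \<open>Noetherian induction: if \<open>a * b\<close> lies in \<open>J\<close> and neither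
  factor does, the primes found for (J, a) and (J, b) together work. Every prime over
  \<open>J\<close> contains one of these finitely many, so they take the place of the minimal
  primes.\<close>

lemma prime_product:
  assumes "noeth_in A" "ideal_in A J"
  shows "\<exists>Qs. (\<forall>Q\<in>set Qs. prime_in A Q \<and> J \<subseteq> Q) \<and> prods_in Qs J"
  using assms
proof (induction rule: noeth_induct)
  case (step J)
  show ?case
  proof (cases "J = A")
    case True
    then show ?thesis using one_mem by (intro exI[of _ "[]"]) (auto simp: prods_in_def)
  next
    case nA: False
    show ?thesis
    proof (cases "prime_in A J")
      case True
      then show ?thesis using one_mult[OF ideal_in_subset[OF step(1)]]
        by (intro exI[of _ "[J]"]) (auto simp: prods_in_def list_all2_Cons2)
    next
      case False
      then obtain a b where ab: "a \<in> A" "b \<in> A" "a * b \<in> J" "a \<notin> J" "b \<notin> J"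
        using nA step(1) unfolding prime_in_def by blast
      have "ideal_in A (adjoin A J a)" "J \<subset> adjoin A J a" and b: "ideal_in A (adjoin A J b)" "J \<subset> adjoin A J b"
        using adjoin_ideal[OF step(1)] adjoin_superset[of J] adjoin_self[OF step(1)] ab by blast+
      from step(2)[OF this(1,2)] obtain Q1 where
        Q1: "\<forall>Q\<in>set Q1. prime_in A Q \<and> adjoin A J a \<subseteq> Q" "prods_in Q1 (adjoin A J a)" by blast
      from step(2)[OF b] obtain Q2 where
        Q2: "\<forall>Q\<in>set Q2. prime_in A Q \<and> adjoin A J b \<subseteq> Q" "prods_in Q2 (adjoin A J b)" by blast
      note Q = Q1 Q2
      have "prods_in (Q1 @ Q2) J" unfolding prods_in_def
      proof (intro allI impI)
        fix as assume "list_all2 (\<in>) as (Q1 @ Q2)"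
        then obtain as1 as2 where as: "as = as1 @ as2" "list_all2 (\<in>) as1 Q1" "list_all2 (\<in>) as2 Q2"
          by (auto simp: list_all2_append2)
        obtain i s where i: "e * prod_list as1 = i + s * a" "i \<in> J" "s \<in> A"
          using Q(2) as(2) unfolding prods_in_def adjoin_def by blast
        obtain j t where j: "e * prod_list as2 = j + t * b" "j \<in> J" "t \<in> A"
          using Q(4) as(3) unfolding prods_in_def adjoin_def by blast
        have "e * prod_list as = (e * prod_list as1) * (e * prod_list as2)"
          using one_mult[OF one_mem] by (simp add: as(1) mult_ac) (metis mult.assoc)
        also have "\<dots> = i * (j + t * b) + (s * a) * j + (s * t) * (a * b)" by (simp add: i j algebra_simps)
        also have "\<dots> \<in> J"
          using i j ab ideal_in_subset[OF step(1)]
          by (intro ideal_in_add[OF step(1)] ideal_in_mult2[OF step(1) _ i(2)] ideal_in_mult[OF step(1) _ j(2)] ideal_in_mult[OF step(1) _ ab(3)])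
            (auto intro!: mem_intros)
        finally show "e * prod_list as \<in> J" .
      qed
      then show ?thesis using Q(1,3) adjoin_superset by (intro exI[of _ "Q1 @ Q2"]) fastforce
    qed
  qed
qed

lemma product_avoidance:
  assumes P: "prime_in A P" and m: "ideal_in A m" "\<not> m \<subseteq> P"
  shows "finite F \<Longrightarrow> (\<And>Q. Q \<in> F \<Longrightarrow> ideal_in A Q \<and> \<not> Q \<subseteq> P) \<Longrightarrow> \<exists>y\<in>m. y \<notin> P \<and> (\<forall>Q\<in>F. y \<in> Q)"
proof (induction F rule: finite_induct)
  case (insert Q F)
  then obtain y where y: "y \<in> m" "y \<notin> P" "\<forall>Q\<in>F. y \<in> Q" by auto
  obtain z where z: "z \<in> Q" "z \<notin> P" using insert.prems by blast
  have Q: "ideal_in A Q" using insert.prems by blast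
  have zA: "z \<in> A" using ideal_in_subset[OF Q z(1)] .
  have yA: "y \<in> A" using ideal_in_subset[OF m(1) y(1)] .
  have "z * y \<in> m" using ideal_in_mult[OF m(1) zA y(1)] .
  moreover have "z * y \<notin> P" using prime_in_mult[OF P zA yA] y z by blast
  moreover have "z * y \<in> Q" using ideal_in_mult2[OF Q yA z(1)] .
  moreover have "z * y \<in> Q'" if "Q' \<in> F" for Q' using ideal_in_mult[of A Q' z y] insert.prems that zA y(3) by blast
  ultimately show ?case by blast
qed (use m(2) in auto)

text \<open>If one prime of the set contains another, the smaller may be dropped. Otherwise an
  element avoiding all primes but \<open>Q\<close> is corrected, if it lies in \<open>Q\<close>, by
  an element outside \<open>Q\<close> that lies in all the others.\<close>

lemma prime_avoidance:
  assumes m: "ideal_in A m"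
  shows "finite F \<Longrightarrow> (\<And>Q. Q \<in> F \<Longrightarrow> prime_in A Q \<and> \<not> m \<subseteq> Q) \<Longrightarrow> \<exists>x\<in>m. \<forall>Q\<in>F. x \<notin> Q"
proof (induction F rule: finite_psubset_induct)
  case (psubset F)
  show ?case
  proof (cases "F = {}")
    case True
    then show ?thesis using ideal_in_zero[OF m] by blast
  next
    case False
    then obtain Q where Q: "Q \<in> F" by blast
    define F' where "F' = F - {Q}"
    have F': "F = insert Q F'" "F' \<subset> F" "Q \<notin> F'" using Q by (auto simp: F'_def)
    show ?thesis
    proof (cases "\<exists>Q'\<in>F'. Q' \<subseteq> Q")
      case True
      then obtain Q' where Q': "Q' \<in> F'" "Q' \<subseteq> Q" by blast
      have "F - {Q'} \<subset> F" using Q' F' by blast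
      then obtain x where x: "x \<in> m" "\<forall>Q\<in>F - {Q'}. x \<notin> Q" using psubset.IH[of "F - {Q'}"] psubset.prems by blast
      have "Q \<in> F - {Q'}" using Q Q'(1) F'(3) by blast
      then have "x \<notin> Q'" using x(2) Q'(2) by blast
      then show ?thesis using x by blast
    next
      case False
      obtain x where x: "x \<in> m" "\<forall>Q\<in>F'. x \<notin> Q" using psubset.IH[OF F'(2)] psubset.prems F'(1) by blast
      show ?thesis
      proof (cases "x \<in> Q")
        case True
        have "\<exists>y\<in>m. y \<notin> Q \<and> (\<forall>Q'\<in>F'. y \<in> Q')"
          using psubset.prems[of Q] psubset.prems[OF subsetD[OF psubset_imp_subset[OF F'(2)]]] False Q psubset.hyps
          by (intro product_avoidance[OF _ m]) (auto simp: F'_def dest: prime_in_ideal)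
        then obtain y where y: "y \<in> m" "y \<notin> Q" "\<forall>Q'\<in>F'. y \<in> Q'" by blast
        have "x + y \<in> m" using ideal_in_add[OF m x(1) y(1)] .
        moreover have "x + y \<notin> Q"
          using ideal_in_diff[OF prime_in_ideal, of Q "x + y" x] psubset.prems[OF Q] True y(2) by auto
        moreover have "x + y \<notin> Q'" if "Q' \<in> F'" for Q'
          using ideal_in_diff[OF prime_in_ideal, of Q' "x + y" y] psubset.prems[of Q'] that F'(1) x(2) y(3) by auto
        ultimately show ?thesis using F'(1) by blast
      next
        case False
        then show ?thesis using x F'(1) by blast
      qed
    qed
  qed
qed

lemma loc_prime_subset:
  assumes m: "loc A e m" and P: "prime_in A P" shows "P \<subseteq> m"
proof
  fix x assume x: "x \<in> P"
  show "x \<in> m"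
  proof (rule ccontr)
    assume "x \<notin> m"
    then obtain y where "y \<in> A" "x * y = e" using m ideal_in_subset[OF prime_in_ideal[OF P] x] unfolding loc_def by blast
    then show False using ideal_in_mult2[OF prime_in_ideal[OF P] _ x, of y] prime_in_one[OF P] by simp
  qed
qed

text \<open>\<open>x\<close> is chosen outside the primes of \<open>prime_product\<close> other than
  \<open>m\<close>. A chain over (J, x) starts at a prime containing one of these. If that one is
  \<open>m\<close>, the chain has length 0; otherwise the containment is proper because of
  \<open>x\<close>, and the chain extends downwards to a longer one over \<open>J\<close>.\<close>

lemma parameter_step:
  assumes N: "noeth_in A" and m: "loc A e m" and J: "ideal_in A J" and d: "dim_le A J (Suc n)"
  shows "\<exists>x\<in>m. dim_le A (adjoin A J x) n"
proof -
  have mp: "prime_in A m" using m unfolding loc_def by blast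
  obtain Qs where Qs: "\<And>Q. Q \<in> set Qs \<Longrightarrow> prime_in A Q \<and> J \<subseteq> Q" "prods_in Qs J" using prime_product[OF N J] by blast
  have "\<exists>x\<in>m. \<forall>Q\<in>set Qs - {m}. x \<notin> Q"
    using loc_prime_subset[OF m] Qs(1) by (intro prime_avoidance[OF prime_in_ideal[OF mp]]) auto
  then obtain x where x: "x \<in> m" "\<And>Q. Q \<in> set Qs \<Longrightarrow> Q \<noteq> m \<Longrightarrow> x \<notin> Q" by auto
  have xA: "x \<in> A" using ideal_in_subset[OF prime_in_ideal[OF mp] x(1)] .
  have "k \<le> n" if c: "prime_chain A (adjoin A J x) P k" for P k
  proof -
    have P0: "prime_in A (P 0)" "adjoin A J x \<subseteq> P 0" using c unfolding prime_chain_def by auto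
    have "prods_in Qs (P 0)" using Qs(2) P0(2) adjoin_superset[of J x] unfolding prods_in_def by blast
    then obtain Q where Q: "Q \<in> set Qs" "Q \<subseteq> P 0"
      using prods_in_prime[OF P0(1)] Qs(1) prime_in_ideal unfolding ideal_in_def by metis
    show ?thesis
    proof (cases "Q = m")
      case True
      then have "P 0 = m" using Q(2) loc_prime_subset[OF m P0(1)] by blast
      have "k = 0"
      proof (rule ccontr)
        assume "k \<noteq> 0"
        then have "prime_in A (P (Suc 0))" "P 0 \<subset> P (Suc 0)" using c unfolding prime_chain_def by auto
        then show False using loc_prime_subset[OF m] \<open>P 0 = m\<close> by blast
      qed
      then show ?thesis by simp
    next
      case False
      have "x \<in> P 0" using P0(2) adjoin_self[OF J xA] by blast
      then have "Q \<subset> P 0" using Q x(2)[OF Q(1) False] by blast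
      then have "prime_chain A J (case_nat Q P) (Suc k)"
        using prime_chain_Cons[OF c] Qs(1)[OF Q(1)] adjoin_superset by blast
      then show ?thesis using d unfolding dim_le_def by fastforce
    qed
  qed
  then show ?thesis using x(1) unfolding dim_le_def by blast
qed

lemma parameters:
  assumes N: "noeth_in A" and m: "loc A e m"
  shows "ideal_in A J \<Longrightarrow> dim_le A J n \<Longrightarrow> \<exists>xs. length xs = n \<and> set xs \<subseteq> m \<and> dim_le A (adjoin_list A J xs) 0"
proof (induction n arbitrary: J)
  case (Suc n)
  then obtain x where x: "x \<in> m" "dim_le A (adjoin A J x) n" using parameter_step[OF N m] by blast
  have "x \<in> A" using x(1) m ideal_in_subset prime_in_ideal unfolding loc_def by blast
  then obtain xs where "length xs = n" "set xs \<subseteq> m" "dim_le A (adjoin_list A (adjoin A J x) xs) 0"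
    using Suc.IH[OF adjoin_ideal[OF Suc.prems(1)] x(2)] by blast
  then show ?case using x(1) by (intro exI[of _ "x # xs"]) auto
qed auto

text \<open>Every prime over \<open>J\<close> is \<open>m\<close>, so some power of \<open>m\<close>
  lies in \<open>J\<close>. Noetherian induction enlarges the ideal by elements that
  \<open>m\<close> kills until \<open>A\<close> is reached.\<close>

lemma dim_0_filtered:
  assumes N: "noeth_in A" and m: "loc A e m" and J: "ideal_in A J" and d: "dim_le A J 0"
  shows "\<exists>k. filtered A m J k A"
proof -
  have mp: "prime_in A m" using m unfolding loc_def by blast
  obtain Qs where Qs: "\<And>Q. Q \<in> set Qs \<Longrightarrow> prime_in A Q \<and> J \<subseteq> Q" "prods_in Qs J" using prime_product[OF N J] by blast
  have Qm: "Q = m" if Q: "Q \<in> set Qs" for Q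
  proof (rule ccontr)
    assume "Q \<noteq> m"
    then have "Q \<subset> m" using loc_prime_subset[OF m] Qs(1)[OF Q] by blast
    then have "prime_chain A J (case_nat Q (\<lambda>_. m)) (Suc 0)"
      using Qs(1)[OF Q] mp by (intro prime_chain_Cons[of A J "\<lambda>_. m" 0]) (auto simp: prime_chain_def)
    then show False using d unfolding dim_le_def by fastforce
  qed
  define t where "t = length Qs"
  have Qs': "Qs = replicate t m" unfolding t_def by (rule replicate_eqI) (use Qm in auto)
  have "J \<subseteq> I \<longrightarrow> (\<exists>k. filtered A m I k A)" if "ideal_in A I" for I
    using N that
  proof (induction rule: noeth_induct)
    case (step I)
    show ?case
    proof
      assume JI: "J \<subseteq> I"
      show "\<exists>k. filtered A m I k A"
      proof (cases "I = A")
        case True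
        then show ?thesis using filtered_refl by blast
      next
        case False
        \<comment> \<open>\<open>S l\<close> says that the l-th power of \<open>m\<close> lies in
          \<open>I\<close>. For the least such \<open>l\<close>, some product of
          \<open>l - 1\<close> elements of \<open>m\<close> lies outside \<open>I\<close>, and
          \<open>m\<close> kills it modulo \<open>I\<close>.\<close>
        define S where "S l \<longleftrightarrow> prods_in (replicate l m) I" for l
        have "S t" using Qs(2) JI unfolding S_def Qs' prods_in_def by blast
        define l where "l = (LEAST l. S l)"
        have l: "S l" unfolding l_def using \<open>S t\<close> by (rule LeastI)
        have "e \<notin> I" using False ideal_in_whole[OF step(1)] by blast
        then have "\<not> S 0" using one_mult[OF one_mem] by (auto simp: S_def prods_in_def)
        then obtain l' where l': "l = Suc l'" using l by (cases l) auto
        then have "\<not> S l'" using not_less_Least[of l' S] by (auto simp: l_def)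
        then obtain as where as: "list_all2 (\<in>) as (replicate l' m)" "e * prod_list as \<notin> I"
          unfolding S_def prods_in_def by blast
        define y where "y = e * prod_list as"
        have "set as \<subseteq> m" using as(1) by (auto simp: list_all2_conv_all_nth set_conv_nth)
        then have yA: "y \<in> A" unfolding y_def
        proof (induction as)
          case (Cons a as)
          then have "a * (e * prod_list as) \<in> A" using ideal_in_subset[OF prime_in_ideal[OF mp]] mult_mem by auto
          then show ?case by (simp add: mult_ac)
        qed (simp add: one_mem)
        have ay: "a * y \<in> I" if "a \<in> m" for a
        proof -
          have "list_all2 (\<in>) (a # as) (replicate l m)" using as(1) that by (simp add: l')
          then have "e * prod_list (a # as) \<in> I" using l unfolding S_def prods_in_def by blast
          then show ?thesis by (simp add: y_def mult_ac)
        qed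
        have "I \<subset> adjoin A I y" using adjoin_superset[of I y] adjoin_self[OF step(1) yA] as(2) unfolding y_def by blast
        then obtain k where "filtered A m (adjoin A I y) k A"
          using step(2)[OF adjoin_ideal[OF step(1) yA]] JI by blast
        then show ?thesis using filtered_step[OF yA ay] by blast
      qed
    qed
  qed
  then show ?thesis using J by blast
qed

end

section \<open>Growth of free ranks under Frobenius\<close>

definition free_rank :: "'u::comm_ring_1 set \<Rightarrow> 'u \<Rightarrow> nat \<Rightarrow> 'u set \<Rightarrow> nat" where
  "free_rank A e q V = Max {k. splits A e q V k}"

text \<open>Lifts of a basis of the residue field over the field of its p-th powers; \<alpha> is the
  logarithm of \<open>card W\<close> to base \<open>p\<close>.\<close>

definition residue_basis :: "'u::comm_ring_1 set \<Rightarrow> 'u set \<Rightarrow> nat \<Rightarrow> 'u set \<Rightarrow> bool" where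
  "residue_basis A m p W \<longleftrightarrow> finite W \<and> W \<subseteq> A \<and> indep_mod A m p m W (\<lambda>x. x) \<and> A \<subseteq> qspan A p (m \<union> W)"

lemma pow_pow_add: "(b ^ (p ^ n)) ^ (p ^ a) = (b::'z::monoid_mult) ^ (p ^ (a + n))"
  by (simp add: power_add mult.commute flip: power_mult)

lemma loc_prime: "loc A e m \<Longrightarrow> prime_in A m"
  unfolding loc_def by blast

context char_p_subring begin

lemma qspan_in_self: "C \<subseteq> A \<Longrightarrow> qspan C q A \<subseteq> A"
  by (intro qspan_subset) (auto intro!: mem_intros)

lemma zero_ideal_in: "ideal_in A {0}"
  using zero_mem by (intro ideal_inI) auto

lemma unit_pmodule: "pmodule A q {v. e * v = v}"
  by (rule pmoduleI) (auto simp: distrib_left mult.left_commute[of e])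

lemma qspan_unit: "(\<And>x. x \<in> X \<Longrightarrow> e * x = x) \<Longrightarrow> v \<in> qspan A q X \<Longrightarrow> e * v = v"
  using qspan_subset_pmodule[OF unit_pmodule, of X q] by blast

lemma qspan_insert_zero: "qspan A q ({0} \<union> X) = qspan A q X"
proof
  show "qspan A q ({0} \<union> X) \<subseteq> qspan A q X"
    using pmodule_zero[OF qspan_pmodule'] pmodule_add[OF qspan_pmodule'] 
    by (intro qspan_subset) (auto intro: qspan_smult_base)
qed (rule qspan_mono; blast)

context
  fixes m V n K
  assumes m: "loc A e m" and V: "pmodule A (p ^ n) V" and VE: "\<And>v. v \<in> V \<Longrightarrow> e * v = v"
    and K: "generated_mod A (p ^ n) V {} K"
begin

lemma splits_bounded: "splits A e (p ^ n) V k \<Longrightarrow> k \<le> K"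
  by (rule splits_le_generated[OF loc_prime[OF m] V _ generated_mod_mono[OF K]]) auto

lemma finite_splits: "finite {k. splits A e (p ^ n) V k}"
  using splits_bounded by (blast intro: finite_subset[of _ "{..K}"])

lemma splits_free_rank: "splits A e (p ^ n) V (free_rank A e (p ^ n) V)"
  using Max_in[OF finite_splits] splits_0 unfolding free_rank_def by blast

lemma splits_le_free_rank: "splits A e (p ^ n) V k \<Longrightarrow> k \<le> free_rank A e (p ^ n) V"
  using Max_ge[OF finite_splits] unfolding free_rank_def by blast

lemma generated_mod_free_rank: "generated_mod A (p ^ n) V (nonsplit A m (p ^ n) V) (free_rank A e (p ^ n) V)"
  using splits_le_free_rank[of "Suc (free_rank A e (p ^ n) V)"]
  by (intro generated_mod_splits[OF m V VE splits_free_rank]) auto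

lemma free_rank_le: "generated_mod A (p ^ n) V (nonsplit A m (p ^ n) V) l \<Longrightarrow> free_rank A e (p ^ n) V \<le> l"
  by (rule splits_le_generated[OF loc_prime[OF m] V splits_free_rank])

end

text \<open>For \<open>x\<close> in \<open>V\<close>, every functional \<phi> on F^(a+n)_* V gives a
  functional y \<mapsto> \<phi>(y^(p^a) x) on F^n_* A. Hence nonsplit elements of F^n_* A multiply
  \<open>G\<close> into the nonsplit part of \<open>V\<close>, and each member of \<open>G\<close>
  accounts for at most \<open>k\<close> generators.\<close>

lemma generated_mod_sum:
  assumes m: "ideal_in A m" and G: "finite G" "\<And>g. g \<in> G \<Longrightarrow> e * g = g"
    and k: "generated_mod A (p ^ n) A (nonsplit A m (p ^ n) A) k"
  shows "generated_mod A (p ^ (a + n)) (qspan A (p ^ a) G)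
    (nonsplit A m (p ^ (a + n)) (qspan A (p ^ a) G)) (card G * k)"
proof -
  define V where "V = qspan A (p ^ a) G"
  define N where "N = nonsplit A m (p ^ (a + n)) V"
  have V: "pmodule A (p ^ a) V" unfolding V_def by (rule qspan_pmodule')
  have V': "pmodule A (p ^ (a + n)) V"
    using pmodule_pow[OF V, of A "p ^ n"] pow_mem_q by (simp add: power_add mult.commute)
  have N': "pmodule A (p ^ (a + n)) N" unfolding N_def by (rule nonsplit_pmodule[OF m V'])
  have GV: "G \<subseteq> V" using G by (auto simp: V_def intro!: qspan_base)
  have VE: "e * v = v" if "v \<in> V" for v using qspan_unit[OF G(2)] that unfolding V_def by blast
  \<comment> \<open>Precomposing functionals with multiplication by \<open>c ^ p ^ a\<close> shows
    that the nonsplit part is stable under all \<open>p ^ a\<close>-th powers, as the tower lemma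
    demands.\<close>
  have N: "pmodule A (p ^ a) N"
  proof (rule pmoduleI)
    show "c ^ p ^ a * v \<in> N" if c: "c \<in> A" and v: "v \<in> N" for c v
      unfolding N_def nonsplit_def
    proof (intro CollectI conjI allI impI)
      have vV: "v \<in> V" using v by (auto simp: N_def nonsplit_def)
      then show "c ^ p ^ a * v \<in> V" using pmodule_smult[OF V c] by blast
      fix \<phi> assume L: "qlin A (p ^ (a + n)) V \<phi>"
      have "qlin A (p ^ (a + n)) V (\<lambda>v. \<phi> (c ^ p ^ a * v))"
        using L pmodule_smult[OF V c] unfolding qlin_def
        by (auto simp: distrib_left mult.left_commute[of "c ^ p ^ a"])
      then show "\<phi> (c ^ p ^ a * v) \<in> m" using v unfolding N_def nonsplit_def by blast
    qed
  qed (use pmodule_zero[OF N'] pmodule_add[OF N'] in auto)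
  obtain X where X: "X \<subseteq> A" "finite X" "card X \<le> k" "A \<subseteq> qspan A (p ^ n) (nonsplit A m (p ^ n) A \<union> X)"
    using k unfolding generated_mod_def by blast
  have c: "char_p_subring A e p" by (rule char_p_subring_axioms)
  let ?Y = "(\<lambda>(x, y). y ^ p ^ a * x) ` (G \<times> X)"
  have "V \<subseteq> qspan A (p ^ (a + n)) (N \<union> ?Y)"
  proof (rule qspan_tower[OF c c subset_refl _ N X(4) _ X(1)])
    show "V \<subseteq> qspan A (p ^ a) (N \<union> G)" unfolding V_def by (rule qspan_mono) auto
    show "y ^ p ^ a * x \<in> N" if y: "y \<in> nonsplit A m (p ^ n) A" and x: "x \<in> G" for y x
      unfolding N_def nonsplit_def
    proof (intro CollectI conjI allI impI)
      have yA: "y \<in> A" using y by (auto simp: nonsplit_def)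
      then show "y ^ p ^ a * x \<in> V" using pmodule_smult[OF V] GV x by blast
      fix \<phi> assume L: "qlin A (p ^ (a + n)) V \<phi>"
      have "qlin A (p ^ n) A (\<lambda>y. \<phi> (y ^ p ^ a * x))"
        unfolding qlin_def
      proof (intro conjI ballI)
        show "(\<lambda>y. \<phi> (y ^ p ^ a * x)) \<in> A \<rightarrow> A" using qlinD(1)[OF L] pmodule_smult[OF V] GV x by blast
        show "\<phi> ((y + z) ^ p ^ a * x) = \<phi> (y ^ p ^ a * x) + \<phi> (z ^ p ^ a * x)" if "y \<in> A" "z \<in> A" for y z
          using qlinD(2)[OF L] pmodule_smult[OF V] GV x that by (simp add: add_pow distrib_right subset_iff)
        show "\<phi> ((b ^ p ^ n * y) ^ p ^ a * x) = b * \<phi> (y ^ p ^ a * x)" if "b \<in> A" "y \<in> A" for b y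
          using qlinD(3)[OF L that(1), of "y ^ p ^ a * x"] pmodule_smult[OF V that(2)] GV x
          by (simp add: power_mult_distrib pow_pow_add mult.assoc subset_iff)
      qed
      then show "\<phi> (y ^ p ^ a * x) \<in> m" using y unfolding nonsplit_def by blast
    qed
    show "nonsplit A m (p ^ n) A \<subseteq> A" by (rule nonsplit_subset)
    show "e * x = x" if "x \<in> N" for x using that VE by (auto simp: N_def nonsplit_def)
    show "e * x = x" if "x \<in> G" for x by (rule G(2)[OF that])
  qed
  moreover have "?Y \<subseteq> V" using X(1) GV pmodule_smult[OF V] by auto
  moreover have "card ?Y \<le> card G * k"
    using card_image_le[of "G \<times> X" "\<lambda>(x, y). y ^ p ^ a * x"] G(1) X(2,3)
    by (simp add: card_cartesian_product) (meson le_trans mult_le_mono2)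
  ultimately show ?thesis unfolding generated_mod_def V_def[symmetric] N_def[symmetric]
    using G(1) X(2) by (intro exI[of _ ?Y]) auto
qed

text \<open>\<open>V\<close> modulo \<open>V'\<close> is generated by \<open>G\<close> and killed by
  \<open>c\<close>, acting through its \<open>p ^ a\<close>-th power. Modulo \<open>m\<close> its
  pushforward under F^n needs at most \<open>card G\<close> times as many generators as F^n_*
  (A/cA).\<close>

lemma generated_mod_cofactor:
  assumes m: "ideal_in A m" and G: "finite G" "\<And>g. g \<in> G \<Longrightarrow> e * g = g" and V_def: "V = qspan A (p ^ a) G"
    and V': "pmodule A (p ^ a) V'" "V' \<subseteq> V" and c: "c \<in> A" "\<And>v. v \<in> V \<Longrightarrow> c ^ (p ^ a) * v \<in> V'"
    and Z: "Z \<subseteq> A" "finite Z" "A \<subseteq> qspan A (p ^ n) (adjoin A {0} c \<union> qspan m (p ^ n) A \<union> Z)"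
  shows "generated_mod A (p ^ (a + n)) V (V' \<union> qspan m (p ^ (a + n)) V) (card G * card Z)"
proof -
  define Q where "Q = qspan m (p ^ (a + n)) V"
  define N where "N = qspan A (p ^ (a + n)) (V' \<union> Q)"
  have V: "pmodule A (p ^ a) V" unfolding V_def by (rule qspan_pmodule')
  have VE: "e * v = v" if "v \<in> V" for v using qspan_unit[OF G(2)] that unfolding V_def by blast
  have V2: "pmodule A (p ^ (a + n)) V"
    using pmodule_pow[OF V, of A "p ^ n"] pow_mem_q by (simp add: power_add mult.commute)
  have GV: "G \<subseteq> V" using G by (auto simp: V_def intro!: qspan_base)
  have QV: "Q \<subseteq> V" unfolding Q_def
    using pmodule_smult[OF V2] ideal_in_subset[OF m] pmodule_zero[OF V2] pmodule_add[OF V2]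
    by (intro qspan_subset) auto
  have NV: "N \<subseteq> V" unfolding N_def by (rule qspan_subset_pmodule[OF V2]) (use QV V'(2) in blast)
  have N2: "pmodule A (p ^ (a + n)) N" unfolding N_def by (rule qspan_pmodule')
  have QN: "V' \<union> Q \<subseteq> N" using QV V'(2) VE unfolding N_def by (blast intro!: qspan_base)
  have Qsm: "b ^ p ^ a * v \<in> Q" if b: "b \<in> A" and v: "v \<in> Q" for b v
  proof -
    have "Q \<subseteq> {v. b ^ p ^ a * v \<in> Q}" unfolding Q_def
    proof (rule qspan_subset)
      show "r ^ p ^ (a + n) * x \<in> {v. b ^ p ^ a * v \<in> qspan m (p ^ (a + n)) V}" if "r \<in> m" "x \<in> V" for r x
        using qspan_smult_base[OF that(1) pmodule_smult[OF V b that(2)], of "p ^ (a + n)"]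
        by (simp add: mult.left_commute)
    qed (auto simp: distrib_left intro: qspan_zero qspan_add)
    then show ?thesis using v by blast
  qed
  have N: "pmodule A (p ^ a) N"
  proof (rule pmoduleI)
    show "b ^ p ^ a * v \<in> N" if b: "b \<in> A" and v: "v \<in> N" for b v
    proof -
      have "V' \<union> Q \<subseteq> {v. b ^ p ^ a * v \<in> N}" using Qsm[OF b] pmodule_smult[OF V'(1) b] QN by blast
      then have "N \<subseteq> {v. b ^ p ^ a * v \<in> N}"
        using qspan_subset_pmodule[OF pmodule_colon[OF N2]] unfolding N_def by blast
      then show ?thesis using v by blast
    qed
  qed (use pmodule_zero[OF N2] pmodule_add[OF N2] in auto)
  have ch: "char_p_subring A e p" by (rule char_p_subring_axioms)
  let ?M = "adjoin A {0} c \<union> qspan m (p ^ n) A"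
  let ?Y = "(\<lambda>(x, y). y ^ p ^ a * x) ` (G \<times> Z)"
  have "V \<subseteq> qspan A (p ^ (a + n)) (N \<union> ?Y)"
  proof (rule qspan_tower[OF ch ch subset_refl _ N Z(3) _ Z(1)])
    show "V \<subseteq> qspan A (p ^ a) (N \<union> G)" unfolding V_def by (rule qspan_mono) auto
    show "?M \<subseteq> A"
      using qspan_in_self[of m] ideal_in_subset[OF m] adjoin_ideal[OF zero_ideal_in c(1)]
      unfolding ideal_in_def by blast
    show "y ^ p ^ a * x \<in> N" if y: "y \<in> ?M" and x: "x \<in> G" for y x
    proof (cases "y \<in> adjoin A {0} c")
      case True
      then obtain b where b: "b \<in> A" "y = b * c" by (auto simp: adjoin_def)
      have "b ^ p ^ a * (c ^ p ^ a * x) \<in> V'" using c(2)[of x] pmodule_smult[OF V'(1) b(1)] x GV by blast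
      then show ?thesis using b QN by (auto simp: power_mult_distrib mult.assoc)
    next
      case False
      have "qspan m (p ^ n) A \<subseteq> {y \<in> A. y ^ p ^ a * x \<in> Q}"
      proof (rule qspan_subset)
        show "0 \<in> {y \<in> A. y ^ p ^ a * x \<in> Q}" using zero_mem zero_pow by (simp add: Q_def qspan_zero)
        show "y + z \<in> {y \<in> A. y ^ p ^ a * x \<in> Q}" if "y \<in> {y \<in> A. y ^ p ^ a * x \<in> Q}" "z \<in> {y \<in> A. y ^ p ^ a * x \<in> Q}" for y z
          using that by (auto simp: add_pow distrib_right Q_def intro: add_mem qspan_add)
        show "r ^ p ^ n * z \<in> {y \<in> A. y ^ p ^ a * x \<in> Q}" if r: "r \<in> m" and z: "z \<in> A" for r z
          using qspan_smult_base[OF r pmodule_smult[OF V z], of x "p ^ (a + n)"] GV x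
            pow_mult_mem[OF ideal_in_subset[OF m r] z]
          by (auto simp: power_mult_distrib pow_pow_add mult.assoc Q_def)
      qed
      then show ?thesis using y False QN by blast
    qed
    show "e * x = x" if "x \<in> N" for x using that VE NV by blast
    show "e * x = x" if "x \<in> G" for x by (rule G(2)[OF that])
  qed
  moreover have "N \<union> ?Y \<subseteq> qspan A (p ^ (a + n)) ((V' \<union> Q) \<union> ?Y)"
  proof (rule Un_least)
    show "N \<subseteq> qspan A (p ^ (a + n)) ((V' \<union> Q) \<union> ?Y)" unfolding N_def by (rule qspan_mono) auto
    have "?Y \<subseteq> V" using Z(1) GV pmodule_smult[OF V] by auto
    then show "?Y \<subseteq> qspan A (p ^ (a + n)) ((V' \<union> Q) \<union> ?Y)" using VE by (blast intro!: qspan_base)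
  qed
  ultimately have "V \<subseteq> qspan A (p ^ (a + n)) ((V' \<union> Q) \<union> ?Y)"
    using qspan_trans by blast
  moreover have "?Y \<subseteq> V" using Z(1) GV pmodule_smult[OF V] by auto
  moreover have "card ?Y \<le> card G * card Z"
    using card_image_le[of "G \<times> Z" "\<lambda>(x, y). y ^ p ^ a * x"] G(1) Z(2) by (simp add: card_cartesian_product)
  ultimately show ?thesis unfolding generated_mod_def Q_def[symmetric]
    using G(1) Z(2) by (intro exI[of _ ?Y]) auto
qed

end

text \<open>\<open>d\<close> bounds the dimension from above; where the exact value matters, a chain
  of primes of length \<open>d\<close> is supplied as well.\<close>

locale F_finite_local_domain = char_p_subring A e p
  for A :: "'u::comm_ring_1 set" and e p +
  fixes m :: "'u set" and d :: nat
  assumes no_zero_divisors: "x \<in> A \<Longrightarrow> y \<in> A \<Longrightarrow> x * y = 0 \<Longrightarrow> x = 0 \<or> y = 0"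
    and one_nonzero: "e \<noteq> 0"
    and noeth: "noeth_in A"
    and loc: "loc A e m"
    and ffinite: "\<exists>H\<subseteq>A. finite H \<and> A \<subseteq> qspan A p H"
    and dim: "dim_le A {0} d"
begin

lemma zero_prime: "prime_in A {0}"
  unfolding prime_in_def
proof (intro conjI ballI impI)
  show "{0} \<noteq> A" using one_nonzero one_mem by blast
  show "a \<in> {0} \<or> b \<in> {0}" if "a \<in> A" "b \<in> A" "a * b \<in> {0}" for a b
    using no_zero_divisors that by blast
qed (rule zero_ideal_in)

lemma m_prime: "prime_in A m"
  using loc unfolding loc_def by blast

lemma m_ideal: "ideal_in A m"
  using m_prime prime_in_ideal by blast

lemma zero_ideal: "ideal_in A {0}"
  using zero_prime prime_in_ideal by blast

lemma m_subset: "m \<subseteq> A"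
  using m_ideal unfolding ideal_in_def by blast

lemma power_generators: "\<exists>Z\<subseteq>A. finite Z \<and> A \<subseteq> qspan A (p ^ n) Z"
proof -
  obtain H where H: "H \<subseteq> A" "finite H" "A \<subseteq> qspan A p H" using ffinite by blast
  then show ?thesis using qspan_power[OF H(2,1) _ zero_ideal, of n] qspan_insert_zero[of _ H] qspan_insert_zero
    by metis
qed

lemma inverse_pow:
  assumes "c \<in> A" "c \<notin> m" obtains b where "b \<in> A" "b ^ (p ^ n) * c ^ (p ^ n) = e"
proof -
  obtain b where "b \<in> A" "c * b = e" using assms loc unfolding loc_def by blast
  then show ?thesis using that[of b] one_pow_q by (metis mult.commute power_mult_distrib)
qed

text \<open>A maximal independent subset of the generators spans up to a factor outside
  \<open>m\<close>, and this factor is invertible.\<close>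

lemma residue_basis_exists: "\<exists>W. residue_basis A m p W"
proof -
  obtain H where H: "H \<subseteq> A" "finite H" "A \<subseteq> qspan A p H" using ffinite by blast
  obtain T c where T: "T \<subseteq> H" "indep_mod A m (p ^ 1) m T (\<lambda>x. x)" "c \<in> A" "c \<notin> m"
    "\<And>v. v \<in> qspan A (p ^ 1) (m \<union> H) \<Longrightarrow> c ^ (p ^ 1) * v \<in> qspan A (p ^ 1) (m \<union> T)"
  proof (rule maximal_indep[OF m_prime ideal_in_pmodule[OF m_ideal] H(2), where n = 1])
    show "e * x = x" if "x \<in> H" for x using H(1) that one_mult by blast
    show "e * x = x" if "x \<in> m" for x using m_subset that one_mult by blast
    show "a ^ (p ^ 1) * x \<in> m" if "a \<in> m" "x \<in> H" for a x
    proof -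
      obtain k where "p = Suc k" using q_pos[of 1] by (cases p) auto
      then have "a ^ p ^ 1 * x = (a ^ k * x) * a" by (simp add: mult_ac)
      moreover have "a ^ k * x \<in> A" using pow_mult_mem[of a x k] that H(1) m_subset by blast
      ultimately show ?thesis using ideal_in_mult[OF m_ideal _ that(1)] by simp
    qed
  qed blast
  obtain b where b: "b \<in> A" "b ^ (p ^ 1) * c ^ (p ^ 1) = e" using inverse_pow[OF T(3,4)] by blast
  have "v \<in> qspan A p (m \<union> T)" if "v \<in> A" for v
  proof -
    have "v \<in> qspan A (p ^ 1) (m \<union> H)" using H(3) that qspan_mono[of A A H "m \<union> H"] by auto
    then have "b ^ (p ^ 1) * (c ^ (p ^ 1) * v) \<in> qspan A (p ^ 1) (m \<union> T)"
      by (intro pmodule_smult[OF qspan_pmodule' b(1)] T(5))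
    moreover have "b ^ (p ^ 1) * (c ^ (p ^ 1) * v) = v"
      using b(2) one_mult[OF that] by (metis mult.assoc)
    ultimately show ?thesis by simp
  qed
  then show ?thesis using T(1,2) H finite_subset[OF T(1)] unfolding residue_basis_def by (intro exI[of _ T]) auto
qed

lemma residue_basis_pos: "residue_basis A m p W \<Longrightarrow> card W > 0"
proof (rule ccontr)
  assume W: "residue_basis A m p W" and "\<not> card W > 0"
  then have "A \<subseteq> qspan A (p ^ 1) m" unfolding residue_basis_def by simp
  then have "A \<subseteq> m" using qspan_subset_pmodule[OF ideal_in_pmodule[OF m_ideal]] by blast
  then show False using one_mem prime_in_one[OF m_prime] by blast
qed

lemma generic_basis:
  obtains G c where "finite G" "G \<subseteq> A" "indep_mod A {0} p {0} G (\<lambda>x. x)" "c \<in> A" "c \<noteq> 0"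
    "\<And>v. v \<in> A \<Longrightarrow> c ^ p * v \<in> qspan A p G"
proof -
  obtain H where H: "H \<subseteq> A" "finite H" "A \<subseteq> qspan A p H" using ffinite by blast
  obtain T c where T: "T \<subseteq> H" "indep_mod A {0} (p ^ 1) {0} T (\<lambda>x. x)" "c \<in> A" "c \<notin> {0}"
    "\<And>v. v \<in> qspan A (p ^ 1) ({0} \<union> H) \<Longrightarrow> c ^ (p ^ 1) * v \<in> qspan A (p ^ 1) ({0} \<union> T)"
  proof (rule maximal_indep[OF zero_prime pmodule_singleton_zero H(2), where n = 1])
    show "e * x = x" if "x \<in> H" for x using H(1) that one_mult by blast
    show "a ^ (p ^ 1) * x \<in> {0}" if "a \<in> {0}" "x \<in> H" for a x using that zero_pow[of 1] by simp
  qed auto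
  note T' = T(5)[unfolded qspan_insert_zero power_one_right]
  have "c ^ p * v \<in> qspan A p T" if "v \<in> A" for v using T' H(3) that by blast
  then show ?thesis using that[of T c] T(1-4) H finite_subset[OF T(1)] by auto
qed

lemma qspan_m: "qspan m q A \<subseteq> A"
  by (rule qspan_in_self[OF m_subset])

text \<open>F-finiteness supplies the finite set to which Nakayama's lemma is applied.\<close>

lemma generators_nakayama:
  assumes Z: "Z \<subseteq> A" "A \<subseteq> qspan A (p ^ n) (qspan m (p ^ n) A \<union> Z)"
  shows "A \<subseteq> qspan A (p ^ n) Z"
proof -
  obtain H where H: "H \<subseteq> A" "finite H" "A \<subseteq> qspan A (p ^ n) H" using power_generators by blast
  let ?W = "qspan A (p ^ n) Z"
  have W: "pmodule A (p ^ n) ?W" by (rule qspan_pmodule')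
  have ZE: "e * v = v" if "v \<in> Z" for v using Z(1) that one_mult by blast
  have ZW: "Z \<subseteq> ?W" using ZE by (auto intro!: qspan_base)
  have "H \<subseteq> ?W"
  proof (rule nakayama[OF loc H(2) W])
    show "e * v = v" if "v \<in> ?W \<union> H" for v using that H(1) one_mult qspan_unit[OF ZE] by blast
    let ?Q = "qspan m (p ^ n) (?W \<union> H)"
    have Q: "pmodule A (p ^ n) ?Q" by (rule qspan_pmodule) (rule ideal_in_mult[OF m_ideal])
    have "a ^ (p ^ n) * v \<in> ?Q" if a: "a \<in> m" and v: "v \<in> A" for a v
    proof -
      have "H \<subseteq> {v. a ^ (p ^ n) * v \<in> ?Q}" using qspan_smult_base[OF a] by blast
      then have "A \<subseteq> {v. a ^ (p ^ n) * v \<in> ?Q}"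
        using qspan_subset_pmodule[OF pmodule_colon[OF Q]] H(3) by blast
      then show ?thesis using v by blast
    qed
    then have "qspan m (p ^ n) A \<subseteq> ?Q"
      using pmodule_zero[OF Q] pmodule_add[OF Q] by (intro qspan_subset) auto
    then have "A \<subseteq> qspan A (p ^ n) (?Q \<union> ?W)"
      using Z(2) ZW qspan_mono[of A A "qspan m (p ^ n) A \<union> Z" "?Q \<union> ?W" "p ^ n"] by blast
    then show "H \<subseteq> qspan A (p ^ n) (?W \<union> ?Q)" using H(1) by (metis Un_commute subset_trans)
  qed
  then show ?thesis using H(3) qspan_subset_pmodule[OF W] by blast
qed

context
  fixes W
  assumes W: "residue_basis A m p W"
begin

lemma residue_generators: "\<exists>Z\<subseteq>A. finite Z \<and> card Z \<le> card W ^ n \<and> A \<subseteq> qspan A (p ^ n) (m \<union> Z)"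
proof -
  have "finite W" "W \<subseteq> A" "A \<subseteq> qspan A p (m \<union> W)" using W unfolding residue_basis_def by auto
  then show ?thesis using qspan_power[OF _ _ _ m_ideal] by blast
qed

text \<open>The \<open>p ^ n\<close>-th powers of the parameters already lie in m F^n_* A, so it
  suffices to generate \<open>A\<close> modulo \<open>J\<close> and these powers. That quotient has
  length at most (p^n)^r k for r parameters, and each of its simple factors takes at most
  \<open>card W ^ n\<close> generators.\<close>

lemma parameter_generators:
  assumes J: "ideal_in A J" and xs: "set xs \<subseteq> m" and f: "filtered A m (adjoin_list A J xs) k A"
  shows "\<exists>Z\<subseteq>A. finite Z \<and> card Z \<le> (p ^ n) ^ length xs * k * card W ^ n \<and>
    A \<subseteq> qspan A (p ^ n) (J \<union> qspan m (p ^ n) A \<union> Z)"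
proof -
  obtain U where U: "U \<subseteq> A" "finite U" "card U \<le> card W ^ n" "A \<subseteq> qspan A (p ^ n) (m \<union> U)"
    using residue_generators by blast
  let ?J = "adjoin_list A J (map (\<lambda>x. x ^ (p ^ n)) xs)"
  have xA: "set xs \<subseteq> A" using xs m_subset by blast
  have "set (map (\<lambda>x. x ^ (p ^ n)) xs) \<subseteq> A" using xA pow_mem_q by auto
  then have J': "ideal_in A ?J" by (rule adjoin_list_ideal[OF J])
  obtain Z where Z: "Z \<subseteq> A" "finite Z" "card Z \<le> (p ^ n) ^ length xs * k * card U" "A \<subseteq> qspan A (p ^ n) (?J \<union> Z)"
    using filtered_generators[OF filtered_list_pow[OF J xA f] J' U(2,1,4)] by blast
  have "?J \<subseteq> qspan A (p ^ n) (J \<union> qspan m (p ^ n) A)" (is "_ \<subseteq> ?S")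
  proof -
    have SA: "?S \<subseteq> A" using qspan_m J unfolding ideal_in_def by (intro qspan_subset_pmodule[OF pmodule_self]) blast
    have base: "J \<union> qspan m (p ^ n) A \<subseteq> ?S"
      using J qspan_m one_mult unfolding ideal_in_def by (blast intro!: qspan_base)
    have "J \<union> qspan m (p ^ n) A \<subseteq> {v. b * v \<in> ?S}" if b: "b \<in> A" for b
    proof -
      have "qspan m (p ^ n) A \<subseteq> {v. b * v \<in> qspan m (p ^ n) A}"
      proof (rule qspan_subset)
        show "r ^ p ^ n * x \<in> {v. b * v \<in> qspan m (p ^ n) A}" if "r \<in> m" "x \<in> A" for r x
          using qspan_smult_base[OF that(1) mult_mem[OF b that(2)], of "p ^ n"] by (simp add: mult.left_commute)
      qed (auto simp: distrib_left intro: qspan_zero qspan_add)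
      then show ?thesis using base ideal_in_mult[OF J b] by blast
    qed
    then have "?S \<subseteq> {v. b * v \<in> ?S}" if "b \<in> A" for b
      using that qspan_subset_pmodule[OF pmodule_colon[OF qspan_pmodule']] by blast
    then have S: "ideal_in A ?S" using SA by (intro ideal_inI) (auto intro: qspan_zero qspan_add)
    have "x ^ (p ^ n) \<in> ?S" if "x \<in> set xs" for x
    proof -
      have "x ^ (p ^ n) = x ^ (p ^ n) * e" using mult_one[OF pow_mem_q] xA that by auto
      then have "x ^ (p ^ n) \<in> qspan m (p ^ n) A" using qspan_smult_base[OF _ one_mem, of x m "p ^ n"] xs that by auto
      then show ?thesis using base by blast
    qed
    then show ?thesis using base by (intro adjoin_list_least[OF S]) auto
  qed
  moreover have "Z \<subseteq> qspan A (p ^ n) (J \<union> qspan m (p ^ n) A \<union> Z)"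
    using Z(1) one_mult by (blast intro!: qspan_base)
  moreover have "?S \<subseteq> qspan A (p ^ n) (J \<union> qspan m (p ^ n) A \<union> Z)" by (rule qspan_mono) auto
  ultimately have "?J \<union> Z \<subseteq> qspan A (p ^ n) (J \<union> qspan m (p ^ n) A \<union> Z)" by blast
  then have "A \<subseteq> qspan A (p ^ n) (J \<union> qspan m (p ^ n) A \<union> Z)" using Z(4) qspan_trans by blast
  moreover have "card Z \<le> (p ^ n) ^ length xs * k * card W ^ n" using Z(3) U(3) by (meson le_trans mult_le_mono2)
  ultimately show ?thesis using Z(1,2) by blast
qed

text \<open>Nakayama's lemma turns generators modulo m F^n_* A into generators. If the parameters
  generate \<open>m\<close> one may take \<open>k = 1\<close>, the case of a regular ring.\<close>

lemma regular_generators: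
  assumes xs: "set xs \<subseteq> m" and f: "filtered A m (adjoin_list A {0} xs) k A"
  shows "\<exists>Z\<subseteq>A. finite Z \<and> card Z \<le> (p ^ n) ^ length xs * k * card W ^ n \<and> A \<subseteq> qspan A (p ^ n) Z"
proof -
  obtain Z where Z: "Z \<subseteq> A" "finite Z" "card Z \<le> (p ^ n) ^ length xs * k * card W ^ n"
      "A \<subseteq> qspan A (p ^ n) ({0} \<union> qspan m (p ^ n) A \<union> Z)"
    using parameter_generators[OF zero_ideal xs f] by blast
  then show ?thesis using generators_nakayama[OF Z(1)] qspan_insert_zero[of "p ^ n" "qspan m (p ^ n) A \<union> Z"]
    by (metis Un_assoc)
qed

lemma total_growth: "\<exists>k. \<forall>n. \<exists>Z\<subseteq>A. finite Z \<and> card Z \<le> k * (p ^ d * card W) ^ n \<and> A \<subseteq> qspan A (p ^ n) Z"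
proof -
  obtain xs where xs: "length xs = d" "set xs \<subseteq> m" "dim_le A (adjoin_list A {0} xs) 0"
    using parameters[OF noeth loc zero_ideal dim] by blast
  have "ideal_in A (adjoin_list A {0} xs)" using adjoin_list_ideal[OF zero_ideal] xs(2) m_subset by blast
  then obtain k where k: "filtered A m (adjoin_list A {0} xs) k A" using dim_0_filtered[OF noeth loc _ xs(3)] by blast
  have "(p ^ n) ^ d * k * card W ^ n = k * (p ^ d * card W) ^ n" for n
    by (simp add: power_mult_distrib mult_ac flip: power_mult)
  then show ?thesis using regular_generators[OF xs(2) k] xs(1) by metis
qed

text \<open>A chain of primes over \<open>c\<close> extends downwards by {0}, so A/cA has dimension
  at most d - 1 and one parameter fewer is used. This saves the factor \<open>p ^ n\<close>.\<close>

lemma cofactor_growth: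
  assumes c: "c \<in> A" "c \<noteq> 0"
  shows "\<exists>k. \<forall>n. \<exists>Z\<subseteq>A. finite Z \<and> card Z * p ^ n \<le> k * (p ^ d * card W) ^ n \<and>
    A \<subseteq> qspan A (p ^ n) (adjoin A {0} c \<union> qspan m (p ^ n) A \<union> Z)"
proof -
  have J: "ideal_in A (adjoin A {0} c)" using adjoin_ideal[OF zero_ideal c(1)] .
  have chain: "Suc k \<le> d" if "prime_chain A (adjoin A {0} c) P k" for P k
  proof -
    have "c \<in> P 0" using that adjoin_self[OF zero_ideal c(1)] unfolding prime_chain_def by blast
    moreover have "0 \<in> P 0" using that ideal_in_zero[OF prime_in_ideal] unfolding prime_chain_def by blast
    ultimately have "{0} \<subset> P 0" using c(2) by blast
    then have "prime_chain A {0} (case_nat {0} P) (Suc k)"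
      using adjoin_superset[of "{0}" c] by (intro prime_chain_Cons[OF that zero_prime]) auto
    then show ?thesis using dim unfolding dim_le_def by blast
  qed
  show ?thesis
  proof (cases d)
    \<comment> \<open>In dimension 0 there is no parameter to save; instead \<open>c\<close> is a
      unit and A/cA vanishes.\<close>
    case 0
    have "c \<notin> m"
    proof
      assume "c \<in> m"
      then have "prime_chain A (adjoin A {0} c) (\<lambda>_. m) 0"
        using m_prime adjoin_least[OF m_ideal, of "{0}" c] ideal_in_zero[OF m_ideal] unfolding prime_chain_def by auto
      then show False using chain[of "\<lambda>_. m" 0] 0 by simp
    qed
    then obtain b where b: "b \<in> A" "c * b = e" using loc c(1) unfolding loc_def by blast
    have "e \<in> adjoin A {0} c" using b by (auto simp: adjoin_def mult.commute)
    then have "adjoin A {0} c = A" using ideal_in_whole[OF J] by blast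
    then have "A \<subseteq> qspan A (p ^ n) (adjoin A {0} c \<union> qspan m (p ^ n) A \<union> {})" for n
      using one_mult by (auto intro!: qspan_base)
    then show ?thesis by (intro exI[of _ 0] allI exI[of _ "{}"]) auto
  next
    case (Suc d')
    have "dim_le A (adjoin A {0} c) d'" using chain Suc unfolding dim_le_def by fastforce
    then obtain xs where xs: "length xs = d'" "set xs \<subseteq> m" "dim_le A (adjoin_list A (adjoin A {0} c) xs) 0"
      using parameters[OF noeth loc J] by blast
    have "ideal_in A (adjoin_list A (adjoin A {0} c) xs)" using adjoin_list_ideal[OF J] xs(2) m_subset by blast
    then obtain k where k: "filtered A m (adjoin_list A (adjoin A {0} c) xs) k A"
      using dim_0_filtered[OF noeth loc _ xs(3)] by blast
    show ?thesis
    proof (intro exI[of _ k] allI)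
      fix n
      obtain Z where Z: "Z \<subseteq> A" "finite Z" "card Z \<le> (p ^ n) ^ length xs * k * card W ^ n"
          "A \<subseteq> qspan A (p ^ n) (adjoin A {0} c \<union> qspan m (p ^ n) A \<union> Z)"
        using parameter_generators[OF J xs(2) k] by blast
      have "card Z * p ^ n \<le> ((p ^ n) ^ d' * k * card W ^ n) * p ^ n" using Z(3) xs(1) by simp
      also have "\<dots> = k * (p ^ d * card W) ^ n"
        by (simp add: Suc power_mult_distrib mult_ac flip: power_mult power_add)
      finally show "\<exists>Z\<subseteq>A. finite Z \<and> card Z * p ^ n \<le> k * (p ^ d * card W) ^ n \<and>
          A \<subseteq> qspan A (p ^ n) (adjoin A {0} c \<union> qspan m (p ^ n) A \<union> Z)" using Z by blast
    qed
  qed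
qed

end

end

section \<open>Sequences of exponential growth and their normalized limits\<close>

lemma le_of_exponential_bound:
  fixes a b k :: nat
  assumes "\<And>n. a ^ n \<le> k * b ^ n"
  shows "a \<le> b"
proof (rule ccontr)
  assume "\<not> a \<le> b"
  then have ab: "b < a" by simp
  show False
  proof (cases "b = 0")
    case True
    then show False using assms[of 1] ab by simp
  next
    case False
    have "1 < real a / real b" using ab False by simp
    then obtain n where n: "real k < (real a / real b) ^ n" using real_arch_pow by blast
    have "real (a ^ n) \<le> real (k * b ^ n)" using assms[of n] of_nat_mono by blast
    then have "(real a / real b) ^ n \<le> real k" using False by (simp add: power_divide divide_le_eq)
    then show False using n by simp
  qed
qed

lemma almost_decreasing_convergent:
  fixes x :: "nat \<Rightarrow> real" and p :: nat
  assumes nonneg: "\<And>n. 0 \<le> x n" and dec: "\<And>n. x (Suc n) \<le> x n + k / real p ^ n" and p: "2 \<le> p" and k: "0 \<le> k"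
  shows "convergent x"
proof -
  \<comment> \<open>The errors still to come sum to at most 2 k / p^n because p is at least 2;
    adding this bound makes the sequence decreasing.\<close>
  define y where "y n = x n + 2 * k / real p ^ n" for n
  have p0: "0 < real p" using p by simp
  have "y (Suc n) \<le> y n" for n
  proof -
    have "2 * k / real p ^ Suc n \<le> k / real p ^ n"
      using p p0 k by (simp add: field_simps mult_left_mono)
    moreover have "2 * k / real p ^ n = k / real p ^ n + k / real p ^ n" by simp
    ultimately show ?thesis using dec[of n] unfolding y_def by linarith
  qed
  then have "decseq y" by (rule decseq_SucI)
  moreover have "0 \<le> y n" for n using nonneg[of n] k unfolding y_def by simp
  ultimately have "convergent y" using decseq_convergent[of y 0] by (metis convergent_def)
  moreover have "(\<lambda>n. 2 * k * (1 / real p) ^ n) \<longlonglongrightarrow> 2 * k * 0"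
    using p by (intro tendsto_mult_left LIMSEQ_power_zero) simp
  then have "convergent (\<lambda>n. 2 * k / real p ^ n)" by (auto simp: convergent_def power_one_over field_simps)
  ultimately have "convergent (\<lambda>n. y n - 2 * k / real p ^ n)" by (rule convergent_diff)
  then show ?thesis by (simp add: y_def)
qed

lemma tendsto_error:
  fixes l :: "nat \<Rightarrow> nat" and B k p :: nat
  assumes "\<And>n. l n * p ^ n \<le> k * B ^ n" "0 < B" "2 \<le> p"
  shows "(\<lambda>n. real (l n) / real B ^ n) \<longlonglongrightarrow> 0"
proof (rule tendsto_sandwich[of "\<lambda>_. 0" _ _ "\<lambda>n. real k * (1 / real p) ^ n"])
  show "(\<lambda>n. real k * (1 / real p) ^ n) \<longlonglongrightarrow> 0"
    using assms(3) by (intro tendsto_mult_right_zero LIMSEQ_power_zero) simp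
  show "\<forall>\<^sub>F n in sequentially. real (l n) / real B ^ n \<le> real k * (1 / real p) ^ n"
  proof (intro always_eventually allI)
    fix n
    have "real (l n * p ^ n) \<le> real (k * B ^ n)" using assms(1)[of n] of_nat_mono by blast
    then show "real (l n) / real B ^ n \<le> real k * (1 / real p) ^ n"
      using assms(2,3) by (simp add: field_simps power_one_over)
  qed
qed (auto intro: always_eventually)

text \<open>Coordinates with respect to an independent set are unique, since the difference of two
  coordinate vectors is a relation; they are therefore linear and serve as the dual
  functionals.\<close>

lemma (in char_p_subring) dual_basis:
  assumes Z: "finite Z" and E: "\<And>z. z \<in> Z \<Longrightarrow> e * z = z" and ind: "indep_mod A {0} (p ^ n) {0} Z (\<lambda>x. x)"
  shows "\<exists>\<phi>. dual_family A e (p ^ n) (qspan A (p ^ n) Z) Z (\<lambda>z. z) \<phi>"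
proof -
  let ?q = "p ^ n"
  define V where "V = qspan A ?q Z"
  have V: "pmodule A ?q V" unfolding V_def by (rule qspan_pmodule')
  have ZV: "Z \<subseteq> V" using E by (auto simp: V_def intro!: qspan_base)
  have rep: "\<exists>c. c \<in> Z \<rightarrow> A \<and> x = (\<Sum>z\<in>Z. c z ^ ?q * z)" if x: "x \<in> V" for x
    using qspan_finite_rep[OF pmodule_singleton_zero Z, of x n] x unfolding V_def qspan_insert_zero by auto
  define C where "C x = (SOME c. c \<in> Z \<rightarrow> A \<and> x = (\<Sum>z\<in>Z. c z ^ ?q * z))" for x
  have C: "C x \<in> Z \<rightarrow> A" "x = (\<Sum>z\<in>Z. C x z ^ ?q * z)" if "x \<in> V" for x
    using someI_ex[OF rep[OF that]] unfolding C_def by blast+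
  have uniq: "c z = C x z" if c: "c \<in> Z \<rightarrow> A" "x = (\<Sum>z\<in>Z. c z ^ ?q * z)" and z: "z \<in> Z" and x: "x \<in> V" for c x z
  proof -
    have cA: "c i \<in> A" "C x i \<in> A" if "i \<in> Z" for i using c(1) C(1)[OF x] that by auto
    have "(\<Sum>z\<in>Z. (c z - C x z) ^ ?q * z) = x - x"
      using c(2) C(2)[OF x] cA by (simp add: diff_pow left_diff_distrib sum_subtractf)
    moreover have "(\<lambda>z. c z - C x z) \<in> Z \<rightarrow> A" using cA by (auto intro: diff_mem)
    ultimately have "c z - C x z \<in> {0}" using indep_modD[OF ind, of "\<lambda>z. c z - C x z"] z by simp
    then show ?thesis by simp
  qed
  have "qlin A ?q V (\<lambda>x. C x z)" if z: "z \<in> Z" for z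
    unfolding qlin_def
  proof (intro conjI ballI)
    show "(\<lambda>x. C x z) \<in> V \<rightarrow> A" using C(1) z by auto
    show "C (x + y) z = C x z + C y z" if x: "x \<in> V" and y: "y \<in> V" for x y
    proof (rule uniq[symmetric, of "\<lambda>z. C x z + C y z", OF _ _ z pmodule_add[OF V x y]])
      show "(\<lambda>z. C x z + C y z) \<in> Z \<rightarrow> A" using C(1)[OF x] C(1)[OF y] by (auto intro: add_mem)
      have "(\<Sum>z\<in>Z. (C x z + C y z) ^ ?q * z) = (\<Sum>z\<in>Z. C x z ^ ?q * z) + (\<Sum>z\<in>Z. C y z ^ ?q * z)"
        using C(1)[OF x] C(1)[OF y] unfolding sum.distrib[symmetric]
        by (intro sum.cong) (simp_all add: add_pow distrib_right Pi_iff)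
      then show "x + y = (\<Sum>z\<in>Z. (C x z + C y z) ^ ?q * z)" using C(2)[OF x] C(2)[OF y] by simp
    qed
    show "C (a ^ ?q * x) z = a * C x z" if a: "a \<in> A" and x: "x \<in> V" for a x
    proof (rule uniq[symmetric, of "\<lambda>z. a * C x z", OF _ _ z pmodule_smult[OF V a x]])
      show "(\<lambda>z. a * C x z) \<in> Z \<rightarrow> A" using C(1)[OF x] a by (auto intro: mult_mem)
      have "(\<Sum>z\<in>Z. (a * C x z) ^ ?q * z) = a ^ ?q * (\<Sum>z\<in>Z. C x z ^ ?q * z)"
        by (simp add: power_mult_distrib sum_distrib_left mult.assoc)
      then show "a ^ ?q * x = (\<Sum>z\<in>Z. (a * C x z) ^ ?q * z)" using C(2)[OF x] by simp
    qed
  qed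
  moreover have "C y z = (if z = y then e else 0)" if y: "y \<in> Z" and z: "z \<in> Z" for y z
  proof (rule uniq[symmetric, of "\<lambda>z. if z = y then e else 0", OF _ _ z])
    have "(\<Sum>z\<in>Z. (if z = y then e else 0) ^ ?q * z) = (\<Sum>z\<in>Z. if z = y then y else 0)"
      using y E by (intro sum.cong) (auto simp: one_pow_q zero_pow)
    then show "y = (\<Sum>z\<in>Z. (if z = y then e else 0) ^ ?q * z)" using y Z by simp
    show "y \<in> V" using ZV y by blast
  qed (use one_mem zero_mem in auto)
  ultimately have "dual_family A e ?q V Z (\<lambda>z. z) (\<lambda>z x. C x z)"
    using ZV unfolding dual_family_def by auto
  then show ?thesis unfolding V_def by blast
qed

section \<open>Generic ranks and convergence of the normalized free ranks\<close>

context F_finite_local_domain begin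

lemma generated_self: "\<exists>K. generated_mod A (p ^ n) A {} K"
  using power_generators[of n] unfolding generated_mod_def by auto

lemma splits_free_rank_self: "splits A e (p ^ n) A (free_rank A e (p ^ n) A)"
  using splits_free_rank[OF loc pmodule_self one_mult] generated_self by blast

lemma generated_mod_free_rank_self:
  "generated_mod A (p ^ n) A (nonsplit A m (p ^ n) A) (free_rank A e (p ^ n) A)"
  using generated_mod_free_rank[OF loc pmodule_self one_mult] generated_self by blast

lemma free_rank_le_self:
  "generated_mod A (p ^ n) A (nonsplit A m (p ^ n) A) l \<Longrightarrow> free_rank A e (p ^ n) A \<le> l"
  using free_rank_le[OF loc pmodule_self one_mult] generated_self by blast

lemma splits_le_self: "splits A e (p ^ n) A k \<Longrightarrow> k \<le> free_rank A e (p ^ n) A"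
  using splits_le_free_rank[OF loc pmodule_self one_mult] generated_self by blast

context
  fixes W
  assumes W: "residue_basis A m p W"
begin

text \<open>The tower turns \<open>G\<close> into \<open>card G ^ n\<close> independent elements of
  F^n_* A, which cannot outnumber its generators. Letting n grow removes the constant in the bound
  for the latter.\<close>

lemma generic_rank_le:
  assumes G: "finite G" "G \<subseteq> A" "indep_mod A {0} p {0} G (\<lambda>x. x)"
  shows "card G \<le> p ^ d * card W"
proof -
  obtain k where k: "\<And>n. \<exists>Z\<subseteq>A. finite Z \<and> card Z \<le> k * (p ^ d * card W) ^ n \<and> A \<subseteq> qspan A (p ^ n) Z"
    using total_growth[OF W] by blast
  have "card G ^ n \<le> k * (p ^ d * card W) ^ n" for n
  proof -
    obtain v where v: "v \<in> {..<card G ^ n} \<rightarrow> A" "indep_mod A {0} (p ^ n) {0} {..<card G ^ n} v"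
      using indep_mod_power[OF G zero_prime] by blast
    obtain Z where Z: "Z \<subseteq> A" "finite Z" "card Z \<le> k * (p ^ d * card W) ^ n" "A \<subseteq> qspan A (p ^ n) Z"
      using k by blast
    have "card {..<card G ^ n} \<le> card Z"
    proof (rule indep_mod_card_le[OF zero_prime pmodule_singleton_zero _ v(2) Z(2)])
      show "v i \<in> qspan A (p ^ n) ({0} \<union> Z)" if "i \<in> {..<card G ^ n}" for i
        using v(1) that Z(4) unfolding qspan_insert_zero by blast
      show "a ^ (p ^ n) * x \<in> {0}" if "a \<in> {0}" "x \<in> Z" for a x using that zero_pow by simp
    qed simp
    then show ?thesis using Z(3) by simp
  qed
  then show ?thesis by (rule le_of_exponential_bound)
qed

lemma growth_pos: "0 < p ^ d * card W"
  using residue_basis_pos[OF W] q_pos by simp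

text \<open>\<open>l n\<close> counts generators of \<open>V\<close> modulo \<open>V'\<close>, which
  \<open>c\<close> kills, and is therefore smaller than the main term by a factor p^n. The exponent
  \<open>a\<close> is 1 for comparing F_* A with a free submodule and 0 for modules over an
  extension.\<close>

lemma generated_mod_compare:
  assumes G: "finite G" "\<And>g. g \<in> G \<Longrightarrow> e * g = g" and V_def: "V = qspan A (p ^ a) G"
    and V': "pmodule A (p ^ a) V'" "V' \<subseteq> V" and c: "c \<in> A" "c \<noteq> 0" "\<And>v. v \<in> V \<Longrightarrow> c ^ (p ^ a) * v \<in> V'"
  shows "\<exists>k l. (\<forall>n. l n * p ^ n \<le> k * (p ^ d * card W) ^ n) \<and>
    (\<forall>n K. generated_mod A (p ^ (a + n)) V' (nonsplit A m (p ^ (a + n)) V') K \<longrightarrow>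
      generated_mod A (p ^ (a + n)) V (nonsplit A m (p ^ (a + n)) V) (K + l n))"
proof -
  obtain k where "\<forall>n. \<exists>Z\<subseteq>A. finite Z \<and> card Z * p ^ n \<le> k * (p ^ d * card W) ^ n \<and>
    A \<subseteq> qspan A (p ^ n) (adjoin A {0} c \<union> qspan m (p ^ n) A \<union> Z)" using cofactor_growth[OF W c(1,2)] by blast
  then obtain Z where Z: "\<And>n. Z n \<subseteq> A" "\<And>n. finite (Z n)" "\<And>n. card (Z n) * p ^ n \<le> k * (p ^ d * card W) ^ n"
    "\<And>n. A \<subseteq> qspan A (p ^ n) (adjoin A {0} c \<union> qspan m (p ^ n) A \<union> Z n)" by metis
  have V: "pmodule A (p ^ (a + n)) V" for n
    using pmodule_pow[OF qspan_pmodule'[of "p ^ a" G], of A "p ^ n"] pow_mem_q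
    by (simp add: V_def power_add mult.commute)
  have VE: "e * v = v" if "v \<in> V" for v using qspan_unit[OF G(2)] that unfolding V_def by blast
  show ?thesis
  proof (intro exI[of _ "card G * k"] exI[of _ "\<lambda>n. card G * card (Z n)"] conjI allI impI)
    show "card G * card (Z n) * p ^ n \<le> card G * k * (p ^ d * card W) ^ n" for n
      using mult_le_mono2[OF Z(3)[of n], of "card G"] by (simp add: mult.assoc)
    show "generated_mod A (p ^ (a + n)) V (nonsplit A m (p ^ (a + n)) V) (K + card G * card (Z n))"
      if K: "generated_mod A (p ^ (a + n)) V' (nonsplit A m (p ^ (a + n)) V') K" for n K
      by (rule generated_mod_submodule[OF m_ideal V V'(2) VE K
        generated_mod_cofactor[OF m_ideal G V_def V' c(1,3) Z(1,2,4)]])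
  qed
qed

text \<open>Only an upper estimate for \<open>free_rank\<close> along \<open>n \<mapsto> n + 1\<close> is needed: it makes the normalized ranks
  decreasing up to a summable error.\<close>

lemma convergent_free_rank: "convergent (\<lambda>n. real (free_rank A e (p ^ n) A) / real (p ^ d * card W) ^ n)"
proof -
  let ?B = "p ^ d * card W"
  let ?r = "\<lambda>n. free_rank A e (p ^ n) A"
  have p2: "2 \<le> p" using prime_p prime_ge_2_nat by blast
  obtain H where H: "H \<subseteq> A" "finite H" "A \<subseteq> qspan A p H" using ffinite by blast
  obtain G c where G: "finite G" "G \<subseteq> A" "indep_mod A {0} p {0} G (\<lambda>x. x)" "c \<in> A" "c \<noteq> 0"
    "\<And>v. v \<in> A \<Longrightarrow> c ^ p * v \<in> qspan A p G" using generic_basis by blast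
  have HE: "e * h = h" if "h \<in> H" for h using H(1) that one_mult by blast
  have GE: "e * h = h" if "h \<in> G" for h using G(2) that one_mult by blast
  have AH: "A = qspan A (p ^ 1) H"
    using H qspan_subset_pmodule[OF pmodule_self[of 1] H(1)] by auto
  have GA: "qspan A (p ^ 1) G \<subseteq> A" using qspan_subset_pmodule[OF pmodule_self[of 1] G(2)] .
  have cV: "c ^ (p ^ 1) * v \<in> qspan A (p ^ 1) G" if "v \<in> A" for v using G(6) that by simp
  obtain k l where kl: "\<And>n. l n * p ^ n \<le> k * ?B ^ n"
    "\<And>n K. generated_mod A (p ^ (1 + n)) (qspan A (p ^ 1) G) (nonsplit A m (p ^ (1 + n)) (qspan A (p ^ 1) G)) K \<Longrightarrow>
      generated_mod A (p ^ (1 + n)) A (nonsplit A m (p ^ (1 + n)) A) (K + l n)"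
    using generated_mod_compare[OF H(2) HE AH qspan_pmodule' GA G(4,5) cV] by blast
  \<comment> \<open>Up to \<open>c\<close>, F_* A is the free module on \<open>G\<close>, whose rank
    is at most \<open>?B\<close>. Applying F^n_* bounds the free rank at level \<open>n + 1\<close>
    by \<open>?B\<close> times that at level \<open>n\<close>, plus the error
    \<open>l n\<close>.\<close>
  have rec: "?r (Suc n) \<le> ?B * ?r n + l n" for n
  proof -
    have "?r (Suc n) \<le> card G * ?r n + l n"
      using free_rank_le_self kl(2)[OF generated_mod_sum[OF m_ideal G(1) GE generated_mod_free_rank_self]]
      by (metis plus_1_eq_Suc)
    then show ?thesis using mult_le_mono1[OF generic_rank_le[OF G(1-3)], of "?r n"] by linarith
  qed
  have B1: "1 \<le> real ?B" using growth_pos by (metis of_nat_1 of_nat_mono Suc_leI One_nat_def)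
  show ?thesis
  proof (rule almost_decreasing_convergent[OF _ _ p2, of _ "real k"])
    fix n
    have "real (?r (Suc n)) \<le> real ?B * real (?r n) + real (l n)"
      using of_nat_mono[OF rec[of n]] by (simp only: of_nat_add of_nat_mult)
    moreover have "real (l n) * real p ^ n \<le> real k * real ?B ^ n"
      using of_nat_mono[OF kl(1)[of n]] by (simp only: of_nat_power of_nat_mult)
    moreover have "y / b ^ Suc n \<le> x / b ^ n + k / q" if "y \<le> b * x + l" "l * q \<le> k * b ^ n" "1 \<le> b" "0 < q" "0 \<le> l"
      for y b x l k q :: real
    proof -
      have "y / b ^ Suc n \<le> (b * x + l) / b ^ Suc n" using that by (intro divide_right_mono) auto
      also have "\<dots> = x / b ^ n + l / (b * b ^ n)" using that by (simp add: add_divide_distrib)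
      also have "l / (b * b ^ n) \<le> l / b ^ n" using that by (intro divide_left_mono) auto
      also have "\<dots> \<le> k / q" using that by (simp add: field_simps)
      finally show ?thesis by simp
    qed
    ultimately show "real (?r (Suc n)) / real ?B ^ Suc n \<le> real (?r n) / real ?B ^ n + real k / real p ^ n"
      using B1 p2 by simp
  qed auto
qed

end

text \<open>At most \<open>N\<close> generators and \<open>N\<close> independent elements make the
  generators a basis: a relation with nonzero coefficient at \<open>z\<close> would let the
  remaining generators span everything up to that coefficient, and even such a set has at least
  \<open>N\<close> members.\<close>

lemma splits_basis:
  assumes Z: "Z \<subseteq> A" "finite Z" "card Z \<le> N" "A \<subseteq> qspan A (p ^ n) Z"
    and v: "v \<in> {..<N} \<rightarrow> A" "indep_mod A {0} (p ^ n) {0} {..<N} v"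
  shows "splits A e (p ^ n) A N"
proof -
  let ?q = "p ^ n"
  have le: "N \<le> card Y" if Y: "Y \<subseteq> A" "finite Y" and b: "b \<in> A" "b \<noteq> 0" "\<And>x. x \<in> A \<Longrightarrow> b ^ ?q * x \<in> qspan A ?q Y" for Y b
  proof -
    have "indep_mod A {0} ?q {0} {..<N} (\<lambda>i. b ^ ?q * v i)"
      unfolding indep_mod_def
    proof (intro ballI impI)
      fix c i assume c: "c \<in> {..<N} \<rightarrow> A" "(\<Sum>i<N. c i ^ ?q * (b ^ ?q * v i)) \<in> {0}" and i: "i \<in> {..<N}"
      have "(\<Sum>i<N. (c i * b) ^ ?q * v i) = (\<Sum>i<N. c i ^ ?q * (b ^ ?q * v i))"
        by (simp add: power_mult_distrib mult.assoc)
      then have "c i * b \<in> {0}" using indep_modD[OF v(2), of "\<lambda>i. c i * b" i] c i b(1) by (auto intro: mult_mem)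
      then show "c i \<in> {0}" using no_zero_divisors[of "c i" b] b c i by auto
    qed
    then have "card {..<N} \<le> card Y"
      using b v(1) Y zero_pow by (intro indep_mod_card_le[OF zero_prime pmodule_singleton_zero])
        (auto simp: qspan_insert_zero[unfolded Un_insert_left Un_empty_left])
    then show ?thesis by simp
  qed
  have cZ: "card Z = N" using le[OF Z(1,2) one_mem one_nonzero] Z(3,4) one_pow_q one_mult by fastforce
  have ind: "indep_mod A {0} ?q {0} Z (\<lambda>x. x)"
    unfolding indep_mod_def
  proof (intro ballI impI)
    fix c z assume c: "c \<in> Z \<rightarrow> A" "(\<Sum>i\<in>Z. c i ^ ?q * i) \<in> {0}" and z: "z \<in> Z"
    show "c z \<in> {0}"
    proof (rule ccontr)
      assume nz: "c z \<notin> {0}"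
      let ?Y = "Z - {z}"
      have S: "pmodule A ?q (qspan A ?q ?Y)" by (rule qspan_pmodule')
      have YA: "?Y \<subseteq> A" using Z(1) by blast
      have "c z ^ ?q * z = - (\<Sum>i\<in>?Y. c i ^ ?q * i)"
        using c(2) sum.remove[OF Z(2) z, of "\<lambda>i. c i ^ ?q * i"] by (simp add: eq_neg_iff_add_eq_0)
      also have "\<dots> = (\<Sum>i\<in>?Y. (- c i) ^ ?q * i)"
        using c(1) by (auto simp: uminus_pow sum_negf[symmetric] Pi_iff intro!: sum.cong)
      also have "\<dots> \<in> qspan A ?q ?Y"
        using c(1) uminus_mem by (intro pmodule_sum[OF S] qspan_smult_base) auto
      finally have zz: "c z ^ ?q * z \<in> qspan A ?q ?Y" .
      have "Z \<subseteq> {x. c z ^ ?q * x \<in> qspan A ?q ?Y}"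
        using zz c(1) z qspan_smult_base[of "c z" A _ ?Y ?q] by blast
      then have "A \<subseteq> {x. c z ^ ?q * x \<in> qspan A ?q ?Y}"
        using qspan_subset_pmodule[OF pmodule_colon[OF S]] Z(4) by blast
      then have "N \<le> card ?Y" using le[OF YA _ _ _ ] Z(2) c(1) z nz by blast
      then show False using cZ z Z(2) card_Diff1_less[OF Z(2) z] by simp
    qed
  qed
  have "qspan A ?q Z = A" using Z(4) qspan_subset_pmodule[OF pmodule_self Z(1)] by blast
  then obtain \<phi> where "dual_family A e ?q A Z (\<lambda>z. z) \<phi>"
    using dual_basis[OF Z(2) _ ind] Z(1) one_mult by auto
  from splits_family[OF this Z(2)] show ?thesis by (simp add: cZ)
qed

end

section \<open>Finite local extensions\<close>

text \<open>Multiply the vectors and compose the functionals. For the ring extension with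
  \<open>t = 0\<close>, each free summand over \<open>B\<close> contributes \<open>f\<close> over
  \<open>A\<close>; for \<open>A = B\<close> the lemma pushes a free module forward along
  Frobenius.\<close>

lemma splits_tower:
  assumes B: "char_p_subring B e p" and AB: "A \<subseteq> B" and V: "pmodule B (p ^ s) V"
    and k: "splits B e (p ^ s) V k" and f: "splits A e (p ^ t) B f"
  shows "splits A e (p ^ (s + t)) V (k * f)"
proof -
  interpret B: char_p_subring B e p by (rule B)
  obtain v \<phi> where dv: "dual_family B e (p ^ s) V {..<k} v \<phi>" using k unfolding splits_def by blast
  have v: "\<And>j. j < k \<Longrightarrow> v j \<in> V" "\<And>j. j < k \<Longrightarrow> qlin B (p ^ s) V (\<phi> j)"
    "\<And>i j. i < k \<Longrightarrow> j < k \<Longrightarrow> \<phi> i (v j) = (if i = j then e else 0)"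
    using dv unfolding dual_family_def by auto
  obtain w \<psi> where dw: "dual_family A e (p ^ t) B {..<f} w \<psi>" using f unfolding splits_def by blast
  have w: "\<And>j. j < f \<Longrightarrow> w j \<in> B" "\<And>j. j < f \<Longrightarrow> qlin A (p ^ t) B (\<psi> j)"
    "\<And>i j. i < f \<Longrightarrow> j < f \<Longrightarrow> \<psi> i (w j) = (if i = j then e else 0)"
    using dw unfolding dual_family_def by auto
  have "dual_family A e (p ^ (s + t)) V ({..<k} \<times> {..<f})
      (\<lambda>(j, i). w i ^ (p ^ s) * v j) (\<lambda>(j, i) x. \<psi> i (\<phi> j x))"
    unfolding dual_family_def
  proof (intro conjI ballI)
    fix x assume "x \<in> {..<k} \<times> {..<f}"
    then obtain j i where x: "x = (j, i)" "j < k" "i < f" by auto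
    show "(case x of (j, i) \<Rightarrow> w i ^ p ^ s * v j) \<in> V"
      using pmodule_smult[OF V w(1)[OF x(3)] v(1)[OF x(2)]] x by simp
    have "qlin A (p ^ (s + t)) V (\<lambda>y. \<psi> i (\<phi> j y))"
      unfolding qlin_def
    proof (intro conjI ballI)
      show "(\<lambda>y. \<psi> i (\<phi> j y)) \<in> V \<rightarrow> A" using qlinD(1)[OF w(2)[OF x(3)]] qlinD(1)[OF v(2)[OF x(2)]] by blast
      show "\<psi> i (\<phi> j (y + z)) = \<psi> i (\<phi> j y) + \<psi> i (\<phi> j z)" if "y \<in> V" "z \<in> V" for y z
        using qlinD(1,2)[OF v(2)[OF x(2)]] qlinD(2)[OF w(2)[OF x(3)]] that by simp
      show "\<psi> i (\<phi> j (a ^ p ^ (s + t) * y)) = a * \<psi> i (\<phi> j y)" if a: "a \<in> A" and y: "y \<in> V" for a y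
      proof -
        have aB: "a ^ (p ^ t) \<in> B" using a AB B.pow_mem_q by blast
        have "a ^ p ^ (s + t) = (a ^ (p ^ t)) ^ (p ^ s)" by (simp add: pow_pow_add)
        then have "\<phi> j (a ^ p ^ (s + t) * y) = a ^ (p ^ t) * \<phi> j y"
          using qlinD(3)[OF v(2)[OF x(2)] aB y] by simp
        then show ?thesis using qlinD(3)[OF w(2)[OF x(3)] a qlinD(1)[OF v(2)[OF x(2)] y]] by simp
      qed
    qed
    then show "qlin A (p ^ (s + t)) V (case x of (j, i) \<Rightarrow> \<lambda>x. \<psi> i (\<phi> j x))" using x by simp
    fix y assume "y \<in> {..<k} \<times> {..<f}"
    then obtain j' i' where y: "y = (j', i')" "j' < k" "i' < f" by auto
    have "\<phi> j (w i' ^ p ^ s * v j') = w i' * \<phi> j (v j')" by (rule qlinD(3)[OF v(2)[OF x(2)] w(1)[OF y(3)] v(1)[OF y(2)]])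
    also have "\<dots> = (if j = j' then w i' else 0)" using v(3)[OF x(2) y(2)] B.mult_one[OF w(1)[OF y(3)]] by simp
    finally have "\<psi> i (\<phi> j (w i' ^ p ^ s * v j')) = (if j = j' \<and> i = i' then e else 0)"
      using w(3)[OF x(3) y(3)] qlin_zero[OF w(2)[OF x(3)] B.zero_mem] by (cases "j = j'"; cases "i = i'") simp_all
    then show "(case x of (j, i) \<Rightarrow> \<lambda>x. \<psi> i (\<phi> j x)) (case y of (j, i) \<Rightarrow> w i ^ p ^ s * v j) = (if x = y then e else 0)"
      using x y by simp
  qed
  from splits_family[OF this] show ?thesis by (simp add: card_cartesian_product)
qed

text \<open>A functional on c V pulls back to \<open>V\<close>, so multiplication by
  \<open>c\<close> preserves nonsplit elements.\<close>

lemma (in char_p_subring) generated_mod_scale: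
  assumes V: "pmodule A q V" and g: "generated_mod A q V (nonsplit A m q V) k"
  shows "generated_mod A q ((\<lambda>v. c * v) ` V) (nonsplit A m q ((\<lambda>v. c * v) ` V)) k"
proof -
  let ?V = "(\<lambda>v. c * v) ` V"
  obtain X where X: "X \<subseteq> V" "finite X" "card X \<le> k" "V \<subseteq> qspan A q (nonsplit A m q V \<union> X)"
    using g unfolding generated_mod_def by blast
  have N: "c * v \<in> nonsplit A m q ?V" if v: "v \<in> nonsplit A m q V" for v
    unfolding nonsplit_def
  proof (intro CollectI conjI allI impI)
    show "c * v \<in> ?V" using v by (auto simp: nonsplit_def)
    fix \<phi> assume L: "qlin A q ?V \<phi>"
    have "qlin A q V (\<lambda>v. \<phi> (c * v))"
      using L unfolding qlin_def by (auto simp: distrib_left mult.left_commute[of c])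
    then show "\<phi> (c * v) \<in> m" using v unfolding nonsplit_def by blast
  qed
  let ?S = "qspan A q (nonsplit A m q ?V \<union> (\<lambda>v. c * v) ` X)"
  have "qspan A q (nonsplit A m q V \<union> X) \<subseteq> {v. c * v \<in> ?S}"
  proof (rule qspan_subset)
    show "a ^ q * x \<in> {v. c * v \<in> ?S}" if "a \<in> A" "x \<in> nonsplit A m q V \<union> X" for a x
    proof -
      have "c * x \<in> nonsplit A m q ?V \<union> (\<lambda>v. c * v) ` X" using that(2) N by blast
      from qspan_smult_base[OF that(1) this, of q] show ?thesis by (simp add: mult.left_commute)
    qed
  qed (auto simp: distrib_left intro: qspan_zero qspan_add)
  then have "?V \<subseteq> ?S" using X(4) by blast
  moreover have "card ((\<lambda>v. c * v) ` X) \<le> k" using card_image_le[OF X(2), of "\<lambda>v. c * v"] X(3) by linarith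
  ultimately show ?thesis unfolding generated_mod_def using X(1,2) by (intro exI[of _ "(\<lambda>v. c * v) ` X"]) auto
qed

text \<open>The ordinary action of \<open>A\<close> on \<open>B\<close> is written with exponent
  \<open>p ^ 0\<close>, so that it is the case \<open>n = 0\<close> of the Frobenius
  actions.\<close>

locale local_extension = R: F_finite_local_domain A e p m d + S: F_finite_local_domain B e p l d
  for A B :: "'u::comm_ring_1 set" and e p m l d +
  assumes AB: "A \<subseteq> B" and ml: "m \<subseteq> l" and finite_ext: "\<exists>Y\<subseteq>B. finite Y \<and> B \<subseteq> qspan A (p ^ 0) Y"
begin

lemma l_pmodule: "pmodule A (p ^ n) l"
  using S.ideal_in_pmodule[OF S.m_ideal, of n] AB unfolding pmodule_def by blast

lemma B_pmodule: "pmodule A (p ^ n) B"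
  using S.pmodule_self[of n] AB unfolding pmodule_def by blast

lemma B_unit: "b \<in> B \<Longrightarrow> e * b = b"
  by (rule S.one_mult)

text \<open>\<open>T\<close> lifts a basis of the residue field of \<open>B\<close> over that of
  \<open>A\<close>; the factor outside \<open>m\<close> coming from \<open>maximal_indep\<close> is
  inverted.\<close>

lemma residue_extension:
  "\<exists>T\<subseteq>B. finite T \<and> T \<noteq> {} \<and> indep_mod A m (p ^ 0) l T (\<lambda>x. x) \<and> B \<subseteq> qspan A (p ^ 0) (l \<union> T)"
proof -
  obtain Y where Y: "Y \<subseteq> B" "finite Y" "B \<subseteq> qspan A (p ^ 0) Y" using finite_ext by blast
  have YE: "e * x = x" if "x \<in> Y" for x using Y(1) that B_unit by blast
  have lE: "e * x = x" if "x \<in> l" for x using S.m_subset that B_unit by blast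
  have PX: "a ^ (p ^ 0) * x \<in> l" if "a \<in> m" "x \<in> Y" for a x
    using ideal_in_mult2[OF S.m_ideal, of x a] ml Y(1) that by auto
  obtain T c where T: "T \<subseteq> Y" "indep_mod A m (p ^ 0) l T (\<lambda>x. x)" "c \<in> A" "c \<notin> m"
    "\<And>v. v \<in> qspan A (p ^ 0) (l \<union> Y) \<Longrightarrow> c ^ (p ^ 0) * v \<in> qspan A (p ^ 0) (l \<union> T)"
    using R.maximal_indep[OF R.m_prime l_pmodule Y(2) YE lE PX] by blast
  obtain b where b: "b \<in> A" "b ^ (p ^ 0) * c ^ (p ^ 0) = e" using R.inverse_pow[OF T(3,4)] by blast
  have B: "B \<subseteq> qspan A (p ^ 0) (l \<union> T)"
  proof
    fix v assume v: "v \<in> B"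
    have "v \<in> qspan A (p ^ 0) (l \<union> Y)" using Y(3) v qspan_mono[of A A Y "l \<union> Y"] by auto
    then have "b ^ (p ^ 0) * (c ^ (p ^ 0) * v) \<in> qspan A (p ^ 0) (l \<union> T)"
      by (intro pmodule_smult[OF R.qspan_pmodule' b(1)] T(5))
    moreover have "b ^ (p ^ 0) * (c ^ (p ^ 0) * v) = v"
      using b(2) B_unit[OF v] by (metis mult.assoc)
    ultimately show "v \<in> qspan A (p ^ 0) (l \<union> T)" by simp
  qed
  have "T \<noteq> {}"
  proof
    assume "T = {}"
    then have "B \<subseteq> l" using B qspan_subset_pmodule[OF l_pmodule, of l 0] by auto
    then show False using S.one_mem S.prime_in_one[OF S.m_prime] by blast
  qed
  then show ?thesis using T(1,2) Y(1,2) B finite_subset[OF T(1)] by (intro exI[of _ T]) auto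
qed

text \<open>Both products are the degree of the residue field of \<open>B\<close> over the \<open>p\<close>-th powers of the residue
  field of \<open>A\<close>.\<close>

lemma residue_basis_card:
  assumes W: "residue_basis A m p W" and U: "residue_basis B l p U"
  shows "card W = card U"
proof -
  have W': "finite W" "W \<subseteq> A" "indep_mod A m (p ^ 1) m W (\<lambda>x. x)" "A \<subseteq> qspan A (p ^ 1) (m \<union> W)"
    using W unfolding residue_basis_def by auto
  have U': "finite U" "U \<subseteq> B" "indep_mod B l (p ^ 1) l U (\<lambda>x. x)" "B \<subseteq> qspan B (p ^ 1) (l \<union> U)"
    using U unfolding residue_basis_def by auto
  obtain T where T: "T \<subseteq> B" "finite T" "T \<noteq> {}" "indep_mod A m (p ^ 0) l T (\<lambda>x. x)" "B \<subseteq> qspan A (p ^ 0) (l \<union> T)"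
    using residue_extension by blast
  note cA = R.char_p_subring_axioms and cB = S.char_p_subring_axioms
  have lB: "e * x = x" if "x \<in> l" for x using S.m_subset that B_unit by blast
  have TE: "e * x = x" if "x \<in> T" for x using T(1) that B_unit by blast
  have UE: "e * x = x" if "x \<in> U" for x using U'(2) that B_unit by blast
  have pl: "a ^ (p ^ k) * x \<in> l" if a: "a \<in> l" and x: "x \<in> B" for a x k
  proof -
    obtain i where "p ^ k = Suc i" using R.q_pos[of k] by (cases "p ^ k") auto
    then have "a ^ p ^ k * x = (a ^ i * x) * a" by (simp add: mult_ac)
    moreover have "a ^ i * x \<in> B" using S.pow_mult_mem a x S.m_subset by blast
    ultimately show ?thesis using ideal_in_mult[OF S.m_ideal _ a] by simp
  qed
  \<comment> \<open>The first tower passes through the residue field of \<open>A\<close> and has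
    basis \<open>T \<times> W\<close>. The second passes through the p-th powers of the residue
    field of \<open>B\<close>, to which Frobenius carries the basis \<open>T\<close>; its basis is
    \<open>U \<times> T\<close>.\<close>
  have ind1: "indep_mod A m (p ^ (0 + 1)) l (T \<times> W) (\<lambda>(i, j). j ^ (p ^ 0) * i)"
    by (rule indep_mod_tower[OF cA subset_refl W'(1) T(2,4) W'(3)]) (use W'(2) in auto)
  have ind2: "indep_mod A m (p ^ (1 + 0)) l (U \<times> T) (\<lambda>(i, j). j ^ (p ^ 1) * i)"
    by (rule indep_mod_tower[OF cB AB T(2) U'(1,3) T(4)]) (use T(1) in auto)
  have sp1: "B \<subseteq> qspan A (p ^ (0 + 1)) (l \<union> (\<lambda>(x, y). y ^ (p ^ 0) * x) ` (T \<times> W))"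
    by (rule qspan_tower[OF cA cA subset_refl T(5) l_pmodule W'(4) _ W'(2) R.m_subset])
      (use pl[of _ _ 0] ml T(1) lB TE in auto)
  have sp2: "B \<subseteq> qspan A (p ^ (1 + 0)) (l \<union> (\<lambda>(x, y). y ^ (p ^ 1) * x) ` (U \<times> T))"
    by (rule qspan_tower[OF cA cB AB U'(4) S.ideal_in_pmodule[OF S.m_ideal] T(5) _ T(1) S.m_subset])
      (use pl[of _ _ 1] U'(2) lB UE in auto)
  have le: "card I \<le> card X" if fI: "finite I" and iI: "indep_mod A m (p ^ 1) l I v" and fX: "finite X"
      and XB: "X \<subseteq> B" and vB: "v ` I \<subseteq> B" and BX: "B \<subseteq> qspan A (p ^ 1) (l \<union> X)"
    for v and I :: "('u \<times> 'u) set" and X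
  proof (rule R.indep_mod_card_le[OF R.m_prime l_pmodule fI iI fX])
    show "v i \<in> qspan A (p ^ 1) (l \<union> X)" if "i \<in> I" for i using that vB BX by blast
    show "a ^ p ^ 1 * x \<in> l" if "a \<in> m" "x \<in> X" for a x using that XB ml pl by blast
  qed
  have m1: "(\<lambda>(x, y). y ^ (p ^ 0) * x) ` (T \<times> W) \<subseteq> B" using T(1) W'(2) AB by (auto intro: S.mult_mem)
  have m2: "(\<lambda>(x, y). y ^ (p ^ 1) * x) ` (U \<times> T) \<subseteq> B" using U'(2) T(1) by (auto intro!: S.pow_mult_mem)
  have "card (T \<times> W) \<le> card ((\<lambda>(x, y). y ^ (p ^ 1) * x) ` (U \<times> T))"
    using ind1 sp2 U'(1) T(2) W'(1) m1 m2 by (intro le) auto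
  also have "\<dots> \<le> card (U \<times> T)" using U'(1) T(2) by (intro card_image_le) auto
  finally have 1: "card T * card W \<le> card U * card T" by (simp add: card_cartesian_product)
  have "card (U \<times> T) \<le> card ((\<lambda>(x, y). y ^ (p ^ 0) * x) ` (T \<times> W))"
    using ind2 sp1 U'(1) T(2) W'(1) m1 m2 by (intro le) auto
  also have "\<dots> \<le> card (T \<times> W)" using W'(1) T(2) by (intro card_image_le) auto
  finally have 2: "card U * card T \<le> card T * card W" by (simp add: card_cartesian_product)
  have "card T > 0" using T(2,3) by auto
  then show ?thesis using 1 2 by (simp add: mult.commute)
qed

context
  fixes W U c f
  assumes W: "residue_basis A m p W"
    and U: "finite U" "U \<subseteq> B" "indep_mod A {0} (p ^ 0) {0} U (\<lambda>x. x)"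
    and c: "c \<in> A" "c \<noteq> 0" "\<And>b. b \<in> B \<Longrightarrow> c * b \<in> qspan A (p ^ 0) U"
    and f: "splits A e (p ^ 0) B f" "generated_mod A (p ^ 0) B (nonsplit A m (p ^ 0) B) f"
begin

lemma U_unit: "u \<in> U \<Longrightarrow> e * u = u"
  using U(2) B_unit by blast

lemma U_span: "qspan A (p ^ 0) U \<subseteq> B"
  using qspan_subset_pmodule[OF B_pmodule U(2)] .

text \<open>Free summands of F^n_* B over \<open>B\<close> give \<open>f\<close> times as many over
  \<open>A\<close>. Their number is bounded by comparing \<open>B\<close> with the span of
  \<open>U\<close>, where each member of \<open>U\<close> contributes one copy of F^n_* A.\<close>

lemma free_rank_extension_upper:
  "\<exists>k err. (\<forall>n. err n * p ^ n \<le> k * (p ^ d * card W) ^ n) \<and>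
    (\<forall>n. f * free_rank B e (p ^ n) B \<le> card U * free_rank A e (p ^ n) A + err n)"
proof -
  obtain Y where Y: "Y \<subseteq> B" "finite Y" "B \<subseteq> qspan A (p ^ 0) Y" using finite_ext by blast
  have YE: "e * x = x" if "x \<in> Y" for x using Y(1) that B_unit by blast
  have BY: "B = qspan A (p ^ 0) Y" using Y qspan_subset_pmodule[OF B_pmodule Y(1)] by blast
  have cB: "c ^ (p ^ 0) * v \<in> qspan A (p ^ 0) U" if "v \<in> B" for v using c(3)[OF that] by simp
  obtain k err where err: "\<And>n. err n * p ^ n \<le> k * (p ^ d * card W) ^ n"
    "\<And>n K. generated_mod A (p ^ (0 + n)) (qspan A (p ^ 0) U) (nonsplit A m (p ^ (0 + n)) (qspan A (p ^ 0) U)) K \<Longrightarrow>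
      generated_mod A (p ^ (0 + n)) B (nonsplit A m (p ^ (0 + n)) B) (K + err n)"
    using R.generated_mod_compare[OF W Y(2) YE BY R.qspan_pmodule' U_span c(1,2) cB] by blast
  have "f * free_rank B e (p ^ n) B \<le> card U * free_rank A e (p ^ n) A + err n" for n
  proof -
    have g: "generated_mod A (p ^ n) B (nonsplit A m (p ^ n) B) (card U * free_rank A e (p ^ n) A + err n)"
      using err(2)[OF R.generated_mod_sum[OF R.m_ideal U(1) U_unit R.generated_mod_free_rank_self]]
      by (simp only: add_0)
    have "splits A e (p ^ n) B (free_rank B e (p ^ n) B * f)"
      using splits_tower[OF S.char_p_subring_axioms AB S.pmodule_self S.splits_free_rank_self f(1)]
      by (simp only: add_0_right)
    from R.splits_le_generated[OF R.m_prime B_pmodule this g] show ?thesis by (simp add: mult.commute)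
  qed
  then show ?thesis using err(1) by blast
qed

text \<open>The comparison runs the other way: c B lies in the span of \<open>U\<close> and contains
  \<open>c\<close> times that span. If F^n_* B has \<open>N n\<close> generators over
  \<open>B\<close>, then over \<open>A\<close> it needs at most \<open>f * N n\<close> modulo its
  nonsplit part.\<close>

lemma free_rank_extension_lower:
  assumes Z: "\<And>n. \<exists>Z\<subseteq>B. finite Z \<and> card Z \<le> N n \<and> B \<subseteq> qspan B (p ^ n) Z"
  shows "\<exists>k err. (\<forall>n. err n * p ^ n \<le> k * (p ^ d * card W) ^ n) \<and>
    (\<forall>n. card U * free_rank A e (p ^ n) A \<le> f * N n + err n)"
proof -
  let ?V = "qspan A (p ^ 0) U" and ?cB = "(\<lambda>b. c * b) ` B"
  have cB: "pmodule A (p ^ 0) ?cB"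
  proof (rule pmoduleI)
    show "0 \<in> ?cB" using S.zero_mem by force
    show "x + y \<in> ?cB" if "x \<in> ?cB" "y \<in> ?cB" for x y
      using that S.add_mem by (auto simp flip: distrib_left)
    show "a ^ p ^ 0 * x \<in> ?cB" if "a \<in> A" "x \<in> ?cB" for a x
      using that AB S.mult_mem by (auto simp: mult.left_commute[of _ c])
  qed
  have cV: "c ^ (p ^ 0) * v \<in> ?cB" if "v \<in> ?V" for v using U_span that by auto
  have sub: "?cB \<subseteq> ?V" using c(3) by auto
  obtain k err where err: "\<And>n. err n * p ^ n \<le> k * (p ^ d * card W) ^ n"
    "\<And>n K. generated_mod A (p ^ (0 + n)) ?cB (nonsplit A m (p ^ (0 + n)) ?cB) K \<Longrightarrow>
      generated_mod A (p ^ (0 + n)) ?V (nonsplit A m (p ^ (0 + n)) ?V) (K + err n)"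
    using R.generated_mod_compare[OF W U(1) U_unit HOL.refl cB sub c(1,2) cV] by blast
  have "card U * free_rank A e (p ^ n) A \<le> f * N n + err n" for n
  proof -
    obtain Z where Z: "Z \<subseteq> B" "finite Z" "card Z \<le> N n" "B \<subseteq> qspan B (p ^ n) Z" using Z by blast
    obtain X where X: "X \<subseteq> B" "finite X" "card X \<le> f" "B \<subseteq> qspan A (p ^ 0) (nonsplit A m (p ^ 0) B \<union> X)"
      using f(2) unfolding generated_mod_def by blast
    let ?N = "nonsplit A m (p ^ n) B"
    have N: "pmodule A (p ^ n) ?N" by (rule R.nonsplit_pmodule[OF R.m_ideal B_pmodule])
    have comp: "b ^ p ^ n * v \<in> ?N" if "\<And>\<phi>. qlin A (p ^ n) B \<phi> \<Longrightarrow> \<phi> (b ^ p ^ n * v) \<in> m" "b \<in> B" "v \<in> B" for b v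
      using that S.pow_mult_mem unfolding nonsplit_def by blast
    \<comment> \<open>Precomposing a functional with multiplication by an element of
      \<open>B\<close> gives a functional again, so the nonsplit part over \<open>A\<close> is a
      \<open>B\<close>-submodule. This admits \<open>B\<close> as the middle ring of the
      tower.\<close>
    have NB: "pmodule B (p ^ n) ?N"
    proof (rule pmoduleI)
      show "b ^ p ^ n * v \<in> ?N" if b: "b \<in> B" and v: "v \<in> ?N" for b v
      proof (rule comp[OF _ b])
        show "v \<in> B" using v by (auto simp: nonsplit_def)
        fix \<phi> assume L: "qlin A (p ^ n) B \<phi>"
        have "qlin A (p ^ n) B (\<lambda>v. \<phi> (b ^ p ^ n * v))"
          using L S.pow_mult_mem[OF b] unfolding qlin_def
          by (auto simp: distrib_left mult.left_commute[of "b ^ p ^ n"])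
        then show "\<phi> (b ^ p ^ n * v) \<in> m" using v unfolding nonsplit_def by blast
      qed
    qed (use pmodule_zero[OF N] pmodule_add[OF N] in auto)
    have MN: "y ^ p ^ n * x \<in> ?N" if y: "y \<in> nonsplit A m (p ^ 0) B" and x: "x \<in> Z" for y x
    proof (rule comp)
      have xB: "x \<in> B" using x Z(1) by blast
      show "y \<in> B" "x \<in> B" using y xB by (auto simp: nonsplit_def)
      fix \<phi> assume L: "qlin A (p ^ n) B \<phi>"
      have "qlin A (p ^ 0) B (\<lambda>y. \<phi> (y ^ p ^ n * x))"
        unfolding qlin_def
      proof (intro conjI ballI)
        show "(\<lambda>y. \<phi> (y ^ p ^ n * x)) \<in> B \<rightarrow> A" using qlinD(1)[OF L] S.pow_mult_mem xB by blast
        show "\<phi> ((y + z) ^ p ^ n * x) = \<phi> (y ^ p ^ n * x) + \<phi> (z ^ p ^ n * x)" if "y \<in> B" "z \<in> B" for y z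
          using qlinD(2)[OF L] S.pow_mult_mem xB that by (simp add: S.add_pow distrib_right)
        show "\<phi> ((a ^ p ^ 0 * y) ^ p ^ n * x) = a * \<phi> (y ^ p ^ n * x)" if "a \<in> A" "y \<in> B" for a y
          using qlinD(3)[OF L that(1) S.pow_mult_mem[OF that(2) xB]] by (simp add: power_mult_distrib mult.assoc)
      qed
      then show "\<phi> (y ^ p ^ n * x) \<in> m" using y unfolding nonsplit_def by blast
    qed
    let ?Y = "(\<lambda>(x, y). y ^ (p ^ n) * x) ` (Z \<times> X)"
    have BN: "B \<subseteq> qspan B (p ^ n) (?N \<union> Z)" using Z(4) qspan_mono[of B B Z "?N \<union> Z" "p ^ n"] by blast
    have "B \<subseteq> qspan A (p ^ (n + 0)) (?N \<union> ?Y)"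
      by (rule qspan_tower[OF R.char_p_subring_axioms S.char_p_subring_axioms AB BN NB X(4) MN X(1) nonsplit_subset])
        (use Z(1) B_unit nonsplit_subset in blast)+
    moreover have "?Y \<subseteq> B" using Z(1) X(1) by (auto intro!: S.pow_mult_mem)
    moreover have "card ?Y \<le> f * N n"
      using card_image_le[of "Z \<times> X" "\<lambda>(x, y). y ^ (p ^ n) * x"] Z(2,3) X(2,3) mult_le_mono[OF Z(3) X(3)]
      by (simp add: card_cartesian_product mult.commute)
    ultimately have "generated_mod A (p ^ n) B ?N (f * N n)"
      unfolding generated_mod_def using Z(2) X(2) by (intro exI[of _ ?Y]) auto
    then have g: "generated_mod A (p ^ n) ?V (nonsplit A m (p ^ n) ?V) (f * N n + err n)"
      using err(2)[of n] R.generated_mod_scale[OF B_pmodule] by (simp only: add_0)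
    obtain \<phi> where "dual_family A e (p ^ 0) ?V U (\<lambda>z. z) \<phi>" using R.dual_basis[OF U(1) U_unit U(3)] by blast
    from splits_family[OF this U(1)] have "splits A e (p ^ 0) ?V (card U)" .
    then have "splits A e (p ^ n) ?V (card U * free_rank A e (p ^ n) A)"
      using splits_tower[OF R.char_p_subring_axioms subset_refl R.qspan_pmodule' _ R.splits_free_rank_self]
      by (metis add_0)
    moreover have "pmodule A (p ^ n) ?V"
      using pmodule_pow[OF R.qspan_pmodule'[of "p ^ 0" U], of A "p ^ n"] R.pow_mem_q by simp
    ultimately show ?thesis using R.splits_le_generated[OF R.m_prime _ _ g] by blast
  qed
  then show ?thesis using err(1) by blast
qed

end

end

section \<open>Lengths of chains of submodules\<close>

text \<open>Lengths refer to an arbitrary family of sets ordered by inclusion, so the same interval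
  can be measured in two families, one for each way in which the scalars act.\<close>

definition strict_chain :: "'a set set \<Rightarrow> 'a set \<Rightarrow> 'a set \<Rightarrow> nat \<Rightarrow> bool" where
  "strict_chain \<L> W V k \<longleftrightarrow> (\<exists>f. f 0 = W \<and> f k = V \<and> (\<forall>i\<le>k. f i \<in> \<L>) \<and> (\<forall>i<k. f i \<subset> f (Suc i)))"

text \<open>One-sided bounds in place of a number let lengths be estimated before they are known to
  be finite.\<close>

definition length_ge :: "'a set set \<Rightarrow> 'a set \<Rightarrow> 'a set \<Rightarrow> nat \<Rightarrow> bool" where
  "length_ge \<L> W V n \<longleftrightarrow> (\<exists>k\<ge>n. strict_chain \<L> W V k)"

definition length_le :: "'a set set \<Rightarrow> 'a set \<Rightarrow> 'a set \<Rightarrow> nat \<Rightarrow> bool" where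
  "length_le \<L> W V n \<longleftrightarrow> (\<forall>k. strict_chain \<L> W V k \<longrightarrow> k \<le> n)"

lemma chain_mono:
  assumes "\<And>i. i < k \<Longrightarrow> f i \<subseteq> f (Suc i)"
  shows "j \<le> k \<Longrightarrow> i \<le> j \<Longrightarrow> f i \<subseteq> (f j :: 'a set)"
proof (induction j)
  case (Suc j)
  then show ?case using assms[of j] by (cases "i = Suc j") auto
qed simp

lemma strict_chain_mono: "\<forall>i<k. f i \<subset> f (Suc i) \<Longrightarrow> i \<le> j \<Longrightarrow> j \<le> k \<Longrightarrow> f i \<subseteq> (f j :: 'a set)"
  using chain_mono[of k f j i] by blast

lemma strict_chain_trans:
  assumes "strict_chain \<L> W U a" "strict_chain \<L> U V b"
  shows "strict_chain \<L> W V (a + b)"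
proof -
  obtain f where f: "f 0 = W" "f a = U" "\<forall>i\<le>a. f i \<in> \<L>" "\<forall>i<a. f i \<subset> f (Suc i)"
    using assms(1) unfolding strict_chain_def by blast
  obtain g where g: "g 0 = U" "g b = V" "\<forall>i\<le>b. g i \<in> \<L>" "\<forall>i<b. g i \<subset> g (Suc i)"
    using assms(2) unfolding strict_chain_def by blast
  define h where "h i = (if i \<le> a then f i else g (i - a))" for i
  have hb: "h (a + i) = g i" for i using f(2) g(1) by (cases "i = 0") (auto simp: h_def)
  have "h i \<subset> h (Suc i)" if "i < a + b" for i
  proof (cases "i < a")
    case True
    then show ?thesis using f(4) by (simp add: h_def)
  next
    case False
    then obtain j where j: "i = a + j" using le_Suc_ex[of a i] by auto
    then have "g j \<subset> g (Suc j)" using g(4) that by simp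
    then show ?thesis using hb[of j] hb[of "Suc j"] j by simp
  qed
  moreover have "h i \<in> \<L>" if "i \<le> a + b" for i using f(3) g(3) that by (auto simp: h_def)
  ultimately show ?thesis unfolding strict_chain_def
    using f(1) g(2) hb[of b] by (intro exI[of _ h]) (auto simp: h_def)
qed

lemma strict_chain_refl: "W \<in> \<L> \<Longrightarrow> strict_chain \<L> W W 0"
  unfolding strict_chain_def by auto

lemma strict_chain_one:
  assumes "W \<in> \<L>" "V \<in> \<L>" "W \<subset> V" shows "strict_chain \<L> W V 1"
  unfolding strict_chain_def using assms by (intro exI[of _ "case_nat W (\<lambda>_. V)"]) (auto split: nat.splits)

lemma strict_chain_subset: "strict_chain \<L> W V k \<Longrightarrow> W \<in> \<L> \<and> V \<in> \<L> \<and> W \<subseteq> V"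
proof -
  assume "strict_chain \<L> W V k"
  then obtain f where f: "f 0 = W" "f k = V" "\<forall>i\<le>k. f i \<in> \<L>" "\<forall>i<k. f i \<subset> f (Suc i)"
    unfolding strict_chain_def by blast
  then show ?thesis using strict_chain_mono[OF f(4), of 0 k] by auto
qed

lemma length_le_refl: "length_le \<L> W W 0"
  unfolding length_le_def
proof (intro allI impI)
  fix k assume "strict_chain \<L> W W k"
  then obtain f where f: "f 0 = W" "f k = W" "\<forall>i<k. f i \<subset> f (Suc i)"
    unfolding strict_chain_def by blast
  show "k \<le> 0"
  proof (rule ccontr)
    assume "\<not> k \<le> 0"
    then have "f 0 \<subset> f 1" "f 1 \<subseteq> f k" using f(3) strict_chain_mono[OF f(3), of 1 k] by auto
    then show False using f(1,2) by blast
  qed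
qed

lemma length_ge_trans: "length_ge \<L> W U a \<Longrightarrow> length_ge \<L> U V b \<Longrightarrow> length_ge \<L> W V (a + b)"
  unfolding length_ge_def using strict_chain_trans add_mono by metis

lemma length_ge_zero: "W \<in> \<L> \<Longrightarrow> V \<in> \<L> \<Longrightarrow> W \<subseteq> V \<Longrightarrow> length_ge \<L> W V 0"
  unfolding length_ge_def using strict_chain_refl[of W \<L>] strict_chain_one[of W \<L> V] by blast

lemma length_ge_extend:
  assumes "length_ge \<L> W V n" "W' \<in> \<L>" "V' \<in> \<L>" "W' \<subseteq> W" "V \<subseteq> V'"
  shows "length_ge \<L> W' V' n"
proof -
  have "W \<in> \<L>" "V \<in> \<L>" using assms(1) strict_chain_subset unfolding length_ge_def by blast+
  then have "length_ge \<L> W' V' (0 + n + 0)"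
    using assms by (intro length_ge_trans length_ge_zero) auto
  then show ?thesis by simp
qed

lemma length_le_mono:
  assumes "length_le \<L> W' V' n" "W' \<in> \<L>" "V' \<in> \<L>" "W' \<subseteq> W" "V \<subseteq> V'"
  shows "length_le \<L> W V n"
  unfolding length_le_def
proof (intro allI impI)
  fix k assume "strict_chain \<L> W V k"
  then have "length_ge \<L> W' V' k" using length_ge_extend assms(2-5) unfolding length_ge_def by blast
  then show "k \<le> n" using assms(1) unfolding length_ge_def length_le_def by fastforce
qed

lemma length_ge_le: "length_ge \<L> W V a \<Longrightarrow> length_le \<L> W V b \<Longrightarrow> a \<le> b"
  unfolding length_ge_def length_le_def by fastforce

lemma strict_chain_map:
  assumes c: "strict_chain \<L> W V k" and "\<And>X. X \<in> \<L> \<Longrightarrow> W \<subseteq> X \<Longrightarrow> X \<subseteq> V \<Longrightarrow> F X \<in> \<L>'"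
    and "\<And>X Y. X \<in> \<L> \<Longrightarrow> Y \<in> \<L> \<Longrightarrow> W \<subseteq> X \<Longrightarrow> X \<subset> Y \<Longrightarrow> Y \<subseteq> V \<Longrightarrow> F X \<subset> F Y"
  shows "strict_chain \<L>' (F W) (F V) k"
proof -
  obtain f where f: "f 0 = W" "f k = V" "\<forall>i\<le>k. f i \<in> \<L>" "\<forall>i<k. f i \<subset> f (Suc i)"
    using c unfolding strict_chain_def by blast
  have "W \<subseteq> f i" "f i \<subseteq> V" if "i \<le> k" for i
    using strict_chain_mono[OF f(4), of 0 i] strict_chain_mono[OF f(4), of i k] f(1,2) that by auto
  then show ?thesis unfolding strict_chain_def using f assms(2,3)
    by (intro exI[of _ "F \<circ> f"]) auto
qed

lemma length_ge_map:
  assumes "length_ge \<L> W V n" and "\<And>X. X \<in> \<L> \<Longrightarrow> W \<subseteq> X \<Longrightarrow> X \<subseteq> V \<Longrightarrow> F X \<in> \<L>'"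
    and "\<And>X Y. X \<in> \<L> \<Longrightarrow> Y \<in> \<L> \<Longrightarrow> W \<subseteq> X \<Longrightarrow> X \<subset> Y \<Longrightarrow> Y \<subseteq> V \<Longrightarrow> F X \<subset> F Y"
  shows "length_ge \<L>' (F W) (F V) n"
  using assms strict_chain_map[where F = F] unfolding length_ge_def by metis

lemma length_ge_refine:
  assumes c: "strict_chain \<L> W V k"
    and step: "\<And>X Y. X \<in> \<L> \<Longrightarrow> Y \<in> \<L> \<Longrightarrow> W \<subseteq> X \<Longrightarrow> X \<subset> Y \<Longrightarrow> length_ge \<L>' X Y s"
    and W: "W \<in> \<L>'"
  shows "length_ge \<L>' W V (k * s)"
proof -
  obtain f where f: "f 0 = W" "f k = V" "\<forall>i\<le>k. f i \<in> \<L>" "\<forall>i<k. f i \<subset> f (Suc i)"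
    using c unfolding strict_chain_def by blast
  have "length_ge \<L>' W (f j) (j * s)" if "j \<le> k" for j using that
  proof (induction j)
    case 0
    then show ?case using f(1) length_ge_zero[OF W W] by simp
  next
    case (Suc j)
    have "W \<subseteq> f j" using strict_chain_mono[OF f(4), of 0 j] f(1) Suc.prems by auto
    then have "length_ge \<L>' (f j) (f (Suc j)) s" using f Suc.prems by (intro step) auto
    then have "length_ge \<L>' W (f (Suc j)) (j * s + s)" using Suc by (intro length_ge_trans[of _ _ "f j"]) auto
    then show ?case by (simp add: add.commute)
  qed
  then show ?thesis using f(2) by blast
qed

lemma weak_chain:
  assumes "\<And>i. i \<le> k \<Longrightarrow> f i \<in> \<L>" "\<And>i. i < k \<Longrightarrow> f i \<subseteq> f (Suc i)"
  shows "strict_chain \<L> (f 0) (f k) (card {i. i < k \<and> f i \<noteq> f (Suc i)})"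
  using assms
proof (induction k)
  case 0
  then show ?case by (auto intro: strict_chain_refl)
next
  case (Suc k)
  have IH: "strict_chain \<L> (f 0) (f k) (card {i. i < k \<and> f i \<noteq> f (Suc i)})" using Suc by simp
  have eq: "{i. i < Suc k \<and> f i \<noteq> f (Suc i)} =
      (if f k = f (Suc k) then {} else {k}) \<union> {i. i < k \<and> f i \<noteq> f (Suc i)}" by (auto simp: less_Suc_eq)
  show ?case
  proof (cases "f k = f (Suc k)")
    case True
    then show ?thesis using IH by (simp add: eq)
  next
    case False
    then have "strict_chain \<L> (f k) (f (Suc k)) 1" using Suc.prems by (intro strict_chain_one) auto
    from strict_chain_trans[OF IH this] show ?thesis using False by (simp add: eq)
  qed
qed

text \<open>A strict step of the chain stays strict after intersecting with \<open>U\<close> or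
  after joining with \<open>U\<close>, by the modular law; so two shorter chains count all steps.
  The join is a parameter \<open>J\<close> because in the application it involves
  saturation.\<close>

lemma length_le_add:
  assumes a: "length_le \<L> W U a" and b: "length_le \<L> U V b" and sub: "W \<subseteq> U" "U \<subseteq> V"
    and meet: "\<And>X. X \<in> \<L> \<Longrightarrow> W \<subseteq> X \<Longrightarrow> X \<inter> U \<in> \<L>"
    and J: "\<And>X. X \<in> \<L> \<Longrightarrow> W \<subseteq> X \<Longrightarrow> X \<subseteq> V \<Longrightarrow> J X \<in> \<L>" "\<And>X Y. X \<subseteq> Y \<Longrightarrow> J X \<subseteq> J Y" "J W = U" "J V = V"
    and modular: "\<And>X Y. X \<in> \<L> \<Longrightarrow> Y \<in> \<L> \<Longrightarrow> W \<subseteq> X \<Longrightarrow> X \<subseteq> Y \<Longrightarrow> Y \<subseteq> V \<Longrightarrow> X \<inter> U = Y \<inter> U \<Longrightarrow> J X = J Y \<Longrightarrow> X = Y"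
  shows "length_le \<L> W V (a + b)"
  unfolding length_le_def
proof (intro allI impI)
  fix k assume "strict_chain \<L> W V k"
  then obtain f where f: "f 0 = W" "f k = V" "\<forall>i\<le>k. f i \<in> \<L>" "\<forall>i<k. f i \<subset> f (Suc i)"
    unfolding strict_chain_def by blast
  have bd: "W \<subseteq> f i" "f i \<subseteq> V" if "i \<le> k" for i
    using strict_chain_mono[OF f(4), of 0 i] strict_chain_mono[OF f(4), of i k] f(1,2) that by auto
  let ?A = "{i. i < k \<and> f i \<inter> U \<noteq> f (Suc i) \<inter> U}" and ?B = "{i. i < k \<and> J (f i) \<noteq> J (f (Suc i))}"
  have "strict_chain \<L> (f 0 \<inter> U) (f k \<inter> U) (card ?A)"
    by (rule weak_chain[where f = "\<lambda>i. f i \<inter> U"]) (use f meet bd in auto)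
  then have A: "card ?A \<le> a" using a f(1,2) sub unfolding length_le_def by (simp add: Int_absorb1 Int_absorb2)
  have "strict_chain \<L> (J (f 0)) (J (f k)) (card ?B)"
  proof (rule weak_chain[where f = "\<lambda>i. J (f i)"])
    show "J (f i) \<in> \<L>" if "i \<le> k" for i using J(1) f(3) bd that by blast
    show "J (f i) \<subseteq> J (f (Suc i))" if "i < k" for i using J(2) f(4) that by blast
  qed
  then have B: "card ?B \<le> b" using b f(1,2) J(3,4) unfolding length_le_def by simp
  have "{..<k} \<subseteq> ?A \<union> ?B"
  proof
    fix i assume i: "i \<in> {..<k}"
    have "f i \<noteq> f (Suc i)" using f(4) i by blast
    then show "i \<in> ?A \<union> ?B" using modular[of "f i" "f (Suc i)"] f(3,4) bd[of i] bd[of "Suc i"] i by auto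
  qed
  then have "card {..<k} \<le> card (?A \<union> ?B)" by (intro card_mono) auto
  also have "\<dots> \<le> card ?A + card ?B" by (rule card_Un_le)
  finally show "k \<le> a + b" using A B by simp
qed

lemma length_le_attained:
  assumes "length_le \<L> W V n" "W \<in> \<L>" "V \<in> \<L>" "W \<subseteq> V"
  obtains k where "strict_chain \<L> W V k" "length_le \<L> W V k"
proof -
  let ?S = "{k. strict_chain \<L> W V k}"
  have f: "finite ?S" using assms(1) unfolding length_le_def by (intro finite_subset[of ?S "{..n}"]) auto
  have "?S \<noteq> {}" using length_ge_zero[OF assms(2-4)] unfolding length_ge_def by blast
  then have "Max ?S \<in> ?S" "\<And>k. k \<in> ?S \<Longrightarrow> k \<le> Max ?S" using f Max_in[of ?S] Max_ge[of ?S] by blast+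
  then show ?thesis using that[of "Max ?S"] unfolding length_le_def by blast
qed

section \<open>Degrees of residue fields along adjacent primes\<close>

text \<open>With no prime strictly between \<open>P\<close> and \<open>Q\<close>, the localization
  of A/P at \<open>Q\<close> is a local domain of dimension one, whose quotients by nonzero ideals
  have finite length.\<close>

locale adjacent_primes = char_p_subring A e p for A :: "'u::comm_ring_1 set" and e p +
  fixes P Q :: "'u set"
  assumes noeth: "noeth_in A" and P: "prime_in A P" and Q: "prime_in A Q" and PQ: "P \<subset> Q"
    and adjacent: "\<And>M. prime_in A M \<Longrightarrow> P \<subset> M \<Longrightarrow> M \<subseteq> Q \<Longrightarrow> M = Q"
begin

text \<open>The members of \<open>lat n\<close> correspond to the submodules of the localization at \<open>Q\<close> of \<open>A / P\<close>, with
  scalars acting through \<open>p ^ n\<close>-th powers.\<close>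

definition lat :: "nat \<Rightarrow> 'u set set" where
  "lat n = {W. W \<subseteq> A \<and> pmodule A (p ^ n) W \<and> P \<subseteq> W \<and> (\<forall>s\<in>A. s \<notin> Q \<longrightarrow> (\<forall>w\<in>A. s ^ (p ^ n) * w \<in> W \<longrightarrow> w \<in> W))}"

text \<open>The contraction to \<open>A\<close> of the localization of \<open>X\<close> at
  \<open>Q\<close>.\<close>

definition sat :: "nat \<Rightarrow> 'u set \<Rightarrow> 'u set" where
  "sat n X = {a \<in> A. \<exists>s\<in>A. s \<notin> Q \<and> s ^ (p ^ n) * a \<in> X}"

lemma latD:
  assumes "W \<in> lat n"
  shows "W \<subseteq> A" "pmodule A (p ^ n) W" "P \<subseteq> W" "s \<in> A \<Longrightarrow> s \<notin> Q \<Longrightarrow> w \<in> A \<Longrightarrow> s ^ (p ^ n) * w \<in> W \<Longrightarrow> w \<in> W"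
  using assms unfolding lat_def by blast+

lemma Qmult: "s \<in> A \<Longrightarrow> s \<notin> Q \<Longrightarrow> t \<in> A \<Longrightarrow> t \<notin> Q \<Longrightarrow> s * t \<in> A \<and> s * t \<notin> Q"
  using prime_in_mult[OF Q] mult_mem by blast

lemma e_Q: "e \<notin> Q"
  by (rule prime_in_one[OF Q])

lemma lat_diff:
  assumes "W \<in> lat n" "x \<in> W" "y \<in> W" shows "x - y \<in> W"
  using pmodule_diff[OF latD(2)[OF assms(1)] assms(2,3)] one_mult latD(1)[OF assms(1)] assms(3) by blast

lemma sat_superset: "X \<subseteq> A \<Longrightarrow> X \<subseteq> sat n X"
  using one_mem e_Q one_pow_q one_mult unfolding sat_def by (auto intro!: bexI[of _ e])

lemma sat_self: "x \<in> X \<Longrightarrow> x \<in> A \<Longrightarrow> x \<in> sat n X"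
  using one_mem e_Q one_pow_q one_mult unfolding sat_def by (auto intro!: bexI[of _ e])

lemma sat_mono: "X \<subseteq> Y \<Longrightarrow> sat n X \<subseteq> sat n Y"
  unfolding sat_def by blast

lemma sat_lat:
  assumes X: "pmodule A (p ^ n) X" "P \<subseteq> X"
  shows "sat n X \<in> lat n"
  unfolding lat_def
proof (intro CollectI conjI ballI impI)
  show "sat n X \<subseteq> A" unfolding sat_def by blast
  show "P \<subseteq> sat n X"
  proof
    fix x assume x: "x \<in> P"
    then have xA: "x \<in> A" using ideal_in_subset[OF prime_in_ideal[OF P]] by blast
    then show "x \<in> sat n X" using x X(2) one_mem e_Q one_pow_q one_mult[OF xA] unfolding sat_def
      by (auto intro!: bexI[of _ e])
  qed
  show "pmodule A (p ^ n) (sat n X)"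
  proof (rule pmoduleI)
    show "0 \<in> sat n X" using zero_mem one_mem e_Q pmodule_zero[OF X(1)] unfolding sat_def by (auto intro!: bexI[of _ e])
    show "a + b \<in> sat n X" if a: "a \<in> sat n X" and b: "b \<in> sat n X" for a b
    proof -
      obtain s where s: "s \<in> A" "s \<notin> Q" "s ^ (p ^ n) * a \<in> X" "a \<in> A" using a unfolding sat_def by blast
      obtain t where t: "t \<in> A" "t \<notin> Q" "t ^ (p ^ n) * b \<in> X" "b \<in> A" using b unfolding sat_def by blast
      have "(s * t) ^ (p ^ n) * (a + b) = t ^ (p ^ n) * (s ^ (p ^ n) * a) + s ^ (p ^ n) * (t ^ (p ^ n) * b)"
        by (simp add: power_mult_distrib algebra_simps)
      also have "\<dots> \<in> X" by (intro pmodule_add[OF X(1)] pmodule_smult[OF X(1)] s t)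
      finally show ?thesis using Qmult[OF s(1,2) t(1,2)] add_mem[OF s(4) t(4)] unfolding sat_def by blast
    qed
    show "c ^ p ^ n * a \<in> sat n X" if c: "c \<in> A" and a: "a \<in> sat n X" for c a
    proof -
      obtain s where s: "s \<in> A" "s \<notin> Q" "s ^ (p ^ n) * a \<in> X" "a \<in> A" using a unfolding sat_def by blast
      have "s ^ p ^ n * (c ^ p ^ n * a) \<in> X" using pmodule_smult[OF X(1) c s(3)] by (simp add: mult.left_commute)
      then show ?thesis using s pow_mult_mem[OF c s(4)] unfolding sat_def by blast
    qed
  qed
  fix s w assume s: "s \<in> A" "s \<notin> Q" and w: "w \<in> A" "s ^ p ^ n * w \<in> sat n X"
  then obtain t where t: "t \<in> A" "t \<notin> Q" "t ^ (p ^ n) * (s ^ p ^ n * w) \<in> X" unfolding sat_def by blast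
  then have "(t * s) ^ (p ^ n) * w \<in> X" by (simp add: power_mult_distrib mult.assoc)
  then show "w \<in> sat n X" using Qmult[OF t(1,2) s] w(1) unfolding sat_def by blast
qed

lemma sat_least: "W \<in> lat n \<Longrightarrow> X \<subseteq> W \<Longrightarrow> sat n X \<subseteq> W"
  using latD(4) unfolding sat_def by blast

lemma sat_fixed: "W \<in> lat n \<Longrightarrow> sat n W = W"
  using sat_least[of W n W] sat_superset latD(1) by blast

lemma A_lat: "A \<in> lat n"
  using pmodule_self P unfolding lat_def prime_in_def ideal_in_def by blast

lemma P_pmodule: "pmodule A (p ^ n) P"
  by (rule ideal_in_pmodule[OF prime_in_ideal[OF P]])

lemma P_subset: "P \<subseteq> A"
  using P unfolding prime_in_def ideal_in_def by blast

lemma P_pow_mult: "a \<in> P \<Longrightarrow> x \<in> A \<Longrightarrow> a ^ (p ^ n) * x \<in> P"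
proof -
  assume a: "a \<in> P" and x: "x \<in> A"
  obtain i where "p ^ n = Suc i" using q_pos[of n] by (cases "p ^ n") auto
  then have "a ^ p ^ n * x = (a ^ i * x) * a" by (simp add: mult_ac)
  then show ?thesis using ideal_in_mult[OF prime_in_ideal[OF P] pow_mult_mem a] a x P_subset by auto
qed

lemma Q_lat: "Q \<in> lat 0"
  using prime_in_mult[OF Q] Q PQ unfolding lat_def prime_in_def ideal_in_def by auto

lemma lat_0_ideal: "W \<in> lat 0 \<Longrightarrow> ideal_in A W"
  using latD[of W 0] unfolding ideal_in_def by simp

text \<open>Powers of elements outside the prime \<open>Q\<close> stay outside. Chains of saturated
  ideals can therefore be read in every \<open>lat n\<close>.\<close>

lemma lat_0_lat: 
  assumes W: "W \<in> lat 0" shows "W \<in> lat n"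
proof -
  have "s ^ (p ^ n) \<notin> Q" if "s \<in> A" "s \<notin> Q" for s using prime_in_pow1[OF Q that(1) _ q_pos] that(2) by blast
  then have "w \<in> W" if "s \<in> A" "s \<notin> Q" "w \<in> A" "s ^ p ^ n * w \<in> W" for s w
    using latD(4)[OF W pow_mem_q, of s n w] that by simp
  then show ?thesis using latD(1,3)[OF W] ideal_in_pmodule[OF lat_0_ideal[OF W]] unfolding lat_def by blast
qed

lemma lat_inter: "W \<in> lat n \<Longrightarrow> U \<in> lat n \<Longrightarrow> W \<inter> U \<in> lat n"
  unfolding lat_def pmodule_def by auto

lemma lat_length_add:
  assumes a: "length_le (lat n) W U a" and b: "length_le (lat n) U V b"
    and W: "W \<in> lat n" and U: "U \<in> lat n" and V: "V \<in> lat n" and sub: "W \<subseteq> U" "U \<subseteq> V"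
  shows "length_le (lat n) W V (a + b)"
proof -
  \<comment> \<open>The join of \<open>X\<close> and \<open>U\<close> in \<open>lat n\<close> is the
    saturation of their sum.\<close>
  define S where "S X = {x + u | x u. x \<in> X \<and> u \<in> U}" for X
  have pm: "pmodule A (p ^ n) (S X)" if X: "X \<in> lat n" for X
  proof (rule pmoduleI)
    show "0 \<in> S X" using pmodule_zero[OF latD(2)[OF X]] pmodule_zero[OF latD(2)[OF U]] unfolding S_def by force
    show "y + z \<in> S X" if y: "y \<in> S X" and z: "z \<in> S X" for y z
    proof -
      obtain x u x' u' where "y = x + u" "z = x' + u'" "x \<in> X" "x' \<in> X" "u \<in> U" "u' \<in> U" using y z unfolding S_def by blast
      then have "y + z = (x + x') + (u + u')" "x + x' \<in> X" "u + u' \<in> U"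
        using pmodule_add[OF latD(2)[OF X]] pmodule_add[OF latD(2)[OF U]] by auto
      then show ?thesis unfolding S_def by blast
    qed
    show "c ^ p ^ n * y \<in> S X" if c: "c \<in> A" and yJ: "y \<in> S X" for c y
    proof -
      obtain x u where y: "y = x + u" "x \<in> X" "u \<in> U" using yJ unfolding S_def by blast
      then have "c ^ p ^ n * y = c ^ p ^ n * x + c ^ p ^ n * u" by (simp add: distrib_left)
      then show ?thesis using y pmodule_smult[OF latD(2)[OF X] c] pmodule_smult[OF latD(2)[OF U] c] unfolding S_def by blast
    qed
  qed
  have XJ: "X \<subseteq> S X" for X using pmodule_zero[OF latD(2)[OF U]] unfolding S_def by force
  have UJ: "U \<subseteq> S X" if "X \<in> lat n" for X using pmodule_zero[OF latD(2)[OF that]] unfolding S_def by force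
  have small: "S X \<subseteq> Y" if "Y \<in> lat n" "X \<subseteq> Y" "U \<subseteq> Y" for X Y
    using that pmodule_add[OF latD(2)[OF that(1)]] unfolding S_def by blast
  have SA: "S X \<subseteq> A" if "X \<in> lat n" for X by (rule small[OF A_lat latD(1)[OF that] latD(1)[OF U]])
  show ?thesis
  proof (rule length_le_add[OF a b sub, where J = "\<lambda>X. sat n (S X)"])
  show "sat n (S X) \<in> lat n" if "X \<in> lat n" for X
    using sat_lat[OF pm[OF that]] latD(3)[OF that] XJ[of X] by blast
  show "sat n (S X) \<subseteq> sat n (S Y)" if "X \<subseteq> Y" for X Y
    using that unfolding S_def by (intro sat_mono) blast
  show "sat n (S W) = U"
  proof
    show "sat n (S W) \<subseteq> U" by (rule sat_least[OF U small[OF U sub(1) subset_refl]])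
    show "U \<subseteq> sat n (S W)" using UJ[OF W] sat_superset[OF SA[OF W], of n] by (rule subset_trans)
  qed
  show "sat n (S V) = V"
  proof
    show "sat n (S V) \<subseteq> V" by (rule sat_least[OF V small[OF V subset_refl sub(2)]])
    show "V \<subseteq> sat n (S V)" using XJ sat_superset[OF SA[OF V], of n] by (rule subset_trans)
  qed
  show "X = Y" if X: "X \<in> lat n" and Y: "Y \<in> lat n" and XY: "X \<subseteq> Y" and i: "X \<inter> U = Y \<inter> U"
    and j: "sat n (S X) = sat n (S Y)" for X Y
  proof (rule equalityI[OF XY], rule subsetI)
    fix v assume v: "v \<in> Y"
    then have vA: "v \<in> A" using latD(1)[OF Y] by blast
    then have "v \<in> sat n (S X)" using sat_superset[OF SA[OF Y], of n] XJ[of Y] v j by blast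
    then obtain s x u where s: "s \<in> A" "s \<notin> Q" "s ^ (p ^ n) * v = x + u" "x \<in> X" "u \<in> U" unfolding sat_def S_def by blast
    have "s ^ (p ^ n) * v - x \<in> Y" using lat_diff[OF Y pmodule_smult[OF latD(2)[OF Y] s(1) v]] s(4) XY by blast
    then have "u \<in> X" using s(3,5) i by auto
    then have "s ^ (p ^ n) * v \<in> X" using s pmodule_add[OF latD(2)[OF X]] by auto
    then show "v \<in> X" using latD(4)[OF X s(1,2) vA] by blast
  qed
qed (use U lat_inter in auto)
qed

text \<open>Sending W to the ideal of all a with \<open>a ^ (p ^ n) * y \<in> W\<close> is strictly
  monotone on the interval, since locally every element of \<open>W1\<close> is a multiple of
  \<open>y\<close> modulo \<open>W0\<close>. Chains over \<open>p ^ n\<close>-th powers become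
  chains of ideals above \<open>J\<close>.\<close>

lemma length_le_cyclic:
  assumes W0: "W0 \<in> lat n" and y: "y \<in> A" and J: "J \<in> lat 0" "\<And>a. a \<in> J \<Longrightarrow> a ^ (p ^ n) * y \<in> W0"
    and W1: "\<And>v. v \<in> W1 \<Longrightarrow> \<exists>s\<in>A. s \<notin> Q \<and> (\<exists>a\<in>A. \<exists>w\<in>W0. s ^ (p ^ n) * v = w + a ^ (p ^ n) * y)"
    and l: "length_le (lat 0) J A l"
  shows "length_le (lat n) W0 W1 l"
  unfolding length_le_def
proof (intro allI impI)
  fix k assume c: "strict_chain (lat n) W0 W1 k"
  let ?G = "\<lambda>W. {a \<in> A. a ^ (p ^ n) * y \<in> W}"
  have G: "?G W \<in> lat 0" if W: "W \<in> lat n" for W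
    unfolding lat_def
  proof (rule CollectI, intro conjI ballI impI)
    show "pmodule A (p ^ 0) (?G W)"
      using pmodule_zero[OF latD(2)[OF W]] pmodule_add[OF latD(2)[OF W]] pmodule_smult[OF latD(2)[OF W]]
      by (intro pmoduleI) (auto simp: zero_pow zero_mem add_pow distrib_right power_mult_distrib mult.assoc intro: add_mem mult_mem)
    show "P \<subseteq> ?G W" using P_pow_mult[OF _ y] latD(3)[OF W] P_subset by blast
    fix s w assume s: "s \<in> A" "s \<notin> Q" "w \<in> A" "s ^ p ^ 0 * w \<in> ?G W"
    then have "s ^ (p ^ n) * (w ^ (p ^ n) * y) \<in> W" by (simp add: power_mult_distrib mult.assoc)
    then show "w \<in> ?G W" using latD(4)[OF W s(1,2) pow_mult_mem[OF s(3) y]] s(3) by blast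
  qed auto
  have "strict_chain (lat 0) (?G W0) (?G W1) k"
  proof (rule strict_chain_map[OF c G])
    fix X Y assume X: "X \<in> lat n" and Y: "Y \<in> lat n" and "W0 \<subseteq> X" "X \<subset> Y" "Y \<subseteq> W1"
    then obtain v where v: "v \<in> Y" "v \<notin> X" by blast
    have vA: "v \<in> A" using v(1) latD(1)[OF Y] by blast
    obtain s a w where s: "s \<in> A" "s \<notin> Q" "a \<in> A" "w \<in> W0" "s ^ (p ^ n) * v = w + a ^ (p ^ n) * y"
      using W1[of v] v(1) \<open>Y \<subseteq> W1\<close> by blast
    have wY: "w \<in> Y" "w \<in> X" using s(4) \<open>W0 \<subseteq> X\<close> \<open>X \<subset> Y\<close> by blast+
    have "s ^ (p ^ n) * v - w \<in> Y" by (rule lat_diff[OF Y pmodule_smult[OF latD(2)[OF Y] s(1) v(1)] wY(1)])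
    then have aY: "a \<in> ?G Y" using s(3,5) by simp
    have "a \<notin> ?G X"
    proof
      assume "a \<in> ?G X"
      then have "s ^ (p ^ n) * v \<in> X" using s(5) pmodule_add[OF latD(2)[OF X] wY(2)] by simp
      then show False using latD(4)[OF X s(1,2) vA] v(2) by blast
    qed
    then show "?G X \<subset> ?G Y" using aY \<open>X \<subset> Y\<close> by blast
  qed
  moreover have "J \<subseteq> ?G W0" using J(2) latD(1)[OF J(1)] by blast
  ultimately show "k \<le> l" using length_le_mono[OF l J(1) A_lat, of "?G W0" "?G W1"] unfolding length_le_def by blast
qed

lemma length_le_generated:
  assumes W0: "W0 \<in> lat n" and J: "J \<in> lat 0" and l: "length_le (lat 0) J A l"
  shows "finite T \<Longrightarrow> T \<subseteq> A \<Longrightarrow> (\<And>a y. a \<in> J \<Longrightarrow> y \<in> T \<Longrightarrow> a ^ (p ^ n) * y \<in> W0) \<Longrightarrow>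
    length_le (lat n) W0 (sat n (qspan A (p ^ n) (W0 \<union> T))) (card T * l)"
proof (induction T rule: finite_induct)
  case empty
  have "qspan A (p ^ n) W0 = W0"
    using qspan_subset_pmodule[OF latD(2)[OF W0] subset_refl] qspan_base[of _ W0 n] one_mult latD(1)[OF W0] by blast
  then have "sat n (qspan A (p ^ n) (W0 \<union> {})) = W0" using sat_fixed[OF W0] by simp
  then show ?case using length_le_refl[of "lat n" W0] by simp
next
  case (insert y T)
  have sp: "W0 \<union> X \<subseteq> qspan A (p ^ n) (W0 \<union> X)" if "X \<subseteq> A" for X
    using latD(1)[OF W0] that one_mult by (blast intro!: qspan_base)
  have spA: "qspan A (p ^ n) (W0 \<union> X) \<subseteq> A" if "X \<subseteq> A" for X
    using latD(1)[OF W0] that by (intro qspan_subset_pmodule[OF pmodule_self]) auto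
  have L: "sat n (qspan A (p ^ n) (W0 \<union> X)) \<in> lat n" if "X \<subseteq> A" for X
    using sat_lat[OF qspan_pmodule'] sp[OF that] latD(3)[OF W0] by blast
  have W0s: "W0 \<subseteq> sat n (qspan A (p ^ n) (W0 \<union> X))" if "X \<subseteq> A" for X
    using sp[OF that] sat_superset[OF spA[OF that]] by blast
  let ?U = "sat n (qspan A (p ^ n) (W0 \<union> T))" and ?V = "sat n (qspan A (p ^ n) (W0 \<union> insert y T))"
  have 1: "length_le (lat n) W0 ?U (card T * l)" using insert by auto
  have 2: "length_le (lat n) ?U ?V l"
  proof (rule length_le_cyclic[OF L _ J _ _ l])
    show "a ^ p ^ n * y \<in> ?U" if "a \<in> J" for a using insert.prems that W0s[of T] by blast
    fix v assume "v \<in> ?V"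
    then obtain s where s: "s \<in> A" "s \<notin> Q" "s ^ (p ^ n) * v \<in> qspan A (p ^ n) (W0 \<union> insert y T)" unfolding sat_def by blast
    let ?N = "qspan A (p ^ n) (W0 \<union> T)"
    have "qspan A (p ^ n) (W0 \<union> insert y T) \<subseteq> qspan A (p ^ n) (?N \<union> {y})"
      using sp[of T] insert.prems(1) by (intro qspan_mono) auto
    then have "s ^ (p ^ n) * v \<in> qspan A (p ^ n) (?N \<union> {y})" using s(3) by blast
    from qspan_finite_rep[OF qspan_pmodule' _ this] obtain w c where
      wc: "w \<in> ?N" "c \<in> {y} \<rightarrow> A" "s ^ (p ^ n) * v = w + (\<Sum>x\<in>{y}. c x ^ (p ^ n) * x)" by blast
    moreover have "w \<in> ?U" using sat_superset[OF spA, of T n] wc(1) insert.prems(1) by blast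
    ultimately show "\<exists>s\<in>A. s \<notin> Q \<and> (\<exists>a\<in>A. \<exists>w\<in>?U. s ^ p ^ n * v = w + a ^ p ^ n * y)" using s by auto
  qed (use insert.prems in auto)
  have "?U \<subseteq> ?V" by (intro sat_mono qspan_mono) auto
  then have "length_le (lat n) W0 ?V (card T * l + l)"
    using lat_length_add[OF 1 2 W0 L L W0s] insert.prems(1) by auto
  then show ?case using insert.hyps by (simp add: add.commute)
qed

text \<open>A maximal member among the colon ideals of elements of \<open>I'\<close> outside
  \<open>I\<close> is prime. It contains \<open>z\<close>, hence \<open>P\<close> properly, and it
  lies in \<open>Q\<close> by saturation; adjacency leaves only \<open>Q\<close>. So each proper
  inclusion contains a copy of the residue field at \<open>Q\<close>.\<close>

lemma associated_element:
  assumes I: "I \<in> lat 0" and I': "I' \<in> lat 0" and lt: "I \<subset> I'" and z: "z \<in> I" "z \<notin> P"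
  obtains y where "y \<in> I'" "y \<notin> I" "{a \<in> A. a * y \<in> I} = Q"
proof -
  let ?c = "\<lambda>y. {a \<in> A. a * y \<in> I}"
  note iI = lat_0_ideal[OF I] and iI' = lat_0_ideal[OF I']
  have id: "ideal_in A (?c y)" for y
    using ideal_in_zero[OF iI] ideal_in_add[OF iI] ideal_in_mult[OF iI]
    by (intro ideal_inI) (auto simp: zero_mem distrib_right mult.assoc intro: add_mem mult_mem)
  have "?c ` (I' - I) \<noteq> {}" "\<forall>J\<in>?c ` (I' - I). ideal_in A J" using lt id by auto
  then obtain M where M: "M \<in> ?c ` (I' - I)" "\<forall>J\<in>?c ` (I' - I). M \<subseteq> J \<longrightarrow> J = M"
    using noeth[unfolded noeth_in_def, rule_format, of "?c ` (I' - I)"] by auto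
  then obtain y where y: "y \<in> I'" "y \<notin> I" "M = ?c y" by blast
  have yA: "y \<in> A" using ideal_in_subset[OF iI' y(1)] .
  have "prime_in A M" unfolding prime_in_def
  proof (intro conjI ballI impI)
    show "ideal_in A M" using id y(3) by simp
    have "e \<notin> M" using y(2,3) one_mult[OF yA] by simp
    then show "M \<noteq> A" using one_mem by blast
    fix a b assume ab: "a \<in> A" "b \<in> A" "a * b \<in> M"
    show "a \<in> M \<or> b \<in> M"
    proof (cases "b \<in> M")
      case False
      then have "b * y \<in> I' - I" using ab(2) y(3) ideal_in_mult[OF iI' ab(2) y(1)] by blast
      moreover have "M \<subseteq> ?c (b * y)"
      proof
        fix a assume "a \<in> M"
        then have "a \<in> A" "b * (a * y) \<in> I" using ideal_in_mult[OF iI ab(2)] y(3) by auto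
        then show "a \<in> ?c (b * y)" by (simp add: mult.left_commute)
      qed
      ultimately have "?c (b * y) = M" using M(2) by blast
      moreover have "a \<in> ?c (b * y)" using ab y(3) by (auto simp: mult.assoc)
      ultimately show ?thesis by blast
    qed blast
  qed
  moreover have "P \<subset> M"
  proof -
    have "I \<subseteq> M" using ideal_in_mult2[OF iI yA] ideal_in_subset[OF iI] y(3) by blast
    then show ?thesis using latD(3)[OF I] z by blast
  qed
  moreover have "M \<subseteq> Q"
  proof
    fix s assume "s \<in> M"
    then show "s \<in> Q" using latD(4)[OF I _ _ yA, of s] y(2,3) by auto
  qed
  ultimately have "M = Q" by (rule adjacent)
  then show ?thesis using that[OF y(1,2)] y(3) by simp
qed

lemma length_le_Q: "length_le (lat 0) Q A 1"
  unfolding length_le_def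
proof (intro allI impI)
  fix k assume "strict_chain (lat 0) Q A k"
  then obtain f where f: "f 0 = Q" "f k = A" "\<forall>i\<le>k. f i \<in> lat 0" "\<forall>i<k. f i \<subset> f (Suc i)"
    unfolding strict_chain_def by blast
  show "k \<le> 1"
  proof (rule ccontr)
    assume "\<not> k \<le> 1"
    then have *: "f 0 \<subset> f 1" "f 1 \<subset> f 2" "f 1 \<in> lat 0" "f 2 \<in> lat 0" using f(3,4) by (auto simp: numeral_2_eq_2)
    then obtain a where a: "a \<in> f 1" "a \<notin> Q" using f(1) by blast
    have aA: "a \<in> A" using a(1) latD(1)[OF *(3)] by blast
    have "a ^ (p ^ 0) * e \<in> f 1" using a(1) mult_one[OF aA] by simp
    then have "e \<in> f 1" using latD(4)[OF *(3) aA a(2) one_mem] by blast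
    then have "f 1 = A" using ideal_in_whole[OF lat_0_ideal[OF *(3)]] by blast
    then show False using *(2) latD(1)[OF *(4)] by blast
  qed
qed

text \<open>Noetherian induction: adjoining an element with colon ideal \<open>Q\<close> adds length
  at most one, because A/Q becomes a field after localization.\<close>

lemma finite_length:
  assumes "I \<in> lat 0" "z \<in> I" "z \<notin> P"
  shows "\<exists>k. length_le (lat 0) I A k"
proof -
  have "ideal_in A I" using lat_0_ideal[OF assms(1)] .
  with noeth have "I \<in> lat 0 \<longrightarrow> z \<in> I \<longrightarrow> (\<exists>k. length_le (lat 0) I A k)"
  proof (induction rule: noeth_induct)
    case (step I)
    show ?case
    proof (intro impI)
      assume I: "I \<in> lat 0" and z: "z \<in> I"
      show "\<exists>k. length_le (lat 0) I A k"
      proof (cases "I = A")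
        case True
        then show ?thesis using length_le_refl by blast
      next
        case False
        then have lt: "I \<subset> A" using latD(1)[OF I] by blast
        obtain y where y: "y \<in> A" "y \<notin> I" "{a \<in> A. a * y \<in> I} = Q"
          using associated_element[OF I A_lat lt z assms(3)] by blast
        let ?I = "sat 0 (adjoin A I y)"
        have ad: "ideal_in A (adjoin A I y)" using adjoin_ideal[OF step(1) y(1)] .
        have adA: "adjoin A I y \<subseteq> A" using ad unfolding ideal_in_def by blast
        have L: "?I \<in> lat 0" using sat_lat[of 0] ideal_in_pmodule[OF ad, of 0] adjoin_superset[of I y] latD(3)[OF I] by blast
        have sub: "adjoin A I y \<subseteq> ?I" using sat_superset[OF adA] .
        have "I \<subset> ?I" using adjoin_superset[of I y] adjoin_self[OF step(1) y(1)] y(2) sub by blast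
        then obtain k where k: "length_le (lat 0) ?I A k" using step(2)[OF lat_0_ideal[OF L]] L z by blast
        have "length_le (lat 0) I ?I 1"
        proof (rule length_le_cyclic[OF I y(1) Q_lat _ _ length_le_Q])
          show "a ^ p ^ 0 * y \<in> I" if "a \<in> Q" for a using that y(3) by auto
          show "\<exists>s\<in>A. s \<notin> Q \<and> (\<exists>a\<in>A. \<exists>w\<in>I. s ^ p ^ 0 * v = w + a ^ p ^ 0 * y)" if "v \<in> ?I" for v
            using that unfolding sat_def adjoin_def by (simp, blast)
        qed
        from lat_length_add[OF this k I L A_lat] show ?thesis using \<open>I \<subset> ?I\<close> latD(1)[OF L] by blast
      qed
    qed
  qed
  then show ?thesis using assms by blast
qed

text \<open>Multiplying \<open>y\<close> by a family independent modulo \<open>Q\<close> splits one step over \<open>A\<close> into \<open>s\<close> steps over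
  the \<open>p\<close>-th powers.\<close>

lemma length_ge_step:
  assumes w: "w \<in> {..<s} \<rightarrow> A" "indep_mod A Q (p ^ 1) Q {..<s} w"
    and I: "I \<in> lat 0" and I': "I' \<in> lat 0" and lt: "I \<subset> I'" and z: "z \<in> I" "z \<notin> P"
  shows "length_ge (lat 1) I I' s"
proof -
  obtain y where y: "y \<in> I'" "y \<notin> I" "{a \<in> A. a * y \<in> I} = Q" using associated_element[OF I I' lt z] by blast
  have yA: "y \<in> A" using y(1) latD(1)[OF I'] by blast
  have wA: "w i \<in> A" if "i < s" for i using w(1) that by blast
  \<comment> \<open>\<open>D j\<close> adds to \<open>I\<close> the first \<open>j\<close> products
    \<open>w i * y\<close> with p-th powers as coefficients; the saturations of these sets form the
    chain of \<open>s\<close> steps.\<close>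
  define D where "D j = {u + (\<Sum>i<j. a i ^ (p ^ 1) * (w i * y)) | u a. u \<in> I \<and> a \<in> {..<j} \<rightarrow> A}" for j
  note I1 = latD(2)[OF lat_0_lat[OF I, of 1]]
  have D: "pmodule A (p ^ 1) (D j)" for j
  proof (rule pmoduleI)
    show "0 \<in> D j" using pmodule_zero[OF I1] zero_mem zero_pow[of 1]
      unfolding D_def by (intro CollectI exI[of _ 0] exI[of _ "\<lambda>_. 0"]) auto
    show "x + x' \<in> D j" if x: "x \<in> D j" and x': "x' \<in> D j" for x x'
    proof -
      obtain u a where ua: "x = u + (\<Sum>i<j. a i ^ (p ^ 1) * (w i * y))" "u \<in> I" "a \<in> {..<j} \<rightarrow> A" using x unfolding D_def by blast
      obtain u' a' where ua': "x' = u' + (\<Sum>i<j. a' i ^ (p ^ 1) * (w i * y))" "u' \<in> I" "a' \<in> {..<j} \<rightarrow> A" using x' unfolding D_def by blast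
      have "(\<Sum>i<j. (a i + a' i) ^ (p ^ 1) * (w i * y)) = (\<Sum>i<j. a i ^ (p ^ 1) * (w i * y)) + (\<Sum>i<j. a' i ^ (p ^ 1) * (w i * y))"
        unfolding sum.distrib[symmetric]
      proof (intro sum.cong refl)
        fix i assume "i \<in> {..<j}"
        then have "a i \<in> A" "a' i \<in> A" using ua(3) ua'(3) by auto
        then show "(a i + a' i) ^ (p ^ 1) * (w i * y) = a i ^ (p ^ 1) * (w i * y) + a' i ^ (p ^ 1) * (w i * y)"
          using add_pow[of "a i" "a' i" 1] by (simp add: distrib_right)
      qed
      then have "x + x' = (u + u') + (\<Sum>i<j. (a i + a' i) ^ (p ^ 1) * (w i * y))" using ua(1) ua'(1) by simp
      moreover have "(\<lambda>i. a i + a' i) \<in> {..<j} \<rightarrow> A" using ua(3) ua'(3) by (auto intro: add_mem)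
      ultimately show ?thesis using pmodule_add[OF I1 ua(2) ua'(2)] unfolding D_def by (intro CollectI exI conjI)
    qed
    show "c ^ p ^ 1 * x \<in> D j" if c: "c \<in> A" and x: "x \<in> D j" for c x
    proof -
      obtain u a where ua: "x = u + (\<Sum>i<j. a i ^ (p ^ 1) * (w i * y))" "u \<in> I" "a \<in> {..<j} \<rightarrow> A" using x unfolding D_def by blast
      have "c ^ p ^ 1 * x = c ^ p ^ 1 * u + (\<Sum>i<j. (c * a i) ^ (p ^ 1) * (w i * y))"
        by (simp add: ua(1) distrib_left sum_distrib_left power_mult_distrib mult.assoc)
      moreover have "(\<lambda>i. c * a i) \<in> {..<j} \<rightarrow> A" using ua(3) c by (auto intro: mult_mem)
      ultimately show ?thesis using pmodule_smult[OF I1 c ua(2)] unfolding D_def by (intro CollectI exI conjI)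
    qed
  qed
  have ID: "I \<subseteq> D j" for j
  proof
    fix x assume "x \<in> I"
    then show "x \<in> D j" using zero_mem zero_pow[of 1]
      unfolding D_def by (intro CollectI exI[of _ x] exI[of _ "\<lambda>_. 0"]) auto
  qed
  have DI': "D j \<subseteq> I'" if "j \<le> s" for j
  proof
    fix x assume "x \<in> D j"
    then obtain u a where ua: "x = u + (\<Sum>i<j. a i ^ (p ^ 1) * (w i * y))" "u \<in> I" "a \<in> {..<j} \<rightarrow> A" unfolding D_def by blast
    have "a i ^ (p ^ 1) * (w i * y) \<in> I'" if "i < j" for i
    proof -
      have "w i * y \<in> I'" using ideal_in_mult[OF lat_0_ideal[OF I'] wA y(1)] that \<open>j \<le> s\<close> by simp
      then show ?thesis using pmodule_smult[OF latD(2)[OF lat_0_lat[OF I', of 1]]] ua(3) that by blast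
    qed
    then have "(\<Sum>i<j. a i ^ (p ^ 1) * (w i * y)) \<in> I'" by (intro ideal_in_sum[OF lat_0_ideal[OF I']]) simp
    moreover have "u \<in> I'" using ua(2) lt by blast
    ultimately show "x \<in> I'" unfolding ua(1) using ideal_in_add[OF lat_0_ideal[OF I']] by blast
  qed
  have DA: "D j \<subseteq> A" if "j \<le> s" for j using DI'[OF that] latD(1)[OF I'] by blast
  let ?C = "\<lambda>j. sat 1 (D j)"
  have C: "?C j \<in> lat 1" for j using sat_lat[OF D] ID[of j] latD(3)[OF I] by blast
  have CS: "?C j \<subset> ?C (Suc j)" if j: "j < s" for j
  proof -
    have "D j \<subseteq> D (Suc j)"
    proof
      fix x assume "x \<in> D j"
      then obtain u a where ua: "x = u + (\<Sum>i<j. a i ^ (p ^ 1) * (w i * y))" "u \<in> I" "a \<in> {..<j} \<rightarrow> A" unfolding D_def by blast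
      have "(\<Sum>i<Suc j. (a(j := 0)) i ^ (p ^ 1) * (w i * y)) = (\<Sum>i<j. a i ^ (p ^ 1) * (w i * y))"
        using zero_pow[of 1] by (simp add: lessThan_Suc)
      moreover have "a(j := 0) \<in> {..<Suc j} \<rightarrow> A" using ua(3) zero_mem by (auto simp: less_Suc_eq Pi_iff)
      ultimately show "x \<in> D (Suc j)" using ua(1,2) unfolding D_def by (intro CollectI exI[of _ u] exI[of _ "a(j := 0)"]) auto
    qed
    then have sub: "?C j \<subseteq> ?C (Suc j)" by (rule sat_mono)
    have wyA: "w j * y \<in> A" using mult_mem[OF wA[OF j] yA] .
    have "w j * y \<in> D (Suc j)"
    proof -
      define a where "a i = (if i = j then e else 0)" for i
      have "(\<Sum>i<Suc j. a i ^ (p ^ 1) * (w i * y)) = e ^ (p ^ 1) * (w j * y) + (\<Sum>i<j. 0)"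
        using zero_pow[of 1] by (simp add: a_def)
      also have "\<dots> = w j * y" using one_pow_q[of 1] one_mult[OF wyA] by simp
      finally have "w j * y = 0 + (\<Sum>i<Suc j. a i ^ (p ^ 1) * (w i * y))" by simp
      moreover have "a \<in> {..<Suc j} \<rightarrow> A" using one_mem zero_mem by (auto simp: a_def)
      ultimately show ?thesis using pmodule_zero[OF I1] unfolding D_def by blast
    qed
    then have in1: "w j * y \<in> ?C (Suc j)" using sat_superset[OF DA[of "Suc j"], of 1] j by auto
    have "w j * y \<notin> ?C j"
    proof
      assume "w j * y \<in> ?C j"
      then obtain t u a where t: "t \<in> A" "t \<notin> Q" "t ^ (p ^ 1) * (w j * y) = u + (\<Sum>i<j. a i ^ (p ^ 1) * (w i * y))"
          "u \<in> I" "a \<in> {..<j} \<rightarrow> A" unfolding sat_def D_def by blast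
      \<comment> \<open>If \<open>w j * y\<close> belonged to the previous member, its relation
        would make a combination of the \<open>w i\<close> multiply \<open>y\<close> into
        \<open>I\<close>, hence lie in \<open>Q\<close>, although its last coefficient
        \<open>t\<close> is outside \<open>Q\<close>.\<close>
      define c where "c i = (if i = j then t else - a i)" for i
      have aA: "a i \<in> A" if "i < j" for i using t(5) that by blast
      have cA: "c \<in> {..<Suc j} \<rightarrow> A" using t(1) aA uminus_mem by (auto simp: c_def less_Suc_eq)
      have "(\<Sum>i<Suc j. c i ^ (p ^ 1) * w i) = (\<Sum>i<j. (- a i) ^ (p ^ 1) * w i) + t ^ (p ^ 1) * w j"
        by (simp add: c_def)
      also have "(\<Sum>i<j. (- a i) ^ (p ^ 1) * w i) = - (\<Sum>i<j. a i ^ (p ^ 1) * w i)"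
        unfolding sum_negf[symmetric] using aA uminus_pow[of _ 1] by (intro sum.cong) auto
      finally have E: "(\<Sum>i<Suc j. c i ^ (p ^ 1) * w i) = - (\<Sum>i<j. a i ^ (p ^ 1) * w i) + t ^ (p ^ 1) * w j" .
      have "(\<Sum>i<Suc j. c i ^ (p ^ 1) * w i) * y = t ^ (p ^ 1) * (w j * y) - (\<Sum>i<j. a i ^ (p ^ 1) * w i) * y"
        unfolding E by (simp add: distrib_right left_diff_distrib mult.assoc)
      also have "(\<Sum>i<j. a i ^ (p ^ 1) * w i) * y = (\<Sum>i<j. a i ^ (p ^ 1) * (w i * y))"
        by (simp add: sum_distrib_right mult.assoc)
      finally have "(\<Sum>i<Suc j. c i ^ (p ^ 1) * w i) * y = t ^ (p ^ 1) * (w j * y) - (\<Sum>i<j. a i ^ (p ^ 1) * (w i * y))" .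
      then have "(\<Sum>i<Suc j. c i ^ (p ^ 1) * w i) * y \<in> I" using t(3,4) by simp
      moreover have "(\<Sum>i<Suc j. c i ^ (p ^ 1) * w i) \<in> A"
        using cA wA j by (intro sum_mem pow_mult_mem) auto
      ultimately have "(\<Sum>i<Suc j. c i ^ (p ^ 1) * w i) \<in> Q" using y(3) by blast
      moreover have "indep_mod A Q (p ^ 1) Q {..<Suc j} w"
        by (rule indep_mod_mono[OF w(2)]) (use j in auto)
      ultimately have "c j \<in> Q" using indep_modD[of A Q "p ^ 1" Q "{..<Suc j}" w c j] cA by blast
      then show False using t(2) by (simp add: c_def)
    qed
    then show ?thesis using sub in1 by blast
  qed
  have C0: "?C 0 = I"
  proof -
    have "D 0 = I" unfolding D_def by auto
    then show ?thesis using sat_fixed[OF lat_0_lat[OF I]] by simp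
  qed
  have "strict_chain (lat 1) I (?C s) s"
    unfolding strict_chain_def using C CS C0 by (intro exI[of _ ?C]) auto
  then have "length_ge (lat 1) I (?C s) s" unfolding length_ge_def by blast
  moreover have "?C s \<subseteq> I'" using sat_least[OF lat_0_lat[OF I'] DI'] by blast
  ultimately show ?thesis using length_ge_extend[OF _ lat_0_lat[OF I] lat_0_lat[OF I']] by blast
qed

text \<open>Multiplication by \<open>x ^ k\<close> identifies the interval above \<open>W\<close> with the one above \<open>x ^ k W\<close>.\<close>

definition shift :: "nat \<Rightarrow> 'u \<Rightarrow> 'u set \<Rightarrow> 'u set" where
  "shift n x W = sat n {x * w + v | w v. w \<in> W \<and> v \<in> P}"

lemma shift_pmodule:
  assumes W: "pmodule A (p ^ n) W"
  shows "pmodule A (p ^ n) {x * w + v | w v. w \<in> W \<and> v \<in> P}" (is "pmodule _ _ ?S")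
proof (rule pmoduleI)
  show "0 \<in> ?S" using pmodule_zero[OF W] pmodule_zero[OF P_pmodule[of 0]] by force
  show "y + z \<in> ?S" if y: "y \<in> ?S" and z: "z \<in> ?S" for y z
  proof -
    obtain w v where wv: "y = x * w + v" "w \<in> W" "v \<in> P" using y by blast
    obtain w' v' where wv': "z = x * w' + v'" "w' \<in> W" "v' \<in> P" using z by blast
    have "y + z = x * (w + w') + (v + v')" using wv wv' by (simp add: algebra_simps)
    then show ?thesis using pmodule_add[OF W wv(2) wv'(2)] pmodule_add[OF P_pmodule[of 0] wv(3) wv'(3)] by blast
  qed
  show "c ^ p ^ n * y \<in> ?S" if c: "c \<in> A" and y: "y \<in> ?S" for c y
  proof -
    obtain w v where wv: "y = x * w + v" "w \<in> W" "v \<in> P" using y by blast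
    have "c ^ p ^ n * y = x * (c ^ p ^ n * w) + c ^ p ^ n * v" using wv by (simp add: algebra_simps)
    then show ?thesis using pmodule_smult[OF W c wv(2)] pmodule_smult[OF P_pmodule c wv(3)] by blast
  qed
qed

lemma shift_lat: 
  assumes W: "W \<in> lat n" shows "shift n x W \<in> lat n"
  unfolding shift_def
proof (rule sat_lat[OF shift_pmodule[OF latD(2)[OF W]]])
  show "P \<subseteq> {x * w + v | w v. w \<in> W \<and> v \<in> P}" using pmodule_zero[OF latD(2)[OF W]] by force
qed

lemma shift_mem: "w \<in> W \<Longrightarrow> x * w \<in> A \<Longrightarrow> x * w \<in> shift n x W"
proof -
  assume w: "w \<in> W" "x * w \<in> A"
  have "x * w = x * w + 0" by simp
  then have "x * w \<in> {x * w + v | w v. w \<in> W \<and> v \<in> P}" using w(1) pmodule_zero[OF P_pmodule[of 0]] by blast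
  then show "x * w \<in> shift n x W" unfolding shift_def using w(2) by (rule sat_self)
qed

text \<open>\<open>x\<close> is a nonzerodivisor modulo the prime \<open>P\<close>, so
  multiplication by its powers is injective on A/P.\<close>

lemma shift_strict:
  assumes x: "x \<in> A" "x \<notin> P" and W: "W \<in> lat n" and V: "V \<in> lat n" and lt: "W \<subset> V"
  shows "shift n (x ^ k) W \<subset> shift n (x ^ k) V"
proof -
  have sub: "shift n (x ^ k) W \<subseteq> shift n (x ^ k) V" unfolding shift_def using lt by (intro sat_mono) blast
  obtain v where v: "v \<in> V" "v \<notin> W" using lt by blast
  have vA: "v \<in> A" using v(1) latD(1)[OF V] by blast
  have xv: "x ^ k * v \<in> A" using pow_mult_mem[OF x(1) vA] .
  have "x ^ k * v \<in> shift n (x ^ k) V" using shift_mem[OF v(1) xv] .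
  moreover have "x ^ k * v \<notin> shift n (x ^ k) W"
  proof
    assume "x ^ k * v \<in> shift n (x ^ k) W"
    then obtain s w u where s: "s \<in> A" "s \<notin> Q" "s ^ (p ^ n) * (x ^ k * v) = x ^ k * w + u" "w \<in> W" "u \<in> P"
      unfolding shift_def sat_def by blast
    have wA: "w \<in> A" using s(4) latD(1)[OF W] by blast
    have sv: "s ^ (p ^ n) * v \<in> A" using pow_mult_mem[OF s(1) vA] .
    have "x ^ k * (s ^ (p ^ n) * v - w) = u" using s(3) by (simp add: algebra_simps)
    then have "s ^ (p ^ n) * v - w \<in> P" using prime_in_pow[OF P x(1), of k] x(2) s(5) diff_mem[OF sv wA] by auto
    then have "(s ^ (p ^ n) * v - w) + w \<in> W" using pmodule_add[OF latD(2)[OF W] _ s(4)] latD(3)[OF W] by blast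
    then show False using latD(4)[OF W s(1,2) vA] v(2) by simp
  qed
  ultimately show ?thesis using sub by blast
qed

lemma length_ge_shift:
  "x \<in> A \<Longrightarrow> x \<notin> P \<Longrightarrow> length_ge (lat n) W V l \<Longrightarrow> length_ge (lat n) (shift n (x ^ k) W) (shift n (x ^ k) V) l"
  by (rule length_ge_map[where F = "shift n (x ^ k)"]) (use shift_lat shift_strict in blast)+

text \<open>In the chain of ideals generated by the powers of \<open>x\<close>, each quotient
  contains an image of the first under an injective multiplication, so the lengths add up.\<close>

lemma length_ge_powers:
  assumes x: "x \<in> A" "x \<notin> P" and l: "length_ge (lat 0) (shift 0 x A) A l"
  shows "length_ge (lat 0) (shift 0 (x ^ k) A) A (k * l)"
proof (induction k)
  case 0
  show ?case using length_ge_zero[OF shift_lat[OF A_lat] A_lat latD(1)[OF shift_lat[OF A_lat]]] by simp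
next
  case (Suc k)
  have "length_ge (lat 0) (shift 0 (x ^ k) (shift 0 x A)) (shift 0 (x ^ k) A) l"
    by (rule length_ge_shift[OF x l])
  then have 1: "length_ge (lat 0) (shift 0 (x ^ k) (shift 0 x A)) A (l + k * l)" using Suc length_ge_trans by blast
  have "shift 0 (x ^ Suc k) A \<subseteq> shift 0 (x ^ k) (shift 0 x A)"
    unfolding shift_def[of 0 "x ^ Suc k"]
  proof (rule sat_least[OF shift_lat[OF shift_lat[OF A_lat]]], rule subsetI)
    fix z assume "z \<in> {x ^ Suc k * w + v | w v. w \<in> A \<and> v \<in> P}"
    then obtain w v where z: "z = x ^ k * (x * w) + v" "w \<in> A" "v \<in> P" by (auto simp: mult.assoc mult.left_commute)
    have xw: "x * w \<in> A" using mult_mem[OF x(1) z(2)] .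
    have "x * w \<in> shift 0 x A" using shift_mem[OF z(2) xw] .
    then have "z \<in> {x ^ k * w + v | w v. w \<in> shift 0 x A \<and> v \<in> P}" using z by blast
    moreover have "z \<in> A" using z pow_mult_mem[OF x(1) xw] P_subset add_mem by blast
    ultimately show "z \<in> shift 0 (x ^ k) (shift 0 x A)" unfolding shift_def[of 0 "x ^ k"] by (rule sat_self)
  qed
  from length_ge_extend[OF 1 shift_lat[OF A_lat] A_lat this subset_refl] show ?case by simp
qed

text \<open>With \<open>U\<close> generically free of rank \<open>card G\<close> inside \<open>A\<close>, the two ways of computing the length of
  \<open>A / x ^ p U\<close> over the \<open>p\<close>-th powers give the inequality.\<close>

lemma degree_adjacent:
  assumes w: "w \<in> {..<s} \<rightarrow> A" "indep_mod A Q (p ^ 1) Q {..<s} w"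
    and H: "H \<subseteq> A" "finite H" "A \<subseteq> qspan A (p ^ 1) H"
    and G: "G \<subseteq> A" "finite G" and c: "c \<in> A" "c \<notin> P" "\<And>v. v \<in> A \<Longrightarrow> c ^ (p ^ 1) * v \<in> qspan A (p ^ 1) (P \<union> G)"
  shows "p * s \<le> card G"
proof -
  obtain x where x: "x \<in> Q" "x \<notin> P" using PQ by blast
  have xA: "x \<in> A" using x(1) ideal_in_subset[OF prime_in_ideal[OF Q]] by blast
  have X: "shift 0 z A \<in> lat 0" for z by (rule shift_lat[OF A_lat])
  have zX: "z \<in> shift 0 z A" if "z \<in> A" for z
  proof -
    show ?thesis using shift_mem[OF one_mem, of z 0] mult_one[OF that] that by simp
  qed
  have XQ: "shift 0 x A \<subseteq> Q"
    unfolding shift_def using x(1) PQ ideal_in_mult2[OF prime_in_ideal[OF Q] _ x(1)] ideal_in_add[OF prime_in_ideal[OF Q]]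
    by (intro sat_least[OF Q_lat]) blast
  obtain l0 where "length_le (lat 0) (shift 0 x A) A l0" using finite_length[OF X zX[OF xA] x(2)] by blast
  \<comment> \<open>\<open>l\<close> is the exact length: it enters the upper estimate as a bound
    and the lower one through an actual chain.\<close>
  then obtain l where l: "strict_chain (lat 0) (shift 0 x A) A l" "length_le (lat 0) (shift 0 x A) A l"
    using length_le_attained[OF _ X A_lat latD(1)[OF X]] by blast
  have "shift 0 x A \<subset> A" using XQ latD(1)[OF Q_lat] e_Q one_mem by blast
  then have "1 \<le> l" using l(2) strict_chain_one[OF X A_lat] unfolding length_le_def by blast
  \<comment> \<open>\<open>U\<close> is the saturated span of \<open>G\<close>. Since
    \<open>c\<close> carries \<open>A\<close> into it, A/U has a finite length \<open>M\<close>,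
    which occurs on both sides of the final estimate and cancels.\<close>
  define U where "U = sat 1 (qspan A (p ^ 1) (P \<union> G))"
  have PG: "P \<union> G \<subseteq> qspan A (p ^ 1) (P \<union> G)" using P_subset G(1) one_mult by (blast intro!: qspan_base)
  have PGA: "qspan A (p ^ 1) (P \<union> G) \<subseteq> A" using P_subset G(1) by (intro qspan_subset_pmodule[OF pmodule_self]) auto
  have U: "U \<in> lat 1" unfolding U_def using PG by (intro sat_lat[OF qspan_pmodule']) auto
  have PGU: "qspan A (p ^ 1) (P \<union> G) \<subseteq> U" unfolding U_def by (rule sat_superset[OF PGA])
  have UA: "U \<subseteq> A" using latD(1)[OF U] .
  define Y where "Y = shift 1 (x ^ p) U"
  have Y: "Y \<in> lat 1" unfolding Y_def by (rule shift_lat[OF U])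
  have sh: "y \<in> shift 1 (z ^ p) V" if "y \<in> A" "t \<in> A" "t \<notin> Q" "t ^ (p ^ 1) * y = z ^ p * w + v" "w \<in> V" "v \<in> P" for y z V t w v
    using that unfolding shift_def sat_def by blast
  \<comment> \<open>Over p-th powers \<open>z\<close> acts as \<open>z ^ p\<close>. A module
    generated by \<open>T\<close> modulo \<open>W\<close> and killed by \<open>z\<close> is locally
    a quotient of \<open>card T\<close> copies of A/zA.\<close>
  have bound: "length_le (lat 0) (shift 0 z A) A k \<Longrightarrow> finite T \<Longrightarrow> T \<subseteq> A \<Longrightarrow> (\<And>y b. y \<in> T \<Longrightarrow> b \<in> A \<Longrightarrow> z ^ (p ^ 1) * (b ^ (p ^ 1) * y) \<in> W)
      \<Longrightarrow> W \<in> lat 1 \<Longrightarrow> z \<in> A \<Longrightarrow> V \<in> lat 1 \<Longrightarrow> V \<subseteq> sat 1 (qspan A (p ^ 1) (W \<union> T)) \<Longrightarrow> length_le (lat 1) W V (card T * k)"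
    for z k T W V
  proof -
    assume k: "length_le (lat 0) (shift 0 z A) A k" and T: "finite T" "T \<subseteq> A" and W: "W \<in> lat 1" and z: "z \<in> A"
      and TW: "\<And>y b. y \<in> T \<Longrightarrow> b \<in> A \<Longrightarrow> z ^ (p ^ 1) * (b ^ (p ^ 1) * y) \<in> W" and V: "V \<in> lat 1" "V \<subseteq> sat 1 (qspan A (p ^ 1) (W \<union> T))"
    have "length_le (lat 1) W (sat 1 (qspan A (p ^ 1) (W \<union> T))) (card T * k)"
    proof (rule length_le_generated[OF W X k T])
      fix a y assume a: "a \<in> shift 0 z A" and y: "y \<in> T"
      have aA: "a \<in> A" using a latD(1)[OF X] by blast
      obtain t b v where t: "t \<in> A" "t \<notin> Q" "t * a = z * b + v" "b \<in> A" "v \<in> P" using a unfolding shift_def sat_def by auto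
      have yA: "y \<in> A" using y T(2) by blast
      have vA: "v \<in> A" using t(5) P_subset by blast
      have "t ^ (p ^ 1) * (a ^ (p ^ 1) * y) = (t * a) ^ (p ^ 1) * y" by (simp add: power_mult_distrib mult.assoc)
      also have "\<dots> = z ^ (p ^ 1) * (b ^ (p ^ 1) * y) + v ^ (p ^ 1) * y"
        unfolding t(3) add_pow[OF mult_mem[OF z t(4)] vA] by (simp add: power_mult_distrib distrib_right mult.assoc)
      also have "\<dots> \<in> W" using TW[OF y t(4)] P_pow_mult[OF t(5) yA, of 1] latD(3)[OF W] pmodule_add[OF latD(2)[OF W]] by blast
      finally show "a ^ p ^ 1 * y \<in> W" using latD(4)[OF W t(1,2) pow_mult_mem[OF aA yA]] by blast
    qed
    moreover have "sat 1 (qspan A (p ^ 1) (W \<union> T)) \<in> lat 1"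
      using latD(1,3)[OF W] T(2) one_mult by (intro sat_lat[OF qspan_pmodule']) (blast intro!: qspan_base)
    ultimately show "length_le (lat 1) W V (card T * k)" using V(2) length_le_mono[OF _ W] by blast
  qed
  obtain k where k: "length_le (lat 0) (shift 0 c A) A k" using finite_length[OF X zX[OF c(1)] c(2)] by blast
  have "length_le (lat 1) U A (card H * k)"
  proof (rule bound[OF k H(2,1) _ U c(1) A_lat])
    show "c ^ p ^ 1 * (b ^ p ^ 1 * y) \<in> U" if "y \<in> H" "b \<in> A" for y b
      using c(3)[OF pow_mult_mem[OF that(2)]] that(1) H(1) PGU by blast
    have "A \<subseteq> qspan A (p ^ 1) (U \<union> H)" using H(3) qspan_mono[of A A H "U \<union> H" "p ^ 1"] by blast
    then show "A \<subseteq> sat 1 (qspan A (p ^ 1) (U \<union> H))" using sat_superset[of "qspan A (p ^ 1) (U \<union> H)" 1]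
        qspan_subset_pmodule[OF pmodule_self, of "U \<union> H" 1] UA H(1) by blast
  qed
  then obtain M where M: "strict_chain (lat 1) U A M" "length_le (lat 1) U A M"
    using length_le_attained[OF _ U A_lat UA] by blast
  have YU: "Y \<subseteq> U"
    unfolding Y_def shift_def using latD(3)[OF U] pmodule_smult[OF latD(2)[OF U] xA] pmodule_add[OF latD(2)[OF U]]
    by (intro sat_least[OF U]) (simp, blast)
  have "length_le (lat 1) Y U (card G * l)"
  proof (rule bound[OF l(2) G(2,1) _ Y xA U])
    show "x ^ p ^ 1 * (b ^ p ^ 1 * y) \<in> Y" if "y \<in> G" "b \<in> A" for y b
    proof -
      have "b ^ p ^ 1 * y \<in> U" using pmodule_smult[OF latD(2)[OF U] that(2)] that(1) PG PGU by blast
      moreover have "x ^ p ^ 1 * (b ^ p ^ 1 * y) \<in> A" using pow_mult_mem[OF xA] calculation UA by blast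
      ultimately show ?thesis unfolding Y_def
        by (intro sh[OF _ one_mem e_Q, of _ x "b ^ p ^ 1 * y" 0]) (use one_pow_q[of 1] one_mult pmodule_zero[OF P_pmodule[of 0]] in auto)
    qed
    show "U \<subseteq> sat 1 (qspan A (p ^ 1) (Y \<union> G))"
      unfolding U_def using latD(3)[OF Y] by (intro sat_mono qspan_mono) auto
  qed
  from lat_length_add[OF this M(2) Y U A_lat YU UA] have upper: "length_le (lat 1) Y A (card G * l + M)" .
  \<comment> \<open>The same interval is now measured through x^p A. Its lower part is an image of
    A/U and has length at least \<open>M\<close>; its upper part consists of at least
    \<open>p * l\<close> steps of ideals, each of which refines into \<open>s\<close> steps over
    p-th powers.\<close>
  have "length_ge (lat 1) U A M" using M(1) unfolding length_ge_def by blast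
  from length_ge_shift[OF xA x(2) this] have low1: "length_ge (lat 1) Y (shift 1 (x ^ p) A) M" unfolding Y_def .
  have "length_ge (lat 0) (shift 0 x A) A l" using l(1) unfolding length_ge_def by blast
  then obtain j where j: "p * l \<le> j" "strict_chain (lat 0) (shift 0 (x ^ p) A) A j"
    using length_ge_powers[OF xA x(2), of l p] unfolding length_ge_def by blast
  have xp: "x ^ p \<in> A" "x ^ p \<notin> P" using pow_mem_q[OF xA, of 1] prime_in_pow1[OF P xA, of p] x(2) q_pos[of 1] by auto
  have "length_ge (lat 1) (shift 0 (x ^ p) A) A (j * s)"
  proof (rule length_ge_refine[OF j(2) _ lat_0_lat[OF X]])
    show "length_ge (lat 1) I I' s" if "I \<in> lat 0" "I' \<in> lat 0" "shift 0 (x ^ p) A \<subseteq> I" "I \<subset> I'" for I I'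
      using length_ge_step[OF w that(1,2,4) _ xp(2)] zX[OF xp(1)] that(3) by blast
  qed
  moreover have "shift 1 (x ^ p) A \<subseteq> shift 0 (x ^ p) A"
    unfolding shift_def[of 1]
  proof (rule sat_least[OF lat_0_lat[OF X]])
    have "{x ^ p * w + v | w v. w \<in> A \<and> v \<in> P} \<subseteq> A" using pow_mult_mem[OF xA] P_subset add_mem by blast
    then show "{x ^ p * w + v | w v. w \<in> A \<and> v \<in> P} \<subseteq> shift 0 (x ^ p) A"
      unfolding shift_def by (rule sat_superset)
  qed
  ultimately have "length_ge (lat 1) (shift 1 (x ^ p) A) A (j * s)"
    using length_ge_extend[OF _ shift_lat[OF A_lat] A_lat] by blast
  from length_ge_le[OF length_ge_trans[OF low1 this] upper] have "j * s \<le> card G * l" by simp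
  moreover have "(p * l) * s \<le> j * s" using j(1) by simp
  moreover have "(p * s) * l = (p * l) * s" by (simp add: mult_ac)
  ultimately have "(p * s) * l \<le> card G * l" by linarith
  then show ?thesis using \<open>1 \<le> l\<close> by simp
qed

end

section \<open>The generic rank from a maximal chain of primes\<close>

context F_finite_local_domain begin

text \<open>A chain whose length attains the bound for the dimension can neither be prolonged at an
  end nor refined, so its consecutive members are adjacent primes.\<close>

lemma prime_chain_saturated:
  assumes c: "prime_chain A {0} P d"
  shows "P 0 = {0}" "P d = m" "i < d \<Longrightarrow> prime_in A M \<Longrightarrow> P i \<subset> M \<Longrightarrow> M \<subseteq> P (Suc i) \<Longrightarrow> M = P (Suc i)"
proof -
  have Pp: "prime_in A (P i)" if "i \<le> d" for i using c that unfolding prime_chain_def by blast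
  have Pz: "{0} \<subseteq> P i" if "i \<le> d" for i using c that unfolding prime_chain_def by blast
  have Ps: "P i \<subset> P (Suc i)" if "i < d" for i using c that unfolding prime_chain_def by blast
  have no: False if "prime_chain A {0} P' (Suc d)" for P'
    using dim that unfolding dim_le_def by fastforce
  show "P 0 = {0}"
  proof (rule ccontr)
    assume "P 0 \<noteq> {0}"
    then have "{0} \<subset> P 0" using Pz[of 0] by blast
    from prime_chain_Cons[OF c zero_prime subset_refl this subset_refl] show False by (rule no)
  qed
  show "P d = m"
  proof (rule ccontr)
    assume ne: "P d \<noteq> m"
    have "P d \<subset> m" using loc_prime_subset[OF loc Pp[OF le_refl]] ne by blast
    then have "prime_chain A {0} (\<lambda>i. if i \<le> d then P i else m) (Suc d)"
      using Pp Pz Ps m_prime ideal_in_zero[OF m_ideal] unfolding prime_chain_def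
      by (auto simp: less_Suc_eq le_Suc_eq)
    then show False by (rule no)
  qed
  assume i: "i < d" and M: "prime_in A M" "P i \<subset> M" "M \<subseteq> P (Suc i)"
  show "M = P (Suc i)"
  proof (rule ccontr)
    assume ne: "M \<noteq> P (Suc i)"
    let ?P = "\<lambda>j. if j \<le> i then P j else if j = Suc i then M else P (j - 1)"
    have "prime_chain A {0} ?P (Suc d)"
      unfolding prime_chain_def
    proof (intro conjI allI impI)
      show "prime_in A (?P j)" if "j \<le> Suc d" for j using Pp[of j] Pp[of "j - 1"] M(1) that i by auto
      show "{0} \<subseteq> ?P j" if "j \<le> Suc d" for j
        using Pz[of j] Pz[of "j - 1"] ideal_in_zero[OF prime_in_ideal[OF M(1)]] that i by auto
      show "?P j \<subset> ?P (Suc j)" if "j < Suc d" for j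
      proof -
        consider "j < i" | "j = i" | "j = Suc i" | "Suc i < j" by linarith
        then show ?thesis
        proof cases
          case 4
          then have "j - 1 < d" "Suc (j - 1) = j" using that by auto
          then show ?thesis using Ps[of "j - 1"] 4 by auto
        qed (use Ps[of j] M(2,3) ne i in auto)
      qed
    qed
    then show False by (rule no)
  qed
qed

text \<open>One half of Kunz's formula for the degree of the fraction field over its \<open>p\<close>-th powers.\<close>

lemma generic_rank_ge:
  assumes c: "prime_chain A {0} P d" and W: "residue_basis A m p W"
  shows "\<exists>G\<subseteq>A. finite G \<and> indep_mod A {0} p {0} G (\<lambda>x. x) \<and> p ^ d * card W \<le> card G"
proof -
  have Pp: "prime_in A (P i)" if "i \<le> d" for i using c that unfolding prime_chain_def by blast
  have Ps: "P i \<subset> P (Suc i)" if "i < d" for i using c that unfolding prime_chain_def by blast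
  obtain H where H: "H \<subseteq> A" "finite H" "A \<subseteq> qspan A (p ^ 1) H" using ffinite by auto
  \<comment> \<open>Downwards from \<open>m\<close>, where the degree is \<open>card W\<close>, to
    {0}: each of the \<open>d\<close> steps multiplies the degree over p-th powers by at least
    \<open>p\<close>.\<close>
  have "\<exists>G\<subseteq>A. finite G \<and> indep_mod A (P (d - i)) p (P (d - i)) G (\<lambda>x. x) \<and> p ^ i * card W \<le> card G"
    if "i \<le> d" for i
    using that
  proof (induction i)
    case 0
    show ?case using W prime_chain_saturated(2)[OF c] unfolding residue_basis_def by auto
  next
    case (Suc i)
    then obtain G' where G': "G' \<subseteq> A" "finite G'" "indep_mod A (P (d - i)) p (P (d - i)) G' (\<lambda>x. x)" "p ^ i * card W \<le> card G'"
      by auto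
    define j where "j = d - Suc i"
    have j: "j < d" "d - i = Suc j" "d - Suc i = j" using Suc.prems by (auto simp: j_def)
    interpret adjacent_primes A e p "P j" "P (Suc j)"
      by unfold_locales (use noeth Pp[of j] Pp[of "Suc j"] Ps[of j] j(1) prime_chain_saturated(3)[OF c j(1)] in auto)
    obtain f where f: "bij_betw f {..<card G'} G'" using ex_bij_betw_nat_finite[OF G'(2)] by (auto simp: atLeast0LessThan)
    have w: "indep_mod A (P (Suc j)) (p ^ 1) (P (Suc j)) {..<card G'} ((\<lambda>x. x) \<circ> f)"
      using indep_mod_reindex[OF f, of A "P (Suc j)" p "P (Suc j)" "\<lambda>x. x"] G'(3) j(2) by simp
    have wA: "(\<lambda>x. x) \<circ> f \<in> {..<card G'} \<rightarrow> A" using f G'(1) by (auto simp: bij_betw_def)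
    have HE: "e * x = x" if "x \<in> H" for x using H(1) that one_mult by blast
    have PE: "e * x = x" if "x \<in> P j" for x using P_subset that one_mult by blast
    have PH: "a ^ (p ^ 1) * x \<in> P j" if "a \<in> P j" "x \<in> H" for a x using P_pow_mult that H(1) by blast
    obtain G b where G: "G \<subseteq> H" "indep_mod A (P j) (p ^ 1) (P j) G (\<lambda>x. x)" "b \<in> A" "b \<notin> P j"
      "\<And>v. v \<in> qspan A (p ^ 1) (P j \<union> H) \<Longrightarrow> b ^ (p ^ 1) * v \<in> qspan A (p ^ 1) (P j \<union> G)"
      using maximal_indep[OF P P_pmodule H(2) HE PE PH] by blast
    have "b ^ (p ^ 1) * v \<in> qspan A (p ^ 1) (P j \<union> G)" if "v \<in> A" for v
      using G(5) H(3) that qspan_mono[of A A H "P j \<union> H" "p ^ 1"] by blast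
    from degree_adjacent[OF wA w H _ _ G(3,4) this]
    have "p * card G' \<le> card G" using G(1) H(1,2) finite_subset by blast
    moreover have "p ^ Suc i * card W = p * (p ^ i * card W)" by simp
    ultimately have "p ^ Suc i * card W \<le> card G" using mult_le_mono2[OF G'(4), of p] by linarith
    then show ?case using G(1,2) H(1,2) finite_subset[OF G(1)] j(3) by (intro exI[of _ G]) auto
  qed
  from this[of d] show ?thesis using prime_chain_saturated(1)[OF c] by simp
qed

end

section \<open>Comparison of the two signatures\<close>

context local_extension begin

context
  fixes W U c f W'
  assumes W: "residue_basis A m p W" and W': "residue_basis B l p W'"
    and U: "finite U" "U \<subseteq> B" "indep_mod A {0} (p ^ 0) {0} U (\<lambda>x. x)"
    and c: "c \<in> A" "c \<noteq> 0" "\<And>b. b \<in> B \<Longrightarrow> c * b \<in> qspan A (p ^ 0) U"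
    and f: "splits A e (p ^ 0) B f" "generated_mod A (p ^ 0) B (nonsplit A m (p ^ 0) B) f"
begin

abbreviation "sigA \<equiv> lim (\<lambda>n. real (free_rank A e (p ^ n) A) / real (p ^ d * card W) ^ n)"
abbreviation "sigB \<equiv> lim (\<lambda>n. real (free_rank B e (p ^ n) B) / real (p ^ d * card W') ^ n)"

lemma sigA_limit: "(\<lambda>n. real (free_rank A e (p ^ n) A) / real (p ^ d * card W) ^ n) \<longlonglongrightarrow> sigA"
  using R.convergent_free_rank[OF W] convergent_LIMSEQ_iff by blast

lemma sigB_limit: "(\<lambda>n. real (free_rank B e (p ^ n) B) / real (p ^ d * card W) ^ n) \<longlonglongrightarrow> sigB"
  unfolding residue_basis_card[OF W W'] using S.convergent_free_rank[OF W'] convergent_LIMSEQ_iff by blast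

lemma limit_scale:
  fixes x :: "nat \<Rightarrow> nat" and X b :: real
  shows "(\<lambda>n. real (x n) / b ^ n) \<longlonglongrightarrow> X \<Longrightarrow> (\<lambda>n. real (k * x n) / b ^ n) \<longlonglongrightarrow> real k * X"
  using tendsto_mult_left[of "\<lambda>n. real (x n) / b ^ n" X sequentially "real k"] by simp

lemma limit_le:
  fixes x y err :: "nat \<Rightarrow> nat" and k :: nat and X Y :: real
  assumes x: "(\<lambda>n. real (x n) / real (p ^ d * card W) ^ n) \<longlonglongrightarrow> X"
    and y: "(\<lambda>n. real (y n) / real (p ^ d * card W) ^ n) \<longlonglongrightarrow> Y"
    and err: "\<And>n. err n * p ^ n \<le> k * (p ^ d * card W) ^ n" and le: "\<And>n. x n \<le> y n + err n"
  shows "X \<le> Y"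
proof -
  let ?B = "p ^ d * card W"
  have "(\<lambda>n. real (err n) / real ?B ^ n) \<longlonglongrightarrow> 0"
    using tendsto_error[OF err R.growth_pos[OF W]] R.prime_p prime_ge_2_nat by blast
  from tendsto_add[OF y this] have "(\<lambda>n. real (y n) / real ?B ^ n + real (err n) / real ?B ^ n) \<longlonglongrightarrow> Y" by simp
  moreover have "real (x n) / real ?B ^ n \<le> real (y n) / real ?B ^ n + real (err n) / real ?B ^ n" for n
    using of_nat_mono[OF le[of n]] unfolding add_divide_distrib[symmetric] by (intro divide_right_mono) auto
  ultimately show ?thesis using x by (intro LIMSEQ_le) auto
qed

lemma signature_le: "real f * sigB \<le> real (card U) * sigA"
proof -
  obtain k err where err: "\<And>n. err n * p ^ n \<le> k * (p ^ d * card W) ^ n"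
    "\<And>n. f * free_rank B e (p ^ n) B \<le> card U * free_rank A e (p ^ n) A + err n"
    using free_rank_extension_upper[OF W U c f] by blast
  show ?thesis by (rule limit_le[OF limit_scale[OF sigB_limit] limit_scale[OF sigA_limit] err])
qed

lemma U_card_pos: "0 < card U"
proof (rule ccontr)
  assume "\<not> 0 < card U"
  then have "U = {}" using U(1) by simp
  then have "c * e \<in> qspan A (p ^ 0) {}" using c(3)[OF S.one_mem] by simp
  moreover have "qspan A (p ^ 0) {} \<subseteq> {0}" by (rule qspan_subset) auto
  ultimately show False using R.mult_one[OF c(1)] c(2) by auto
qed

text \<open>The generators coming from the parameters are as many as the generic rank, so F^n_* B is
  free and its normalized rank is 1 for every n. The lower comparison then applies with this rank as
  \<open>N n\<close> and reverses the inequality.\<close>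

lemma signature_regular:
  assumes P: "prime_chain B {0} P d" and xs: "length xs = d" "set xs \<subseteq> l" "adjoin_list B {0} xs = l"
  shows "sigB = 1" "real f = real (card U) * sigA"
proof -
  let ?B = "p ^ d * card W"
  have W_eq: "card W' = card W" using residue_basis_card[OF W W'] by simp
  have B0: "0 < ?B" by (rule R.growth_pos[OF W])
  have "adjoin B l e = B"
    using S.adjoin_self[OF S.m_ideal S.one_mem] S.adjoin_ideal[OF S.m_ideal S.one_mem] S.ideal_in_whole by blast
  \<comment> \<open>Since the parameters generate \<open>l\<close>, adjoining \<open>e\<close>
    reaches \<open>B\<close> in a single step, so \<open>k = 1\<close>.\<close>
  then have fil: "filtered B l (adjoin_list B {0} xs) (Suc 0) B"
    unfolding xs(3) using ideal_in_mult2[OF S.m_ideal S.one_mem]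
    by (intro filtered_step[OF S.one_mem]) (auto intro: filtered_refl)
  have Z: "\<exists>Z\<subseteq>B. finite Z \<and> card Z \<le> ?B ^ n \<and> B \<subseteq> qspan B (p ^ n) Z" for n
  proof -
    have "(p ^ n) ^ length xs * Suc 0 * card W' ^ n = ?B ^ n"
      by (simp add: xs(1) W_eq power_mult_distrib mult.commute flip: power_mult)
    then show ?thesis using S.regular_generators[OF W' xs(2) fil, of n] by metis
  qed
  obtain G where G: "G \<subseteq> B" "finite G" "indep_mod B {0} p {0} G (\<lambda>x. x)" "?B \<le> card G"
    using S.generic_rank_ge[OF P W'] W_eq by auto
  have "card G \<le> ?B" using S.generic_rank_le[OF W' G(2,1,3)] W_eq by simp
  then have cG: "card G = ?B" using G(4) by simp
  have fr: "free_rank B e (p ^ n) B = ?B ^ n" for n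
  proof -
    obtain Y where Y: "Y \<subseteq> B" "finite Y" "card Y \<le> ?B ^ n" "B \<subseteq> qspan B (p ^ n) Y" using Z by blast
    obtain v where v: "v \<in> {..<?B ^ n} \<rightarrow> B" "indep_mod B {0} (p ^ n) {0} {..<?B ^ n} v"
      using S.indep_mod_power[OF G(2,1,3) S.zero_prime, of n] unfolding cG by blast
    have "?B ^ n \<le> free_rank B e (p ^ n) B" by (rule S.splits_le_self[OF S.splits_basis[OF Y v]])
    moreover have "generated_mod B (p ^ n) B (nonsplit B l (p ^ n) B) (?B ^ n)"
      using Y qspan_mono[of B B Y "nonsplit B l (p ^ n) B \<union> Y" "p ^ n"] unfolding generated_mod_def by blast
    then have "free_rank B e (p ^ n) B \<le> ?B ^ n" by (rule S.free_rank_le_self)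
    ultimately show ?thesis by simp
  qed
  have one: "(\<lambda>n. real (?B ^ n) / real ?B ^ n) \<longlonglongrightarrow> 1"
  proof -
    have "real (?B ^ n) / real ?B ^ n = 1" for n
      unfolding of_nat_power using B0 by (intro divide_self) (metis less_numeral_extra(3) of_nat_eq_0_iff power_not_zero)
    then show ?thesis by simp
  qed
  have "(\<lambda>n. real (free_rank B e (p ^ n) B) / real ?B ^ n) \<longlonglongrightarrow> 1" using one unfolding fr .
  then show s1: "sigB = 1" using sigB_limit LIMSEQ_unique by blast
  obtain k err where err: "\<And>n. err n * p ^ n \<le> k * ?B ^ n"
    "\<And>n. card U * free_rank A e (p ^ n) A \<le> f * ?B ^ n + err n"
    using free_rank_extension_lower[OF W U c f Z] by blast
  have "real (card U) * sigA \<le> real f * 1"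
    by (rule limit_le[OF limit_scale[OF sigA_limit] limit_scale[OF one] err])
  then show "real f = real (card U) * sigA" using signature_le s1 by simp
qed

end

end

section \<open>Embedding rings into a type of class \<open>comm_ring_1\<close>\<close>

text \<open>The product of all commutative rings carried by subsets of a type contains each of them, with a
  different unit. The factor \<^typ>\<open>int\<close> only keeps the product nontrivial. This transports ring-theoretic
  statements about carrier sets to a type class, where sums and powers need no closure conditions.\<close>

typedef 'a uring = "{zF :: int \<times> ('a ring \<Rightarrow> 'a).
    \<forall>A. if cring A then snd zF A \<in> carrier A else snd zF A = undefined}"
  by (intro exI[of _ "(0, \<lambda>A. if cring A then \<zero>\<^bsub>A\<^esub> else undefined)"])
    (auto simp: cring.cring_simprules)

setup_lifting type_definition_uring

instantiation uring :: (type) comm_ring_1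
begin

lift_definition zero_uring :: "'a uring" is "(0, \<lambda>A. if cring A then \<zero>\<^bsub>A\<^esub> else undefined)"
  by (auto simp: cring.cring_simprules)

lift_definition one_uring :: "'a uring" is "(1, \<lambda>A. if cring A then \<one>\<^bsub>A\<^esub> else undefined)"
  by (auto simp: cring.cring_simprules)

lift_definition plus_uring :: "'a uring \<Rightarrow> 'a uring \<Rightarrow> 'a uring" is
  "\<lambda>x y. (fst x + fst y, \<lambda>A. if cring A then snd x A \<oplus>\<^bsub>A\<^esub> snd y A else undefined)"
  by (auto simp: cring.cring_simprules)

lift_definition times_uring :: "'a uring \<Rightarrow> 'a uring \<Rightarrow> 'a uring" is
  "\<lambda>x y. (fst x * fst y, \<lambda>A. if cring A then snd x A \<otimes>\<^bsub>A\<^esub> snd y A else undefined)"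
  by (auto simp: cring.cring_simprules)

lift_definition uminus_uring :: "'a uring \<Rightarrow> 'a uring" is
  "\<lambda>x. (- fst x, \<lambda>A. if cring A then \<ominus>\<^bsub>A\<^esub> snd x A else undefined)"
  by (auto simp: cring.cring_simprules)

lift_definition minus_uring :: "'a uring \<Rightarrow> 'a uring \<Rightarrow> 'a uring" is
  "\<lambda>x y. (fst x - fst y, \<lambda>A. if cring A then snd x A \<oplus>\<^bsub>A\<^esub> (\<ominus>\<^bsub>A\<^esub> snd y A) else undefined)"
  by (auto simp: cring.cring_simprules)

instance
proof
  fix a b c :: "'a uring"
  show "a + b + c = a + (b + c)" by transfer (auto simp: cring.cring_simprules fun_eq_iff)
  show "a + b = b + a" by transfer (auto simp: cring.cring_simprules fun_eq_iff)
  show "0 + a = a" by transfer (auto simp: cring.cring_simprules fun_eq_iff prod_eq_iff)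
  show "- a + a = 0" by transfer (auto simp: cring.cring_simprules fun_eq_iff)
  show "a - b = a + - b" by transfer (auto simp: cring.cring_simprules fun_eq_iff)
  show "a * b * c = a * (b * c)" by transfer (auto simp: cring.cring_simprules fun_eq_iff)
  show "a * b = b * a" by transfer (auto simp: cring.cring_simprules fun_eq_iff)
  show "1 * a = a" by transfer (auto simp: cring.cring_simprules fun_eq_iff prod_eq_iff)
  show "(a + b) * c = a * c + b * c" by transfer (auto simp: cring.cring_simprules fun_eq_iff algebra_simps)
  show "(0::'a uring) \<noteq> 1" by transfer auto
qed

end

text \<open>Only the coordinate at \<open>L\<close> carries \<open>x\<close>; the others and the
  integer are zero. The map respects sums and products, but its value at the unit of
  \<open>L\<close> is an idempotent other than \<open>1\<close>.\<close>

lift_definition uring_emb :: "'a ring \<Rightarrow> 'a \<Rightarrow> 'a uring" is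
  "\<lambda>L x. (0, \<lambda>A. if cring A then if A = L \<and> x \<in> carrier L then x else \<zero>\<^bsub>A\<^esub> else undefined)"
  by (auto simp: cring.cring_simprules)

lemma uring_emb_add:
  "cring L \<Longrightarrow> x \<in> carrier L \<Longrightarrow> y \<in> carrier L \<Longrightarrow> uring_emb L (x \<oplus>\<^bsub>L\<^esub> y) = uring_emb L x + uring_emb L y"
  by transfer (auto simp: cring.cring_simprules fun_eq_iff)

lemma uring_emb_mult:
  "cring L \<Longrightarrow> x \<in> carrier L \<Longrightarrow> y \<in> carrier L \<Longrightarrow> uring_emb L (x \<otimes>\<^bsub>L\<^esub> y) = uring_emb L x * uring_emb L y"
  by transfer (auto simp: cring.cring_simprules fun_eq_iff)

lemma uring_emb_inj: "cring L \<Longrightarrow> inj_on (uring_emb L) (carrier L)"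
proof (rule inj_onI)
  fix x y assume L: "cring L" and "x \<in> carrier L" "y \<in> carrier L" "uring_emb L x = uring_emb L y"
  moreover have "snd (Rep_uring (uring_emb L z)) L = z" if "z \<in> carrier L" for z
    using L that by (simp add: uring_emb.rep_eq)
  ultimately show "x = y" by metis
qed

locale ring_embedding = L?: field L for L :: "('a, 'b) ring_scheme" (structure) +
  fixes j :: "'a \<Rightarrow> 'u::comm_ring_1"
  assumes j_inj: "inj_on j (carrier L)"
    and j_add: "x \<in> carrier L \<Longrightarrow> y \<in> carrier L \<Longrightarrow> j (x \<oplus> y) = j x + j y"
    and j_mult: "x \<in> carrier L \<Longrightarrow> y \<in> carrier L \<Longrightarrow> j (x \<otimes> y) = j x * j y"

lemma ring_embedding_exists:
  fixes L :: "('a, 'b) ring_scheme"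
  assumes "field L"
  shows "\<exists>j :: 'a \<Rightarrow> 'a uring. ring_embedding L j"
proof -
  interpret L: field L by (rule assms)
  \<comment> \<open>The product ranges over ring records without extra fields, so \<open>L\<close>
    is replaced by its truncation with the same operations.\<close>
  define L0 :: "'a ring" where
    "L0 = \<lparr>carrier = carrier L, monoid.mult = monoid.mult L, one = one L, zero = zero L, add = add L\<rparr>"
  have s: "carrier L0 = carrier L" "mult L0 = mult L" "one L0 = one L" "zero L0 = zero L" "add L0 = add L"
    by (simp_all add: L0_def)
  have "cring L0"
  proof (rule cringI)
    show "abelian_group L0"
      by (rule abelian_groupI) (auto simp: s L.a_ac intro: bexI[of _ "\<ominus>\<^bsub>L\<^esub> _"] L.l_neg)
    show "comm_monoid L0"
      by (rule comm_monoidI) (auto simp: s L.m_ac)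
  qed (auto simp: s L.l_distr)
  then have "ring_embedding L (uring_emb L0)"
    using uring_emb_inj[of L0] uring_emb_add[of L0] uring_emb_mult[of L0] unfolding s
    by (intro ring_embedding.intro ring_embedding_axioms.intro assms) auto
  then show ?thesis by blast
qed

section \<open>Images of subrings, ideals and primes under the embedding\<close>

context ring_embedding begin

lemma j_zero [simp]: "j \<zero> = 0"
  using j_add[of \<zero> \<zero>] by simp

lemma j_uminus: "x \<in> carrier L \<Longrightarrow> j (\<ominus> x) = - j x"
  using j_add[of x "\<ominus> x"] by (simp add: L.r_neg eq_neg_iff_add_eq_0 add.commute)

lemma j_eq_iff: "x \<in> carrier L \<Longrightarrow> y \<in> carrier L \<Longrightarrow> j x = j y \<longleftrightarrow> x = y"
  using j_inj by (auto dest: inj_onD)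

lemma j_eq_0_iff: "x \<in> carrier L \<Longrightarrow> j x = 0 \<longleftrightarrow> x = \<zero>"
  using j_eq_iff[of x \<zero>] by simp

lemma j_unit: "x \<in> carrier L \<Longrightarrow> j \<one> * j x = j x"
  using j_mult[of \<one> x] by simp

lemma j_image_iff: "x \<in> carrier L \<Longrightarrow> X \<subseteq> carrier L \<Longrightarrow> j x \<in> j ` X \<longleftrightarrow> x \<in> X"
  using j_eq_iff by blast

lemma j_image_subset: "X \<subseteq> carrier L \<Longrightarrow> Y \<subseteq> carrier L \<Longrightarrow> j ` X \<subseteq> j ` Y \<longleftrightarrow> X \<subseteq> Y"
  using j_eq_iff by blast

text \<open>The zeroth power in \<open>L\<close> is the unit of \<open>L\<close>, whose image need
  not be \<open>1\<close>.\<close>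

lemma j_pow: "x \<in> carrier L \<Longrightarrow> j (x [^] n) = (if n = 0 then j \<one> else j x ^ n)"
proof (induction n)
  case (Suc n)
  then show ?case using j_mult[of "x [^] n" x] j_unit[of x] by (auto simp: mult.commute)
qed simp

end

locale embedded_subring = ring_embedding L j for L :: "('a, 'b) ring_scheme" (structure) and j :: "'a \<Rightarrow> 'u::comm_ring_1" +
  fixes R :: "'a set"
  assumes subring: "subring R L"
begin

abbreviation "LR \<equiv> L\<lparr>carrier := R\<rparr>"

lemma R_subset: "R \<subseteq> carrier L"
  using subringE(1)[OF subring] .

lemma R_carrier: "x \<in> R \<Longrightarrow> x \<in> carrier L"
  using R_subset by blast

lemma cring_R: "cring LR"
  using L.subcring_iff[OF R_subset] L.subcringI'[OF subring] by simp

sublocale R: cring LR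
  by (rule cring_R)

lemma uminus_R: "x \<in> R \<Longrightarrow> \<ominus>\<^bsub>LR\<^esub> x = \<ominus> x"
proof -
  assume x: "x \<in> R"
  have "x \<oplus> \<ominus>\<^bsub>LR\<^esub> x = \<zero>" using R.r_neg[of x] x by simp
  then show ?thesis using L.minus_equality[of "\<ominus>\<^bsub>LR\<^esub> x" x] R.a_inv_closed[of x] x R_carrier by (simp add: L.a_comm)
qed

lemma pow_R: "x [^]\<^bsub>LR\<^esub> (n::nat) = x [^] n"
  by (simp add: nat_pow_def)

sublocale jR: unital_subring "j ` R" "j \<one>"
proof
  show "j \<one> \<in> j ` R" using subringE(3)[OF subring] by blast
  show "x + y \<in> j ` R" if "x \<in> j ` R" "y \<in> j ` R" for x y
    using that subringE(7)[OF subring] R_carrier by (auto simp flip: j_add)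
  show "x * y \<in> j ` R" if "x \<in> j ` R" "y \<in> j ` R" for x y
    using that subringE(6)[OF subring] R_carrier by (auto simp flip: j_mult)
  show "- x \<in> j ` R" if "x \<in> j ` R" for x
    using that subringE(5)[OF subring] R_carrier by (auto simp flip: j_uminus)
  show "j \<one> * x = x" if "x \<in> j ` R" for x
    using that j_unit R_carrier by auto
qed

lemma char_p_R:
  assumes "prime_char p LR" shows "char_p_subring (j ` R) (j \<one>) p"
proof
  show "Factorial_Ring.prime p" using assms unfolding prime_char_def by blast
  have "[n] \<cdot>\<^bsub>LR\<^esub> \<one> \<in> carrier L \<and> j ([n] \<cdot>\<^bsub>LR\<^esub> \<one>) = of_nat n * j \<one>" for n :: nat
    by (induction n) (auto simp: add_pow_def nat_pow_def j_add algebra_simps)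
  moreover have "[p] \<cdot>\<^bsub>LR\<^esub> \<one> = \<zero>" using assms unfolding prime_char_def by simp
  ultimately show "of_nat p * j \<one> = 0" using j_zero by metis
qed

lemma ideal_image:
  assumes "ideal I LR" shows "ideal_in (j ` R) (j ` I)" "I \<subseteq> R"
proof -
  interpret I: ideal I LR by (rule assms)
  show IR: "I \<subseteq> R" using I.a_subset by simp
  then have IL: "I \<subseteq> carrier L" using R_subset by blast
  show "ideal_in (j ` R) (j ` I)"
  proof (rule ideal_inI)
    show "0 \<in> j ` I" using I.zero_closed by (force simp flip: j_zero)
    show "x + y \<in> j ` I" if "x \<in> j ` I" "y \<in> j ` I" for x y
      using that I.a_closed IL by (auto simp: subset_iff simp flip: j_add)
    show "a * x \<in> j ` I" if "a \<in> j ` R" "x \<in> j ` I" for a x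
      using that I.I_l_closed IL R_carrier by (auto simp: subset_iff simp flip: j_mult)
  qed (use IR in blast)
qed

lemma ideal_preimage:
  assumes I: "I \<subseteq> R" and J: "ideal_in (j ` R) (j ` I)" shows "ideal I LR"
proof (rule idealI[OF R.ring_axioms])
  have IL: "I \<subseteq> carrier L" using I R_subset by blast
  have mem: "x \<in> I" if "j x \<in> j ` I" "x \<in> R" for x using j_image_iff[of x I] that IL R_carrier by blast
  show "subgroup I (add_monoid LR)"
  proof (rule R.add.subgroupI)
    show "I \<subseteq> carrier LR" using I by simp
    show "I \<noteq> {}" using ideal_in_zero[OF J] by blast
    show "\<ominus>\<^bsub>LR\<^esub> a \<in> I" if a: "a \<in> I" for a
      using jR.ideal_in_uminus[OF J, of "j a"] a I IL mem[of "\<ominus> a"] subringE(5)[OF subring]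
      by (auto simp: uminus_R j_uminus subset_iff)
    show "a \<oplus>\<^bsub>LR\<^esub> b \<in> I" if a: "a \<in> I" and b: "b \<in> I" for a b
      using ideal_in_add[OF J, of "j a" "j b"] a b I IL mem[of "a \<oplus> b"] subringE(7)[OF subring]
      by (auto simp: j_add subset_iff)
  qed
  show "x \<otimes>\<^bsub>LR\<^esub> a \<in> I" if a: "a \<in> I" and x: "x \<in> carrier LR" for a x
    using ideal_in_mult[OF J, of "j x" "j a"] a x I IL mem[of "x \<otimes> a"] subringE(6)[OF subring] R_carrier
    by (auto simp: j_mult subset_iff)
  show "a \<otimes>\<^bsub>LR\<^esub> x \<in> I" if a: "a \<in> I" and x: "x \<in> carrier LR" for a x
    using ideal_in_mult2[OF J, of "j x" "j a"] a x I IL mem[of "a \<otimes> x"] subringE(6)[OF subring] R_carrier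
    by (auto simp: j_mult subset_iff)
qed

lemma ideal_in_image:
  assumes "ideal_in (j ` R) J" obtains I where "I \<subseteq> R" "J = j ` I" "ideal I LR"
  using assms ideal_preimage unfolding ideal_in_def by (metis subset_imageE)

lemma primeideal_iff: "I \<subseteq> R \<Longrightarrow> primeideal I LR \<longleftrightarrow> prime_in (j ` R) (j ` I)"
proof -
  assume I: "I \<subseteq> R"
  then have IL: "I \<subseteq> carrier L" using R_subset by blast
  have ne: "R \<noteq> I \<longleftrightarrow> j ` I \<noteq> j ` R" using j_image_subset[OF R_subset IL] I by blast
  have pr: "(\<forall>a\<in>R. \<forall>b\<in>R. a \<otimes> b \<in> I \<longrightarrow> a \<in> I \<or> b \<in> I) \<longleftrightarrow>
      (\<forall>a\<in>j ` R. \<forall>b\<in>j ` R. a * b \<in> j ` I \<longrightarrow> a \<in> j ` I \<or> b \<in> j ` I)"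
    using R_carrier j_image_iff[OF _ IL] by (simp flip: j_mult)
  show ?thesis
  proof
    assume P: "primeideal I LR"
    interpret P: primeideal I LR by (rule P)
    show "prime_in (j ` R) (j ` I)" unfolding prime_in_def
      using ideal_image(1)[OF P.is_ideal] P.I_notcarr P.I_prime ne pr by simp
  next
    assume P: "prime_in (j ` R) (j ` I)"
    show "primeideal I LR"
      using P ne pr ideal_preimage[OF I prime_in_ideal[OF P]] unfolding prime_in_def
      by (intro primeidealI[OF _ cring_R]) auto
  qed
qed

text \<open>Every nonempty chain of ideals contains its union, so Zorn's lemma yields maximal
  members, which the embedding transfers.\<close>

lemma noeth_image:
  assumes "noetherian_ring LR" shows "noeth_in (j ` R)"
  unfolding noeth_in_def
proof (intro allI impI)
  interpret noetherian_ring LR by (rule assms)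
  fix \<S> :: "'u set set"
  assume S: "\<S> \<noteq> {} \<and> (\<forall>I\<in>\<S>. ideal_in (j ` R) I)"
  define T where "T = {I. ideal I LR \<and> j ` I \<in> \<S>}"
  have "T \<noteq> {}"
  proof -
    obtain J where J: "J \<in> \<S>" "ideal_in (j ` R) J" using S by blast
    obtain I where "J = j ` I" "ideal I LR" using ideal_in_image[OF J(2)] by metis
    then show ?thesis using J unfolding T_def by blast
  qed
  then have "\<exists>M\<in>T. \<forall>X\<in>T. M \<subseteq> X \<longrightarrow> X = M"
  proof (rule subset_Zorn_nonempty)
    fix C assume C: "C \<noteq> {}" "subset.chain T C"
    then have "subset.chain {I. ideal I LR} C" unfolding pred_on.chain_def T_def by blast
    then have "\<Union>C \<in> C" using ideal_chain_is_trivial C(1) by blast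
    then show "\<Union>C \<in> T" using C(2) unfolding pred_on.chain_def by blast
  qed
  then obtain M where M: "M \<in> T" "\<And>X. X \<in> T \<Longrightarrow> M \<subseteq> X \<Longrightarrow> X = M" by blast
  show "\<exists>M\<in>\<S>. \<forall>I\<in>\<S>. M \<subseteq> I \<longrightarrow> I = M"
  proof (intro bexI[of _ "j ` M"] ballI impI)
    show "j ` M \<in> \<S>" using M(1) unfolding T_def by blast
    fix J assume J: "J \<in> \<S>" "j ` M \<subseteq> J"
    obtain I where I: "I \<subseteq> R" "J = j ` I" "ideal I LR" using ideal_in_image S J(1) by metis
    have "M \<subseteq> R" using M(1) ideal_image(2) unfolding T_def by blast
    then have "M \<subseteq> I" using J(2) I R_subset j_image_subset[of M I] by auto
    then show "J = j ` M" using M(2)[of I] I J(1) unfolding T_def by auto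
  qed
qed

lemma maximalideal_unique:
  assumes "local_ring LR" shows "maximalideal (max_ideal LR) LR" "maximalideal I LR \<Longrightarrow> I = max_ideal LR"
proof -
  have ex: "\<exists>!I. maximalideal I LR" using assms unfolding local_ring_def by blast
  show "maximalideal (max_ideal LR) LR" unfolding max_ideal_def by (rule theI'[OF ex])
  then show "maximalideal I LR \<Longrightarrow> I = max_ideal LR" using ex by blast
qed

text \<open>An element outside the maximal ideal generates the whole ring: otherwise Noetherianity
  provides an ideal maximal among the proper ones containing it, and by uniqueness this is the
  maximal ideal.\<close>

lemma loc_image:
  assumes loc: "local_ring LR" and N: "noeth_in (j ` R)"
  shows "loc (j ` R) (j \<one>) (j ` max_ideal LR)" "max_ideal LR \<subseteq> R"
proof -
  let ?M = "max_ideal LR"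
  interpret M: maximalideal ?M LR by (rule maximalideal_unique(1)[OF loc])
  show MR: "?M \<subseteq> R" using M.a_subset by simp
  have Mp: "prime_in (j ` R) (j ` ?M)"
    using primeideal_iff[OF MR] R.maximalideal_prime[OF M.is_maximalideal] by blast
  show "loc (j ` R) (j \<one>) (j ` ?M)" unfolding loc_def
  proof (intro conjI ballI impI Mp)
    fix x assume x: "x \<in> j ` R" "x \<notin> j ` ?M"
    let ?X = "adjoin (j ` R) {0} x"
    have z: "ideal_in (j ` R) {0}" using jR.zero_mem by (intro ideal_inI) auto
    have X: "ideal_in (j ` R) ?X" using jR.adjoin_ideal[OF z x(1)] .
    have xX: "x \<in> ?X" using jR.adjoin_self[OF z x(1)] .
    have "j \<one> \<in> ?X"
    proof (rule ccontr)
      assume e: "j \<one> \<notin> ?X"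
      let ?S = "{J. ideal_in (j ` R) J \<and> j \<one> \<notin> J \<and> ?X \<subseteq> J}"
      have "?X \<in> ?S" using X e by blast
      then obtain J where J: "J \<in> ?S" "\<And>I. I \<in> ?S \<Longrightarrow> J \<subseteq> I \<Longrightarrow> I = J"
        using N[unfolded noeth_in_def, rule_format, of ?S] by auto
      obtain I where I: "I \<subseteq> R" "J = j ` I" "ideal I LR" using ideal_in_image J(1) by blast
      have IL: "I \<subseteq> carrier L" using I(1) R_subset by blast
      have "maximalideal I LR"
      proof (rule maximalidealI[OF I(3)])
        show "carrier LR \<noteq> I" using J(1) I(2) jR.one_mem by auto
        fix I' assume I': "ideal I' LR" "I \<subseteq> I'" "I' \<subseteq> carrier LR"
        have I'L: "I' \<subseteq> carrier L" using I'(3) R_subset by simp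
        show "I' = I \<or> I' = carrier LR"
        proof (cases "j \<one> \<in> j ` I'")
          case True
          then have "j ` I' = j ` R" using jR.ideal_in_whole[OF ideal_image(1)[OF I'(1)]] by blast
          then show ?thesis using I'(3) j_image_subset[OF R_subset I'L] by auto
        next
          case False
          have "?X \<subseteq> j ` I'" using J(1) I(2) I'(2) by blast
          then have "j ` I' = J" using False ideal_image(1)[OF I'(1)] I(2) I'(2) by (intro J(2)) blast+
          then show ?thesis using I(2) I'(2) j_image_subset[OF I'L IL] by auto
        qed
      qed
      then have "I = ?M" using maximalideal_unique(2)[OF loc] by blast
      then show False using x(2) xX J(1) I(2) by blast
    qed
    then show "\<exists>y\<in>j ` R. x * y = j \<one>" by (auto simp: adjoin_def mult.commute)
  qed
qed

lemma krull_dim_image: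
  assumes d: "krull_dim LR = enat d" and ne: "\<exists>I. primeideal I LR"
  shows "dim_le (j ` R) {0} d" "\<exists>P. prime_chain (j ` R) {0} P d"
proof -
  let ?C = "\<lambda>n P. (\<forall>i\<le>n. primeideal (P i) LR) \<and> (\<forall>i<n. P i \<subset> P (Suc i))"
  let ?S = "{enat n | n. \<exists>P :: nat \<Rightarrow> 'a set. ?C n P}"
  have S: "Sup ?S = enat d" using d unfolding krull_dim_def .
  have le: "n \<le> d" if "?C n P" for n P
  proof -
    have "enat n \<in> ?S" using that by blast
    then have "enat n \<le> Sup ?S" by (rule Sup_upper)
    then show ?thesis unfolding S by simp
  qed
  have PR: "P \<subseteq> R" if "primeideal P LR" for P
    using ideal_image(2) primeideal.axioms(1)[OF that] by blast
  show "dim_le (j ` R) {0} d"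
    unfolding dim_le_def
  proof (intro allI impI)
    fix P k assume c: "prime_chain (j ` R) {0} P k"
    define P' where "P' i = {x \<in> R. j x \<in> P i}" for i
    have im: "j ` P' i = P i" if "i \<le> k" for i
      using c that unfolding P'_def prime_chain_def prime_in_def ideal_in_def by blast
    have PR': "P' i \<subseteq> R" for i by (auto simp: P'_def)
    have "primeideal (P' i) LR" if "i \<le> k" for i
      using primeideal_iff[OF PR'] im[OF that] c that unfolding prime_chain_def by simp
    moreover have "P' i \<subset> P' (Suc i)" if i: "i < k" for i
    proof -
      have "j ` P' i \<subset> j ` P' (Suc i)" using im[of i] im[of "Suc i"] c i unfolding prime_chain_def by simp
      moreover have "P' i \<subseteq> carrier L" "P' (Suc i) \<subseteq> carrier L" using PR' R_subset by blast+
      ultimately show ?thesis using j_image_subset[of "P' i" "P' (Suc i)"] by blast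
    qed
    ultimately show "k \<le> d" using le by blast
  qed
  \<comment> \<open>A prime ideal is a chain of length 0, so the set of lengths is nonempty and,
    being finite, contains its supremum. The supremum of the empty set would be 0 without any
    chain.\<close>
  define T where "T = ?S"
  have "T \<noteq> {}" using ne unfolding T_def by (auto intro!: exI[of _ 0])
  moreover have "finite T"
    unfolding T_def by (rule finite_subset[of _ "enat ` {..d}"]) (use le in auto)
  ultimately have "Sup T \<in> T" using Max_in[of T] by (simp add: Sup_enat_def)
  then have "Sup ?S \<in> ?S" unfolding T_def .
  then obtain P where P: "?C d P" unfolding S by auto
  have "prime_chain (j ` R) {0} (\<lambda>i. j ` P i) d"
    unfolding prime_chain_def
  proof (intro conjI allI impI)
    show "prime_in (j ` R) (j ` P i)" if "i \<le> d" for i using P that primeideal_iff[OF PR] by blast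
    then show "{0} \<subseteq> j ` P i" if "i \<le> d" for i using that ideal_in_zero[OF prime_in_ideal] by blast
    show "j ` P i \<subset> j ` P (Suc i)" if i: "i < d" for i
    proof -
      have PP: "P i \<subset> P (Suc i)" "P i \<subseteq> carrier L" "P (Suc i) \<subseteq> carrier L"
        using P i PR[of "P i"] PR[of "P (Suc i)"] R_subset by auto
      then show ?thesis using j_image_subset[OF PP(3,2)] by blast
    qed
  qed
  then show "\<exists>P. prime_chain (j ` R) {0} P d" by blast
qed

lemma regular_image:
  assumes reg: "regular_local_ring LR" and d: "krull_dim LR = enat d"
  shows "\<exists>xs. length xs = d \<and> set xs \<subseteq> j ` max_ideal LR \<and> adjoin_list (j ` R) {0} xs = j ` max_ideal LR"
proof -
  let ?M = "max_ideal LR"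
  have N: "noetherian_ring LR" and loc: "local_ring LR" and e: "embedding_dim LR = d"
    using reg d unfolding regular_local_ring_def by auto
  interpret N: noetherian_ring LR by (rule N)
  interpret M: maximalideal ?M LR by (rule maximalideal_unique(1)[OF loc])
  have MR: "?M \<subseteq> R" using M.a_subset by simp
  obtain B0 where "B0 \<subseteq> carrier LR" "finite B0" "?M = Idl\<^bsub>LR\<^esub> B0" using N.finetely_gen[OF M.is_ideal] by blast
  \<comment> \<open>A finite generating set exists, so the \<open>LEAST\<close> in
    \<open>embedding_dim\<close> is attained.\<close>
  then have "\<exists>n. \<exists>B \<subseteq> carrier LR. finite B \<and> card B = n \<and> genideal LR B = ?M" by blast
  from LeastI_ex[OF this] obtain B where B: "B \<subseteq> R" "finite B" "card B = d" "genideal LR B = ?M"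
    unfolding embedding_dim_def[symmetric] e by auto
  obtain bs where bs: "set bs = B" "distinct bs" using finite_distinct_list[OF B(2)] by blast
  let ?xs = "map j bs"
  let ?I = "adjoin_list (j ` R) {0} ?xs"
  have z: "ideal_in (j ` R) {0}" using jR.zero_mem by (intro ideal_inI) auto
  have BM: "B \<subseteq> ?M" using R.genideal_self[of B] B(1,4) by simp
  have Mi: "ideal_in (j ` R) (j ` ?M)" using ideal_image(1)[OF M.is_ideal] .
  have I: "ideal_in (j ` R) ?I" using jR.adjoin_list_ideal[OF z, of ?xs] bs B(1) by auto
  have "?I \<subseteq> j ` ?M" using jR.adjoin_list_least[OF Mi, of "{0}" ?xs] ideal_in_zero[OF Mi] bs BM by auto
  moreover have "j ` ?M \<subseteq> ?I"
  proof -
    obtain J where J: "J \<subseteq> R" "?I = j ` J" "ideal J LR" using ideal_in_image[OF I] by metis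
    have JL: "J \<subseteq> carrier L" using J(1) R_subset by blast
    have "set ?xs \<subseteq> ?I" using bs B(1) by (intro jR.adjoin_list_self z) auto
    then have "j ` B \<subseteq> j ` J" using bs J(2) by simp
    then have "B \<subseteq> J" using j_image_subset[OF _ JL] B(1) R_subset by blast
    then have "?M \<subseteq> J" unfolding B(4)[symmetric] by (rule R.genideal_minimal[OF J(3)])
    then show ?thesis using J(2) by blast
  qed
  ultimately show ?thesis using bs B(3) distinct_card[OF bs(2)] BM by (intro exI[of _ ?xs]) auto
qed

end

section \<open>Direct summands as dual families\<close>

lemma qlin_subset: "qlin A q V \<phi> \<Longrightarrow> W \<subseteq> V \<Longrightarrow> qlin A q W \<phi>"
  unfolding qlin_def by blast

context char_p_subring begin

text \<open>Functionals on the summand \<open>G\<close> are extended by composition with the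
  projection along \<open>N\<close>.\<close>

lemma dual_family_summand:
  assumes G: "pmodule A (p ^ n) G" and N: "pmodule A (p ^ n) N" and V: "V = {g + w | g w. g \<in> G \<and> w \<in> N}"
    and GN: "G \<inter> N = {0}" and E: "\<And>x. x \<in> G \<union> N \<Longrightarrow> e * x = x" and d: "dual_family A e (p ^ n) G I v \<phi>"
  shows "\<exists>\<psi>. dual_family A e (p ^ n) V I v \<psi>"
proof -
  define \<pi> where "\<pi> x = (SOME g. g \<in> G \<and> x - g \<in> N)" for x
  have pi: "\<pi> x = g" if g: "g \<in> G" and w: "x - g \<in> N" for x g
  proof -
    have h: "\<pi> x \<in> G" "x - \<pi> x \<in> N" using someI[of "\<lambda>g. g \<in> G \<and> x - g \<in> N" g] g w unfolding \<pi>_def by auto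
    have "\<pi> x - g \<in> G" using pmodule_diff[OF G h(1) g] E g by blast
    moreover have "(x - g) - (x - \<pi> x) \<in> N" using pmodule_diff[OF N w h(2)] E h(2) by blast
    ultimately have "\<pi> x - g \<in> G \<inter> N" by simp
    then show ?thesis using GN by auto
  qed
  have piV: "\<pi> x \<in> G" "x - \<pi> x \<in> N" if x: "x \<in> V" for x
  proof -
    obtain g w where "x = g + w" "g \<in> G" "w \<in> N" using x V by blast
    then show "\<pi> x \<in> G" "x - \<pi> x \<in> N" using pi[of g x] by auto
  qed
  have GV: "G \<subseteq> V" using pmodule_zero[OF N] unfolding V by force
  have "qlin A (p ^ n) V (\<lambda>x. \<phi> i (\<pi> x))" if i: "i \<in> I" for i
  proof -
    have L: "qlin A (p ^ n) G (\<phi> i)" using d i unfolding dual_family_def by blast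
    show ?thesis unfolding qlin_def
    proof (intro conjI ballI)
      show "(\<lambda>x. \<phi> i (\<pi> x)) \<in> V \<rightarrow> A" using qlinD(1)[OF L piV(1)] by blast
      show "\<phi> i (\<pi> (x + y)) = \<phi> i (\<pi> x) + \<phi> i (\<pi> y)" if x: "x \<in> V" and y: "y \<in> V" for x y
      proof -
        have "\<pi> (x + y) = \<pi> x + \<pi> y"
          using pmodule_add[OF N piV(2)[OF x] piV(2)[OF y]] by (intro pi pmodule_add[OF G] piV x y) (simp add: algebra_simps)
        then show ?thesis using qlinD(2)[OF L piV(1)[OF x] piV(1)[OF y]] by simp
      qed
      show "\<phi> i (\<pi> (a ^ p ^ n * x)) = a * \<phi> i (\<pi> x)" if a: "a \<in> A" and x: "x \<in> V" for a x
      proof -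
        have "\<pi> (a ^ p ^ n * x) = a ^ p ^ n * \<pi> x"
          using pmodule_smult[OF N a piV(2)[OF x]] by (intro pi pmodule_smult[OF G a] piV x) (simp add: right_diff_distrib)
        then show ?thesis using qlinD(3)[OF L a piV(1)[OF x]] by simp
      qed
    qed
  qed
  moreover have "\<pi> g = g" if "g \<in> G" for g using pi[OF that, of g] pmodule_zero[OF N] by simp
  ultimately have "dual_family A e (p ^ n) V I v (\<lambda>i x. \<phi> i (\<pi> x))"
    using d GV unfolding dual_family_def by auto
  then show ?thesis by blast
qed

text \<open>The converse: the vectors of a dual family span a free module, and the common kernel of
  the functionals is its complement.\<close>

lemma splits_decomposition:
  assumes V: "pmodule A (p ^ n) V" and E: "\<And>x. x \<in> V \<Longrightarrow> e * x = x" and e0: "e \<noteq> 0" and s: "splits A e (p ^ n) V k"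
  shows "\<exists>Z N. Z \<subseteq> V \<and> finite Z \<and> card Z = k \<and> indep_mod A {0} (p ^ n) {0} Z (\<lambda>x. x) \<and> N \<subseteq> V \<and> pmodule A (p ^ n) N \<and>
    V = {g + w | g w. g \<in> qspan A (p ^ n) Z \<and> w \<in> N} \<and> qspan A (p ^ n) Z \<inter> N = {0}"
proof -
  let ?q = "p ^ n"
  obtain v \<phi> where d: "dual_family A e ?q V {..<k} v \<phi>" using s unfolding splits_def by blast
  have v: "v i \<in> V" and L: "qlin A ?q V (\<phi> i)" if "i < k" for i using d that unfolding dual_family_def by auto
  have dd: "\<phi> i (v j) = (if i = j then e else 0)" if "i < k" "j < k" for i j
    using d that unfolding dual_family_def by auto
  have inj: "inj_on v {..<k}"
  proof (rule inj_onI)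
    fix i j assume ij: "i \<in> {..<k}" "j \<in> {..<k}" "v i = v j"
    then show "i = j" using dd[of i i] dd[of i j] e0 by (cases "i = j") auto
  qed
  define Z where "Z = v ` {..<k}"
  define N where "N = {x \<in> V. \<forall>i<k. \<phi> i x = 0}"
  have ZV: "Z \<subseteq> V" using v by (auto simp: Z_def)
  have eval: "\<phi> i (\<Sum>j<k. c j ^ ?q * v j) = c i" if c: "\<And>j. j < k \<Longrightarrow> c j \<in> A" and i: "i < k" for c i
  proof -
    have "\<phi> i (\<Sum>j<k. c j ^ ?q * v j) = (\<Sum>j<k. \<phi> i (c j ^ ?q * v j))"
      using v c by (intro qlin_sum[OF L[OF i] V] pmodule_smult[OF V]) auto
    also have "\<dots> = (\<Sum>j<k. if j = i then c i else 0)"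
      using qlinD(3)[OF L[OF i] c v] dd i c mult_one by (intro sum.cong) auto
    finally show ?thesis using i by simp
  qed
  have Zsum: "(\<Sum>z\<in>Z. c z ^ ?q * z) = (\<Sum>j<k. c (v j) ^ ?q * v j)" for c
    unfolding Z_def by (simp add: sum.reindex[OF inj])
  have ind: "indep_mod A {0} ?q {0} Z (\<lambda>x. x)"
    unfolding indep_mod_def
  proof (intro ballI impI)
    fix c z assume c: "c \<in> Z \<rightarrow> A" "(\<Sum>z\<in>Z. c z ^ ?q * z) \<in> {0}" and z: "z \<in> Z"
    obtain i where i: "i < k" "z = v i" using z by (auto simp: Z_def)
    have cv: "c (v j) \<in> A" if "j < k" for j using c(1) that by (auto simp: Z_def)
    have "\<phi> i (\<Sum>j<k. c (v j) ^ ?q * v j) = c (v i)" by (rule eval[of "\<lambda>j. c (v j)", OF cv i(1)])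
    moreover have "(\<Sum>j<k. c (v j) ^ ?q * v j) = 0" using c(2) unfolding Zsum by simp
    ultimately show "c z \<in> {0}" using qlin_zero[OF L[OF i(1)] pmodule_zero[OF V]] i(2) by simp
  qed
  have N: "pmodule A ?q N"
  proof (rule pmoduleI)
    show "0 \<in> N" using qlin_zero[OF L pmodule_zero[OF V]] pmodule_zero[OF V] by (simp add: N_def)
    show "x + y \<in> N" if "x \<in> N" "y \<in> N" for x y
      using that qlinD(2)[OF L] pmodule_add[OF V] by (simp add: N_def)
    show "a ^ ?q * x \<in> N" if "a \<in> A" "x \<in> N" for a x
      using that qlinD(3)[OF L] pmodule_smult[OF V] by (simp add: N_def)
  qed
  have G: "qspan A ?q Z \<subseteq> V" by (rule qspan_subset_pmodule[OF V ZV])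
  have "V \<subseteq> {g + w | g w. g \<in> qspan A ?q Z \<and> w \<in> N}"
  proof
    fix x assume x: "x \<in> V"
    define g where "g = (\<Sum>j<k. \<phi> j x ^ ?q * v j)"
    have pA: "\<phi> j x \<in> A" if "j < k" for j using qlinD(1)[OF L[OF that] x] .
    have gZ: "g \<in> qspan A ?q Z" unfolding g_def
      using pA by (intro pmodule_sum[OF qspan_pmodule'] qspan_smult_base) (auto simp: Z_def)
    then have gV: "g \<in> V" using G by blast
    have xg: "x - g \<in> V" using pmodule_diff[OF V x gV E[OF gV]] .
    have "\<phi> i (x - g) = 0" if i: "i < k" for i
    proof -
      have "\<phi> i ((x - g) + g) = \<phi> i (x - g) + \<phi> i g" by (rule qlinD(2)[OF L[OF i] xg gV])
      moreover have "\<phi> i g = \<phi> i x" unfolding g_def by (rule eval[OF pA i])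
      ultimately show ?thesis by simp
    qed
    then have "x - g \<in> N" using xg by (simp add: N_def)
    moreover have "x = g + (x - g)" by simp
    ultimately show "x \<in> {g + w | g w. g \<in> qspan A ?q Z \<and> w \<in> N}" using gZ by blast
  qed
  moreover have "{g + w | g w. g \<in> qspan A ?q Z \<and> w \<in> N} \<subseteq> V" using G pmodule_add[OF V] by (auto simp: N_def)
  moreover have "qspan A ?q Z \<inter> N = {0}"
  proof -
    have "x = 0" if x: "x \<in> qspan A ?q Z" "x \<in> N" for x
    proof -
      obtain c where c: "c \<in> Z \<rightarrow> A" "x = (\<Sum>z\<in>Z. c z ^ ?q * z)"
        using qspan_finite_rep[OF pmodule_singleton_zero, of Z x n] x(1) unfolding qspan_insert_zero Z_def by auto
      have cv: "c (v j) \<in> A" if "j < k" for j using c(1) that by (auto simp: Z_def)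
      have "c (v i) = 0" if "i < k" for i
        using eval[of "\<lambda>j. c (v j)", OF cv that] x(2) that c(2) unfolding Zsum by (simp add: N_def)
      then show "x = 0" unfolding c(2) Zsum by (simp add: zero_pow)
    qed
    then show ?thesis using pmodule_zero[OF N] pmodule_zero[OF qspan_pmodule'] by blast
  qed
  ultimately show ?thesis using ZV ind N card_image[OF inj]
    by (intro exI[of _ Z] exI[of _ N]) (auto simp: Z_def N_def)
qed

end

text \<open>A module record on a subset of \<open>L\<close> whose scalars act through
  \<open>p ^ n\<close>-th powers. Frobenius modules, \<open>S\<close> over \<open>R\<close> with
  \<open>n = 0\<close>, and their submodules are all instances, so one translation serves
  them.\<close>

locale power_module = embedded_subring L j R for L :: "('a, 'b) ring_scheme" (structure) and j :: "'a \<Rightarrow> 'u::comm_ring_1" and R +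
  fixes p n :: nat and V :: "'a set" and M :: "('a, 'a) module"
  assumes ch: "char_p_subring (j ` R) (j \<one>) p"
    and V: "V \<subseteq> carrier L" "\<zero> \<in> V" "\<And>x y. x \<in> V \<Longrightarrow> y \<in> V \<Longrightarrow> x \<oplus> y \<in> V" "\<And>x. x \<in> V \<Longrightarrow> \<ominus> x \<in> V"
    and M: "carrier M = V" "add M = add L" "zero M = \<zero>"
    and smult: "\<And>r x. r \<in> R \<Longrightarrow> x \<in> V \<Longrightarrow> r \<odot>\<^bsub>M\<^esub> x \<in> V"
      "\<And>r x. r \<in> R \<Longrightarrow> x \<in> V \<Longrightarrow> j (r \<odot>\<^bsub>M\<^esub> x) = j r ^ (p ^ n) * j x"
begin

abbreviation "A \<equiv> j ` R"
abbreviation "e \<equiv> j \<one>"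

sublocale C: char_p_subring A e p
  by (rule ch)

lemma V_carrier: "x \<in> V \<Longrightarrow> x \<in> carrier L"
  using V(1) by blast

sublocale M: abelian_group M
proof (rule abelian_groupI)
  show "\<exists>y\<in>carrier M. y \<oplus>\<^bsub>M\<^esub> x = \<zero>\<^bsub>M\<^esub>" if "x \<in> carrier M" for x
    using that V(4) V_carrier L.l_neg unfolding M by blast
qed (use V V_carrier in \<open>auto simp: M L.a_ac\<close>)

lemma jV_unit: "x \<in> j ` V \<Longrightarrow> e * x = x"
  using j_unit V_carrier by auto

lemma jV_pmodule: "pmodule A (p ^ n) (j ` V)"
proof (rule pmoduleI)
  show "0 \<in> j ` V" using V(2) j_zero by force
  show "x + y \<in> j ` V" if "x \<in> j ` V" "y \<in> j ` V" for x y
    using that V(3) V_carrier by (auto simp flip: j_add)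
  show "a ^ p ^ n * x \<in> j ` V" if "a \<in> A" "x \<in> j ` V" for a x
    using that smult(1) by (auto simp flip: smult(2))
qed

lemma finsum_image:
  assumes "finite F" "f \<in> F \<rightarrow> V"
  shows "finsum M f F \<in> V" "j (finsum M f F) = (\<Sum>x\<in>F. j (f x))"
proof -
  have "finsum M f F \<in> V \<and> j (finsum M f F) = (\<Sum>x\<in>F. j (f x))" using assms
  proof (induction F rule: finite_induct)
    case empty
    then show ?case by (simp add: M V(2))
  next
    case (insert x F)
    then have "finsum M f (insert x F) = f x \<oplus> finsum M f F"
      using M.finsum_insert[of F x f] by (auto simp: M)
    then show ?case using insert V(3) V_carrier by (auto simp: j_add Pi_iff)
  qed
  then show "finsum M f F \<in> V" "j (finsum M f F) = (\<Sum>x\<in>F. j (f x))" by blast+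
qed

lemma combination_image:
  assumes "finite F" "F \<subseteq> V" "c \<in> F \<rightarrow> R"
  shows "(\<Oplus>\<^bsub>M\<^esub>b\<in>F. c b \<odot>\<^bsub>M\<^esub> b) \<in> V"
    "j (\<Oplus>\<^bsub>M\<^esub>b\<in>F. c b \<odot>\<^bsub>M\<^esub> b) = (\<Sum>z\<in>j ` F. j (c (inv_into F j z)) ^ (p ^ n) * z)"
proof -
  have f: "(\<lambda>b. c b \<odot>\<^bsub>M\<^esub> b) \<in> F \<rightarrow> V" using assms smult(1) by auto
  then show "(\<Oplus>\<^bsub>M\<^esub>b\<in>F. c b \<odot>\<^bsub>M\<^esub> b) \<in> V" using finsum_image(1) assms(1) by blast
  have inj: "inj_on j F" using j_inj assms(2) V(1) by (meson inj_on_subset subset_trans)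
  have "j (\<Oplus>\<^bsub>M\<^esub>b\<in>F. c b \<odot>\<^bsub>M\<^esub> b) = (\<Sum>b\<in>F. j (c b \<odot>\<^bsub>M\<^esub> b))" by (rule finsum_image(2)[OF assms(1) f])
  also have "\<dots> = (\<Sum>b\<in>F. j (c b) ^ (p ^ n) * j b)" using assms smult(2) by (intro sum.cong) auto
  also have "\<dots> = (\<Sum>z\<in>j ` F. j (c (inv_into F j z)) ^ (p ^ n) * z)"
    by (simp add: sum.reindex[OF inj] inj)
  finally show "j (\<Oplus>\<^bsub>M\<^esub>b\<in>F. c b \<odot>\<^bsub>M\<^esub> b) = (\<Sum>z\<in>j ` F. j (c (inv_into F j z)) ^ (p ^ n) * z)" .
qed

lemma span_image:
  assumes B: "finite B" "B \<subseteq> V"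
  shows "j ` module_span LR M B = qspan A (p ^ n) (j ` B)" "module_span LR M B \<subseteq> V"
proof -
  have BL: "B \<subseteq> carrier L" using B(2) V(1) by blast
  have inj: "inj_on j B" using j_inj BL inj_on_subset by blast
  show "module_span LR M B \<subseteq> V"
    unfolding module_span_def using combination_image(1) B by (auto intro: finite_subset)
  show "j ` module_span LR M B = qspan A (p ^ n) (j ` B)"
  proof
    show "j ` module_span LR M B \<subseteq> qspan A (p ^ n) (j ` B)"
    proof
      fix y assume "y \<in> j ` module_span LR M B"
      then obtain F c where F: "finite F" "F \<subseteq> B" "c \<in> F \<rightarrow> R" "y = j (\<Oplus>\<^bsub>M\<^esub>b\<in>F. c b \<odot>\<^bsub>M\<^esub> b)"
        unfolding module_span_def by auto
      have "y = (\<Sum>z\<in>j ` F. j (c (inv_into F j z)) ^ (p ^ n) * z)"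
        using combination_image(2)[OF F(1) _ F(3)] F(2,4) B(2) by simp
      also have "\<dots> \<in> qspan A (p ^ n) (j ` B)"
      proof (intro pmodule_sum[OF C.qspan_pmodule'] qspan_smult_base)
        fix z assume z: "z \<in> j ` F"
        then have "inv_into F j z \<in> F" by (rule inv_into_into)
        then show "j (c (inv_into F j z)) \<in> A" using F(3) by blast
        show "z \<in> j ` B" using z F(2) by blast
      qed
      finally show "y \<in> qspan A (p ^ n) (j ` B)" .
    qed
    show "qspan A (p ^ n) (j ` B) \<subseteq> j ` module_span LR M B"
    proof
      fix y assume "y \<in> qspan A (p ^ n) (j ` B)"
      then obtain c where c: "c \<in> j ` B \<rightarrow> A" "y = (\<Sum>z\<in>j ` B. c z ^ (p ^ n) * z)"
        using C.qspan_finite_rep[OF C.pmodule_singleton_zero, of "j ` B" y n] B(1) unfolding C.qspan_insert_zero by auto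
      define c' where "c' b = inv_into R j (c (j b))" for b
      have c': "c' b \<in> R" "j (c' b) = c (j b)" if "b \<in> B" for b
        using c(1) that inv_into_into[of "c (j b)" j R] f_inv_into_f[of "c (j b)" j R] unfolding c'_def by auto
      have "j (\<Oplus>\<^bsub>M\<^esub>b\<in>B. c' b \<odot>\<^bsub>M\<^esub> b) = (\<Sum>z\<in>j ` B. j (c' (inv_into B j z)) ^ (p ^ n) * z)"
        using c' B by (intro combination_image(2)) auto
      also have "\<dots> = y" unfolding c(2) using c'(2) inj by (intro sum.cong) auto
      finally have "y = j (\<Oplus>\<^bsub>M\<^esub>b\<in>B. c' b \<odot>\<^bsub>M\<^esub> b)" by simp
      moreover have "(\<Oplus>\<^bsub>M\<^esub>b\<in>B. c' b \<odot>\<^bsub>M\<^esub> b) \<in> module_span LR M B"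
        unfolding module_span_def using B(1) c'(1) by (intro CollectI exI[of _ B] exI[of _ c']) auto
      ultimately show "y \<in> j ` module_span LR M B" by blast
    qed
  qed
qed

lemma independent_iff:
  assumes B: "finite B" "B \<subseteq> V"
  shows "module_independent LR M B \<longleftrightarrow> indep_mod A {0} (p ^ n) {0} (j ` B) (\<lambda>x. x)"
proof
  have BL: "B \<subseteq> carrier L" using B(2) V(1) by blast
  have inj: "inj_on j B" using j_inj BL inj_on_subset by blast
  assume ind: "module_independent LR M B"
  show "indep_mod A {0} (p ^ n) {0} (j ` B) (\<lambda>x. x)"
    unfolding indep_mod_def
  proof (intro ballI impI)
    fix c z assume c: "c \<in> j ` B \<rightarrow> A" "(\<Sum>z\<in>j ` B. c z ^ (p ^ n) * z) \<in> {0}" and z: "z \<in> j ` B"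
    define c' where "c' b = inv_into R j (c (j b))" for b
    have c': "c' b \<in> R" "j (c' b) = c (j b)" if "b \<in> B" for b
      using c(1) that inv_into_into[of "c (j b)" j R] f_inv_into_f[of "c (j b)" j R] unfolding c'_def by auto
    have c'R: "c' \<in> B \<rightarrow> R" using c' by blast
    have "j (\<Oplus>\<^bsub>M\<^esub>b\<in>B. c' b \<odot>\<^bsub>M\<^esub> b) = (\<Sum>z\<in>j ` B. j (c' (inv_into B j z)) ^ (p ^ n) * z)"
      by (rule combination_image(2)[OF B c'R])
    also have "\<dots> = (\<Sum>z\<in>j ` B. c z ^ (p ^ n) * z)" using c'(2) inj by (intro sum.cong) auto
    finally have "(\<Oplus>\<^bsub>M\<^esub>b\<in>B. c' b \<odot>\<^bsub>M\<^esub> b) = \<zero>\<^bsub>M\<^esub>"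
      using c(2) combination_image(1)[OF B c'R] V_carrier by (simp add: M j_eq_0_iff)
    then have "\<forall>b\<in>B. c' b = \<zero>"
      using ind[unfolded module_independent_def, rule_format, of B c'] B(1) c'R by simp
    then show "c z \<in> {0}" using z c'(2) by force
  qed
next
  assume ind: "indep_mod A {0} (p ^ n) {0} (j ` B) (\<lambda>x. x)"
  show "module_independent LR M B"
    unfolding module_independent_def
  proof (intro allI impI ballI)
    fix F c b assume F: "finite F \<and> F \<subseteq> B \<and> c \<in> F \<rightarrow> carrier LR \<and> (\<Oplus>\<^bsub>M\<^esub>b\<in>F. c b \<odot>\<^bsub>M\<^esub> b) = \<zero>\<^bsub>M\<^esub>" and b: "b \<in> F"
    have cR: "c \<in> F \<rightarrow> R" using F by simp
    have inj: "inj_on j F" using F j_inj B(2) V(1) by (meson inj_on_subset subset_trans)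
    have "(\<Sum>z\<in>j ` F. j (c (inv_into F j z)) ^ (p ^ n) * z) = j (\<Oplus>\<^bsub>M\<^esub>b\<in>F. c b \<odot>\<^bsub>M\<^esub> b)"
      using F B(2) cR by (intro combination_image(2)[symmetric]) auto
    then have s: "(\<Sum>z\<in>j ` F. j (c (inv_into F j z)) ^ (p ^ n) * z) \<in> {0}" using F by (simp add: M)
    have "indep_mod A {0} (p ^ n) {0} (j ` F) (\<lambda>x. x)"
      by (rule C.indep_mod_mono[OF ind]) (use F B(1) in auto)
    moreover have "(\<lambda>z. j (c (inv_into F j z))) \<in> j ` F \<rightarrow> A" using cR inj by auto
    ultimately have "j (c (inv_into F j (j b))) \<in> {0}"
      using indep_modD[of A "{0}" "p ^ n" "{0}" "j ` F" "\<lambda>x. x" "\<lambda>z. j (c (inv_into F j z))" "j b"] s b by blast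
    then have "j (c b) = 0" using inj b by simp
    then show "c b = \<zero>\<^bsub>LR\<^esub>" using cR b R_carrier j_eq_0_iff[of "c b"] by auto
  qed
qed

lemma a_inv_M: "x \<in> V \<Longrightarrow> \<ominus>\<^bsub>M\<^esub> x = \<ominus> x"
proof -
  assume x: "x \<in> V"
  have "\<ominus> x \<oplus>\<^bsub>M\<^esub> x = \<zero>\<^bsub>M\<^esub>" using V_carrier[OF x] by (simp add: M L.l_neg)
  then show ?thesis using M.minus_equality[of "\<ominus> x" x] V(4)[OF x] x by (simp add: M)
qed

lemma submodule_image:
  assumes "submodule N LR M" shows "N \<subseteq> V" "pmodule A (p ^ n) (j ` N)"
proof -
  interpret N: submodule N LR M by (rule assms)
  show NV: "N \<subseteq> V" using N.subset by (simp add: M)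
  have N0: "\<zero> \<in> N" using N.one_closed by (simp add: M)
  have Na: "x \<oplus> y \<in> N" if "x \<in> N" "y \<in> N" for x y using N.m_closed[OF that] by (simp add: M)
  show "pmodule A (p ^ n) (j ` N)"
  proof (rule pmoduleI)
    show "0 \<in> j ` N" using N0 j_zero by force
    show "x + y \<in> j ` N" if "x \<in> j ` N" "y \<in> j ` N" for x y
      using that Na NV V_carrier by (auto simp: subset_iff simp flip: j_add)
    show "a ^ p ^ n * x \<in> j ` N" if "a \<in> A" "x \<in> j ` N" for a x
      using that N.smult_closed NV by (auto simp: subset_iff simp flip: smult(2))
  qed
qed

lemma submodule_preimage:
  assumes N: "N \<subseteq> V" "pmodule A (p ^ n) (j ` N)" shows "submodule N LR M"
proof -
  have NL: "N \<subseteq> carrier L" using N(1) V(1) by blast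
  have mem: "x \<in> N" if "j x \<in> j ` N" "x \<in> V" for x using j_image_iff[OF _ NL] that V_carrier by blast
  show ?thesis
  proof (intro submodule.intro submodule_axioms.intro M.add.subgroupI)
    show "N \<subseteq> carrier M" using N(1) by (simp add: M)
    show "N \<noteq> {}" using pmodule_zero[OF N(2)] by blast
    show "\<ominus>\<^bsub>M\<^esub> a \<in> N" if a: "a \<in> N" for a
    proof -
      have aV: "a \<in> V" using a N(1) by blast
      have "- j a \<in> j ` N" using C.pmodule_uminus[OF N(2), of "j a"] a jV_unit aV by blast
      then show ?thesis using mem[of "\<ominus> a"] V(4)[OF aV] V_carrier[OF aV] by (simp add: a_inv_M[OF aV] j_uminus)
    qed
    show "a \<oplus>\<^bsub>M\<^esub> b \<in> N" if a: "a \<in> N" and b: "b \<in> N" for a b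
    proof -
      have ab: "a \<in> V" "b \<in> V" using a b N(1) by blast+
      have "j a + j b \<in> j ` N" using pmodule_add[OF N(2)] a b by blast
      then show ?thesis using mem[of "a \<oplus> b"] V(3)[OF ab] V_carrier ab by (simp add: M j_add)
    qed
    show "a \<odot>\<^bsub>M\<^esub> x \<in> N" if a: "a \<in> carrier LR" and x: "x \<in> N" for a x
    proof -
      have xV: "x \<in> V" using x N(1) by blast
      have "j a ^ (p ^ n) * j x \<in> j ` N" using pmodule_smult[OF N(2)] a x by simp
      then show ?thesis using mem[of "a \<odot>\<^bsub>M\<^esub> x"] smult[of a x] a xV by simp
    qed
  qed
qed

lemma submodule_power_module:
  assumes N: "N \<subseteq> V" "pmodule A (p ^ n) (j ` N)" shows "power_module L j R p n N (M\<lparr>carrier := N\<rparr>)"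
proof -
  interpret N: submodule N LR M by (rule submodule_preimage[OF N])
  show ?thesis
  proof (intro power_module.intro power_module_axioms.intro embedded_subring_axioms ch)
    show "\<zero> \<in> N" using N.one_closed by (simp add: M)
    show "x \<oplus> y \<in> N" if "x \<in> N" "y \<in> N" for x y using N.m_closed[OF that] by (simp add: M)
    show "\<ominus> x \<in> N" if "x \<in> N" for x
      using N.m_inv_closed[OF that] a_inv_M[of x] that N(1) by (metis a_inv_def subsetD)
  qed (use N V(1) N.smult_closed smult(2) M in auto)
qed

lemma decomposition_splits:
  assumes d: "direct_decomp LR M G N" and f: "free_module_of_rank LR (M\<lparr>carrier := G\<rparr>) k"
  obtains Z where "Z \<subseteq> j ` V" "finite Z" "card Z = k" "j ` G = qspan A (p ^ n) Z"
    "splits A e (p ^ n) (j ` V) k" "j ` V = {g + w | g w. g \<in> j ` G \<and> w \<in> j ` N}"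
proof -
  have G: "submodule G LR M" and N: "submodule N LR M" and sum: "G <+>\<^bsub>M\<^esub> N = V" and int: "G \<inter> N = {\<zero>}"
    using d unfolding direct_decomp_def by (auto simp: M)
  note G' = submodule_image[OF G] and N' = submodule_image[OF N]
  have GL: "G \<subseteq> carrier L" and NL: "N \<subseteq> carrier L" using G'(1) N'(1) V(1) by blast+
  interpret G: power_module L j R p n G "M\<lparr>carrier := G\<rparr>" by (rule submodule_power_module[OF G'])
  obtain B where B: "finite B" "card B = k" "B \<subseteq> G" "module_independent LR (M\<lparr>carrier := G\<rparr>) B"
      "module_span LR (M\<lparr>carrier := G\<rparr>) B = G"
    using f unfolding free_module_of_rank_def module_basis_def by auto
  let ?Z = "j ` B"
  have inj: "inj_on j B" using j_inj B(3) GL by (meson inj_on_subset subset_trans)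
  have Zs: "j ` G = qspan A (p ^ n) ?Z" using G.span_image(1)[OF B(1,3)] B(5) by simp
  have ind: "indep_mod A {0} (p ^ n) {0} ?Z (\<lambda>x. x)" using G.independent_iff[OF B(1,3)] B(4) by blast
  have "e * z = z" if "z \<in> ?Z" for z using that B(3) GL j_unit by auto
  from C.dual_basis[OF _ this ind] obtain \<phi> where \<phi>: "dual_family A e (p ^ n) (j ` G) ?Z (\<lambda>z. z) \<phi>"
    unfolding Zs using B(1) by blast
  have Vs: "j ` V = {g + w | g w. g \<in> j ` G \<and> w \<in> j ` N}"
  proof -
    have "V = {g \<oplus> w | g w. g \<in> G \<and> w \<in> N}" unfolding sum[symmetric] set_add_def' by (auto simp: M)
    moreover have "j (g \<oplus> w) = j g + j w" if "g \<in> G" "w \<in> N" for g w using that GL NL j_add by blast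
    ultimately show ?thesis by (auto simp: image_iff) metis+
  qed
  have int': "j ` G \<inter> j ` N = {0}"
  proof -
    have "j ` G \<inter> j ` N = j ` (G \<inter> N)" using inj_on_image_Int[OF j_inj GL NL] by simp
    then show ?thesis using int by simp
  qed
  have u: "e * x = x" if "x \<in> j ` G \<union> j ` N" for x using that GL NL j_unit by auto
  from \<phi> have "\<exists>\<psi>. dual_family A e (p ^ n) (j ` V) ?Z (\<lambda>z. z) \<psi>"
    by (intro C.dual_family_summand[OF G'(2) N'(2) Vs int' u])
  then obtain \<psi> where "dual_family A e (p ^ n) (j ` V) ?Z (\<lambda>z. z) \<psi>" ..
  from splits_family[OF this] have sp: "splits A e (p ^ n) (j ` V) k" using B(1,2) card_image[OF inj] by simp
  have "?Z \<subseteq> j ` V" using B(3) G'(1) by blast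
  moreover have "finite ?Z" "card ?Z = k" using B(1,2) card_image[OF inj] by simp_all
  ultimately show ?thesis using Zs sp Vs by (rule that)
qed

lemma splits_decomposition_exists:
  assumes e0: "e \<noteq> 0" and s: "splits A e (p ^ n) (j ` V) k"
  shows "\<exists>G N. direct_decomp LR M G N \<and> free_module_of_rank LR (M\<lparr>carrier := G\<rparr>) k"
proof -
  obtain Z N' where Z: "Z \<subseteq> j ` V" "finite Z" "card Z = k" "indep_mod A {0} (p ^ n) {0} Z (\<lambda>x. x)"
    and N': "N' \<subseteq> j ` V" "pmodule A (p ^ n) N'" and sum: "j ` V = {g + w | g w. g \<in> qspan A (p ^ n) Z \<and> w \<in> N'}"
    and int: "qspan A (p ^ n) Z \<inter> N' = {0}"
    using C.splits_decomposition[OF jV_pmodule jV_unit e0 s] by blast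
  let ?G' = "qspan A (p ^ n) Z"
  have G'V: "?G' \<subseteq> j ` V" by (rule qspan_subset_pmodule[OF jV_pmodule Z(1)])
  obtain B where B: "B \<subseteq> V" "Z = j ` B" using Z(1) by (metis subset_imageE)
  obtain G where G: "G \<subseteq> V" "?G' = j ` G" using G'V by (metis subset_imageE)
  obtain N where N: "N \<subseteq> V" "N' = j ` N" using N'(1) by (metis subset_imageE)
  have L: "B \<subseteq> carrier L" "G \<subseteq> carrier L" "N \<subseteq> carrier L" using B(1) G(1) N(1) V(1) by blast+
  have inj: "inj_on j B" using j_inj L(1) by (meson inj_on_subset)
  have fB: "finite B" using Z(2) B(2) finite_imageD[OF _ inj] by blast
  have Gp: "pmodule A (p ^ n) (j ` G)" using C.qspan_pmodule' G(2) by metis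
  have "j ` B \<subseteq> j ` G" using C.qspan_base[of _ Z n] jV_unit Z(1) B(2) G(2) by blast
  then have BG: "B \<subseteq> G" using j_image_subset[OF L(1,2)] by blast
  interpret G: power_module L j R p n G "M\<lparr>carrier := G\<rparr>" by (rule submodule_power_module[OF G(1) Gp])
  have "j ` module_span LR (M\<lparr>carrier := G\<rparr>) B = j ` G" using G.span_image(1)[OF fB BG] B(2) G(2) by simp
  moreover have "module_span LR (M\<lparr>carrier := G\<rparr>) B \<subseteq> G" by (rule G.span_image(2)[OF fB BG])
  ultimately have "module_span LR (M\<lparr>carrier := G\<rparr>) B = G"
    using j_image_subset[of G "module_span LR (M\<lparr>carrier := G\<rparr>) B"] L(2) by blast
  moreover have "module_independent LR (M\<lparr>carrier := G\<rparr>) B" using G.independent_iff[OF fB BG] Z(4) B(2) by simp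
  ultimately have fr: "free_module_of_rank LR (M\<lparr>carrier := G\<rparr>) k"
    unfolding free_module_of_rank_def module_basis_def
    using fB BG Z(3) B(2) card_image[OF inj] by (intro exI[of _ B]) simp
  have "G <+>\<^bsub>M\<^esub> N = V"
  proof -
    have eq: "j (g \<oplus> w) = j g + j w" if "g \<in> G" "w \<in> N" for g w using that L j_add by blast
    have sub: "G <+>\<^bsub>M\<^esub> N \<subseteq> V" using G(1) N(1) V(3) by (auto simp: set_add_def' M)
    have "j ` V \<subseteq> j ` (G <+>\<^bsub>M\<^esub> N)"
    proof
      fix y assume "y \<in> j ` V"
      then obtain g w where "y = j g + j w" "g \<in> G" "w \<in> N" using sum G(2) N(2) by auto
      then show "y \<in> j ` (G <+>\<^bsub>M\<^esub> N)" using eq[of g w] by (auto simp: set_add_def' M intro!: image_eqI[of _ _ "g \<oplus> w"])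
    qed
    moreover have "G <+>\<^bsub>M\<^esub> N \<subseteq> carrier L" using sub V(1) by blast
    ultimately show ?thesis using sub j_image_subset[of V "G <+>\<^bsub>M\<^esub> N"] V(1) by blast
  qed
  moreover have "G \<inter> N = {\<zero>}"
  proof -
    have "j ` (G \<inter> N) = {0}" using int G(2) N(2) inj_on_image_Int[OF j_inj L(2,3)] by simp
    then have "j ` (G \<inter> N) = j ` {\<zero>}" by simp
    then show ?thesis using inj_on_image_eq_iff[OF j_inj, of "G \<inter> N" "{\<zero>}"] L by auto
  qed
  moreover have "submodule G LR M" "submodule N LR M"
    using submodule_preimage G(1) Gp N(1) N'(2) N(2) by auto
  ultimately have "direct_decomp LR M G N" unfolding direct_decomp_def by (simp add: M)
  then show ?thesis using fr by blast
qed

lemma max_free_rank_eq: "e \<noteq> 0 \<Longrightarrow> max_free_rank LR M = free_rank A e (p ^ n) (j ` V)"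
proof -
  assume e0: "e \<noteq> 0"
  have "{k. \<exists>G N. direct_decomp LR M G N \<and> free_module_of_rank LR (M\<lparr>carrier := G\<rparr>) k} =
      {k. splits A e (p ^ n) (j ` V) k}"
  proof (intro equalityI subsetI)
    fix k assume "k \<in> {k. \<exists>G N. direct_decomp LR M G N \<and> free_module_of_rank LR (M\<lparr>carrier := G\<rparr>) k}"
    then obtain G N where d: "direct_decomp LR M G N" and f: "free_module_of_rank LR (M\<lparr>carrier := G\<rparr>) k" by blast
    have "splits A e (p ^ n) (j ` V) k" by (rule decomposition_splits[OF d f])
    then show "k \<in> {k. splits A e (p ^ n) (j ` V) k}" ..
  next
    fix k assume "k \<in> {k. splits A e (p ^ n) (j ` V) k}"
    then have "splits A e (p ^ n) (j ` V) k" ..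
    from splits_decomposition_exists[OF e0 this]
    show "k \<in> {k. \<exists>G N. direct_decomp LR M G N \<and> free_module_of_rank LR (M\<lparr>carrier := G\<rparr>) k}" ..
  qed
  then show ?thesis unfolding max_free_rank_def free_rank_def by simp
qed

text \<open>A functional on \<open>V\<close> with a unit value on \<open>N\<close> would split off a
  free summand of rank one from \<open>N\<close>. Hence \<open>N\<close> lies in the nonsplit part
  of \<open>V\<close>, and the basis of \<open>G\<close> generates modulo it; this makes
  \<open>k\<close> the maximal free rank.\<close>

lemma nonfree_complement:
  assumes e0: "e \<noteq> 0" and m: "loc A e m" and d: "direct_decomp LR M G N"
    and f: "free_module_of_rank LR (M\<lparr>carrier := G\<rparr>) k" and nf: "no_free_summand LR (M\<lparr>carrier := N\<rparr>)"
  shows "splits A e (p ^ n) (j ` V) k" "generated_mod A (p ^ n) (j ` V) (nonsplit A m (p ^ n) (j ` V)) k"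
proof -
  obtain Z where Z: "Z \<subseteq> j ` V" "finite Z" "card Z = k" "j ` G = qspan A (p ^ n) Z"
    "splits A e (p ^ n) (j ` V) k" "j ` V = {g + w | g w. g \<in> j ` G \<and> w \<in> j ` N}"
    using decomposition_splits[OF d f] by blast
  show "splits A e (p ^ n) (j ` V) k" by (rule Z(5))
  have N: "submodule N LR M" using d unfolding direct_decomp_def by blast
  note N' = submodule_image[OF N]
  have eA: "e \<in> A" by (rule jR.one_mem)
  have inv: "\<exists>b\<in>A. x * b = e" if "x \<in> A" "x \<notin> m" for x using m that unfolding loc_def by blast
  interpret N: power_module L j R p n N "M\<lparr>carrier := N\<rparr>" by (rule submodule_power_module[OF N'])
  have NV: "j ` N \<subseteq> j ` V" using N'(1) by blast
  have "\<phi> y \<in> m" if L: "qlin A (p ^ n) (j ` V) \<phi>" and y: "y \<in> j ` N" for \<phi> y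
  proof (rule ccontr)
    assume "\<phi> y \<notin> m"
    moreover have "\<phi> y \<in> A" using y NV by (intro qlinD(1)[OF L]) blast
    ultimately obtain b where b: "b \<in> A" "\<phi> y * b = e" using inv[of "\<phi> y"] by blast
    have by': "b ^ p ^ n * y \<in> j ` N" by (rule pmodule_smult[OF N'(2) b(1) y])
    have "qlin A (p ^ n) (j ` N) \<phi>"
      by (rule qlin_subset[OF L NV])
    moreover have "\<phi> (b ^ p ^ n * y) = e" using qlinD(3)[OF L b(1)] y NV b(2) by (auto simp: mult.commute)
    ultimately have "dual_family A e (p ^ n) (j ` N) {0::nat} (\<lambda>_. b ^ p ^ n * y) (\<lambda>_. \<phi>)"
      using by' unfolding dual_family_def by simp
    from splits_family[OF this] have "splits A e (p ^ n) (j ` N) 1" by simp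
    from N.splits_decomposition_exists[OF e0 this] obtain G1 N1 where
      1: "direct_decomp LR (M\<lparr>carrier := N\<rparr>) G1 N1" "free_module_of_rank LR (M\<lparr>carrier := N\<rparr>\<lparr>carrier := G1\<rparr>) 1" by blast
    then have "free_module LR (M\<lparr>carrier := N\<rparr>\<lparr>carrier := G1\<rparr>)"
      unfolding free_module_def free_module_of_rank_def by blast
    then have G1: "G1 = {\<zero>}" using nf 1(1) unfolding no_free_summand_def by (auto simp: M)
    obtain B where B: "finite B" "card B = 1" "B \<subseteq> G1" "module_independent LR (M\<lparr>carrier := N\<rparr>\<lparr>carrier := G1\<rparr>) B"
      using 1(2) unfolding free_module_of_rank_def module_basis_def by auto
    \<comment> \<open>The hypothesis on \<open>N\<close> says that the summand is zero, so its
      one-element basis is {0}; independence of the zero vector contradicts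
      \<open>e \<noteq> 0\<close>.\<close>
    have B0: "B = {\<zero>}" using B(2,3) G1 by (metis card.empty subset_singletonD zero_neq_one)
    have sG: "submodule G1 LR (M\<lparr>carrier := N\<rparr>)" using 1(1) unfolding direct_decomp_def by blast
    interpret G1: power_module L j R p n G1 "M\<lparr>carrier := N\<rparr>\<lparr>carrier := G1\<rparr>"
      by (rule N.submodule_power_module[OF N.submodule_image[OF sG]])
    have "indep_mod A {0} (p ^ n) {0} {0} (\<lambda>x. x)" using G1.independent_iff[OF B(1,3)] B(4) unfolding B0 by simp
    then have "e \<in> {0}" using indep_modD[of A "{0}" "p ^ n" "{0}" "{0}" "\<lambda>x. x" "\<lambda>_. e" 0] eA by auto
    then show False using e0 by simp
  qed
  then have Nn: "j ` N \<subseteq> nonsplit A m (p ^ n) (j ` V)" using NV unfolding nonsplit_def by blast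
  let ?S = "qspan A (p ^ n) (nonsplit A m (p ^ n) (j ` V) \<union> Z)"
  have "j ` N \<subseteq> ?S" using Nn jV_unit NV by (blast intro!: C.qspan_base)
  moreover have "j ` G \<subseteq> ?S" unfolding Z(4) by (rule qspan_mono) auto
  ultimately have "j ` V \<subseteq> ?S" unfolding Z(6) using qspan_add by blast
  then show "generated_mod A (p ^ n) (j ` V) (nonsplit A m (p ^ n) (j ` V)) k"
    unfolding generated_mod_def using Z(1-3) by blast
qed

lemma finitely_generated_image:
  assumes "finitely_generated_module LR M"
  shows "\<exists>Y\<subseteq>j ` V. finite Y \<and> j ` V \<subseteq> qspan A (p ^ n) Y"
proof -
  obtain B where B: "B \<subseteq> V" "finite B" "module_span LR M B = V"
    using assms unfolding finitely_generated_module_def by (auto simp: M)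
  then show ?thesis using span_image(1)[OF B(2,1)] by (intro exI[of _ "j ` B"]) auto
qed

end

section \<open>Frobenius modules and the extension as power modules\<close>

context embedded_subring begin

lemma frobenius_power_module:
  assumes "char_p_subring (j ` R) (j \<one>) p"
  shows "power_module L j R p n R (frobenius_module p n LR)"
proof -
  interpret C: char_p_subring "j ` R" "j \<one>" p by (rule assms)
  have q: "0 < p ^ n" by (rule C.q_pos)
  have sm: "r [^] (p ^ n) \<in> R" if "r \<in> R" for r using R.nat_pow_closed[of r "p ^ n"] that by (simp add: pow_R)
  show ?thesis
  proof (intro power_module.intro power_module_axioms.intro embedded_subring_axioms assms)
    show "r \<odot>\<^bsub>frobenius_module p n LR\<^esub> x \<in> R" if "r \<in> R" "x \<in> R" for r x
      using subringE(6)[OF subring sm[OF that(1)] that(2)] by (simp add: frobenius_module_def pow_R)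
    show "j (r \<odot>\<^bsub>frobenius_module p n LR\<^esub> x) = j r ^ (p ^ n) * j x" if "r \<in> R" "x \<in> R" for r x
    proof -
      have "j (r [^] (p ^ n)) = j r ^ (p ^ n)" using j_pow[OF R_carrier[OF that(1)], of "p ^ n"] q by (metis less_numeral_extra(3))
      then show ?thesis
        using j_mult[OF R_carrier[OF sm[OF that(1)]] R_carrier[OF that(2)]] by (simp add: frobenius_module_def pow_R)
    qed
  qed (use R_subset subringE[OF subring] in \<open>auto simp: frobenius_module_def\<close>)
qed

lemma extension_power_module:
  assumes "char_p_subring (j ` R) (j \<one>) p" and S: "subring S L" "R \<subseteq> S"
  shows "power_module L j R p 0 S (ring_as_module (L\<lparr>carrier := S\<rparr>))"
proof (intro power_module.intro power_module_axioms.intro embedded_subring_axioms assms(1))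
  have SL: "S \<subseteq> carrier L" using subringE(1)[OF S(1)] .
  show "j (r \<odot>\<^bsub>ring_as_module (L\<lparr>carrier := S\<rparr>)\<^esub> x) = j r ^ (p ^ 0) * j x" if "r \<in> R" "x \<in> S" for r x
    using j_mult[of r x] that S(2) SL by (auto simp: ring_as_module_def)
qed (use subringE[OF S(1)] S(2) in \<open>auto simp: ring_as_module_def\<close>)

end

section \<open>Degrees of field extensions\<close>

text \<open>The indices may be lifts with \<open>v\<close> the residue class map, so distinctness is
  asked of the lifts and coefficients are functions on them.\<close>

lemma (in field) dim_eqI:
  assumes K: "subfield K R" and xs: "distinct is" and v: "v ` set is \<subseteq> carrier R"
    and ind: "\<And>c i. c \<in> set is \<rightarrow> K \<Longrightarrow> combine (map c is) (map v is) = \<zero> \<Longrightarrow> i \<in> set is \<Longrightarrow> c i = \<zero>"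
    and span: "\<And>x. x \<in> carrier R \<Longrightarrow> \<exists>c\<in>set is \<rightarrow> K. x = combine (map c is) (map v is)"
  shows "dim K (carrier R) = length is"
proof -
  let ?vs = "map v is"
  have vs: "set ?vs \<subseteq> carrier R" using v by simp
  have coeff: "\<exists>c. Ks = map c is" if "length Ks = length is" for Ks :: "'a list"
    using map_of_zip_map that by (intro exI[of _ "\<lambda>i. the (map_of (zip is Ks) i)"] nth_equalityI)
      (auto simp: map_of_zip_nth[OF _ xs])
  have "independent K ?vs"
  proof (rule ccontr)
    assume "\<not> independent K ?vs"
    from dependent_imp_non_trivial_combine[OF K vs this] obtain Ks
      where Ks: "length Ks = length ?vs" "combine Ks ?vs = \<zero>" "set Ks \<subseteq> K" "set Ks \<noteq> {\<zero>}" by blast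
    obtain c where c: "Ks = map c is" using coeff[of Ks] Ks(1) by auto
    have "c \<in> set is \<rightarrow> K" using Ks(3) unfolding c by auto
    then have "\<forall>i\<in>set is. c i = \<zero>" using ind[of c] Ks(2) unfolding c by blast
    then have "set Ks \<subseteq> {\<zero>}" unfolding c by auto
    then have "Ks = []" using Ks(4) by (metis set_empty subset_singletonD)
    then have "?vs = []" using Ks(1) by simp
    then show False using \<open>\<not> independent K ?vs\<close> by simp
  qed
  moreover have "Span K ?vs = carrier R"
  proof
    show "Span K ?vs \<subseteq> carrier R" using Span_in_carrier[OF subfieldE(3)[OF K] vs] .
    show "carrier R \<subseteq> Span K ?vs"
    proof
      fix x assume "x \<in> carrier R"
      from span[OF this] obtain c where c: "c \<in> set is \<rightarrow> K" "x = combine (map c is) ?vs" by blast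
      then show "x \<in> Span K ?vs"
        unfolding Span_mem_iff_length_version[OF K vs] by (intro exI[of _ "map c is"]) auto
    qed
  qed
  ultimately have "dimension (length ?vs) K (carrier R)" using dimension_independent by metis
  then show ?thesis using dimI[OF K] unfolding over_def by simp
qed

context ring_embedding begin

lemma j_combine:
  assumes "distinct bs" "set bs \<subseteq> carrier L" "c \<in> set bs \<rightarrow> carrier L"
  shows "j (combine (map c bs) bs) = (\<Sum>b\<in>set bs. j (c b) * j b)"
  using assms
proof (induction bs)
  case (Cons b bs)
  have "combine (map c bs) bs \<in> carrier L" using Cons.prems by (intro combine_in_carrier) auto
  then have "j (combine (map c (b # bs)) (b # bs)) = j (c b) * j b + j (combine (map c bs) bs)"
    using Cons.prems by (simp add: j_add j_mult)
  then show ?case using Cons by simp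
qed simp

end

section \<open>Fraction fields and residue fields of embedded rings\<close>

context embedded_subring begin

lemma fractions_carrier: "fractions_in L R \<subseteq> carrier L"
  using R_carrier by (auto simp: fractions_in_def field_Units)

lemma fractionI: "x \<in> carrier L \<Longrightarrow> d \<in> R \<Longrightarrow> d \<noteq> \<zero> \<Longrightarrow> d \<otimes> x \<in> R \<Longrightarrow> x \<in> fractions_in L R"
proof -
  assume x: "x \<in> carrier L" and d: "d \<in> R" "d \<noteq> \<zero>" "d \<otimes> x \<in> R"
  have u: "d \<in> Units L" using d(1,2) R_carrier by (simp add: field_Units)
  have "x = (d \<otimes> x) \<otimes> inv d"
    using x u R_carrier[OF d(1)] by (metis L.Units_inv_closed L.Units_r_inv L.m_assoc L.m_comm L.m_closed L.r_one)
  then show "x \<in> fractions_in L R" using d by (auto simp: fractions_in_def)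
qed

lemma fractionE:
  assumes "x \<in> fractions_in L R" obtains d where "d \<in> R" "d \<noteq> \<zero>" "d \<otimes> x \<in> R"
proof -
  obtain a d where ad: "a \<in> R" "d \<in> R" "d \<noteq> \<zero>" "x = a \<otimes> inv d" using assms by (auto simp: fractions_in_def)
  have u: "d \<in> Units L" using ad R_carrier by (simp add: field_Units)
  have "d \<otimes> x = a" unfolding ad(4)
    using u R_carrier[OF ad(1)] R_carrier[OF ad(2)] by (metis L.Units_inv_closed L.Units_r_inv L.m_lcomm L.r_one)
  then show ?thesis using ad that by simp
qed

lemma fractions_subfield: "subfield (fractions_in L R) L"
proof (rule subfieldI'[OF subringI])
  let ?K = "fractions_in L R"
  show "?K \<subseteq> carrier L" by (rule fractions_carrier)
  show "\<one> \<in> ?K" using fractionI[of \<one> \<one>] subringE(3)[OF subring] by simp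
  show "\<ominus> x \<in> ?K" if x: "x \<in> ?K" for x
  proof -
    have xL: "x \<in> carrier L" using x fractions_carrier by blast
    obtain d where d: "d \<in> R" "d \<noteq> \<zero>" "d \<otimes> x \<in> R" using fractionE[OF x] by blast
    have "d \<otimes> \<ominus> x = \<ominus> (d \<otimes> x)" using xL R_carrier[OF d(1)] by (simp add: L.r_minus)
    then show ?thesis using fractionI[OF _ d(1,2)] subringE(5)[OF subring d(3)] xL by simp
  qed
  fix x y assume x: "x \<in> ?K" and y: "y \<in> ?K"
  have xL: "x \<in> carrier L" and yL: "y \<in> carrier L" using x y fractions_carrier by blast+
  obtain d where d: "d \<in> R" "d \<noteq> \<zero>" "d \<otimes> x \<in> R" using fractionE[OF x] by blast
  obtain d' where d': "d' \<in> R" "d' \<noteq> \<zero>" "d' \<otimes> y \<in> R" using fractionE[OF y] by blast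
  note c = R_carrier[OF d(1)] R_carrier[OF d'(1)] xL yL
  have dd: "d \<otimes> d' \<in> R" "d \<otimes> d' \<noteq> \<zero>"
    using subringE(6)[OF subring d(1) d'(1)] integral[of d d'] c d(2) d'(2) by auto
  have "(d \<otimes> d') \<otimes> (x \<otimes> y) = (d \<otimes> x) \<otimes> (d' \<otimes> y)" using c by (simp add: L.m_ac)
  then show "x \<otimes> y \<in> ?K" using fractionI[OF _ dd] subringE(6)[OF subring d(3) d'(3)] c by simp
  have "(d \<otimes> d') \<otimes> (x \<oplus> y) = d' \<otimes> (d \<otimes> x) \<oplus> d \<otimes> (d' \<otimes> y)" using c by (simp add: L.r_distr L.m_ac)
  moreover have "d' \<otimes> (d \<otimes> x) \<oplus> d \<otimes> (d' \<otimes> y) \<in> R"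
    by (intro subringE(7)[OF subring] subringE(6)[OF subring] d d')
  ultimately show "x \<oplus> y \<in> ?K" using fractionI[OF _ dd] c by simp
next
  fix k assume k: "k \<in> fractions_in L R - {\<zero>}"
  then have kL: "k \<in> carrier L" "k \<noteq> \<zero>" using fractions_carrier by blast+
  have u: "k \<in> Units L" using kL by (simp add: field_Units)
  obtain d where d: "d \<in> R" "d \<noteq> \<zero>" "d \<otimes> k \<in> R" using k fractionE by blast
  have "d \<otimes> k \<noteq> \<zero>" using integral[of d k] kL d(2) R_carrier[OF d(1)] by auto
  moreover have "(d \<otimes> k) \<otimes> inv k = d" using u kL R_carrier[OF d(1)] by (simp add: L.m_assoc)
  ultimately show "inv k \<in> fractions_in L R" using fractionI[of "inv k" "d \<otimes> k"] d u by simp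
qed

lemma common_denominator:
  assumes "finite F" "c \<in> F \<rightarrow> fractions_in L R"
  shows "\<exists>d\<in>R. d \<noteq> \<zero> \<and> (\<forall>b\<in>F. d \<otimes> c b \<in> R)"
  using assms
proof (induction F rule: finite_induct)
  case empty
  then show ?case using subringE(3)[OF subring] by (intro bexI[of _ \<one>]) auto
next
  case (insert x F)
  obtain d where d: "d \<in> R" "d \<noteq> \<zero>" "\<And>b. b \<in> F \<Longrightarrow> d \<otimes> c b \<in> R" using insert by auto
  obtain d' where d': "d' \<in> R" "d' \<noteq> \<zero>" "d' \<otimes> c x \<in> R" using fractionE[of "c x"] insert.prems by blast
  have cL: "c b \<in> carrier L" if "b \<in> insert x F" for b using that insert.prems fractions_carrier by blast
  note dL = R_carrier[OF d(1)] R_carrier[OF d'(1)]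
  have "d \<otimes> d' \<noteq> \<zero>" using integral[of d d'] dL d(2) d'(2) by auto
  moreover have "(d \<otimes> d') \<otimes> c b \<in> R" if b: "b \<in> insert x F" for b
  proof (cases "b = x")
    case True
    have "(d \<otimes> d') \<otimes> c x = d \<otimes> (d' \<otimes> c x)" using dL cL[of x] by (simp add: L.m_assoc)
    then show ?thesis using subringE(6)[OF subring d(1) d'(3)] True by simp
  next
    case False
    have "(d \<otimes> d') \<otimes> c b = d' \<otimes> (d \<otimes> c b)" using dL cL[OF b] by (simp add: L.m_ac)
    then show ?thesis using subringE(6)[OF subring d'(1) d(3)] b False by simp
  qed
  ultimately show ?case using subringE(6)[OF subring d(1) d'(1)] by blast
qed

text \<open>A common denominator turns relations over the fraction field into relations over
  \<open>R\<close>; the spanning hypothesis has its denominators cleared for the same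
  reason.\<close>

lemma degree_eq_card:
  assumes T: "finite T" "T \<subseteq> carrier L" and ind: "indep_mod (j ` R) {0} (p ^ 0) {0} (j ` T) (\<lambda>x. x)"
    and span: "\<And>x. x \<in> carrier L \<Longrightarrow> \<exists>d\<in>R. d \<noteq> \<zero> \<and> (\<exists>a\<in>T \<rightarrow> R. j d * j x = (\<Sum>t\<in>T. j (a t) * j t))"
  shows "ring.dim L (fractions_in L R) (carrier L) = card T"
proof -
  let ?K = "fractions_in L R"
  obtain ts where ts: "set ts = T" "distinct ts" using finite_distinct_list[OF T(1)] by blast
  have inj: "inj_on j T" using j_inj T(2) inj_on_subset by blast
  have "dim ?K (carrier L) = length ts"
  proof (rule dim_eqI[OF fractions_subfield ts(2), where v = "\<lambda>x. x"])
    show "(\<lambda>x. x) ` set ts \<subseteq> carrier L" using ts(1) T(2) by simp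
    fix c i assume c: "c \<in> set ts \<rightarrow> ?K" "combine (map c ts) (map (\<lambda>x. x) ts) = \<zero>" and i: "i \<in> set ts"
    have cL: "c b \<in> carrier L" if "b \<in> T" for b using c(1) that ts(1) fractions_carrier by blast
    have sum: "(\<Sum>b\<in>T. j (c b) * j b) = 0"
      using j_combine[OF ts(2), of c] c(2) cL T(2) ts(1) by auto
    obtain d where d: "d \<in> R" "d \<noteq> \<zero>" "\<And>b. b \<in> T \<Longrightarrow> d \<otimes> c b \<in> R"
      using common_denominator[OF T(1), of c] c(1) ts(1) by blast
    have "(\<Sum>z\<in>j ` T. j (d \<otimes> c (inv_into T j z)) ^ (p ^ 0) * z) = (\<Sum>b\<in>T. j (d \<otimes> c b) * j b)"
      by (simp add: sum.reindex[OF inj] inj)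
    also have "\<dots> = j d * (\<Sum>b\<in>T. j (c b) * j b)"
      unfolding sum_distrib_left using cL R_carrier[OF d(1)] by (intro sum.cong) (auto simp: j_mult mult.assoc)
    finally have "(\<Sum>z\<in>j ` T. j (d \<otimes> c (inv_into T j z)) ^ (p ^ 0) * z) \<in> {0}" using sum by simp
    moreover have "(\<lambda>z. j (d \<otimes> c (inv_into T j z))) \<in> j ` T \<rightarrow> j ` R" using d(3) inj by auto
    ultimately have "j (d \<otimes> c (inv_into T j (j i))) \<in> {0}"
      using indep_modD[OF ind, of "\<lambda>z. j (d \<otimes> c (inv_into T j z))" "j i"] i ts(1) by blast
    then have "j (d \<otimes> c i) = 0" using i ts(1) inj by simp
    then have "d \<otimes> c i = \<zero>" using j_eq_0_iff cL[of i] R_carrier[OF d(1)] i ts(1) by simp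
    then show "c i = \<zero>" using integral[of d "c i"] d(2) cL[of i] R_carrier[OF d(1)] i ts(1) by blast
  next
    fix x assume x: "x \<in> carrier L"
    from span[OF x] obtain d a where d: "d \<in> R" "d \<noteq> \<zero>" and a: "a \<in> T \<rightarrow> R"
      and eq: "j d * j x = (\<Sum>t\<in>T. j (a t) * j t)" by blast
    have u: "d \<in> Units L" using d R_carrier by (simp add: field_Units)
    have dL: "d \<in> carrier L" "inv d \<in> carrier L" using R_carrier[OF d(1)] u by auto
    have aL: "a t \<in> carrier L" if "t \<in> T" for t using a that R_carrier by blast
    define c where "c t = a t \<otimes> inv d" for t
    have cK: "c \<in> set ts \<rightarrow> ?K" using a d ts(1) unfolding c_def fractions_in_def by auto
    have cL: "c \<in> set ts \<rightarrow> carrier L" using aL dL ts(1) unfolding c_def by auto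
    have inv: "j (inv d) * j d = j \<one>" using u dL by (simp flip: j_mult)
    have "j (combine (map c ts) ts) = (\<Sum>t\<in>T. j (c t) * j t)"
      using j_combine[OF ts(2) _ cL] T(2) ts(1) by simp
    also have "\<dots> = (\<Sum>t\<in>T. j (inv d) * (j (a t) * j t))"
      using aL dL by (intro sum.cong) (auto simp: c_def j_mult ac_simps)
    also have "\<dots> = j (inv d) * (j d * j x)" unfolding eq sum_distrib_left ..
    also have "\<dots> = j x" using inv j_unit[OF x] by (simp flip: mult.assoc)
    finally have "combine (map c ts) ts = x"
      using j_eq_iff x cL T(2) ts(1) by (auto intro!: j_eq_iff[THEN iffD1] combine_in_carrier)
    then show "\<exists>c\<in>set ts \<rightarrow> ?K. x = combine (map c ts) (map (\<lambda>x. x) ts)" using cK by auto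
  qed
  then show ?thesis using distinct_card[OF ts(2)] ts(1) by simp
qed

text \<open>Links \<open>card W\<close> to the degree in the definition of \<alpha>: independence
  and generation modulo the maximal ideal become those of the residue classes over the field of p-th
  powers.\<close>

lemma residue_degree:
  assumes ch: "prime_char p LR" and loc: "local_ring LR" and W: "residue_basis (j ` R) (j ` max_ideal LR) p W"
  shows "ring.dim (residue_field LR) ((\<lambda>x. x [^]\<^bsub>residue_field LR\<^esub> p) ` carrier (residue_field LR))
    (carrier (residue_field LR)) = card W"
proof -
  let ?M = "max_ideal LR" and ?k = "residue_field LR"
  interpret C: char_p_subring "j ` R" "j \<one>" p by (rule char_p_R[OF ch])
  interpret M: maximalideal ?M LR by (rule maximalideal_unique(1)[OF loc])
  interpret k: field ?k unfolding residue_field_def by (rule M.quotient_is_field[OF cring_R])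
  define \<pi> where "\<pi> a = ?M +>\<^bsub>LR\<^esub> a" for a
  have p0: "p \<noteq> 0" using C.prime_p by auto
  have MR: "?M \<subseteq> R" using M.a_subset by simp
  have MC: "?M \<subseteq> carrier L" using MR R_subset by blast
  have hom: "\<pi> \<in> ring_hom LR ?k" using M.rcos_ring_hom unfolding \<pi>_def residue_field_def .
  have pi_closed: "\<pi> a \<in> carrier ?k" if "a \<in> R" for a using ring_hom_closed[OF hom] that by simp
  have pi_add: "\<pi> (a \<oplus> b) = \<pi> a \<oplus>\<^bsub>?k\<^esub> \<pi> b" if "a \<in> R" "b \<in> R" for a b using ring_hom_add[OF hom] that by simp
  have pi_mult: "\<pi> (a \<otimes> b) = \<pi> a \<otimes>\<^bsub>?k\<^esub> \<pi> b" if "a \<in> R" "b \<in> R" for a b using ring_hom_mult[OF hom] that by simp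
  have pi_one: "\<pi> \<one> = \<one>\<^bsub>?k\<^esub>" using ring_hom_one[OF hom] by simp
  have k0: "\<zero>\<^bsub>?k\<^esub> = ?M" by (simp add: residue_field_def FactRing_def)
  have pi_0: "\<pi> a = \<zero>\<^bsub>?k\<^esub> \<longleftrightarrow> a \<in> ?M" if "a \<in> R" for a
    using R.a_rcos_zero[OF M.is_ideal, of a] M.rcos_const_imp_mem[of a] that unfolding k0 \<pi>_def by auto
  have pi_surj: "\<exists>a\<in>R. x = \<pi> a" if "x \<in> carrier ?k" for x
    using that by (auto simp: residue_field_def FactRing_def A_RCOSETS_def' \<pi>_def)
  have Rpow: "a [^] n \<in> R" if "a \<in> R" for a and n :: nat using R.nat_pow_closed[of a n] that by (simp add: pow_R)
  have pi_pow: "\<pi> (a [^] (n::nat)) = \<pi> a [^]\<^bsub>?k\<^esub> n" if "a \<in> R" for a n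
    by (induction n) (simp_all add: pi_one pi_mult that Rpow)
  have jpow: "j (a [^] p) = j a ^ p" if "a \<in> R" for a using j_pow[OF R_carrier[OF that], of p] p0 by simp
  note Radd = subringE(7)[OF subring] and Rmult = subringE(6)[OF subring] and Rneg = subringE(5)[OF subring]
  have frob: "(a \<oplus> b) [^] p = a [^] p \<oplus> b [^] p" if "a \<in> R" "b \<in> R" for a b
  proof -
    have "j ((a \<oplus> b) [^] p) = j (a [^] p \<oplus> b [^] p)"
      using that Radd Rpow jpow C.add_pow_p[of "j a" "j b"] R_carrier by (simp add: j_add)
    then show ?thesis using j_eq_iff that Radd Rpow R_carrier by simp
  qed
  let ?F = "\<lambda>x. x [^]\<^bsub>?k\<^esub> p"
  let ?P = "?F ` carrier ?k"
  have P: "?P = (\<lambda>a. \<pi> (a [^] p)) ` R" using pi_surj pi_closed by (force simp: pi_pow)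
  \<comment> \<open>Closure under addition is the additivity of p-th powers in \<open>R\<close>,
    carried over by the residue map.\<close>
  have subf: "subfield ?P ?k"
  proof (rule k.subfieldI'[OF k.subringI])
    show "?P \<subseteq> carrier ?k" by auto
    show "\<one>\<^bsub>?k\<^esub> \<in> ?P" by (rule image_eqI[of _ _ "\<one>\<^bsub>?k\<^esub>"]) simp_all
    fix x y assume "x \<in> ?P" "y \<in> ?P"
    then obtain a b where a: "a \<in> R" "x = \<pi> (a [^] p)" and b: "b \<in> R" "y = \<pi> (b [^] p)" unfolding P by blast
    have "x \<oplus>\<^bsub>?k\<^esub> y = \<pi> ((a \<oplus> b) [^] p)" using a b frob pi_add Rpow by simp
    then show "x \<oplus>\<^bsub>?k\<^esub> y \<in> ?P" unfolding P using Radd[OF a(1) b(1)] by blast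
    have "x \<otimes>\<^bsub>?k\<^esub> y = \<pi> ((a \<otimes> b) [^] p)"
      using a b Rpow R_carrier by (simp add: pi_mult[symmetric] L.nat_pow_distrib)
    then show "x \<otimes>\<^bsub>?k\<^esub> y \<in> ?P" unfolding P using Rmult[OF a(1) b(1)] by blast
  next
    fix x assume "x \<in> ?P"
    then obtain a where a: "a \<in> R" "x = \<pi> (a [^] p)" unfolding P by blast
    have "(a \<oplus> \<ominus> a) [^] p = a [^] p \<oplus> (\<ominus> a) [^] p" by (rule frob[OF a(1) Rneg[OF a(1)]])
    then have "\<zero> = a [^] p \<oplus> (\<ominus> a) [^] p" using a(1) R_carrier p0 by (simp add: L.r_neg nat_pow_zero)
    then have "\<pi> \<zero> = x \<oplus>\<^bsub>?k\<^esub> \<pi> ((\<ominus> a) [^] p)" using a Rpow Rneg pi_add by metis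
    moreover have "\<pi> \<zero> = \<zero>\<^bsub>?k\<^esub>" using pi_0[of \<zero>] M.zero_closed subringE(2)[OF subring] by simp
    ultimately have "\<ominus>\<^bsub>?k\<^esub> x = \<pi> ((\<ominus> a) [^] p)"
      using k.minus_equality[of "\<pi> ((\<ominus> a) [^] p)" x] a pi_closed Rpow Rneg k.a_comm by metis
    then show "\<ominus>\<^bsub>?k\<^esub> x \<in> ?P" unfolding P using Rneg[OF a(1)] by blast
  next
    fix x assume x: "x \<in> ?P - {\<zero>\<^bsub>?k\<^esub>}"
    then obtain y where y: "y \<in> carrier ?k" "x = ?F y" by blast
    have "y \<noteq> \<zero>\<^bsub>?k\<^esub>" using x y p0 by (auto simp: k.nat_pow_zero)
    then have u: "y \<in> Units ?k" using y(1) by (simp add: k.field_Units)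
    have iu: "inv\<^bsub>?k\<^esub> y \<in> carrier ?k" using u by simp
    have "?F (inv\<^bsub>?k\<^esub> y) \<otimes>\<^bsub>?k\<^esub> x = \<one>\<^bsub>?k\<^esub>"
      unfolding y(2) using k.nat_pow_distrib[OF iu y(1), of p] u by simp
    then have "inv\<^bsub>?k\<^esub> x = ?F (inv\<^bsub>?k\<^esub> y)"
      using k.inv_unique'[of x "?F (inv\<^bsub>?k\<^esub> y)"] y iu by (simp add: k.m_comm)
    then show "inv\<^bsub>?k\<^esub> x \<in> ?P" using iu by blast
  qed
  define V where "V = {x \<in> R. j x \<in> W}"
  have VR: "V \<subseteq> R" and VL: "V \<subseteq> carrier L" using R_carrier by (auto simp: V_def)
  have W': "finite W" "W \<subseteq> j ` R" "indep_mod (j ` R) (j ` ?M) (p ^ 1) (j ` ?M) W (\<lambda>x. x)"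
    "j ` R \<subseteq> qspan (j ` R) (p ^ 1) (j ` ?M \<union> W)"
    using W unfolding residue_basis_def by simp_all
  have VW: "W = j ` V" using W'(2) by (auto simp: V_def)
  have inj: "inj_on j V" using j_inj VL inj_on_subset by blast
  have fV: "finite V" using W'(1) finite_imageD[OF _ inj] unfolding VW by blast
  obtain ws where ws: "set ws = V" "distinct ws" using finite_distinct_list[OF fV] by blast
  \<comment> \<open>The same coefficients produce an element of \<open>R\<close> and, through
    \<open>k.combine\<close>, its residue class; this links sums over embedded sets with
    combinations of lists.\<close>
  have comb: "\<exists>x\<in>R. j x = (\<Sum>w\<in>set us. j (a w) ^ p * j w) \<and>
      k.combine (map (\<lambda>w. \<pi> (a w [^] p)) us) (map \<pi> us) = \<pi> x"
    if "distinct us" "set us \<subseteq> R" "a \<in> set us \<rightarrow> R" for us a using that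
  proof (induction us)
    case Nil
    have "\<pi> \<zero> = \<zero>\<^bsub>?k\<^esub>" using pi_0[of \<zero>] M.zero_closed subringE(2)[OF subring] by simp
    then show ?case using subringE(2)[OF subring] by (intro bexI[of _ \<zero>]) simp_all
  next
    case (Cons u us)
    then obtain x where x: "x \<in> R" "j x = (\<Sum>w\<in>set us. j (a w) ^ p * j w)"
      "k.combine (map (\<lambda>w. \<pi> (a w [^] p)) us) (map \<pi> us) = \<pi> x" by auto
    have u: "u \<in> R" "a u \<in> R" using Cons.prems by auto
    have au: "a u [^] p \<otimes> u \<in> R" by (rule Rmult[OF Rpow[OF u(2)] u(1)])
    show ?case
    proof (intro bexI[of _ "(a u [^] p \<otimes> u) \<oplus> x"] conjI)
      show "(a u [^] p \<otimes> u) \<oplus> x \<in> R" by (rule Radd[OF au x(1)])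
      have "j ((a u [^] p \<otimes> u) \<oplus> x) = j (a u) ^ p * j u + j x"
        using R_carrier[OF au] R_carrier[OF x(1)] R_carrier[OF u(1)] R_carrier[OF Rpow[OF u(2)]] jpow[OF u(2)]
        by (simp add: j_add j_mult)
      then show "j ((a u [^] p \<otimes> u) \<oplus> x) = (\<Sum>w\<in>set (u # us). j (a w) ^ p * j w)" using Cons.prems(1) x(2) by simp
      show "k.combine (map (\<lambda>w. \<pi> (a w [^] p)) (u # us)) (map \<pi> (u # us)) = \<pi> ((a u [^] p \<otimes> u) \<oplus> x)"
        using x(3) pi_add[OF au x(1)] pi_mult[OF Rpow[OF u(2)] u(1)] by simp
    qed
  qed
  have "k.dim ?P (carrier ?k) = length ws"
  proof (rule k.dim_eqI[OF subf ws(2), where v = \<pi>])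
    show "\<pi> ` set ws \<subseteq> carrier ?k" using pi_closed VR ws(1) by blast
    fix c i assume c: "c \<in> set ws \<rightarrow> ?P" "k.combine (map c ws) (map \<pi> ws) = \<zero>\<^bsub>?k\<^esub>" and i: "i \<in> set ws"
    have "\<forall>w\<in>set ws. \<exists>a\<in>R. c w = \<pi> (a [^] p)" using c(1) unfolding P by blast
    then obtain a where a: "\<And>w. w \<in> set ws \<Longrightarrow> a w \<in> R" "\<And>w. w \<in> set ws \<Longrightarrow> c w = \<pi> (a w [^] p)" by metis
    have ca: "map c ws = map (\<lambda>w. \<pi> (a w [^] p)) ws" using a(2) by simp
    obtain x where x: "x \<in> R" "j x = (\<Sum>w\<in>set ws. j (a w) ^ p * j w)" "\<pi> x = \<zero>\<^bsub>?k\<^esub>"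
      using comb[OF ws(2), of a] a(1) VR ws(1) c(2) unfolding ca by auto
    have "(\<Sum>z\<in>W. j (a (inv_into V j z)) ^ (p ^ 1) * z) = j x"
      unfolding VW x(2) ws(1) by (simp add: sum.reindex[OF inj] inj)
    moreover have "j x \<in> j ` ?M" using x(1,3) pi_0 by blast
    moreover have "(\<lambda>z. j (a (inv_into V j z))) \<in> W \<rightarrow> j ` R" unfolding VW using a(1) ws(1) inj by auto
    ultimately have "j (a (inv_into V j (j i))) \<in> j ` ?M"
      using indep_modD[OF W'(3), of "\<lambda>z. j (a (inv_into V j z))" "j i"] i ws(1) VW by auto
    then have "j (a i) \<in> j ` ?M" using i ws(1) inj by simp
    then have "\<pi> (a i) = \<zero>\<^bsub>?k\<^esub>" using pi_0 a(1)[OF i] j_image_iff[OF R_carrier MC] by blast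
    then show "c i = \<zero>\<^bsub>?k\<^esub>" using a(2)[OF i] pi_pow[OF a(1)[OF i]] p0 by (simp add: k.nat_pow_zero)
  next
    fix x assume "x \<in> carrier ?k"
    then obtain r where r: "r \<in> R" "x = \<pi> r" using pi_surj by blast
    have Mi: "ideal_in (j ` R) (j ` ?M)" using ideal_image(1)[OF M.is_ideal] .
    obtain w0 c where w0: "w0 \<in> j ` ?M" and c: "c \<in> W \<rightarrow> j ` R" and eq: "j r = w0 + (\<Sum>z\<in>W. c z ^ (p ^ 1) * z)"
      using C.qspan_finite_rep[OF C.ideal_in_pmodule[OF Mi] W'(1), of "j r" 1] W'(4) r(1) by blast
    obtain r0 where r0: "r0 \<in> ?M" "w0 = j r0" using w0 by blast
    have "\<forall>w\<in>V. \<exists>a\<in>R. c (j w) = j a" using c VW by blast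
    then obtain a where a: "\<And>w. w \<in> V \<Longrightarrow> a w \<in> R" "\<And>w. w \<in> V \<Longrightarrow> c (j w) = j (a w)" by metis
    obtain y where y: "y \<in> R" "j y = (\<Sum>w\<in>V. j (a w) ^ p * j w)"
      "k.combine (map (\<lambda>w. \<pi> (a w [^] p)) ws) (map \<pi> ws) = \<pi> y"
      using comb[OF ws(2), of a] a(1) VR ws(1) by auto
    have "(\<Sum>z\<in>W. c z ^ (p ^ 1) * z) = j y" unfolding y(2) VW using a(2) by (simp add: sum.reindex[OF inj])
    then have "j r = j (r0 \<oplus> y)" using eq r0 MC R_carrier[OF y(1)] by (auto simp: j_add)
    then have "r = r0 \<oplus> y" using j_eq_iff R_carrier[OF r(1)] R_carrier[OF y(1)] subsetD[OF MC r0(1)] by simp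
    then have "x = \<pi> r0 \<oplus>\<^bsub>?k\<^esub> \<pi> y" using r(2) pi_add r0(1) MR y(1) by blast
    also have "\<pi> r0 = \<zero>\<^bsub>?k\<^esub>" using pi_0 r0(1) MR by blast
    also have "\<zero>\<^bsub>?k\<^esub> \<oplus>\<^bsub>?k\<^esub> \<pi> y = \<pi> y" using pi_closed[OF y(1)] by (rule k.l_zero)
    finally show "\<exists>c\<in>set ws \<rightarrow> ?P. x = k.combine (map c ws) (map \<pi> ws)"
      using y(3) a(1) ws(1) unfolding P by (intro bexI[of _ "\<lambda>w. \<pi> (a w [^] p)"]) auto
  qed
  then show ?thesis using distinct_card[OF ws(2)] ws(1) card_image[OF inj] VW by simp
qed

end

section \<open>F-signatures of embedded rings\<close>

text \<open>The element \<open>c * e\<close> and the \<open>c * (b * u)\<close> for \<open>u\<close>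
  in \<open>U\<close> lie in the span of \<open>U\<close> and exceed its rank by one, so they are
  dependent; independence of \<open>U\<close> makes the coefficient of \<open>c * e\<close> nonzero.
  Denominators from \<open>B\<close> can thus be replaced by denominators from
  \<open>A\<close>.\<close>

lemma (in local_extension) multiple_in_base:
  assumes U: "finite U" "U \<subseteq> B" "indep_mod A {0} (p ^ 0) {0} U (\<lambda>x. x)"
    and c: "c \<in> A" "c \<noteq> 0" "\<And>b. b \<in> B \<Longrightarrow> c * b \<in> qspan A (p ^ 0) U" and b: "b \<in> B" "b \<noteq> 0"
  shows "\<exists>b'\<in>B. b * b' \<in> A \<and> b * b' \<noteq> 0"
proof -
  \<comment> \<open>\<open>None\<close> indexes \<open>c * e\<close>; the option type keeps the
    vectors apart even where two of them coincide.\<close>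
  define I where "I = insert None (Some ` U)"
  define v where "v i = (case i of None \<Rightarrow> c * e | Some u \<Rightarrow> c * (b * u))" for i
  have I: "finite I" "card I = Suc (card U)" using U(1) by (auto simp: I_def card_image)
  have cB: "c \<in> B" using c(1) AB by blast
  have "v i \<in> qspan A (p ^ 0) ({0} \<union> U)" if "i \<in> I" for i
    using that c(3)[OF S.one_mem] c(3)[OF S.mult_mem[OF b(1) subsetD[OF U(2)]]]
    unfolding I_def v_def R.qspan_insert_zero by auto
  then have "\<not> indep_mod A {0} (p ^ 0) {0} I v"
    using R.indep_mod_card_le[OF R.zero_prime R.pmodule_singleton_zero I(1) _ U(1)] I(2) by fastforce
  then obtain a i where a: "a \<in> I \<rightarrow> A" "(\<Sum>i\<in>I. a i ^ (p ^ 0) * v i) = 0" and i: "i \<in> I" "a i \<noteq> 0"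
    unfolding indep_mod_def by blast
  define s where "s = (\<Sum>u\<in>U. a (Some u) * u)"
  have aU: "a (Some u) \<in> A" if "u \<in> U" for u using a(1) that by (auto simp: I_def)
  have aN: "a None \<in> A" using a(1) by (auto simp: I_def)
  have sB: "s \<in> B" unfolding s_def using aU AB U(2) by (intro S.sum_mem S.mult_mem) auto
  have "a None * (c * e) + (\<Sum>u\<in>U. a (Some u) * (c * (b * u))) = 0"
    using a(2) U(1) unfolding I_def v_def by (simp add: sum.reindex)
  moreover have "(\<Sum>u\<in>U. a (Some u) * (c * (b * u))) = b * (c * s)"
    unfolding s_def sum_distrib_left by (intro sum.cong) (auto simp: ac_simps)
  moreover have "c * e = c" using R.mult_one[OF c(1)] .
  ultimately have eq: "b * - (c * s) = a None * c" by (simp add: neg_eq_iff_add_eq_0 add.commute)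
  have "a None \<noteq> 0"
  proof
    assume "a None = 0"
    then have "b * (c * s) = 0" using eq by simp
    then have "s = 0" using S.no_zero_divisors[OF b(1) S.mult_mem[OF cB sB]] S.no_zero_divisors[OF cB sB] b(2) c(2) by blast
    then have "a (Some u) \<in> {0}" if "u \<in> U" for u
      using indep_modD[OF U(3), of "\<lambda>u. a (Some u)"] aU that unfolding s_def by auto
    then show False using i \<open>a None = 0\<close> by (auto simp: I_def)
  qed
  then have "a None * c \<noteq> 0" using R.no_zero_divisors[OF aN c(1)] c(2) by blast
  then show ?thesis using eq R.mult_mem[OF aN c(1)] S.uminus_mem[OF S.mult_mem[OF cB sB]] by metis
qed

context embedded_subring begin

lemma F_finite_local_domain_image:
  assumes N: "noetherian_domain LR" and loc: "local_ring LR" and d: "krull_dim LR = enat d"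
    and ch: "prime_char p LR" and F: "F_finite p LR"
  shows "F_finite_local_domain (j ` R) (j \<one>) p (j ` max_ideal LR) d"
proof -
  interpret N: noetherian_domain LR by (rule N)
  note C = char_p_R[OF ch]
  have noeth: "noeth_in (j ` R)" using noeth_image N.noetherian_ring_axioms by blast
  have M: "primeideal (max_ideal LR) LR" by (rule R.maximalideal_prime[OF maximalideal_unique(1)[OF loc]])
  interpret P: power_module L j R p 1 R "frobenius_module p 1 LR" by (rule frobenius_power_module[OF C])
  show ?thesis
  proof (intro F_finite_local_domain.intro F_finite_local_domain_axioms.intro C noeth)
    show "x = 0 \<or> y = 0" if x: "x \<in> j ` R" and y: "y \<in> j ` R" and xy: "x * y = 0" for x y
    proof -
      obtain a b where ab: "a \<in> R" "b \<in> R" "x = j a" "y = j b" using x y by blast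
      have "a \<otimes> b = \<zero>"
        using xy ab R_carrier j_eq_0_iff[of "a \<otimes> b"] by (simp add: j_mult)
      then show ?thesis using integral[of a b] ab R_carrier by auto
    qed
    show "j \<one> \<noteq> 0" using j_eq_0_iff[of \<one>] by simp
    show "loc (j ` R) (j \<one>) (j ` max_ideal LR)" by (rule loc_image(1)[OF loc noeth])
    show "\<exists>H\<subseteq>j ` R. finite H \<and> j ` R \<subseteq> qspan (j ` R) p H"
      using P.finitely_generated_image F unfolding F_finite_def by simp
    show "dim_le (j ` R) {0} d" using krull_dim_image(1)[OF d] M by blast
  qed
qed

lemma F_signature_eq:
  assumes D: "F_finite_local_domain (j ` R) (j \<one>) p (j ` max_ideal LR) d"
    and loc: "local_ring LR" and d: "krull_dim LR = enat d" and ch: "prime_char p LR"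
    and W: "residue_basis (j ` R) (j ` max_ideal LR) p W"
  shows "F_signature p LR =
    lim (\<lambda>n. real (free_rank (j ` R) (j \<one>) (p ^ n) (j ` R)) / real (p ^ d * card W) ^ n)"
proof -
  interpret D: F_finite_local_domain "j ` R" "j \<one>" p "j ` max_ideal LR" d by (rule D)
  have "frobenius_free_rank p LR n = free_rank (j ` R) (j \<one>) (p ^ n) (j ` R)" for n
  proof -
    interpret P: power_module L j R p n R "frobenius_module p n LR"
      by (rule frobenius_power_module[OF char_p_R[OF ch]])
    show ?thesis unfolding frobenius_free_rank_def by (rule P.max_free_rank_eq[OF D.one_nonzero])
  qed
  \<comment> \<open>By \<open>residue_degree\<close>, \<alpha> is the logarithm of
    \<open>card W\<close>, so the normalizing power is the n-th power of
    \<open>p ^ d * card W\<close>.\<close>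
  moreover have "real p powr (real n * (real (the_enat (krull_dim LR)) + alpha p LR)) = real (p ^ d * card W) ^ n" for n
  proof -
    have p: "1 < real p" using D.prime_p prime_gt_1_nat by auto
    have W0: "0 < real (card W)" using D.residue_basis_pos[OF W] by simp
    have "alpha p LR = log (real p) (real (card W))"
      unfolding alpha_def Let_def residue_degree[OF ch loc W] ..
    then have "real p powr (real d + alpha p LR) = real (p ^ d * card W)"
      using p W0 by (simp add: powr_add powr_realpow)
    moreover have "real p powr (real n * x) = (real p powr x) ^ n" for x
      using p by (simp add: powr_powr mult.commute flip: powr_realpow)
    ultimately show ?thesis unfolding d by simp
  qed
  ultimately show ?thesis unfolding F_signature_def by simp
qed

end

theorem corollary4p13:
  fixes L :: "('a, 'b) ring_scheme"
    and R S K G M :: "'a set"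
    and p d f :: nat
  assumes "field L"
    and "subring S L" and "subring R L" and "R \<subseteq> S"
    and "carrier L = fractions_in L S"
    and "K = fractions_in L R"
    and "noetherian_domain (L\<lparr>carrier := R\<rparr>)" and "local_ring (L\<lparr>carrier := R\<rparr>)"
    and "noetherian_domain (L\<lparr>carrier := S\<rparr>)" and "local_ring (L\<lparr>carrier := S\<rparr>)"
    and "max_ideal (L\<lparr>carrier := R\<rparr>) \<subseteq> max_ideal (L\<lparr>carrier := S\<rparr>)"
    and "krull_dim (L\<lparr>carrier := R\<rparr>) = enat d" and "krull_dim (L\<lparr>carrier := S\<rparr>) = enat d"
    and "prime_char p (L\<lparr>carrier := R\<rparr>)" and "prime_char p (L\<lparr>carrier := S\<rparr>)"
    and "F_finite p (L\<lparr>carrier := R\<rparr>)" and "F_finite p (L\<lparr>carrier := S\<rparr>)"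
    and "finitely_generated_module (L\<lparr>carrier := R\<rparr>) (ring_as_module (L\<lparr>carrier := S\<rparr>))"
    and "direct_decomp (L\<lparr>carrier := R\<rparr>) (ring_as_module (L\<lparr>carrier := S\<rparr>)) G M"
    and "free_module_of_rank (L\<lparr>carrier := R\<rparr>) ((ring_as_module (L\<lparr>carrier := S\<rparr>))\<lparr>carrier := G\<rparr>) f"
    and "no_free_summand (L\<lparr>carrier := R\<rparr>) ((ring_as_module (L\<lparr>carrier := S\<rparr>))\<lparr>carrier := M\<rparr>)"
  shows "real f * F_signature p (L\<lparr>carrier := S\<rparr>)
           \<le> real (ring.dim L K (carrier L)) * F_signature p (L\<lparr>carrier := R\<rparr>)
       \<and> (regular_local_ring (L\<lparr>carrier := S\<rparr>) \<longrightarrow>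
            real f * F_signature p (L\<lparr>carrier := S\<rparr>)
              = real (ring.dim L K (carrier L)) * F_signature p (L\<lparr>carrier := R\<rparr>)
          \<and> F_signature p (L\<lparr>carrier := R\<rparr>) = real f / real (ring.dim L K (carrier L)))"
proof -
  obtain j :: "'a \<Rightarrow> 'a uring" where j: "ring_embedding L j" using ring_embedding_exists[OF assms(1)] by blast
  interpret R: embedded_subring L j R
    using j assms(3) by (intro embedded_subring.intro embedded_subring_axioms.intro)
  interpret S: embedded_subring L j S
    using j assms(2) by (intro embedded_subring.intro embedded_subring_axioms.intro)
  let ?LR = "L\<lparr>carrier := R\<rparr>" and ?LS = "L\<lparr>carrier := S\<rparr>"
  let ?A = "j ` R" and ?B = "j ` S" and ?e = "j \<one>\<^bsub>L\<^esub>"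
  let ?m = "j ` max_ideal ?LR" and ?l = "j ` max_ideal ?LS"
  have DR: "F_finite_local_domain ?A ?e p ?m d"
    by (rule R.F_finite_local_domain_image[OF assms(7,8,12,14,16)])
  have DS: "F_finite_local_domain ?B ?e p ?l d"
    by (rule S.F_finite_local_domain_image[OF assms(9,10,13,15,17)])
  have P: "power_module L j R p 0 S (ring_as_module ?LS)"
    by (rule R.extension_power_module[OF R.char_p_R[OF assms(14)] assms(2,4)])
  obtain Y where Y: "Y \<subseteq> ?B" "finite Y" "?B \<subseteq> qspan ?A (p ^ 0) Y"
    using power_module.finitely_generated_image[OF P assms(18)] by blast
  interpret E: local_extension ?A ?B ?e p ?m ?l d
    using DR DS Y assms(4,11) by (intro local_extension.intro local_extension_axioms.intro) blast+
  \<comment> \<open>A maximal subset of module generators of \<open>S\<close> independent over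
    \<open>R\<close>. It becomes a basis of \<open>L\<close> over \<open>K\<close>, so
    \<open>card U\<close> is the degree.\<close>
  obtain U c where U: "U \<subseteq> Y" "indep_mod ?A {0} (p ^ 0) {0} U (\<lambda>x. x)" and c: "c \<in> ?A" "c \<notin> {0}"
    and cU: "\<And>v. v \<in> qspan ?A (p ^ 0) ({0} \<union> Y) \<Longrightarrow> c ^ (p ^ 0) * v \<in> qspan ?A (p ^ 0) ({0} \<union> U)"
  proof (rule E.R.maximal_indep[OF E.R.zero_prime E.R.pmodule_singleton_zero Y(2), where n = 0])
    show "?e * x = x" if "x \<in> Y" for x using that Y(1) S.jR.one_mult by blast
  qed auto
  have UB: "finite U" "U \<subseteq> ?B" using U(1) Y(1,2) finite_subset by blast+
  have c0: "c \<noteq> 0" using c(2) by simp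
  have cB: "c * b \<in> qspan ?A (p ^ 0) U" if "b \<in> ?B" for b
  proof -
    have "b \<in> qspan ?A (p ^ 0) ({0} \<union> Y)" using that Y(3) unfolding E.R.qspan_insert_zero by blast
    from cU[OF this] show ?thesis unfolding E.R.qspan_insert_zero by simp
  qed
  obtain W where W: "residue_basis ?A ?m p W" using E.R.residue_basis_exists by blast
  obtain W' where W': "residue_basis ?B ?l p W'" using E.S.residue_basis_exists by blast
  have fs: "splits ?A ?e (p ^ 0) ?B f" "generated_mod ?A (p ^ 0) ?B (nonsplit ?A ?m (p ^ 0) ?B) f"
    using power_module.nonfree_complement[OF P E.R.one_nonzero E.R.loc assms(19,20,21)] by blast+
  define T where "T = {x \<in> S. j x \<in> U}"
  have jT: "j ` T = U" using UB(2) by (auto simp: T_def)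
  have TS: "T \<subseteq> S" "T \<subseteq> carrier L" using S.R_carrier by (auto simp: T_def)
  have inj: "inj_on j T" using R.j_inj TS(2) inj_on_subset by blast
  have fT: "finite T" using UB(1) finite_imageD[OF _ inj] jT by blast
  have "ring.dim L K (carrier L) = card T"
    unfolding assms(6)
  proof (rule R.degree_eq_card[OF fT TS(2), of p])
    show "indep_mod ?A {0} (p ^ 0) {0} (j ` T) (\<lambda>x. x)" unfolding jT by (rule U(2))
    fix x assume x: "x \<in> carrier L"
    obtain s where s: "s \<in> S" "s \<noteq> \<zero>\<^bsub>L\<^esub>" "s \<otimes>\<^bsub>L\<^esub> x \<in> S"
      using S.fractionE[of x] x assms(5) by blast
    have js: "j s \<noteq> 0" using R.j_eq_0_iff[OF S.R_carrier[OF s(1)]] s(2) by simp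
    obtain b' where b': "b' \<in> ?B" "j s * b' \<in> ?A" "j s * b' \<noteq> 0"
      using E.multiple_in_base[OF UB U(2) c(1) c0 cB _ js] s(1) by blast
    \<comment> \<open>\<open>s\<close> clears the denominator of \<open>x\<close> over
      \<open>S\<close>, the factor \<open>b'\<close> moves \<open>s\<close> into \<open>R\<close>,
      and \<open>c\<close> brings the result into the span of \<open>U\<close>.\<close>
    obtain d where d: "d \<in> R" "j d = c * (j s * b')" using R.jR.mult_mem[OF c(1) b'(2)] by auto
    have "j d \<noteq> 0" using E.R.no_zero_divisors[OF c(1) b'(2)] c0 b'(3) d(2) by metis
    then have d0: "d \<noteq> \<zero>\<^bsub>L\<^esub>" by auto
    have "j d * j x = c * (j (s \<otimes>\<^bsub>L\<^esub> x) * b')"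
      unfolding d(2) R.j_mult[OF S.R_carrier[OF s(1)] x] by (simp add: ac_simps)
    moreover have "c * (j (s \<otimes>\<^bsub>L\<^esub> x) * b') \<in> qspan ?A (p ^ 0) U"
      using s(3) b'(1) by (intro cB S.jR.mult_mem) auto
    ultimately obtain a where a: "a \<in> U \<rightarrow> ?A" "j d * j x = (\<Sum>u\<in>U. a u ^ (p ^ 0) * u)"
      using E.R.qspan_finite_rep[OF E.R.pmodule_singleton_zero UB(1), of "j d * j x" 0]
      unfolding E.R.qspan_insert_zero by auto
    have "\<forall>t\<in>T. \<exists>r\<in>R. a (j t) = j r" using a(1) jT by blast
    then obtain r where r: "\<And>t. t \<in> T \<Longrightarrow> r t \<in> R" "\<And>t. t \<in> T \<Longrightarrow> a (j t) = j (r t)" by metis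
    have "j d * j x = (\<Sum>t\<in>T. j (r t) * j t)" using r(2) unfolding a(2) jT[symmetric] by (simp add: sum.reindex[OF inj])
    then show "\<exists>d\<in>R. d \<noteq> \<zero>\<^bsub>L\<^esub> \<and> (\<exists>a\<in>T \<rightarrow> R. j d * j x = (\<Sum>t\<in>T. j (a t) * j t))"
      using d(1) d0 r(1) by blast
  qed
  then have dim: "ring.dim L K (carrier L) = card U" using card_image[OF inj] jT by simp
  note sR = R.F_signature_eq[OF DR assms(8,12,14) W] and sS = S.F_signature_eq[OF DS assms(10,13,15) W']
  note hyps = W W' UB U(2) c(1) c0 cB fs
  have "real f * F_signature p ?LS \<le> real (card U) * F_signature p ?LR"
    unfolding sR sS by (rule E.signature_le[OF hyps])
  moreover have "real f * F_signature p ?LS = real (card U) * F_signature p ?LR \<and>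
      F_signature p ?LR = real f / real (card U)" if rLS: "regular_local_ring ?LS"
  proof -
    have "primeideal (max_ideal ?LS) ?LS"
      by (rule S.R.maximalideal_prime[OF S.maximalideal_unique(1)[OF assms(10)]])
    then obtain Q where Q: "prime_chain ?B {0} Q d" using S.krull_dim_image(2)[OF assms(13)] by blast
    obtain xs where xs: "length xs = d" "set xs \<subseteq> ?l" "adjoin_list ?B {0} xs = ?l"
      using S.regular_image[OF rLS assms(13)] by blast
    note reg = E.signature_regular[OF hyps Q xs]
    have s: "F_signature p ?LS = 1" unfolding sS by (rule reg(1))
    have t: "real f = real (card U) * F_signature p ?LR" unfolding sR by (rule reg(2))
    \<comment> \<open>The division by the degree requires it to be nonzero.\<close>
    have "0 < card U" by (rule E.U_card_pos[OF hyps])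
    then show ?thesis using s t by (simp add: field_simps)
  qed
  ultimately show ?thesis unfolding dim by blast
qed

end
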